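(* Let $q$ be a power of $2$. For $r\ge 5$ odd and all sufficiently large $q$, $$A(q^r) \ge \frac{2q^2+2}{\sqrt{2q}\,(q-1) + 2\lceil 2\sqrt{2q^2+2}\,\rceil + 4}.$$ For $r=3$ and all sufficiently large $q$, $$A(q^3) \ge \frac{2q^2+8}{\sqrt{2q}\,(q-4) + 8\lceil \sqrt{2q^2+8}\,\rceil + 16}.$$
   Context: For a prime power $Q$ and an integer $g\ge 0$, $N_Q(g)$ is the maximum number of rational places (places of degree $1$) of a global function field of genus $g$ with full constant field $\mathbb{F}_Q$, and $A(Q)=\limsup_{g\to\infty} N_Q(g)/g$. In the first statement $r$ is a fixed odd integer and "sufficiently large $q$" refers to powers $q$ of $2$. *)

theory Defs
  imports "HOL-Algebra.Algebra" "HOL-Library.Extended_Real" "HOL-Library.Liminf_Limsup" Complex_Main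
begin

text \<open>
  Algebraic function fields of one variable, in the valuation-ring approach of
  Stichtenoth, \<^emph>\<open>Algebraic Function Fields and Codes\<close>, Chapter 1.
\<close>

locale function_field = field F + subfield K F
  for K :: "'a set" and F :: "('a, 'b) ring_scheme" (structure) +
  assumes finite_over_rational_subfield:
    "\<exists>x \<in> carrier F. transcendental K x \<and>
       finite_dimension (generate_field F (K \<union> {x})) (carrier F)"
begin

definition valuation_ring :: "'a set \<Rightarrow> bool" where
  "valuation_ring V \<longleftrightarrow> subring V F \<and> K \<subset> V \<and> V \<subset> carrier F \<and>
     (\<forall>z \<in> carrier F - {\<zero>}. z \<in> V \<or> inv z \<in> V)"

definition places :: "'a set set" where
  "places = {P. \<exists>V. valuation_ring V \<and> maximalideal P (F\<lparr>carrier := V\<rparr>)}"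

text \<open>
  A place determines its valuation ring: \<^term>\<open>z \<noteq> \<zero>\<close> lies in it iff the inverse of
  \<^term>\<open>z\<close> is not in the place.
\<close>

definition place_ring :: "'a set \<Rightarrow> ('a, 'b) ring_scheme" where
  "place_ring P = F\<lparr>carrier := {z \<in> carrier F. z = \<zero> \<or> inv z \<notin> P}\<rparr>"

text \<open>
  The residue class field is a vector space over the image of \<^term>\<open>K\<close>, which is a
  copy of \<^term>\<open>K\<close> inside it.
\<close>

definition place_degree :: "'a set \<Rightarrow> nat" where
  "place_degree P =
     (let R = place_ring P Quot P
      in ring.dim R ((\<lambda>c. P +>\<^bsub>place_ring P\<^esub> c) ` K) (carrier R))"

definition rational_places :: "'a set set" where
  "rational_places = {P \<in> places. place_degree P = 1}"

text \<open>
  The normalized discrete valuation, meaningful for \<^term>\<open>z \<noteq> \<zero>\<close> only; it does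
  not depend on the choice of the prime element \<^term>\<open>t\<close>.
\<close>

definition place_val :: "'a set \<Rightarrow> 'a \<Rightarrow> int" where
  "place_val P z = (THE n. \<exists>t \<in> carrier (place_ring P). \<exists>u \<in> Units (place_ring P).
      P = PIdl\<^bsub>place_ring P\<^esub> t \<and> z = (t [^] n) \<otimes> u)"

definition divisors :: "('a set \<Rightarrow> int) set" where
  "divisors = {D. finite {P. D P \<noteq> 0} \<and> {P. D P \<noteq> 0} \<subseteq> places}"

definition divisor_degree :: "('a set \<Rightarrow> int) \<Rightarrow> int" where
  "divisor_degree D = (\<Sum>P | D P \<noteq> 0. D P * int (place_degree P))"

definition riemann_roch_space :: "('a set \<Rightarrow> int) \<Rightarrow> 'a set" where
  "riemann_roch_space D =
     {z \<in> carrier F. z = \<zero> \<or> (\<forall>P \<in> places. place_val P z \<ge> - D P)}"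

definition genus :: int where
  "genus = (GREATEST i. \<exists>D \<in> divisors.
      i = divisor_degree D - int (dim K (riemann_roch_space D)) + 1)"

end

text \<open>Finite constant field \<^term>\<open>K\<close>, which is moreover algebraically closed in \<^term>\<open>F\<close>.\<close>

locale global_function_field = function_field K F
  for K :: "'a set" and F :: "('a, 'b) ring_scheme" (structure) +
  assumes finite_constants: "finite K"
    and full_constant_field: "{z \<in> carrier F. algebraic K z} = K"

text \<open>
  A global function field is countable, being a finite extension of a rational function
  field over a finite field. Up to isomorphism it therefore has a carrier consisting of
  natural numbers, so ranging over \<^typ>\<open>nat ring\<close> covers all global function fields.
  For \<^term>\<open>g\<close> fixed the set below is bounded, so its supremum is its maximum.
\<close>

definition max_rational_places :: "nat \<Rightarrow> nat \<Rightarrow> nat" where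
  "max_rational_places Q g = Sup {card (function_field.rational_places K F) |
     (K :: nat set) (F :: nat ring).
       global_function_field K F \<and> card K = Q \<and> function_field.genus K F = int g}"

definition ihara_constant :: "nat \<Rightarrow> ereal" where
  "ihara_constant Q = limsup (\<lambda>g. ereal (real (max_rational_places Q g) / real g))"

end

theory Submission
  imports Defs "HOL-Computational_Algebra.Computational_Algebra" "HOL-Algebra.Algebraic_Closure_Type" "HOL-Library.Z2"
begin

text \<open>Over an algebraic closure of the constants an additive tower \<open>\<eta>\<^sub>i\<^sup>Q + c \<eta>\<^sub>i\<^sup>R + \<eta>\<^sub>i = \<eta>\<^sub>i\<^sub>-\<^sub>1\<close> is built inside
 the power series in \<open>c\<close>, where \<open>R = q\<^sup>j\<close>, \<open>Q = q R\<close> and \<open>r = j + 1\<close>. Its genus is bounded without differents: over the poles of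
 \<open>c\<close> every root has an explicit approximation in the lower field, which bounds the defect of Riemann--Roch spaces on
 average over the conjugacy classes of roots. Elements fixed by the \<open>Q\<close>-Frobenius of the coefficients form a tower over the
 field of \<open>Q = q\<^sup>r\<close> elements, and every conjugate of the generator, being a power series, gives a rational place over
 \<open>c = 0\<close>. So the Ihara constant is at least \<open>(q - 1) / 7\<close>, which exceeds the right-hand sides of order \<open>(2 q)\<^sup>1\<^sup>/\<^sup>2\<close>.\<close>

text \<open>No step of the tower is shown to be irreducible. Its degree is bounded below only
  arithmetically: at a pole of \<open>c\<close> where already \<open>eta 1\<close> is large, the
  order of the pole must be a multiple of \<open>q^(j l)\<close>, because the chain leads to an
  element of value \<open>D - m h\<close> there. Since a step may split into several conjugacy
  classes, the class to continue with is chosen by averaging the defect \<open>dg - ll\<close>.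
  Algebraically closed constants give all places degree 1, on which strong approximation rests;
  finite constants are recovered only at the end, by descent along the Frobenius. Locally everything
  follows from the two slopes of the Newton polygon of one step at a pole of \<open>c\<close>; how
  often each pattern of slopes occurs is a global question, settled by the degree zero of one
  principal divisor per level. All field theory is done with subsets of type-class fields. The
  function fields of the statement are records on \<open>nat\<close>, and the supremum in the Ihara
  constant says something only for a bounded set; so an elementary bound for the number of rational
  places is needed as well, and it also forces the genera of the tower to infinity.\<close>

abbreviation (input) "ri \<equiv> real_of_int"

abbreviation (input) "fC \<equiv> fls_const"

section \<open>Subfields of a type-class field and dimension relative to a subspace\<close>

definition sf :: "'a::field set => bool" where
 "sf k \<longleftrightarrow> 0 : k & 1 : k & (ALL x:k. ALL y:k. x + y : k & x * y : k) & (ALL x:k. - x : k & inverse x : k)"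

lemma sf_simps:
 assumes "sf k"
 shows sf_0: "0 : k" and sf_1: "1 : k"
  and sf_add: "x : k ==> y : k ==> x + y : k"
  and sf_mult: "x : k ==> y : k ==> x * y : k"
  and sf_uminus: "x : k ==> - x : k"
  and sf_inv: "x : k ==> inverse x : k"
  and sf_diff: "x : k ==> y : k ==> x - y : k"
  and sf_divide: "x : k ==> y : k ==> x / y : k"
 using assms unfolding sf_def by (auto simp: diff_conv_add_uminus divide_inverse simp del: add_uminus_conv_diff)

lemma sf_power: "sf k ==> x : k ==> x ^ n : k"
 by (induction n) (auto intro: sf_simps)

lemma sf_sum: "sf k ==> (!!i. i : I ==> f i : k) ==> sum f I : k"
 by (induction I rule: infinite_finite_induct) (auto intro: sf_simps)

lemma sf_prod: "sf k ==> (!!i. i : I ==> f i : k) ==> prod f I : k"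
 by (induction I rule: infinite_finite_induct) (auto intro: sf_simps)

text \<open>The scaling \<open>s\<close> is a parameter so that the same linear algebra serves both
  the ambient field with its multiplication and polynomials with \<open>smult\<close>.\<close>

definition subsp :: "('a::field => 'b::ab_group_add => 'b) => 'a set => 'b set => bool" where
 "subsp s k U \<longleftrightarrow> 0 : U & (ALL x:U. ALL y:U. x + y : U) & (ALL a:k. ALL x:U. s a x : U)"

definition lext :: "('a::field => 'b::ab_group_add => 'b) => 'a set => 'b => 'b set => 'b set" where
 "lext s k v U = {s a v + u | a u. a : k & u : U}"

text \<open>\<open>rdim s k U n V\<close> encodes \<open>dim (V / U) = n\<close> by a chain of
  one-dimensional extensions, so that no quotient space is formed. \<open>U = {0}\<close> gives the
  ordinary dimension; residue fields are covered by taking the maximal ideal for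
  \<open>U\<close>.\<close>

inductive rdim :: "('a::field => 'b::ab_group_add => 'b) => 'a set => 'b set => nat => 'b set => bool"
 for s k U where
 rZ: "rdim s k U 0 U"
| rS: "rdim s k U n V ==> v ~: V ==> rdim s k U (Suc n) (lext s k v V)"

locale klin = vector_space scale for scale :: "'a::field => 'b::ab_group_add => 'b" (infixr "*s" 75) +
 fixes k :: "'a set"
 assumes k: "sf k"
begin

abbreviation "sub \<equiv> subsp scale k"
abbreviation "ext \<equiv> lext scale k"
abbreviation "dm \<equiv> rdim scale k"

lemmas k_simps = sf_simps[OF k]

lemma sub_0: "sub U ==> 0 : U" and sub_add: "sub U ==> x : U ==> y : U ==> x + y : U"
 and sub_scale: "sub U ==> a : k ==> x : U ==> a *s x : U"
 by (auto simp: subsp_def)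

lemma sub_uminus: "sub U ==> x : U ==> - x : U"
 using sub_scale[of U "-1" x] k_simps by simp

lemma sub_diff: "sub U ==> x : U ==> y : U ==> x - y : U"
 using sub_add[of U x "-y"] sub_uminus by simp

lemma sub_sum: "sub U ==> (!!i. i : I ==> f i : U) ==> sum f I : U"
 by (induction I rule: infinite_finite_induct) (auto intro: sub_0 sub_add)

lemma sub_zero: "sub {0}" by (auto simp: subsp_def)

lemma sub_Int: "sub U ==> sub V ==> sub (U Int V)"
 by (auto simp: subsp_def)

lemma extI: "a : k ==> u : U ==> a *s v + u : ext v U"
 unfolding lext_def by blast

lemma sub_ext: assumes "sub U" shows "sub (ext v U)"
 unfolding subsp_def
proof (intro conjI ballI)
 show "0 : ext v U" using extI[OF sf_0[OF k] sub_0[OF assms], of v] by simp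
 fix x y assume "x : ext v U" "y : ext v U"
 then obtain a u b w where *: "x = a *s v + u" "y = b *s v + w" "a : k" "b : k" "u : U" "w : U"
  by (auto simp: lext_def)
 hence "x + y = (a + b) *s v + (u + w)" by (simp add: scale_left_distrib)
 thus "x + y : ext v U" using extI[OF sf_add[OF k *(3,4)] sub_add[OF assms *(5,6)], of v] by simp
next
 fix c x assume "c : k" "x : ext v U"
 then obtain a u where *: "x = a *s v + u" "a : k" "u : U" by (auto simp: lext_def)
 hence "c *s x = (c * a) *s v + c *s u" by (simp add: scale_right_distrib)
 thus "c *s x : ext v U" using extI[OF sf_mult[OF k `c : k` *(2)] sub_scale[OF assms `c : k` *(3)], of v] by simp
qed

lemma ext_sup: "U <= ext v U"
proof
 fix u assume "u : U"
 thus "u : ext v U" using extI[OF sf_0[OF k], of u U v] by simp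
qed

lemma ext_in: "sub U ==> v : ext v U"
 using extI[OF sf_1[OF k] sub_0, of U v] by simp

lemma ext_le: "sub W ==> U <= W ==> v : W ==> ext v U <= W"
 unfolding lext_def using sub_add sub_scale by blast

lemma ext_mono: "U <= W ==> ext v U <= ext v W"
 unfolding lext_def by blast

text \<open>Steinitz exchange: in \<open>w = a v + u\<close> the scalar \<open>a\<close> is nonzero
  because \<open>w\<close> is outside \<open>V\<close>, so \<open>v\<close> can be solved
  for.\<close>

lemma ext_exchange:
 assumes "sub V" "w : ext v V" "w ~: V"
 shows "ext w V = ext v V" "v : ext w V"
proof -
 obtain a u where *: "w = a *s v + u" "a : k" "u : V" using assms by (auto simp: lext_def)
 have a0: "a ~= 0" using * assms by auto
 have "v = inverse a *s w + (- (inverse a *s u))" using a0 by (simp add: *(1) scale_right_distrib)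
 thus v: "v : ext w V"
  using extI[OF sf_inv[OF k *(2)] sub_uminus[OF assms(1) sub_scale[OF assms(1) sf_inv[OF k *(2)] *(3)]], of w] by simp
 show "ext w V = ext v V"
  using ext_le[OF sub_ext[OF assms(1)] ext_sup assms(2)] ext_le[OF sub_ext[OF assms(1)] ext_sup v] by blast
qed

text \<open>Modular law: the line added to \<open>V\<close> can be represented by a vector of
  \<open>M\<close>, after which intersecting with \<open>M\<close> affects only
  \<open>V\<close>.\<close>

lemma ext_int:
 assumes "sub V" "sub M" "w : M" "w ~: V" "w : ext v V"
 shows "M Int ext v V = ext w (M Int V)"
proof -
 have e: "ext w V = ext v V" using ext_exchange assms by blast
 have "M Int ext w V <= ext w (M Int V)"
 proof
  fix x assume "x : M Int ext w V"
  then obtain a u where *: "x = a *s w + u" "a : k" "u : V" "x : M" by (auto simp: lext_def)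
  hence "u = x - a *s w" by simp
  hence "u : M" using * assms sub_diff sub_scale by metis
  thus "x : ext w (M Int V)" using * by (auto simp: lext_def)
 qed
 moreover have "ext w (M Int V) <= M Int ext w V"
  using ext_le[OF assms(2), of "M Int V" w] assms ext_mono[of "M Int V" V w] by blast
 ultimately show ?thesis using e by blast
qed

lemma dm_sub: "dm U n V ==> sub U ==> sub V"
 by (induction rule: rdim.induct) (auto intro: sub_ext)

lemma dm_sup: "dm U n V ==> U <= V"
 by (induction rule: rdim.induct) (use ext_sup in blast)+

lemma dm_trans: "dm V m W ==> dm U n V ==> dm U (n + m) W"
 by (induction rule: rdim.induct) (auto intro: rdim.intros)

text \<open>\<open>(M Int V) / (M Int U)\<close> embeds into \<open>V / U\<close>: each link of the
  chain adds either nothing or one line inside \<open>M\<close>.\<close>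

lemma dm_inter_le:
 assumes "dm U n V" "sub U" "sub M" shows "EX m<=n. dm (M Int U) m (M Int V)"
 using assms(1)
proof (induction rule: rdim.induct)
 case rZ show ?case by (auto intro: rdim.rZ)
next
 case (rS n V v)
 then obtain m where m: "m <= n" "dm (M Int U) m (M Int V)" by auto
 have sV: "sub V" using rS dm_sub assms by auto
 show ?case
 proof (cases "M Int ext v V <= V")
  case True
  hence "M Int ext v V = M Int V" using ext_sup by blast
  thus ?thesis using m by (metis le_Suc_eq)
 next
  case False
  then obtain w where w: "w : M" "w ~: V" "w : ext v V" by auto
  have "M Int ext v V = ext w (M Int V)" using ext_int[OF sV assms(3) w] .
  thus ?thesis using rdim.rS[OF m(2), of w] w m(1) by (metis Int_iff Suc_le_mono)
 qed
qed

text \<open>The last assumption says \<open>V <= M + U\<close>, which makes the embedding of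
  \<open>(M Int V) / (M Int U)\<close> into \<open>V / U\<close> onto.\<close>

lemma dm_inter_eq:
 assumes "dm U n V" "sub U" "sub M" "ALL v:V. EX w:M. v - w : U" shows "dm (M Int U) n (M Int V)"
 using assms(1,4)
proof (induction rule: rdim.induct)
 case rZ show ?case by (auto intro: rdim.rZ)
next
 case (rS n V v)
 have sV: "sub V" using rS dm_sub assms by auto
 have UV: "U <= V" using rS dm_sup by auto
 have IH: "dm (M Int U) n (M Int V)" using rS ext_sup[of V v] by blast
 obtain w where w: "w : M" "v - w : U" using rS ext_in[OF sV, of v] by blast
 have wV: "w ~: V" using w UV sub_add[OF sV, of "v - w" w] rS by auto
 have "w = v - (v - w)" by simp
 hence "w : ext v V" using sub_diff[OF sub_ext[OF sV] ext_in[OF sV], of "v - w" v] w UV ext_sup by (metis subsetD)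
 hence "M Int ext v V = ext w (M Int V)" using ext_int[OF sV assms(3) w(1) wV] by blast
 thus ?case using rdim.rS[OF IH, of w] wV by auto
qed

lemma ext_commute: "ext v (ext w U) = ext w (ext v U)"
proof -
 have "ext v (ext w U) <= ext w (ext v U)" for v w
 proof
  fix x assume "x : ext v (ext w U)"
  then obtain a b u where "x = a *s v + (b *s w + u)" "a : k" "b : k" "u : U" unfolding lext_def by blast
  hence "x = b *s w + (a *s v + u)" "a : k" "b : k" "u : U" by (auto simp: algebra_simps)
  thus "x : ext w (ext v U)" unfolding lext_def by blast
 qed
 thus ?thesis by blast
qed

lemma dm_ext_both:
 assumes "dm U n V" "w ~: V" "sub U" shows "dm (ext w U) n (ext w V)"
 using assms(1,2)
proof (induction rule: rdim.induct)
 case rZ show ?case by (rule rdim.rZ)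
next
 case (rS n V v)
 have sV: "sub V" using rS dm_sub assms by auto
 have wV: "w ~: V" using rS ext_sup by blast
 have "v ~: ext w V"
  using ext_exchange(2)[OF sV, of v w] rS by blast
 hence "dm (ext w U) (Suc n) (ext v (ext w V))"
  using rdim.rS rS.IH[OF wV] by blast
 thus ?case by (simp add: ext_commute)
qed

text \<open>Where \<open>W\<close> leaves \<open>V\<close>, the new vector is exchanged for one of
  \<open>W\<close> and moved to the lower part of the chain; \<open>dm_ext_both\<close> preserves
  the length of the upper part.\<close>

lemma dm_split:
 assumes "dm U n V" "sub U" "sub W" "U <= W" "W <= V"
 shows "EX i j. i + j = n & dm U i W & dm W j V"
 using assms(1,3-)
proof (induction arbitrary: W rule: rdim.induct)
 case rZ
 hence "W = U" by auto
 thus ?case using rdim.rZ by (intro exI[of _ 0]) auto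
next
 case (rS n V v)
 have sV: "sub V" using rS dm_sub assms by auto
 have UV: "U <= V" using rS dm_sup by auto
 show ?case
 proof (cases "W <= V")
  case True
  then obtain i j where "i + j = n" "dm U i W" "dm W j V" using rS.IH rS.prems by blast
  thus ?thesis using rdim.rS[of scale k W j V v] rS.hyps by (metis add_Suc_right)
 next
  case False
  then obtain w where w: "w : W" "w ~: V" "w : ext v V" using rS.prems by auto
  obtain i j where ij: "i + j = n" "dm U i (W Int V)" "dm (W Int V) j V"
   using rS.IH[of "W Int V"] rS.prems sub_Int sV UV by blast
  have e: "W = ext w (W Int V)" using ext_int[OF sV rS.prems(1) w] rS.prems(3) by blast
  have "dm U (Suc i) W" using rdim.rS[OF ij(2), of w] w e by auto
  moreover have "dm W j (ext v V)"
   using dm_ext_both[OF ij(3) w(2)] sub_Int sV rS.prems(1) e ext_exchange(1)[OF sV w(3,2)] by auto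
  ultimately show ?thesis using ij by (metis add_Suc)
 qed
qed

lemma dm_refl: assumes "dm U n U" "sub U" shows "n = 0"
proof (rule ccontr)
 assume "n ~= 0"
 from assms(1) this show False
  by (cases rule: rdim.cases) (use dm_sup ext_in dm_sub assms(2) in blast)+
qed

lemma dm_unique:
 assumes "dm U n V" "dm U m V" "sub U" shows "n = m"
 using assms(1,2)
proof (induction arbitrary: m rule: rdim.induct)
 case rZ thus ?case using dm_refl assms by auto
next
 case (rS n V v)
 have sV: "sub V" using rS dm_sub assms by auto
 have UV: "U <= V" using rS dm_sup by auto
 obtain i j where ij: "i + j = m" "dm U i V" "dm V j (ext v V)"
  using dm_split[OF rS.prems assms(3) sV UV ext_sup] by blast
 have "i = n" using rS.IH[OF ij(2)] by simp
 have "dm V (Suc 0) (ext v V)" using rdim.rS[OF rdim.rZ rS.hyps(2)] .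
 have "j = 1"
 proof -
  have "j ~= 0"
  proof
   assume "j = 0" with ij(3) have "ext v V = V" by (auto elim: rdim.cases)
   thus False using ext_in[OF sV] rS.hyps by metis
  qed
  \<comment> \<open>A nonempty chain above \<open>V\<close> starts with some line; by exchange that
    line already fills \<open>ext v V\<close>, so nothing is left of the chain.\<close>
  have "EX w. w ~: V & dm (ext w V) (j - 1) M" if "dm V j M" "j ~= 0" for j M
   using that
  proof (induction rule: rdim.induct)
   case (rS n Y y)
   show ?case
   proof (cases "n = 0")
   case True
   hence "Y = V" using rS.hyps(1) by (auto elim: rdim.cases)
   thus ?thesis using True rS.hyps(2) rdim.rZ[of scale k] by auto
   next
   case False
   then obtain w where w: "w ~: V" "dm (ext w V) (n - 1) Y" using rS.IH by auto
   thus ?thesis using rdim.rS[OF w(2) rS.hyps(2)] False by auto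
   qed
  qed simp
  from this[OF ij(3) `j ~= 0`] obtain w where w: "w ~: V" "dm (ext w V) (j - 1) (ext v V)" by blast
  hence "w : ext v V" using dm_sup ext_in[OF sV] by blast
  hence "ext w V = ext v V" using ext_exchange(1)[OF sV _ w(1)] by auto
  hence "j - 1 = 0" using dm_refl w(2) sub_ext[OF sV] by metis
  thus ?thesis using `j ~= 0` by simp
 qed
 thus ?case using ij `i = n` by simp
qed

lemma dm_mono:
 assumes "dm U n V" "dm U m W" "W <= V" "sub U" shows "m <= n"
proof -
 obtain i j where "i + j = n" "dm U i W" "dm W j V"
  using dm_split[OF assms(1,4) dm_sub[OF assms(2,4)] dm_sup[OF assms(2)] assms(3)] by blast
 thus ?thesis using dm_unique assms by (metis le_add1)
qed

lemma dm_exists_between: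
 assumes "dm U n V" "sub U" "sub W" "U <= W" "W <= V" shows "EX m<=n. dm U m W"
 using dm_split[OF assms] le_add1 by blast

text \<open>Finiteness is obtained from a uniform bound on the finite chains inside
  \<open>V\<close>: one of greatest length must exhaust \<open>V\<close>.\<close>

lemma dm_bounded:
 assumes "sub U" "sub V" "U <= V" "!!m W. dm U m W ==> W <= V ==> m <= N"
 shows "EX m<=N. dm U m V"
proof -
 define S where "S = (%m. EX W. dm U m W & W <= V)"
 have b: "S m ==> m <= N" for m by (simp add: S_def) (use assms(4) in blast)
 have "S 0" unfolding S_def using assms(3) by (intro exI[of _ U]) (simp add: rdim.rZ)
 hence "S (GREATEST m. S m)" "!!y. S y ==> y <= (GREATEST m. S m)"
  using GreatestI_nat[of S 0 N] Greatest_le_nat[of S _ N] b by simp_all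
 then obtain m where m: "S m" "!!y. S y ==> y <= m" by metis
 then obtain W where W: "dm U m W" "W <= V" unfolding S_def by (elim exE conjE)
 have "V <= W"
 proof
  fix v assume v: "v : V"
  show "v : W"
  proof (rule ccontr)
   assume nv: "v ~: W"
   have "dm U (Suc m) (ext v W)" using rdim.rS[OF W(1) nv] .
   moreover have "ext v W <= V" using ext_le[OF assms(2) W(2) v] .
   ultimately have "S (Suc m)" unfolding S_def by (intro exI conjI)
   thus False using m(2)[of "Suc m"] by simp
  qed
 qed
 hence "W = V" using W(2) by simp
 thus ?thesis using W(1) b[OF m(1)] by auto
qed

lemma dm_basis:
 assumes "dm U n V" "sub U"
 shows "EX w. (ALL i<n. w i : V) & (ALL v:V. EX a. (ALL i. a i : k) & v - (SUM i<n. a i *s w i) : U)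
  & (ALL a. (ALL i<n. a i : k) --> (SUM i<n. a i *s w i) : U --> (ALL i<n. a i = 0))"
 using assms(1)
proof (induction rule: rdim.induct)
 case rZ
 have "ALL v:U. EX a::nat => 'a. (ALL i. a i : k) & v - (SUM i<0. a i *s undefined i) : U"
  by (rule ballI, rule exI[of _ "%_. 0"]) (simp add: sf_0[OF k])
 thus ?case by (intro exI[of _ undefined] conjI) simp_all
next
 case (rS n V v)
 have sV: "sub V" using rS dm_sub assms by auto
 have UV: "U <= V" using rS dm_sup by auto
 obtain w where w: "ALL i<n. w i : V" "ALL v:V. EX a. (ALL i. a i : k) & v - (SUM i<n. a i *s w i) : U"
  "ALL a. (ALL i<n. a i : k) --> (SUM i<n. a i *s w i) : U --> (ALL i<n. a i = 0)"
  using rS.IH by (elim exE conjE)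
 let ?w = "%i. if i = n then v else w i"
 have sm: "(SUM i<Suc n. a i *s ?w i) = (SUM i<n. a i *s w i) + a n *s v" for a
  by simp
 have "EX a. (ALL i. a i : k) & x - (SUM i<Suc n. a i *s ?w i) : U" if x: "x : ext v V" for x
 proof -
  obtain b u where bu: "x = b *s v + u" "b : k" "u : V" using x by (auto simp: lext_def)
  obtain a where a: "ALL i. a i : k" "u - (SUM i<n. a i *s w i) : U" using w(2) bu by blast
  have "x - (SUM i<Suc n. (if i = n then b else a i) *s ?w i) : U"
   unfolding sm using a bu by (simp add: algebra_simps)
  thus ?thesis using a bu by (intro exI[of _ "%i. if i = n then b else a i"]) auto
 qed
 moreover have "ALL i<Suc n. a i = 0" if a: "ALL i<Suc n. a i : k" "(SUM i<Suc n. a i *s ?w i) : U" for a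
 proof -
  have "a n = 0"
  proof (rule ccontr)
   assume "a n ~= 0"
   have s1: "(SUM i<n. a i *s w i) : V" by (rule sub_sum[OF sV], rule sub_scale[OF sV]) (use a(1) w(1) in simp_all)
   have "a n *s v = (SUM i<Suc n. a i *s ?w i) - (SUM i<n. a i *s w i)" unfolding sm by simp
   hence "a n *s v : V" using sub_diff[OF sV subsetD[OF UV a(2)] s1] by simp
   hence "inverse (a n) *s (a n *s v) : V" using sub_scale[OF sV sf_inv[OF k, of "a n"], of "a n *s v"] a(1) by simp
   thus False using `a n ~= 0` rS by simp
  qed
  hence "(SUM i<n. a i *s w i) : U" using a(2) unfolding sm by simp
  hence "ALL i<n. a i = 0" using a(1) w(3) by (meson less_SucI)
  thus ?thesis using `a n = 0` by (metis less_Suc_eq)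
 qed
 moreover have "ALL i<Suc n. ?w i : ext v V"
  using w(1) subsetD[OF ext_sup[of V v]] ext_in[OF sV, of v] by (simp add: less_Suc_eq)
 ultimately show ?case by (intro exI[of _ ?w] conjI ballI allI impI) simp_all
qed

lemma dm_of_indep:
 assumes "sub U" "sub V" "U <= V" "ALL i<n. w i : V"
  "ALL a. (ALL i<n. a i : k) --> (SUM i<n. a i *s w i) : U --> (ALL i<n. a i = 0)"
 shows "EX W. W <= V & dm U n W & (ALL x:W. EX a. (ALL i. a i : k) & x - (SUM i<n. a i *s w i) : U)"
 using assms(4,5)
proof (induction n)
 case 0
 have "ALL v:U. EX a::nat => 'a. (ALL i. a i : k) & v - (SUM i<0. a i *s w i) : U"
  by (rule ballI, rule exI[of _ "%_. 0"]) (simp add: sf_0[OF k])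
 thus ?case using assms(3) by (intro exI[of _ U] conjI) (simp_all add: rdim.rZ)
next
 case (Suc n)
 have "ALL i<n. a i = 0" if a: "ALL i<n. a i : k" "(SUM i<n. a i *s w i) : U" for a
 proof -
  let ?a = "%i. if i < n then a i else 0"
  have "(SUM i<Suc n. ?a i *s w i) : U" using a(2) by simp
  moreover have "ALL i<Suc n. ?a i : k" using a(1) sf_0[OF k] by simp
  ultimately have "ALL i<Suc n. ?a i = 0" using Suc.prems(2)[THEN spec, of ?a] by (elim impE)
  thus ?thesis by (metis less_SucI)
 qed
 hence 1: "ALL a. (ALL i<n. a i : k) --> (SUM i<n. a i *s w i) : U --> (ALL i<n. a i = 0)" by simp
 have 2: "ALL i<n. w i : V" using Suc.prems(1) by simp
 obtain W where W: "W <= V" "dm U n W" "ALL x:W. EX a. (ALL i. a i : k) & x - (SUM i<n. a i *s w i) : U"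
  using Suc.IH[OF 2 1] by (elim exE conjE)
 have "w n ~: W"
 proof
  assume "w n : W"
  then obtain a where a: "ALL i. a i : k" "w n - (SUM i<n. a i *s w i) : U" using W(3) by blast
  let ?a = "%i. if i < n then - a i else 1"
  have "(SUM i<Suc n. ?a i *s w i) = w n - (SUM i<n. a i *s w i)" by (simp add: sum_negf)
  hence "(SUM i<Suc n. ?a i *s w i) : U" using a(2) by simp
  moreover have "ALL i<Suc n. ?a i : k" using a(1) sf_1[OF k] sf_uminus[OF k] by simp
  ultimately have "ALL i<Suc n. ?a i = 0" using Suc.prems(2)[THEN spec, of ?a] by (elim impE)
  thus False by (metis lessI less_irrefl zero_neq_one)
 qed
 hence d: "dm U (Suc n) (ext (w n) W)" using rdim.rS[OF W(2)] by simp
 have c1: "ext (w n) W <= V" using ext_le[OF assms(2) W(1)] Suc.prems(1) by simp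
 have c2: "EX a. (ALL i. a i : k) & x - (SUM i<Suc n. a i *s w i) : U" if x: "x : ext (w n) W" for x
 proof -
  obtain b u where bu: "x = b *s w n + u" "b : k" "u : W" using x unfolding lext_def by (elim CollectE exE conjE)
  obtain a where a: "ALL i. a i : k" "u - (SUM i<n. a i *s w i) : U" using W(3)[THEN bspec, OF bu(3)] by (elim exE conjE)
  have "x - (SUM i<Suc n. (if i = n then b else a i) *s w i) : U"
   using a(2) bu(1) by (simp add: algebra_simps)
  thus ?thesis using a(1) bu(2) by (intro exI[of _ "%i. if i = n then b else a i"]) simp
 qed
 show ?case using d c1 c2 by (intro exI[of _ "ext (w n) W"] conjI ballI)
qed

lemma dm_independent_le:
 assumes "dm U n V" "sub U" "ALL i<m. w i : V"
  "ALL a. (ALL i<m. a i : k) --> (SUM i<m. a i *s w i) : U --> (ALL i<m. a i = 0)"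
 shows "m <= n"
proof -
 obtain W where "W <= V" "dm U m W"
  using dm_of_indep[OF assms(2) dm_sub[OF assms(1,2)] dm_sup[OF assms(1)] assms(3,4)] by (elim exE conjE)
 thus ?thesis using dm_mono[OF assms(1) _ _ assms(2)] by simp
qed

lemma dm_dependent:
 assumes "dm U n V" "sub U" "ALL i<=n. w i : V"
 shows "EX a. (ALL i<=n. a i : k) & (EX i<=n. a i ~= 0) & (SUM i<=n. a i *s w i) : U"
proof (rule ccontr)
 assume c: "~ ?thesis"
 have 1: "ALL a. (ALL i<Suc n. a i : k) --> (SUM i<Suc n. a i *s w i) : U --> (ALL i<Suc n. a i = 0)"
 proof (intro allI impI)
  fix a i assume "ALL i<Suc n. a i : k" "(SUM i<Suc n. a i *s w i) : U" "i < Suc n"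
  thus "a i = 0" using c unfolding lessThan_Suc_atMost less_Suc_eq_le by metis
 qed
 have "ALL i<Suc n. w i : V" using assms(3) by (simp add: less_Suc_eq_le)
 from dm_independent_le[OF assms(1,2) this 1] show False by simp
qed

definition splus :: "'b set => 'b set => 'b set" where
 "splus M V = {x + v | x v. x : M & v : V}"

lemma sub_splus: assumes "sub M" "sub V" shows "sub (splus M V)"
 unfolding subsp_def
proof (intro conjI ballI)
 show "0 : splus M V" using assms[THEN sub_0] unfolding splus_def by force
 fix x y assume "x : splus M V" "y : splus M V"
 then obtain a b c d where "x = a + b" "y = c + d" "a : M" "c : M" "b : V" "d : V" unfolding splus_def by blast
 hence "x + y = (a + c) + (b + d)" "a + c : M" "b + d : V" using sub_add assms by auto
 thus "x + y : splus M V" unfolding splus_def by blast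
next
 fix a x assume a: "a : k" "x : splus M V"
 then obtain m v where mv: "x = m + v" "m : M" "v : V" unfolding splus_def by blast
 thus "a *s x : splus M V" unfolding splus_def
  using sub_scale[OF assms(1) a(1) mv(2)] sub_scale[OF assms(2) a(1) mv(3)] scale_right_distrib[of a m v] by blast
qed

text \<open>Second isomorphism theorem: \<open>(M + V) / M\<close> is \<open>V / (M Int V)\<close>,
  here with trivial intersection.\<close>

lemma dm_splus:
 assumes "dm {0} n V" "sub M" "M Int V = {0}" shows "dm M n (splus M V)"
 using assms(1,3)
proof (induction rule: rdim.induct)
 case rZ
 have "splus M {0} = M" unfolding splus_def by auto
 thus ?case using rdim.rZ[of scale k M] by simp
next
 case (rS n V v)
 have sV: "sub V" using rS dm_sub sub_zero by auto
 have "M Int V = {0}" using rS ext_sup sub_0[OF sV] sub_0[OF assms(2)] by blast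
 hence IH: "dm M n (splus M V)" using rS.IH by auto
 have "v ~: splus M V"
 proof
  assume "v : splus M V"
  then obtain x u where xu: "v = x + u" "x : M" "u : V" unfolding splus_def by blast
  hence "x = v - u" by simp
  hence "x : ext v V" using ext_in[OF sV] ext_sup xu sub_diff[OF sub_ext[OF sV]] by blast
  hence "x = 0" using xu rS.prems by blast
  thus False using xu rS.hyps by auto
 qed
 moreover have "splus M (ext v V) = ext v (splus M V)"
 proof -
  have "x + (a *s v + u) = a *s v + (x + u)" for x a u by (simp add: algebra_simps)
  thus ?thesis unfolding splus_def lext_def by (auto; metis)
 qed
 ultimately show ?case using rdim.rS[OF IH] by metis
qed

end

lemma klin_mult: "sf k ==> klin (*) k"
 unfolding klin_def klin_axioms_def by (auto simp: vector_space_def algebra_simps)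

lemma klin_smult: "sf k ==> klin smult k"
 unfolding klin_def klin_axioms_def vector_space_def by (auto simp: smult_add_left smult_add_right)

lemma lext_image:
 assumes "!!x y. f (x + y) = f x + f y" "!!a x. a : k ==> f (s a x) = s' a (f x)"
 shows "f ` lext s k v U = lext s' k (f v) (f ` U)"
proof
 show "f ` lext s k v U <= lext s' k (f v) (f ` U)" unfolding lext_def using assms by auto blast
 show "lext s' k (f v) (f ` U) <= f ` lext s k v U"
 proof
  fix y assume "y : lext s' k (f v) (f ` U)"
  then obtain a u where "y = s' a (f v) + f u" "a : k" "u : U" unfolding lext_def by blast
  hence "y = f (s a v + u)" "s a v + u : lext s k v U" using assms unfolding lext_def by auto
  thus "y : f ` lext s k v U" by blast
 qed
qed

lemma rdim_image_inj:
 assumes "rdim s k U n V" "inj f" "!!x y. f (x + y) = f x + f y" "!!a x. a : k ==> f (s a x) = s' a (f x)"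
 shows "rdim s' k (f ` U) n (f ` V)"
 using assms(1)
proof (induction rule: rdim.induct)
 case rZ show ?case by (rule rdim.rZ)
next
 case (rS n V v)
 have "f v ~: f ` V" using rS assms(2) by (auto simp: inj_image_mem_iff)
 thus ?case using rdim.rS[OF rS.IH, of "f v"] lext_image[of f k s s' v V] assms by metis
qed


section \<open>Polynomials over a subfield, simple extensions and degrees\<close>

definition pk :: "'a::field set => 'a poly => bool" where
 "pk k p \<longleftrightarrow> (ALL i. coeff p i : k)"

lemma pkD: "pk k p ==> coeff p i : k"
 by (simp add: pk_def)

lemma pk_simps:
 assumes "sf k"
 shows pk_0: "pk k 0" and pk_1: "pk k 1"
  and pk_add: "pk k p ==> pk k q ==> pk k (p + q)"
  and pk_diff: "pk k p ==> pk k q ==> pk k (p - q)"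
  and pk_uminus: "pk k p ==> pk k (- p)"
  and pk_mult: "pk k p ==> pk k q ==> pk k (p * q)"
  and pk_smult: "a : k ==> pk k p ==> pk k (smult a p)"
  and pk_monom: "a : k ==> pk k (monom a n)"
  and pk_pCons: "pk k (pCons a p) \<longleftrightarrow> a : k & pk k p"
  and pk_const: "a : k ==> pk k [:a:]"
proof -
 show 0: "pk k 0" using sf_0[OF assms] by (simp add: pk_def)
 show 1: "pk k (pCons a p) \<longleftrightarrow> a : k & pk k p" for a p
 proof
  assume h: "pk k (pCons a p)"
  have "a : k" using pkD[OF h, of 0] by simp
  moreover have "coeff p i : k" for i using pkD[OF h, of "Suc i"] by simp
  ultimately show "a : k & pk k p" by (simp add: pk_def)
 next
  assume "a : k & pk k p"
  thus "pk k (pCons a p)" by (simp add: pk_def coeff_pCons split: nat.splits)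
 qed
 show c: "a : k ==> pk k [:a:]" for a using 1 0 by simp
 show "pk k 1" using c[OF sf_1[OF assms]] by (simp add: one_pCons)
 show "pk k p ==> pk k q ==> pk k (p + q)" by (simp add: pk_def sf_add[OF assms])
 show "pk k p ==> pk k q ==> pk k (p - q)" by (simp add: pk_def sf_diff[OF assms])
 show "pk k p ==> pk k (- p)" by (simp add: pk_def sf_uminus[OF assms])
 show "pk k p ==> pk k q ==> pk k (p * q)"
  by (simp add: pk_def coeff_mult sf_sum[OF assms] sf_mult[OF assms])
 show "a : k ==> pk k p ==> pk k (smult a p)" by (simp add: pk_def sf_mult[OF assms])
 show "a : k ==> pk k (monom a n)" by (simp add: pk_def coeff_monom sf_0[OF assms])
qed

lemma poly_eq_sum_le: "degree p <= n ==> poly p x = (SUM i<=n. coeff p i * x ^ i)"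
 for x :: "'a::comm_ring_1"
 using arg_cong[OF poly_as_sum_of_monoms'[of p n], of "%p. poly p x"] by (simp add: poly_sum poly_monom)

lemma pk_sum: "sf k ==> (!!i. i : I ==> pk k (f i)) ==> pk k (sum f I)"
 by (induction I rule: infinite_finite_induct) (auto intro: pk_simps)

lemma pk_prod: "sf k ==> (!!i. i : I ==> pk k (f i)) ==> pk k (prod f I)"
 by (induction I rule: infinite_finite_induct) (auto intro: pk_simps)

lemma pk_power: "sf k ==> pk k f ==> pk k (f ^ n)"
 by (induction n) (auto intro: pk_simps)

lemma pk_mono: "pk k p ==> k <= F ==> pk F p"
 by (auto simp: pk_def)

lemma poly_in: "sf F ==> pk F p ==> x : F ==> poly p x : F"
 by (simp add: poly_altdef pk_def sf_sum sf_mult sf_power)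

text \<open>The field \<open>k(x)\<close>. A vanishing denominator gives the quotient 0, so no
  condition on \<open>q\<close> is imposed and membership stays a plain existence statement.\<close>

definition adj :: "'a::field set => 'a => 'a set" where
 "adj k x = {poly p x / poly q x | p q. pk k p & pk k q}"

lemma adjI: "pk k p ==> pk k q ==> poly p x / poly q x : adj k x"
 unfolding adj_def by blast

lemma adj_poly: "sf k ==> pk k p ==> poly p x : adj k x"
 using adjI[of k p 1 x] pk_1 by auto

lemma adj_sup: assumes "sf k" shows "k <= adj k x"
proof
 fix a assume "a : k"
 thus "a : adj k x" using adj_poly[OF assms pk_const[OF assms], of a x] by simp
qed

lemma adj_gen: assumes "sf k" shows "x : adj k x"
 using adj_poly[OF assms, of "[:0,1:]" x] assms by (simp add: pk_pCons pk_0 sf_0 sf_1)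

lemma sf_adj: assumes k: "sf k" shows "sf (adj k x)"
proof -
 have add: "a + b : adj k x" and mult: "a * b : adj k x" if ab: "a : adj k x" "b : adj k x" for a b
 proof -
  obtain p q r s where *: "a = poly p x / poly q x" "b = poly r x / poly s x" "pk k p" "pk k q" "pk k r" "pk k s"
   using ab unfolding adj_def by blast
  have "a * b = poly (p * r) x / poly (q * s) x" using * by simp
  thus "a * b : adj k x" using adjI[OF pk_mult[OF k *(3,5)] pk_mult[OF k *(4,6)], of x] by simp
  show "a + b : adj k x"
  proof (cases "poly q x = 0 | poly s x = 0")
   case True thus ?thesis using ab * by auto
  next
   case False
   hence "a + b = poly (p * s + r * q) x / poly (q * s) x" using * by (simp add: add_frac_eq)
   thus ?thesis using adjI[OF pk_add[OF k pk_mult[OF k *(3,6)] pk_mult[OF k *(5,4)]] pk_mult[OF k *(4,6)], of x] by simp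
  qed
 qed
 have "- a : adj k x & inverse a : adj k x" if "a : adj k x" for a
 proof -
  obtain p q where *: "a = poly p x / poly q x" "pk k p" "pk k q" using `a : adj k x` unfolding adj_def by blast
  have "- a = poly (-p) x / poly q x" "inverse a = poly q x / poly p x" using * by auto
  thus ?thesis using adjI[OF pk_uminus[OF k *(2)] *(3), of x] adjI[OF *(3,2), of x] by simp
 qed
 moreover have "0 : adj k x" "1 : adj k x" using adj_sup[OF k] sf_0[OF k] sf_1[OF k] by auto
 ultimately show ?thesis using add mult by (simp add: sf_def)
qed

lemma adj_le: "sf F ==> k <= F ==> x : F ==> adj k x <= F"
proof
 fix z assume F: "sf F" "k <= F" "x : F" and "z : adj k x"
 then obtain p q where z: "z = poly p x / poly q x" "pk k p" "pk k q" unfolding adj_def by blast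
 thus "z : F" using sf_divide[OF F(1) poly_in[OF F(1) pk_mono[OF z(2) F(2)] F(3)] poly_in[OF F(1) pk_mono[OF z(3) F(2)] F(3)]] by simp
qed

lemma adj_mono: "k <= F ==> adj k x <= adj F x"
 unfolding adj_def pk_def by blast

lemma adj_common_denominator:
 fixes n :: nat assumes k: "sf k" and "ALL i<n. a i : adj k x"
 shows "EX q p. pk k q & poly q x ~= 0 & (ALL i<n. pk k (p i) & a i * poly q x = poly (p i) x)"
 using assms(2)
proof (induction n)
 case 0 show ?case using pk_1[OF k] by (auto intro!: exI[of _ 1])
next
 case (Suc n)
 then obtain q p where qp: "pk k q" "poly q x ~= 0" "ALL i<n. pk k (p i) & a i * poly q x = poly (p i) x"
  using Suc.IH by (metis less_SucI)
 obtain r s where rs: "a n = poly r x / poly s x" "pk k r" "pk k s" using Suc.prems unfolding adj_def by blast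
 show ?case
 proof (cases "poly s x = 0")
  case True
  hence "a n = 0" using rs by simp
  hence "ALL i<Suc n. pk k ((p(n:=0)) i) & a i * poly q x = poly ((p(n:=0)) i) x"
   using qp(3) pk_0[OF k] by (simp add: less_Suc_eq)
  thus ?thesis using qp(1,2) by (intro exI[of _ q] exI[of _ "p(n:=0)"]) simp
 next
  case False
  have "ALL i<Suc n. pk k (((%i. p i * s)(n:=r*q)) i) & a i * poly (q*s) x = poly (((%i. p i * s)(n:=r*q)) i) x"
  proof (intro allI impI)
   fix i assume "i < Suc n"
   then consider "i = n" | "i < n" "i ~= n" by linarith
   thus "pk k (((%i. p i * s)(n:=r*q)) i) & a i * poly (q*s) x = poly (((%i. p i * s)(n:=r*q)) i) x"
   proof cases
   case 1 thus ?thesis using rs(1) False pk_mult[OF k rs(2) qp(1)] by simp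
   next
   case 2
   hence "pk k (p i)" "a i * poly q x = poly (p i) x" using qp(3) by auto
   thus ?thesis using 2 pk_mult[OF k _ rs(3)] by (simp add: mult.assoc[symmetric])
   qed
  qed
  thus ?thesis using qp(2) False pk_mult[OF k qp(1) rs(3)] by (intro exI[of _ "q*s"] exI[of _ "(%i. p i * s)(n:=r*q)"]) simp
 qed
qed

definition transc :: "'a::field set => 'a => bool" where
 "transc k x \<longleftrightarrow> (ALL p. pk k p --> poly p x = 0 --> p = 0)"

abbreviation rd :: "'a::field set => 'a set => nat => 'a set => bool" where
 "rd \<equiv> rdim (*)"

abbreviation ssp :: "'a::field set => 'a set => bool" where
 "ssp \<equiv> subsp (*)"

text \<open>The degree \<open>[S : F]\<close>. It is meaningful only together with
  \<open>ffin F S\<close>, since \<open>THE\<close> is unspecified otherwise.\<close>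

definition fdeg :: "'a::field set => 'a set => nat" where
 "fdeg F S = (THE n. rd F {0} n S)"

definition ffin :: "'a::field set => 'a set => bool" where
 "ffin F S \<longleftrightarrow> (EX n. rd F {0} n S)"

lemma ssp_sf: "sf S ==> k <= S ==> ssp k S"
 by (simp add: subsp_def sf_0 sf_add sf_mult subset_iff)

lemma fdeg_eq: "sf F ==> rd F {0} n S ==> fdeg F S = n"
 unfolding fdeg_def using klin.dm_unique[OF klin_mult] klin.sub_zero[OF klin_mult] by blast

lemma ffin_rd: "sf F ==> ffin F S ==> rd F {0} (fdeg F S) S"
 unfolding ffin_def using fdeg_eq by metis

text \<open>Each \<open>G\<close>-line of the chain is an \<open>n\<close>-dimensional space over
  \<open>F\<close> that meets the previous subspace in 0, and so contributes
  \<open>n\<close>.\<close>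

lemma rd_tower:
 assumes F: "sf F" and G: "sf G" and "rd F {0} n G" and "rd G U m W" and "ssp G U" and "F <= G"
 shows "rd F U (n * m) W"
 using assms(4)
proof (induction rule: rdim.induct)
 case rZ show ?case by (simp add: rdim.rZ)
next
 case (rS m V v)
 interpret F: klin "(*)" F by (rule klin_mult[OF F])
 interpret G: klin "(*)" G by (rule klin_mult[OF G])
 have GV: "ssp G V" using G.dm_sub[OF rS.hyps(1) assms(5)] .
 have FV: "ssp F V" using GV assms(6) unfolding subsp_def by (simp add: subset_iff)
 have v0: "v ~= 0" using rS.hyps G.sub_0[OF GV] by auto
 have "rd F ((%g. g * v) ` {0}) n ((%g. g * v) ` G)"
  by (rule rdim_image_inj[OF assms(3), where f = "%g. g * v"]) (simp_all add: inj_def v0 distrib_right)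
 hence 1: "rd F {0} n ((%g. g * v) ` G)" by simp
 have "V Int (%g. g * v) ` G = {0}"
 proof -
  have "g * v = 0" if g: "g : G" "g * v : V" for g
  proof (rule ccontr)
   assume "g * v ~= 0"
   hence "v = inverse g * (g * v)" by auto
   hence "v : V" using G.sub_scale[OF GV sf_inv[OF G g(1)] g(2)] by metis
   thus False using rS.hyps by simp
  qed
  hence "V Int (%g. g * v) ` G <= {0}" by blast
  moreover have "0 : (%g. g * v) ` G" using sf_0[OF G] by (intro image_eqI[of _ _ 0]) simp_all
  ultimately show ?thesis using G.sub_0[OF GV] by blast
 qed
 from F.dm_splus[OF 1 FV this] have 2: "rd F V n (F.splus V ((%g. g * v) ` G))" .
 have "F.splus V ((%g. g * v) ` G) = lext (*) G v V"
 proof -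
  have "{x + va |x va. x : V & va : (%g. g * v) ` G} = {x + g * v |x g. x : V & g : G}" by blast
  also have "... = {g * v + x |g x. g : G & x : V}" by (metis (no_types, opaque_lifting) add.commute)
  finally show ?thesis unfolding F.splus_def lext_def .
 qed
 thus ?case using F.dm_trans[OF 2 rS.IH] by (simp add: add.commute)
qed

text \<open>A family independent over the larger field is independent over the smaller one, which
  bounds every chain over \<open>G\<close>.\<close>

lemma rd_larger_field:
 assumes F: "sf F" and G: "sf G" and "F <= G" "rd F U n V" "ssp G U" "ssp G V"
 shows "EX m<=n. rd G U m V"
proof -
 interpret F: klin "(*)" F by (rule klin_mult[OF F])
 interpret G: klin "(*)" G by (rule klin_mult[OF G])
 have FU: "ssp F U" using assms(3,5) unfolding subsp_def by (simp add: subset_iff)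
 show ?thesis
 proof (rule G.dm_bounded[OF assms(5,6) F.dm_sup[OF assms(4)]])
  fix m W assume W: "rd G U m W" "W <= V"
  obtain w where w: "ALL i<m. w i : W" "ALL a. (ALL i<m. a i : G) --> (SUM i<m. a i * w i) : U --> (ALL i<m. a i = 0)"
   using G.dm_basis[OF W(1) assms(5)] by (elim exE conjE)
  show "m <= n"
  proof (rule F.dm_independent_le[OF assms(4) FU])
   show "ALL i<m. w i : V" using w(1) W(2) by blast
   show "ALL a. (ALL i<m. a i : F) --> (SUM i<m. a i * w i) : U --> (ALL i<m. a i = 0)"
   proof (intro allI impI)
   fix a i assume a: "ALL i<m. a i : F" "(SUM i<m. a i * w i) : U" "i < m"
   have "ALL i<m. a i : G" using a(1) assms(3) by blast
   thus "a i = 0" using w(2)[THEN spec, of a] a(2,3) by blast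
   qed
  qed
 qed
qed

text \<open>Values at \<open>x\<close> of polynomials of degree below \<open>N\<close>. Bounding
  coefficients instead of \<open>degree\<close> makes \<open>N = 0\<close> give
  \<open>{0}\<close>.\<close>

definition plt :: "'a::field set => 'a => nat => 'a set" where
 "plt k x N = {poly p x | p. pk k p & (ALL j>=N. coeff p j = 0)}"

lemma plt_0: "sf k ==> plt k x 0 = {0}"
proof -
 assume k: "sf k"
 have "p = 0" if "ALL j>=0. coeff p j = 0" for p :: "'a poly" using that by (auto intro: poly_eqI)
 hence "plt k x 0 <= {0}" unfolding plt_def using poly_0[of x] by blast
 moreover have "poly 0 x : plt k x 0" unfolding plt_def using pk_0[OF k] by (intro CollectI exI[of _ 0]) simp
 ultimately show ?thesis by auto
qed

lemma plt_Suc: assumes k: "sf k"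
 shows "plt k x (Suc N) = lext (*) k (x ^ N) (plt k x N)"
proof
 show "lext (*) k (x ^ N) (plt k x N) <= plt k x (Suc N)"
 proof
  fix z assume "z : lext (*) k (x ^ N) (plt k x N)"
  then obtain a p where *: "z = a * x ^ N + poly p x" "a : k" "pk k p" "ALL j>=N. coeff p j = 0"
   unfolding lext_def plt_def by blast
  have "z = poly (monom a N + p) x" using * by (simp add: poly_monom)
  moreover have "pk k (monom a N + p)" using pk_add[OF k pk_monom[OF k *(2)] *(3)] .
  moreover have "ALL j>=Suc N. coeff (monom a N + p) j = 0" using *(4) by (simp add: coeff_monom)
  ultimately show "z : plt k x (Suc N)" unfolding plt_def by blast
 qed
 show "plt k x (Suc N) <= lext (*) k (x ^ N) (plt k x N)"
 proof
  fix z assume "z : plt k x (Suc N)"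
  then obtain p where *: "z = poly p x" "pk k p" "ALL j>=Suc N. coeff p j = 0" unfolding plt_def by blast
  let ?p = "p - monom (coeff p N) N"
  have "z = coeff p N * x ^ N + poly ?p x" using * by (simp add: poly_monom)
  moreover have "pk k ?p" using pk_diff[OF k *(2) pk_monom[OF k pkD[OF *(2)]]] .
  moreover have "ALL j>=N. coeff ?p j = 0"
  proof (intro allI impI)
   fix j assume "j >= N"
   thus "coeff ?p j = 0" using *(3) by (cases "j = N") (auto simp: coeff_monom)
  qed
  ultimately show "z : lext (*) k (x ^ N) (plt k x N)" unfolding lext_def plt_def using pkD[OF *(2)] by blast
 qed
qed

lemma ssp_plt: "sf k ==> ssp k (plt k x N)"
 by (induction N) (simp_all add: plt_0 plt_Suc klin.sub_zero[OF klin_mult] klin.sub_ext[OF klin_mult])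

lemma rd_plt:
 assumes k: "sf k" shows "EX m<=N. rd k {0} m (plt k x N)"
proof (induction N)
 case 0 show ?case using rdim.rZ[of "(*)" k "{0}"] by (simp add: plt_0[OF k])
next
 case (Suc N)
 then obtain m where m: "m <= N" "rd k {0} m (plt k x N)" by blast
 interpret klin "(*)" k by (rule klin_mult[OF k])
 show ?case
 proof (cases "x ^ N : plt k x N")
  case True
  hence "lext (*) k (x ^ N) (plt k x N) = plt k x N"
   using ext_le[OF ssp_plt[OF k] order_refl True] ext_sup by blast
  thus ?thesis using m plt_Suc[OF k] by (metis le_Suc_eq)
 next
  case False
  thus ?thesis using rdim.rS[OF m(2) False] plt_Suc[OF k] m(1) by (metis Suc_le_mono)
 qed
qed

lemma rd_plt_transc:
 assumes k: "sf k" and x: "transc k x" shows "rd k {0} N (plt k x N)"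
proof (induction N)
 case 0 show ?case using rdim.rZ[of "(*)" k "{0}"] by (simp add: plt_0[OF k])
next
 case (Suc N)
 have "x ^ N ~: plt k x N"
 proof
  assume "x ^ N : plt k x N"
  then obtain p where p: "x ^ N = poly p x" "pk k p" "ALL j>=N. coeff p j = 0" unfolding plt_def by blast
  have "poly (p - monom 1 N) x = 0" using p by (simp add: poly_monom)
  moreover have "pk k (p - monom 1 N)" using pk_diff[OF k p(2) pk_monom[OF k sf_1[OF k]]] .
  ultimately have "p = monom 1 N" using x unfolding transc_def by auto
  thus False using p(3) by auto
 qed
 thus ?case using rdim.rS[OF Suc.IH] plt_Suc[OF k] by metis
qed

lemma poly_reduce_dvd:
 assumes L: "sf L" and "pk L G" "G ~= 0" and "pk L p"
 shows "EX h. pk L h & (ALL j>=degree G. coeff h j = 0) & G dvd p - h"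
proof -
 have "degree p < N + degree G ==> pk L p ==>
  EX h. pk L h & (ALL j>=degree G. coeff h j = 0) & G dvd p - h" for N p
 proof (induction N arbitrary: p)
  case 0
  thus ?case by (intro exI[of _ p]) (simp add: coeff_eq_0)
 next
  case (Suc N)
  show ?case
  proof (cases "degree p < N + degree G")
   case True thus ?thesis using Suc by blast
  next
   case False
   hence d: "degree p = N + degree G" using Suc by simp
   define q where "q = p - monom (lead_coeff p / lead_coeff G) N * G"
   have pk: "pk L q" unfolding q_def
   by (intro pk_diff[OF L] pk_mult[OF L] pk_monom[OF L] sf_divide[OF L] pkD Suc.prems(2) assms(2))
   have v: "G dvd p - q" unfolding q_def by simp
   show ?thesis
   proof (cases "q = 0")
   case True
   thus ?thesis using v pk_0[OF L] by (intro exI[of _ 0]) simp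
   next
   case q0: False
   have "degree q <= N + degree G" unfolding q_def using d
   by (intro degree_diff_le order.trans[OF degree_mult_le]) (simp_all add: degree_monom_le)
   moreover have "coeff q (N + degree G) = 0" unfolding q_def using d assms(3) by (simp add: coeff_monom_mult)
   ultimately have "degree q < N + degree G" using q0 by (metis leading_coeff_0_iff order_le_less)
   from Suc.IH[OF this pk] obtain h where h: "pk L h" "ALL j>=degree G. coeff h j = 0" "G dvd q - h" by blast
   have "G dvd (p - q) + (q - h)" by (rule dvd_add[OF v h(3)])
   thus ?thesis using h(1,2) by (intro exI[of _ h]) simp
   qed
  qed
 qed
 from this[of p "Suc (degree p)"] show ?thesis using assms(4) by simp
qed

lemma poly_reduce:
 assumes "sf L" "pk L G" "G ~= 0" "pk L p"
 shows "EX h. pk L h & (ALL j>=degree G. coeff h j = 0) & (ALL x. poly G x = 0 --> poly h x = poly p x)"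
proof -
 obtain h where h: "pk L h" "ALL j>=degree G. coeff h j = 0" "G dvd p - h" using poly_reduce_dvd[OF assms] by (elim exE conjE)
 then obtain g where "p - h = G * g" by (elim dvdE)
 hence "p = h + G * g" by (simp add: diff_eq_eq add.commute)
 thus ?thesis using h(1,2) by (intro exI[of _ h]) simp
qed

text \<open>Finitely many elements of \<open>L(x)\<close> have a common denominator. Multiplying by
  it moves them into \<open>L[x]\<close>, which is spanned by the powers below
  \<open>degree G\<close>, so finiteness follows without inverting anything modulo
  \<open>G\<close>.\<close>

lemma finite_adj:
 assumes L: "sf L" and "pk L G" "G ~= 0" "poly G x = 0" shows "EX m<=degree G. rd L {0} m (adj L x)"
proof -
 interpret klin "(*)" L by (rule klin_mult[OF L])
 have red: "poly p x : plt L x (degree G)" if p: "pk L p" for p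
 proof -
  obtain h where h: "pk L h" "ALL j>=degree G. coeff h j = 0" "ALL x. poly G x = 0 --> poly h x = poly p x"
   using poly_reduce[OF L assms(2,3) p] by (elim exE conjE)
  hence "poly p x = poly h x" using assms(4) by simp
  thus ?thesis unfolding plt_def using h(1,2) by blast
 qed
 obtain d where d: "d <= degree G" "rd L {0} d (plt L x (degree G))" using rd_plt[OF L] by blast
 show ?thesis
 proof (rule dm_bounded[OF sub_zero ssp_sf[OF sf_adj[OF L] adj_sup[OF L]]])
  show "{0} <= adj L x" using sf_0[OF sf_adj[OF L]] by simp
  fix m W assume W: "rd L {0} m W" "W <= adj L x"
  obtain w where w: "ALL i<m. w i : W" "ALL a. (ALL i<m. a i : L) --> (SUM i<m. a i * w i) : {0} --> (ALL i<m. a i = 0)"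
   using dm_basis[OF W(1) sub_zero] by (elim exE conjE)
  have wA: "ALL i<m. w i : adj L x" using w(1) W(2) by blast
  obtain q p where qp: "pk L q" "poly q x ~= 0" "ALL i<m. pk L (p i) & w i * poly q x = poly (p i) x"
   using adj_common_denominator[OF L wA] by (elim exE conjE)
  have "m <= d"
  proof (rule dm_independent_le[OF d(2) sub_zero])
   show "ALL i<m. w i * poly q x : plt L x (degree G)"
   proof (intro allI impI)
   fix i assume "i < m"
   thus "w i * poly q x : plt L x (degree G)" using red[of "p i"] qp(3)[rule_format, of i] by simp
   qed
   show "ALL a. (ALL i<m. a i : L) --> (SUM i<m. a i * (w i * poly q x)) : {0} --> (ALL i<m. a i = 0)"
   proof (intro allI impI)
   fix a i assume a: "ALL i<m. a i : L" "(SUM i<m. a i * (w i * poly q x)) : {0}" "i < m"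
   have "(SUM i<m. a i * w i) * poly q x = 0" using a(2) unfolding sum_distrib_right mult.assoc by blast
   hence "(SUM i<m. a i * w i) : {0}" using qp(2) by simp
   thus "a i = 0" using w(2) a(1,3) by blast
   qed
  qed
  thus "m <= degree G" using d(1) by simp
 qed
qed

lemma algebraic_of_finite:
 assumes F: "sf F" and S: "sf S" "F <= S" "rd F {0} n S" "z : S"
 shows "EX p. pk F p & p ~= 0 & degree p <= n & poly p z = 0"
proof -
 interpret klin "(*)" F by (rule klin_mult[OF F])
 obtain a where a: "ALL i<=n. a i : F" "EX i<=n. a i ~= 0" "(SUM i<=n. a i * z ^ i) : {0}"
  using dm_dependent[OF S(3) sub_zero, of "%i. z ^ i"] sf_power[OF S(1,4)] by blast
 let ?p = "SUM i<=n. monom (a i) i"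
 have "pk F ?p" using a(1) by (intro pk_sum[OF F] pk_monom[OF F]) simp
 moreover have c: "coeff ?p j = (if j <= n then a j else 0)" for j
  by (simp add: coeff_sum coeff_monom)
 have "?p ~= 0" using a(2) c by (metis coeff_0)
 moreover have "degree ?p <= n" using c by (intro degree_le) auto
 moreover have "poly ?p z = 0" using a(3) by (simp add: poly_sum poly_monom)
 ultimately show ?thesis by blast
qed

text \<open>An algebraic relation of \<open>y\<close> over \<open>k(x)\<close> becomes, after
  clearing denominators, a polynomial relation between both elements. Read as a polynomial in
  \<open>x\<close> over \<open>k(y)\<close> it is nonzero because \<open>y\<close> is
  transcendental, so \<open>x\<close> is algebraic over \<open>k(y)\<close>.\<close>

lemma transc_adj_swap:
 assumes k: "sf k" and S: "sf S" and kS: "k <= S" and x: "x : S" and fin: "ffin (adj k x) S"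
  and y: "y : S" "transc k y"
 shows "ffin (adj k y) S"
proof -
 let ?F = "adj k x" let ?L = "adj k y"
 have F: "sf ?F" "?F <= S" using sf_adj[OF k] adj_le[OF S kS x] by auto
 have L: "sf ?L" "?L <= S" using sf_adj[OF k] adj_le[OF S kS y(1)] by auto
 obtain n where n: "rd ?F {0} n S" using fin unfolding ffin_def by blast
 obtain P where P: "pk ?F P" "P ~= 0" "degree P <= n" "poly P y = 0" using algebraic_of_finite[OF F(1) S F(2) n y(1)] by blast
 obtain q p where qp: "pk k q" "poly q x ~= 0" "ALL i<Suc n. pk k (p i) & coeff P i * poly q x = poly (p i) x"
  using adj_common_denominator[OF k, of "Suc n" "coeff P" x] pkD[OF P(1)] by blast
 define M where "M = Max ((%i. degree (p i)) ` {..n})"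
 have M: "degree (p i) <= M" if "i <= n" for i unfolding M_def using that by auto
 \<comment> \<open>Exchange of the variables: \<open>g i\<close> collects the coefficient of
   \<open>x^i\<close> as a polynomial in \<open>y\<close>.\<close>
 define g where "g = (%i. SUM j<=n. monom (coeff (p j) i) j)"
 define G where "G = (SUM i<=M. monom (poly (g i) y) i)"
 have pkg: "pk k (g i)" for i unfolding g_def by (intro pk_sum[OF k] pk_monom[OF k] pkD) (simp add: qp(3) less_Suc_eq_le)
 have pkG: "pk ?L G" unfolding G_def by (intro pk_sum[OF L(1)] pk_monom[OF L(1)] adj_poly[OF k] pkg)
 have cg: "coeff (g i) j = (if j <= n then coeff (p j) i else 0)" for i j
  unfolding g_def by (simp add: coeff_sum coeff_monom)
 have cG: "coeff G i = (if i <= M then poly (g i) y else 0)" for i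
  unfolding G_def by (simp add: coeff_sum coeff_monom)
 have "poly G x = (SUM i<=M. SUM j<=n. coeff (p j) i * y ^ j * x ^ i)"
  unfolding G_def g_def by (simp add: poly_sum poly_monom sum_distrib_right)
 also have "... = (SUM j<=n. SUM i<=M. coeff (p j) i * y ^ j * x ^ i)" by (rule sum.swap)
 also have "... = (SUM j<=n. poly (p j) x * y ^ j)"
 proof (rule sum.cong)
  fix j assume "j : {..n}"
  hence "poly (p j) x = (SUM i<=M. coeff (p j) i * x ^ i)" using M[of j] by (intro poly_eq_sum_le) auto
  thus "(SUM i<=M. coeff (p j) i * y ^ j * x ^ i) = poly (p j) x * y ^ j"
   by (simp add: sum_distrib_right mult.assoc mult.commute[of "y ^ j"])
 qed simp
 also have "... = poly q x * (SUM j<=n. coeff P j * y ^ j)"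
  using qp(3) unfolding sum_distrib_left by (intro sum.cong) (auto simp: less_Suc_eq_le mult_ac)
 also have "(SUM j<=n. coeff P j * y ^ j) = poly P y" using P(3) by (rule poly_eq_sum_le[symmetric])
 finally have G0: "poly G x = 0" using P(4) by simp
 have "G ~= 0"
 proof -
  obtain j where j: "coeff P j ~= 0" using P(2) by (metis leading_coeff_0_iff)
  hence jn: "j <= n" using P(3) le_degree by fastforce
  have "poly (p j) x ~= 0" using qp j jn by (metis less_Suc_eq_le mult_eq_0_iff)
  hence "p j ~= 0" by auto
  then obtain i where i: "coeff (p j) i ~= 0" by (metis leading_coeff_0_iff)
  have "i <= M" using M[OF jn] le_degree[OF i] by simp
  have "coeff (g i) j ~= 0" using cg i jn by simp
  hence "g i ~= 0" by auto
  hence "poly (g i) y ~= 0" using y(2)[unfolded transc_def, rule_format, OF pkg] by blast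
  hence "coeff G i ~= 0" using cG `i <= M` by simp
  thus ?thesis by auto
 qed
 then obtain a where a: "rd ?L {0} a (adj ?L x)" using finite_adj[OF L(1) pkG _ G0] by blast
 have A: "sf (adj ?L x)" "adj ?L x <= S" using sf_adj[OF L(1)] adj_le[OF S L(2) x] by auto
 have FA: "?F <= adj ?L x" using adj_mono[OF adj_sup[OF k]] .
 have "ssp (adj ?L x) {0}" using klin.sub_zero[OF klin_mult[OF A(1)]] .
 moreover have "ssp (adj ?L x) S" using ssp_sf[OF S A(2)] .
 ultimately obtain m where m: "rd (adj ?L x) {0} m S" using rd_larger_field[OF F(1) A(1) FA n] by blast
 thus ?thesis unfolding ffin_def
  using rd_tower[OF L(1) A(1) a m klin.sub_zero[OF klin_mult[OF A(1)]] adj_sup[OF L(1)]] by blast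
qed

text \<open>The quotient of a ring by the ideal generated by \<^term>\<open>x\<close> has dimension at most the degree over \<^term>\<open>k(x)\<close>:
 a relation with coefficients in \<^term>\<open>k[x]\<close> not all divisible by \<^term>\<open>x\<close> reduces to a relation over \<^term>\<open>k\<close>.\<close>

lemma quotient_dim_le:
 assumes k: "sf k" and S: "sf S" and n: "rd (adj k x) {0} n S" and x: "x ~= 0" "x : R" and R: "k <= R" "R <= S"
  and ring: "ALL a:R. ALL b:R. a + b : R & a * b : R"
  and m: "rd k ((*) x ` R) m W" "W <= R"
 shows "m <= n"
proof -
 interpret klin "(*)" k by (rule klin_mult[OF k])
 let ?F = "adj k x"
 interpret F: klin "(*)" ?F by (rule klin_mult[OF sf_adj[OF k]])
 have sR: "ssp k R" unfolding subsp_def using ring subsetD[OF R(1)] sf_0[OF k] by simp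
 have sx: "ssp k ((*) x ` R)" unfolding subsp_def
 proof (intro conjI ballI)
  show "0 : (*) x ` R" using sub_0[OF sR] by force
  fix a b assume "a : (*) x ` R" "b : (*) x ` R"
  then obtain c d where "a = x * c" "b = x * d" "c : R" "d : R" by blast
  hence "a + b = x * (c + d)" "c + d : R" using ring by (simp_all add: distrib_left)
  thus "a + b : (*) x ` R" by blast
 next
  fix a b assume "a : k" "b : (*) x ` R"
  then obtain c where "b = x * c" "c : R" by blast
  hence "a * b = x * (a * c)" "a * c : R" using ring subsetD[OF R(1) `a : k`] by (simp_all add: mult.left_commute)
  thus "a * b : (*) x ` R" by blast
 qed
 obtain w where w: "ALL i<m. w i : W" "ALL a. (ALL i<m. a i : k) --> (SUM i<m. a i * w i) : (*) x ` R --> (ALL i<m. a i = 0)"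
  using dm_basis[OF m(1) sx] by (elim exE conjE)
 have wR: "ALL i<m. w i : R" using w(1) m(2) by blast
 have polyR: "poly p x : R" if "pk k p" for p using that
 proof (induction p)
  case 0 thus ?case using sub_0[OF sR] by simp
 next
  case (pCons a p)
  hence "a : R" "poly p x : R" using pk_pCons[OF k, of a p] subsetD[OF R(1), of a] by simp_all
  thus ?case using ring x(2) by simp
 qed
 \<comment> \<open>Constant terms come first: modulo \<open>x R\<close> only they survive, so they
   vanish by independence of \<open>w\<close>; then the relation is divided by
   \<open>x\<close>.\<close>
 have ind: "ALL i<m. p i = 0" if "ALL i<m. pk k (p i) & (ALL j>=N. coeff (p i) j = 0)" "(SUM i<m. poly (p i) x * w i) = 0" for p N
  using that
 proof (induction N arbitrary: p)
  case 0 thus ?case by (auto intro: poly_eqI)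
 next
  case (Suc N)
  define c where "c = (%i. coeff (p i) 0)"
  define p' where "p' = (%i. poly_shift 1 (p i))"
  have pe: "p i = pCons (c i) (p' i)" for i unfolding c_def p'_def
   by (rule poly_eqI) (simp add: coeff_pCons coeff_poly_shift split: nat.splits)
  have pk': "ALL i<m. c i : k & pk k (p' i)" using Suc.prems(1) pe pk_pCons[OF k] by metis
  have sR': "(SUM i<m. poly (p' i) x * w i) : R"
  proof (rule sub_sum[OF sR])
   fix i assume "i : {..<m}"
   hence "poly (p' i) x : R" "w i : R" using polyR pk' wR by simp_all
   thus "poly (p' i) x * w i : R" using ring by simp
  qed
  have e: "(SUM i<m. poly (p i) x * w i) = (SUM i<m. c i * w i) + x * (SUM i<m. poly (p' i) x * w i)"
   unfolding sum_distrib_left sum.distrib[symmetric]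
  proof (rule sum.cong)
   fix i
   show "poly (p i) x * w i = c i * w i + x * (poly (p' i) x * w i)"
   by (simp only: pe[of i] poly_pCons distrib_right mult.assoc)
  qed (rule refl)
  hence "(SUM i<m. c i * w i) = x * - (SUM i<m. poly (p' i) x * w i)" unfolding mult_minus_right using Suc.prems(2) by (metis eq_neg_iff_add_eq_0)
  moreover have "- (SUM i<m. poly (p' i) x * w i) : R" using sub_uminus[OF sR sR'] .
  ultimately have "(SUM i<m. c i * w i) : (*) x ` R" by blast
  hence c0: "ALL i<m. c i = 0" using w(2)[THEN spec, of c] pk' by blast
  hence "(SUM i<m. c i * w i) = 0" by simp
  hence "(SUM i<m. poly (p' i) x * w i) = 0" using e Suc.prems(2) x(1) by simp
  moreover have "ALL i<m. pk k (p' i) & (ALL j>=N. coeff (p' i) j = 0)"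
   using pk' Suc.prems(1) by (simp add: p'_def coeff_poly_shift)
  ultimately have "ALL i<m. p' i = 0" using Suc.IH by blast
  thus ?case using pe c0 by simp
 qed
 show ?thesis
 proof (rule F.dm_independent_le[OF n F.sub_zero])
  show "ALL i<m. w i : S" using wR R(2) by blast
  show "ALL a. (ALL i<m. a i : ?F) --> (SUM i<m. a i * w i) : {0} --> (ALL i<m. a i = 0)"
  proof (intro allI impI)
   fix a i assume a: "ALL i<m. a i : ?F" "(SUM i<m. a i * w i) : {0}" "i < m"
   obtain q p where qp: "pk k q" "poly q x ~= 0" "ALL i<m. pk k (p i) & a i * poly q x = poly (p i) x"
   using adj_common_denominator[OF k a(1)] by blast
   have "(SUM i<m. poly (p i) x * w i) = (SUM i<m. a i * w i) * poly q x"
   unfolding sum_distrib_right using qp(3) by (intro sum.cong) (auto simp: algebra_simps)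
   hence z: "(SUM i<m. poly (p i) x * w i) = 0" using a(2) by simp
   define N where "N = Suc (Max ((%i. degree (p i)) ` {..<m}))"
   have "ALL i<m. pk k (p i) & (ALL j>=N. coeff (p i) j = 0)"
   proof (intro allI impI conjI)
   fix i j assume i: "i < m"
   show "pk k (p i)" using qp i by blast
   assume "N <= j"
   moreover have "degree (p i) < N" unfolding N_def using i by (auto simp: less_Suc_eq_le)
   ultimately show "coeff (p i) j = 0" by (intro coeff_eq_0) simp
   qed
   from ind[OF this z] have "p i = 0" using a(3) by blast
   thus "a i = 0" using qp a(3) by (metis mult_eq_0_iff poly_0)
  qed
 qed
qed

section \<open>Chevalley's extension theorem\<close>

definition sring :: "'a::field set => bool" where
 "sring R \<longleftrightarrow> 1 : R & (ALL x:R. ALL y:R. x - y : R & x * y : R)"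

lemma sring_simps:
 assumes "sring R"
 shows sring_1: "1 : R" and sring_diff: "x : R ==> y : R ==> x - y : R"
  and sring_mult: "x : R ==> y : R ==> x * y : R"
  and sring_0: "0 : R" and sring_uminus: "x : R ==> - x : R"
  and sring_add: "x : R ==> y : R ==> x + y : R"
proof -
 show 1: "1 : R" and d: "x : R ==> y : R ==> x - y : R"
  and "x : R ==> y : R ==> x * y : R" for x y using assms by (simp_all add: sring_def)
 show 0: "0 : R" using d[OF 1 1] by simp
 show u: "x : R ==> - x : R" for x using d[OF 0, of x] by simp
 show "x : R ==> y : R ==> x + y : R" for x y using d[OF _ u, of x y] by simp
qed

lemma sring_sum: "sring R ==> (!!i. i : I ==> f i : R) ==> sum f I : R"
 by (induction I rule: infinite_finite_induct) (simp_all add: sring_simps)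

lemma sring_prod: "sring R ==> (!!i. i : I ==> f i : R) ==> prod f I : R"
 by (induction I rule: infinite_finite_induct) (simp_all add: sring_simps)

lemma sring_power: "sring R ==> x : R ==> x ^ n : R"
 by (induction n) (simp_all add: sring_simps)

lemma sring_sf: "sf S ==> sring S"
 by (simp add: sring_def sf_simps)

lemma sring_poly: "sring R ==> pk R p ==> x : R ==> poly p x : R"
 by (simp add: poly_altdef pk_def sring_sum sring_mult sring_power)

definition radj :: "'a::field set => 'a => 'a set" where
 "radj R z = {poly p z | p. pk R p}"

lemma radjI: "pk R p ==> poly p z : radj R z" unfolding radj_def by blast

lemma radj_sup: assumes "sring R" shows "R <= radj R z" "z : radj R z"
proof -
 show "R <= radj R z"
 proof
  fix a assume "a : R"
  hence "pk R [:a:]" by (simp add: pk_def coeff_pCons sring_0[OF assms] split: nat.splits)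
  from radjI[OF this, of z] show "a : radj R z" by simp
 qed
 have "pk R [:0,1:]" by (simp add: pk_def coeff_pCons sring_0[OF assms] sring_1[OF assms] split: nat.splits)
 from radjI[OF this, of z] show "z : radj R z" by simp
qed

lemma sring_radj: assumes R: "sring R" shows "sring (radj R z)"
 unfolding sring_def
proof (intro conjI ballI)
 show "1 : radj R z" using radj_sup(1)[OF R] sring_1[OF R] by blast
 fix x y assume "x : radj R z" "y : radj R z"
 then obtain p q where pq: "x = poly p z" "y = poly q z" "pk R p" "pk R q" unfolding radj_def by blast
 have "pk R (p - q)" using pq(3,4) by (simp add: pk_def sring_diff[OF R])
 from radjI[OF this, of z] show "x - y : radj R z" using pq by simp
 have "pk R (p * q)" using pq(3,4) by (simp add: pk_def coeff_mult sring_mult[OF R] sring_sum[OF R])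
 from radjI[OF this, of z] show "x * y : radj R z" using pq by simp
qed

text \<open>\<open>t * poly p z = 1\<close> says that the inverse of \<open>t\<close> lies in
  \<open>V[z]\<close>. The relation for \<open>inverse z\<close> gives
  \<open>(1 - t b) z^n = t r(z)\<close> with \<open>degree r < n\<close>. Multiplying the relation
  for \<open>z\<close> by \<open>1 - t b\<close> and substituting this removes its leading
  term.\<close>

lemma chevalley_step:
 assumes V: "sring V" "t : V" "inverse t ~: V" and z: "z ~= 0" and p: "pk V p" "t * poly p z = 1"
  and q: "pk V q" "t * poly q (inverse z) = 1" and dd: "degree q <= degree p"
 shows "EX p'. pk V p' & t * poly p' z = 1 & degree p' < degree p"
proof -
 define n where "n = degree p" define m where "m = degree q"
 have n0: "n > 0"
 proof (rule ccontr)
  assume "~ n > 0"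
  hence "poly p z = coeff p 0" using poly_eq_sum_le[of p 0 z] unfolding n_def by simp
  hence "inverse t = coeff p 0" using p(2) by (metis inverse_unique)
  thus False using V(3) pkD[OF p(1), of 0] by simp
 qed
 define b where "b = coeff q 0"
 define r where "r = (SUM i:{1..m}. monom (coeff q i) (n - i))"
 define p0 where "p0 = p - monom (coeff p n) n"
 define p' where "p' = [:b:] + smult (1 - t * b) p0 + smult (t * coeff p n) r"
 note s = sring_simps[OF V(1)]
 have bV: "b : V" unfolding b_def using pkD[OF q(1)] .
 have cr: "coeff r j = (SUM i:{1..m}. if n - i = j then coeff q i else 0)" for j
  unfolding r_def by (simp add: coeff_sum coeff_monom)
 have pkr: "pk V r" unfolding pk_def cr by (intro allI sring_sum[OF V(1)]) (simp add: s(4) pkD[OF q(1)])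
 have pk0: "pk V p0" unfolding p0_def pk_def using pkD[OF p(1)] s by simp
 have pk': "pk V p'" unfolding p'_def pk_def
  using pkD[OF pk0] pkD[OF pkr] pkD[OF p(1)] bV V(2) s by (simp add: coeff_pCons split: nat.splits)
 have "poly q (inverse z) = (SUM i<=m. coeff q i * inverse z ^ i)" unfolding m_def by (rule poly_eq_sum_le) simp
 also have "... = b + (SUM i:{1..m}. coeff q i * inverse z ^ i)"
  unfolding b_def by (simp add: atMost_atLeast0 sum.atLeast_Suc_atMost)
 finally have "t * b + t * (SUM i:{1..m}. coeff q i * inverse z ^ i) = 1" using q(2) by (simp only: distrib_left)
 hence "1 - t * b = t * (SUM i:{1..m}. coeff q i * inverse z ^ i)"
  using add_diff_cancel_left'[of "t * b" "t * (SUM i:{1..m}. coeff q i * inverse z ^ i)"] by (simp only:)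
 hence "(1 - t * b) * z ^ n = t * (SUM i:{1..m}. coeff q i * inverse z ^ i * z ^ n)" by (simp only: sum_distrib_right mult.assoc)
 also have "(SUM i:{1..m}. coeff q i * inverse z ^ i * z ^ n) = poly r z"
  unfolding r_def poly_sum poly_monom
 proof (rule sum.cong)
  fix i assume "i : {1..m}"
  hence "i <= n" using dd n_def m_def by simp
  hence "z ^ n = z ^ i * z ^ (n - i)" by (simp flip: power_add)
  thus "coeff q i * inverse z ^ i * z ^ n = coeff q i * z ^ (n - i)" using z by (simp add: field_simps)
 qed simp
 finally have r: "(1 - t * b) * z ^ n = t * poly r z" .
 have pz: "poly p z = poly p0 z + coeff p n * z ^ n" unfolding p0_def by (simp add: poly_monom)
 have "t * poly p' z = t * b + (1 - t * b) * (t * poly p0 z) + t * coeff p n * (t * poly r z)"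
  unfolding p'_def by (simp add: algebra_simps)
 also have "... = t * b + (1 - t * b) * (t * poly p z)" unfolding r[symmetric] pz by (simp add: algebra_simps)
 finally have "t * poly p' z = 1" using p(2) by simp
 moreover have "degree p' <= n - 1"
 proof (rule degree_le, intro allI impI)
  fix j assume j: "n - 1 < j"
  hence "j >= n" "j > 0" using n0 by auto
  have "coeff p0 j = 0" unfolding p0_def using `j >= n` n_def by (cases "j = n") (simp_all add: coeff_eq_0)
  moreover have "coeff r j = 0" unfolding cr using `j >= n` n0 by (intro sum.neutral) auto
  ultimately show "coeff p' j = 0" unfolding p'_def using `j > 0` by (simp add: coeff_pCons split: nat.splits)
 qed
 ultimately show ?thesis using pk' n0 n_def by (intro exI[of _ p'] conjI) simp_all
qed

lemma chevalley_descent: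
 assumes V: "sring V" "t : V" "inverse t ~: V"
 shows "z ~= 0 ==> pk V p ==> t * poly p z = 1 ==> pk V q ==> t * poly q (inverse z) = 1 ==> False"
proof (induction "degree p + degree q" arbitrary: p q z rule: less_induct)
 case less
 show ?case
 proof (cases "degree q <= degree p")
  case True
  obtain p' where "pk V p'" "t * poly p' z = 1" "degree p' < degree p"
   using chevalley_step[OF V less.prems True] by blast
  thus ?thesis using less.hyps[of p' q z] less.prems by simp
 next
  case False
  obtain q' where "pk V q'" "t * poly q' (inverse z) = 1" "degree q' < degree q"
   using chevalley_step[OF V, of "inverse z" q p] less.prems False by auto
  thus ?thesis using less.hyps[of p q' z] less.prems by simp
 qed
qed

text \<open>Zorn's lemma yields a maximal ring without \<open>inverse t\<close>. If neither
  \<open>z\<close> nor \<open>inverse z\<close> were in it, adjoining either would bring in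
  \<open>inverse t\<close>, and the descent on degrees excludes that both happen.\<close>

lemma chevalley:
 assumes S: "sf S" and R: "sring R" "R <= S" "t : R" "inverse t ~: R"
 shows "EX V. sring V & R <= V & V <= S & inverse t ~: V & (ALL z:S. z : V | inverse z : V)"
proof -
 define A where "A = {V. sring V & R <= V & V <= S & inverse t ~: V}"
 have RA: "R : A" unfolding A_def using R by blast
 have un: "\<Union>C : A" if C: "C ~= {}" "subset.chain A C" for C
 proof -
  have CA: "!!V. V : C ==> sring V & R <= V & V <= S & inverse t ~: V"
   using C(2) unfolding subset.chain_def A_def by blast
  have lin: "!!V W. V : C ==> W : C ==> V <= W | W <= V" using C(2) unfolding subset.chain_def by blast
  have "sring (\<Union>C)" unfolding sring_def
  proof (intro conjI ballI)
   obtain V where "V : C" using C(1) by blast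
   thus "1 : \<Union>C" using CA sring_1 by blast
   fix x y assume "x : \<Union>C" "y : \<Union>C"
   then obtain V W where VW: "V : C" "W : C" "x : V" "y : W" by blast
   then obtain Z where Z: "Z : C" "x : Z" "y : Z" using lin[of V W] by blast
   have sz: "sring Z" using CA[OF Z(1)] by simp
   show "x - y : \<Union>C" using sring_diff[OF sz Z(2,3)] Z(1) by blast
   show "x * y : \<Union>C" using sring_mult[OF sz Z(2,3)] Z(1) by blast
  qed
  moreover have "R <= \<Union>C" using C(1) CA by blast
  moreover have "\<Union>C <= S" using CA by blast
  moreover have "inverse t ~: \<Union>C" using CA by blast
  ultimately show ?thesis unfolding A_def by blast
 qed
 have "EX M:A. ALL Y:A. M <= Y --> Y = M" using RA un by (intro subset_Zorn_nonempty) blast+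
 then obtain V where V: "V : A" "!!Y. Y : A ==> V <= Y ==> Y = V" by blast
 have Vp: "sring V" "R <= V" "V <= S" "inverse t ~: V" using V(1) unfolding A_def by auto
 have tV: "t : V" using R(3) Vp(2) by blast
 have t0: "t ~= 0" using Vp(4) sring_0[OF Vp(1)] by auto
 have ext: "EX p. pk V p & t * poly p z = 1" if z: "z : S" "z ~: V" for z
 proof -
  have "radj V z <= S" unfolding radj_def using poly_in[OF S pk_mono[OF _ Vp(3)] z(1)] by blast
  moreover have "radj V z ~= V" using radj_sup(2)[OF Vp(1), of z] z(2) by blast
  ultimately have "inverse t : radj V z"
   using V(2)[of "radj V z"] radj_sup(1)[OF Vp(1), of z] sring_radj[OF Vp(1), of z] Vp(2) unfolding A_def by blast
  then obtain p where "inverse t = poly p z" "pk V p" unfolding radj_def by blast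
  thus ?thesis using t0 by (metis right_inverse)
 qed
 have "z : V | inverse z : V" if "z : S" for z
 proof (rule ccontr)
  assume c: "~ ?thesis"
  hence z0: "z ~= 0" using sring_0[OF Vp(1)] by auto
  have "EX p. pk V p & t * poly p z = 1" using ext `z : S` c by blast
  moreover have "EX q. pk V q & t * poly q (inverse z) = 1" using ext[of "inverse z"] sf_inv[OF S `z : S`] c by blast
  ultimately show False using chevalley_descent[OF Vp(1) tV Vp(4) z0] by blast
 qed
 thus ?thesis using Vp by blast
qed

section \<open>Places, uniformisers and valuations\<close>

definition places :: "'a::field set => 'a set => 'a set set" where
 "places k S = {V. sring V & k <= V & V <= S & V ~= S & (ALL z:S. z : V | inverse z : V)}"

definition mx :: "'a::field set => 'a set" where
 "mx V = {z : V. z = 0 | inverse z ~: V}"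

definition unif :: "'a::field set => 'a" where
 "unif V = (SOME t. t : V & mx V = (*) t ` V)"

definition val :: "'a::field set => 'a => int" where
 "val V z = (THE n. EX u:V - mx V. z = unif V powi n * u)"

definition pdeg :: "'a::field set => 'a set => nat" where
 "pdeg k V = (THE n. rd k (mx V) n V)"

text \<open>\<open>fin\<close> mentions a single element; by \<open>transc_adj_swap\<close> every
  element outside \<open>k\<close> then serves as well. \<open>full\<close> says that
  \<open>k\<close> is algebraically closed in \<open>S\<close>.\<close>

locale ff =
 fixes k S :: "'a::field set"
 assumes k: "sf k" and S: "sf S" and kS: "k <= S"
  and fin: "EX x:S. transc k x & ffin (adj k x) S"
  and full: "!!z. z : S ==> z ~: k ==> transc k z"
begin

sublocale klin "(*)" k by (rule klin_mult[OF k])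

lemma ffin_adj: "z : S ==> z ~: k ==> ffin (adj k z) S"
 using fin transc_adj_swap[OF k S kS] full by blast

abbreviation "Pl \<equiv> places k S"

lemma PlD: assumes "V : Pl"
 shows "sring V" "k <= V" "V <= S" "V ~= S" "z : S ==> z : V | inverse z : V"
 using assms unfolding places_def by blast+

lemma mxD: "z : mx V ==> z : V" unfolding mx_def by blast

lemma mx_k: assumes "V : Pl" "z : mx V" "z ~= 0" shows "z ~: k"
 using assms(2,3) subsetD[OF PlD(2)[OF assms(1)] sf_inv[OF k, of z]] unfolding mx_def by blast

lemma mx_mult: assumes V: "V : Pl" and "a : mx V" "b : V" shows "a * b : mx V"
proof -
 note s = sring_simps[OF PlD(1)[OF V]]
 have "a * b : V" using assms s(3) mxD by blast
 moreover have "inverse (a * b) ~: V" if "a * b ~= 0"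
 proof
  assume "inverse (a * b) : V"
  hence "b * inverse (a * b) : V" using s(3)[OF assms(3)] by blast
  moreover have "b * inverse (a * b) = inverse a" using that
   by (simp add: inverse_mult_distrib mult.left_commute[of b])
  ultimately have "inverse a : V" by metis
  thus False using assms(2) that unfolding mx_def by simp
 qed
 ultimately show ?thesis unfolding mx_def by blast
qed

lemma mx_add: assumes V: "V : Pl" and ab: "a : mx V" "b : mx V" shows "a + b : mx V"
proof -
 note s = sring_simps[OF PlD(1)[OF V]]
 have *: "a + b : mx V" if "a / b : V" "a : mx V" "b : mx V" for a b
 proof (cases "b = 0")
  case False
  have "b * (1 + a / b) : mx V" using mx_mult[OF V that(3) s(6)[OF s(1) that(1)]] .
  thus ?thesis using False by (simp add: distrib_left add.commute)
 qed (use that in simp)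
 have "a / b : S" by (rule sf_divide[OF S]) (use ab mxD PlD(3)[OF V] in blast)+
 hence "a / b : V | b / a : V" using PlD(5)[OF V, of "a / b"] by simp
 thus ?thesis using *[OF _ ab] *[OF _ ab(2,1)] by (auto simp: add.commute)
qed

lemma mx_0: assumes "V : Pl" shows "0 : mx V"
 unfolding mx_def using sring_0[OF PlD(1)[OF assms]] by simp

lemma ssp_V: "V : Pl ==> ssp k V"
 using sring_simps[OF PlD(1)] subsetD[OF PlD(2)] by (simp add: subsp_def)

lemma ssp_mx: "V : Pl ==> ssp k (mx V)"
 using mx_0 mx_add mx_mult[of V _ _] subsetD[OF PlD(2)] by (simp add: subsp_def) (metis mult.commute)

lemma mx_nonzero: assumes V: "V : Pl" shows "EX t:mx V. t ~= 0"
proof -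
 obtain z where z: "z : S" "z ~: V" using PlD(3,4)[OF V] by blast
 hence "inverse z : V" "z ~= 0" using PlD(5)[OF V] sring_0[OF PlD(1)[OF V]] by blast+
 hence "inverse z : mx V" unfolding mx_def using z by simp
 thus ?thesis using `z ~= 0` by (intro bexI[of _ "inverse z"]) simp_all
qed

lemma ssp_mult: assumes V: "V : Pl" "t : V" shows "ssp k ((*) t ` V)"
 unfolding subsp_def
proof (intro conjI ballI)
 show "0 : (*) t ` V" using sub_0[OF ssp_V[OF V(1)]] by (intro image_eqI[of _ _ 0]) simp_all
 fix a b assume "a : (*) t ` V" "b : (*) t ` V"
 then obtain c d where "a = t * c" "b = t * d" "c : V" "d : V" by blast
 thus "a + b : (*) t ` V" using sub_add[OF ssp_V[OF V(1)]] by (intro image_eqI[of _ _ "c + d"]) (simp_all add: distrib_left)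
next
 fix a b assume "a : k" "b : (*) t ` V"
 then obtain c where "b = t * c" "c : V" by blast
 thus "a * b : (*) t ` V" using sub_scale[OF ssp_V[OF V(1)] `a : k`] by (intro image_eqI[of _ _ "a * c"]) (simp_all add: mult.left_commute)
qed

lemma quotient_finite:
 assumes V: "V : Pl" "t : mx V" "t ~= 0" shows "EX m<=fdeg (adj k t) S. rd k ((*) t ` V) m V"
proof (rule dm_bounded[OF ssp_mult[OF V(1) mxD[OF V(2)]] ssp_V[OF V(1)]])
 note s = sring_simps[OF PlD(1)[OF V(1)]]
 have tV: "t : V" using mxD V(2) by blast
 show "(*) t ` V <= V" using s(3)[OF tV] by blast
 fix m W assume W: "rd k ((*) t ` V) m W" "W <= V"
 have tS: "t : S" using tV PlD(3)[OF V(1)] by blast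
 have f: "rd (adj k t) {0} (fdeg (adj k t) S) S"
  using ffin_rd[OF sf_adj[OF k] ffin_adj[OF tS mx_k[OF V]]] .
 show "m <= fdeg (adj k t) S"
  by (rule quotient_dim_le[OF k S f V(3) tV PlD(2,3)[OF V(1)] _ W]) (intro ballI conjI s(6) s(3); assumption)
qed

text \<open>Among the nonzero elements of the maximal ideal take \<open>t\<close> with
  \<open>dim (V / t V)\<close> least. For \<open>y\<close> in the ideal but outside
  \<open>t V\<close>, the quotient \<open>t / y\<close> lies in \<open>V\<close>, so
  \<open>y V\<close> is strictly larger than \<open>t V\<close> and has smaller codimension.\<close>

lemma mx_principal:
 assumes V: "V : Pl" shows "EX t. t : V & mx V = (*) t ` V"
proof -
 define D where "D = (%d. EX t:mx V. t ~= 0 & rd k ((*) t ` V) d V)"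
 have "EX d. D d" unfolding D_def using mx_nonzero[OF V] quotient_finite[OF V] by meson
 hence "D (LEAST d. D d)" "!!e. D e ==> (LEAST d. D d) <= e" by (simp_all add: LeastI_ex Least_le)
 then obtain d where d: "D d" "!!e. D e ==> d <= e" by metis
 then obtain t where t: "t : mx V" "t ~= 0" "rd k ((*) t ` V) d V" unfolding D_def by blast
 note s = sring_simps[OF PlD(1)[OF V]]
 have "mx V <= (*) t ` V"
 proof
  fix y assume y: "y : mx V"
  show "y : (*) t ` V"
  proof (rule ccontr)
   assume n: "y ~: (*) t ` V"
   hence y0: "y ~= 0" using sub_0[OF ssp_mult[OF V mxD[OF t(1)]]] by blast
   have "y / t ~: V" using n t(2) by (metis image_eqI nonzero_mult_div_cancel_left times_divide_eq_right)
   moreover have "y / t : S" by (rule sf_divide[OF S]) (use y t(1) mxD PlD(3)[OF V] in blast)+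
   ultimately have ty: "t / y : V" using PlD(5)[OF V, of "y / t"] by simp
   have sub: "(*) t ` V <= (*) y ` V"
   proof
   fix a assume "a : (*) t ` V"
   then obtain c where c: "a = t * c" "c : V" by blast
   hence "a = y * ((t / y) * c)" using y0 by simp
   thus "a : (*) y ` V" using s(3)[OF ty c(2)] by blast
   qed
   have yV: "y : V" using y mxD by blast
   obtain i j where ij: "i + j = d" "rd k ((*) t ` V) i ((*) y ` V)" "rd k ((*) y ` V) j V"
   using dm_split[OF t(3) ssp_mult[OF V mxD[OF t(1)]] ssp_mult[OF V yV] sub] s(3)[OF yV] by blast
   have "i ~= 0"
   proof
   assume "i = 0"
   hence "(*) y ` V = (*) t ` V" using ij(2) by (blast elim: rdim.cases)
   thus False using n s(1) by (metis image_eqI mult.right_neutral)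
   qed
   moreover have "D j" unfolding D_def using y y0 ij(3) by blast
   ultimately show False using d(2)[of j] ij(1) by simp
  qed
 qed
 moreover have "(*) t ` V <= mx V" using mx_mult[OF V t(1)] by blast
 ultimately show ?thesis using mxD[OF t(1)] by blast
qed

lemma unif: assumes V: "V : Pl" shows "unif V : mx V" "mx V = (*) (unif V) ` V" "unif V ~= 0" "unif V : S"
proof -
 have u: "unif V : V & mx V = (*) (unif V) ` V" unfolding unif_def using someI_ex[OF mx_principal[OF V]] .
 show m: "mx V = (*) (unif V) ` V" using u by blast
 show "unif V : mx V" unfolding m using sring_1[OF PlD(1)[OF V]] by (metis image_eqI mult.right_neutral)
 show "unif V : S" using u PlD(3)[OF V] by blast
 show "unif V ~= 0"
 proof
  assume "unif V = 0"
  hence "mx V <= {0}" using m by auto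
  thus False using mx_nonzero[OF V] by blast
 qed
qed

lemma unit_inverse: "V : Pl ==> u : V - mx V ==> u ~= 0 & inverse u : V - mx V"
 using sring_0[OF PlD(1)] unfolding mx_def by auto

lemma unit_mult: assumes V: "V : Pl" and "u : V - mx V" "w : V - mx V" shows "u * w : V - mx V"
proof -
 have u: "u ~= 0" "inverse u : V" "w ~= 0" "inverse w : V" using unit_inverse[OF V] assms by auto
 have "u * w : V" "inverse w * inverse u : V" using sring_mult[OF PlD(1)[OF V]] assms u by auto
 moreover have "inverse (u * w) = inverse w * inverse u" by (simp add: mult.commute)
 ultimately have "inverse (u * w) : V" by metis
 thus ?thesis unfolding mx_def using u `u * w : V` by (simp del: inverse_mult_distrib)
qed

lemma rd_mult_image:
 assumes "rd k U n W" "c ~= 0" shows "rd k ((*) c ` U) n ((*) c ` W)"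
proof (rule rdim_image_inj[OF assms(1), where f = "(*) c"])
 show "inj ((*) c)" using assms(2) by (simp add: inj_def)
 show "c * (x + y) = c * x + c * y" for x y by (rule distrib_left)
 show "c * (a * x) = a * (c * x)" for a x by (rule mult.left_commute)
qed

lemma mx_neq: assumes "V : Pl" shows "mx V ~= V"
 using sring_1[OF PlD(1)[OF assms]] unfolding mx_def by (metis (mono_tags, lifting) CollectD inverse_1 zero_neq_one)

lemma val_exists_V: assumes V: "V : Pl" and z: "z : V" "z ~= 0"
 shows "EX n::nat. EX u:V - mx V. z = unif V ^ n * u"
proof (cases "z : mx V")
 case False thus ?thesis using z by (intro exI[of _ 0] bexI[of _ z]) simp_all
next
 case True
 let ?t = "unif V"
 note s = sring_simps[OF PlD(1)[OF V]]
 have tV: "?t : V" using unif(1)[OF V] mxD by blast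
 obtain d where d: "rd k ((*) z ` V) d V" using quotient_finite[OF V True z(2)] by blast
 have ex: "EX m<=N. EX u:V - mx V. z = ?t ^ m * u" if "z ~: (*) (?t ^ Suc N) ` V" for N
  using that
 proof (induction N)
  case 0
  thus ?case using unif(2)[OF V] True by simp
 next
  case (Suc N)
  show ?case
  proof (cases "z : (*) (?t ^ Suc N) ` V")
   case False thus ?thesis using Suc.IH le_Suc_eq by blast
  next
   case True
   then obtain u where u: "z = ?t ^ Suc N * u" "u : V" by blast
   have "u ~: mx V"
   proof
   assume "u : mx V"
   then obtain w where "u = ?t * w" "w : V" using unif(2)[OF V] by blast
   hence "z = ?t ^ Suc (Suc N) * w" using u(1) by (simp only: power_Suc2 mult.assoc)
   thus False using Suc.prems `w : V` by blast
   qed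
   thus ?thesis using u by (intro exI[of _ "Suc N"]) auto
  qed
 qed
 \<comment> \<open>\<open>V / t^N V\<close> has dimension at least \<open>N\<close>, so an element
   with \<open>dim (V / z V) = d\<close> is not divisible by \<open>t^(d + 1)\<close>; this bounds
   the exponent.\<close>
 have chain: "EX m>=N. rd k ((*) (?t ^ N) ` V) m V" for N
 proof (induction N)
  case 0
  have "(*) (1::'a) ` V = V" by simp
  thus ?case using rdim.rZ[of "(*)" k V] by auto
 next
  case (Suc N)
  then obtain m where m: "m >= N" "rd k ((*) (?t ^ N) ` V) m V" by blast
  obtain e where e: "rd k ((*) ?t ` V) e V" using quotient_finite[OF V unif(1,3)[OF V]] by blast
  have "rd k ((*) (?t ^ N) ` ((*) ?t ` V)) e ((*) (?t ^ N) ` V)"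
   by (rule rd_mult_image[OF e]) (simp add: unif(3)[OF V])
  moreover have "(*) (?t ^ N) ` ((*) ?t ` V) = (*) (?t ^ Suc N) ` V"
   unfolding image_image by (rule image_cong) (simp_all only: power_Suc2 mult.assoc)
  ultimately have e2: "rd k ((*) (?t ^ Suc N) ` V) (e + m) V" using dm_trans[OF m(2)] by metis
  have "e ~= 0"
  proof
   assume "e = 0"
   hence "V = mx V" using e unfolding unif(2)[OF V, symmetric] by (blast elim: rdim.cases)
   thus False using mx_neq[OF V] by simp
  qed
  thus ?case using e2 m(1) by (intro exI[of _ "e + m"]) simp
 qed
 have "z ~: (*) (?t ^ Suc d) ` V"
 proof
  assume zz: "z : (*) (?t ^ Suc d) ` V"
  obtain m where m: "m >= Suc d" "rd k ((*) (?t ^ Suc d) ` V) m V" using chain by blast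
  have "(*) z ` V <= (*) (?t ^ Suc d) ` V"
  proof
   fix a assume "a : (*) z ` V"
   then obtain c w where "a = z * c" "c : V" "z = ?t ^ Suc d * w" "w : V" using zz by blast
   thus "a : (*) (?t ^ Suc d) ` V" using s(3)[of w c] by (metis image_eqI mult.assoc)
  qed
  then obtain i j where "i + j = d" "rd k ((*) (?t ^ Suc d) ` V) j V"
   using dm_split[OF d ssp_mult[OF V z(1)] ssp_mult[OF V sring_power[OF PlD(1)[OF V] tV]], of "Suc d"] dm_sup[OF m(2)] by blast
  thus False using dm_unique[OF _ m(2) ssp_mult[OF V sring_power[OF PlD(1)[OF V] tV]]] m(1) by fastforce
 qed
 from ex[OF this] show ?thesis by blast
qed

lemma val_exists: assumes V: "V : Pl" and z: "z : S" "z ~= 0"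
 shows "EX n::int. EX u:V - mx V. z = unif V powi n * u"
proof (cases "z : V")
 case True
 then obtain n u where "u : V - mx V" "z = unif V ^ n * u" using val_exists_V[OF V _ z(2)] by blast
 thus ?thesis by (intro exI[of _ "int n"]) (auto simp: power_int_of_nat)
next
 case False
 hence "inverse z : V" using PlD(5)[OF V z(1)] by blast
 then obtain n u where u: "u : V - mx V" "inverse z = unif V ^ n * u" using val_exists_V[OF V, of "inverse z"] z(2) by auto
 hence "z = inverse (unif V ^ n * u)" by (metis inverse_inverse_eq)
 hence "z = unif V powi (- int n) * inverse u" by (simp add: power_int_minus power_int_of_nat)
 thus ?thesis using unit_inverse[OF V u(1)] by blast
qed

lemma unit_power_unique: assumes V: "V : Pl" and u: "u : V - mx V" "w : V - mx V" and e: "unif V powi n * u = unif V powi m * w"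
 shows "n = m"
proof -
 have *: "n <= m" if u: "u : V - mx V" "w : V - mx V" and e: "unif V powi n * u = unif V powi m * w" for n m :: int and u w
 proof (rule ccontr)
  assume "~ n <= m"
  then obtain d where d: "n = m + int (Suc d)" using zless_iff_Suc_zadd[of m n] by auto
  have "unif V powi n = unif V powi m * unif V ^ Suc d"
   unfolding d using power_int_add[of "unif V" m "int (Suc d)"] unif(3)[OF V] by (simp only: power_int_of_nat simp_thms)
  hence "unif V powi m * (unif V ^ Suc d * u) = unif V powi m * w" using e by (simp only: mult.assoc)
  hence "unif V ^ Suc d * u = w" using unif(3)[OF V] by (simp only: mult_cancel_left power_int_eq_0_iff) simp
  hence "w = unif V * (unif V ^ d * u)" by (simp only: power_Suc mult.assoc)
  moreover have "unif V ^ d * u : V" using sring_mult[OF PlD(1)[OF V]] sring_power[OF PlD(1)[OF V]] unif(1)[OF V] mxD u by blast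
  ultimately have "w : mx V" using mx_mult[OF V unif(1)[OF V]] by metis
  thus False using u by blast
 qed
 show ?thesis using *[OF u e] *[OF u(2,1) e[symmetric]] by simp
qed

lemma val: assumes V: "V : Pl" and z: "z : S" "z ~= 0" shows "EX u:V - mx V. z = unif V powi (val V z) * u"
proof -
 have "EX! n. EX u:V - mx V. z = unif V powi n * u"
  using val_exists[OF V z] unit_power_unique[OF V] by (intro ex_ex1I) blast+
 from theI'[OF this] show ?thesis unfolding val_def .
qed

lemma val_eqI: assumes V: "V : Pl" and z: "u : V - mx V" "z = unif V powi n * u" shows "val V z = n"
 unfolding val_def
proof (rule the_equality)
 show "EX u:V - mx V. z = unif V powi n * u" using z by blast
 fix m assume "EX u:V - mx V. z = unif V powi m * u"
 thus "m = n" using unit_power_unique[OF V _ z(1)] z(2) by metis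
qed

lemma val_mult: assumes V: "V : Pl" and z: "z : S" "z ~= 0" "w : S" "w ~= 0" shows "val V (z * w) = val V z + val V w"
proof -
 define a b where "a = val V z" and "b = val V w"
 obtain u v where u: "u : V - mx V" "z = unif V powi a * u" "v : V - mx V" "w = unif V powi b * v"
  unfolding a_def b_def using val[OF V z(1,2)] val[OF V z(3,4)] by blast
 have "z * w = (unif V powi a * unif V powi b) * (u * v)" unfolding u(2,4) by (simp only: mult.assoc mult.left_commute)
 hence "z * w = unif V powi (val V z + val V w) * (u * v)"
  using power_int_add[of "unif V" a b] unif(3)[OF V] by (simp add: a_def b_def)
 thus ?thesis using val_eqI[OF V unit_mult[OF V u(1,3)]] by blast
qed

lemma val_unit: "V : Pl ==> u : V - mx V ==> val V u = 0"
 using val_eqI[of V u u 0] by simp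

lemma val_1: "V : Pl ==> val V 1 = 0"
 using val_unit[of V 1] sring_1[OF PlD(1)] by (simp add: mx_def)

lemma val_const: "V : Pl ==> a : k ==> a ~= 0 ==> val V a = 0"
 using val_unit[of V a] subsetD[OF PlD(2)] sf_inv[OF k] by (simp add: mx_def)

lemma val_unif: "V : Pl ==> val V (unif V) = 1"
 using val_eqI[of V 1 "unif V" 1] sring_1[OF PlD(1)] by (simp add: mx_def)

lemma val_inverse: assumes V: "V : Pl" and z: "z : S" "z ~= 0" shows "val V (inverse z) = - val V z"
 using val_mult[OF V z sf_inv[OF S z(1)]] val_1[OF V] z(2) by simp

lemma val_divide: assumes V: "V : Pl" and z: "z : S" "z ~= 0" "w : S" "w ~= 0" shows "val V (z / w) = val V z - val V w"
 unfolding divide_inverse using val_mult[OF V z(1,2) sf_inv[OF S z(3)]] val_inverse[OF V z(3,4)] z(4) by simp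

lemma val_power: assumes V: "V : Pl" and z: "z : S" "z ~= 0" shows "val V (z ^ n) = int n * val V z"
 by (induction n) (simp_all add: val_1[OF V] val_mult[OF V] z sf_power[OF S] algebra_simps)

lemma val_powi: assumes V: "V : Pl" shows "val V (unif V powi n) = n"
 using val_eqI[OF V, of 1 "unif V powi n" n] sring_1[OF PlD(1)[OF V]] by (simp add: mx_def)

lemma powi_S: "z : S ==> z powi n : S"
 by (simp add: power_int_def sf_power[OF S] sf_inv[OF S])

lemma val_ge_0: assumes V: "V : Pl" and z: "z : S" "z ~= 0" shows "z : V \<longleftrightarrow> val V z >= 0"
proof
 assume "z : V"
 then obtain n u where "u : V - mx V" "z = unif V ^ n * u" using val_exists_V[OF V _ z(2)] by blast
 thus "val V z >= 0" using val_eqI[OF V, of u z "int n"] by (simp add: power_int_of_nat)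
next
 assume "val V z >= 0"
 then obtain n where n: "val V z = int n" using nonneg_int_cases by blast
 obtain u where "u : V - mx V" "z = unif V ^ n * u" using val[OF V z] n by (auto simp: power_int_of_nat)
 thus "z : V" using sring_mult[OF PlD(1)[OF V] sring_power[OF PlD(1)[OF V] mxD[OF unif(1)[OF V]]]] by simp
qed

lemma val_gt_0: assumes V: "V : Pl" and z: "z : S" "z ~= 0" shows "z : mx V \<longleftrightarrow> val V z > 0"
 unfolding mx_def using val_ge_0[OF V z] val_ge_0[OF V sf_inv[OF S z(1)]] val_inverse[OF V z] z(2) by auto

text \<open>The fractional ideals; \<^term>\<open>0\<close> is treated separately because \<^term>\<open>val V 0\<close> is a junk value.\<close>

definition Id :: "'a set => int => 'a set" where
 "Id V n = {z : S. z = 0 | n <= val V z}"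

lemma Id_iff: "z : Id V n \<longleftrightarrow> z : S & (z = 0 | n <= val V z)"
 unfolding Id_def by blast

lemma Id_eq: assumes V: "V : Pl" shows "Id V n = (*) (unif V powi n) ` V"
proof
 let ?t = "unif V powi n"
 have t: "?t : S" "?t ~= 0" using powi_S unif(3,4)[OF V] by auto
 show "Id V n <= (*) ?t ` V"
 proof
  fix z assume z: "z : Id V n"
  hence zS: "z : S" by (simp add: Id_iff)
  have "z / ?t : V"
  proof (cases "z = 0")
   case False
   thus ?thesis using z zS t val_divide[OF V zS False t] val_powi[OF V] val_ge_0[OF V sf_divide[OF S zS t(1)]] by (simp add: Id_iff)
  qed (simp add: sring_0[OF PlD(1)[OF V]])
  thus "z : (*) ?t ` V" using t(2) by (intro image_eqI[of _ _ "z / ?t"]) simp_all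
 qed
 show "(*) ?t ` V <= Id V n"
 proof
  fix z assume "z : (*) ?t ` V"
  then obtain c where c: "z = ?t * c" "c : V" by blast
  hence cS: "c : S" using PlD(3)[OF V] by blast
  show "z : Id V n" unfolding Id_iff c(1)
   using val_mult[OF V t cS] val_powi[OF V] val_ge_0[OF V cS] c(2) sf_mult[OF S t(1) cS] by auto
 qed
qed

lemma ssp_Id: assumes V: "V : Pl" shows "ssp k (Id V n)"
proof -
 have "rd k ((*) (unif V powi n) ` V) 0 ((*) (unif V powi n) ` V)" by (rule rdim.rZ)
 show ?thesis unfolding Id_eq[OF V] subsp_def
 proof (intro conjI ballI)
  show "0 : (*) (unif V powi n) ` V" using sub_0[OF ssp_V[OF V]] by (intro image_eqI[of _ _ 0]) simp_all
  fix a b assume "a : (*) (unif V powi n) ` V" "b : (*) (unif V powi n) ` V"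
  then obtain c d where "a = unif V powi n * c" "b = unif V powi n * d" "c : V" "d : V" by blast
  thus "a + b : (*) (unif V powi n) ` V" using sub_add[OF ssp_V[OF V]] by (intro image_eqI[of _ _ "c + d"]) (simp_all add: distrib_left)
 next
  fix a b assume "a : k" "b : (*) (unif V powi n) ` V"
  then obtain c where "b = unif V powi n * c" "c : V" by blast
  thus "a * b : (*) (unif V powi n) ` V" using sub_scale[OF ssp_V[OF V] `a : k`] by (intro image_eqI[of _ _ "a * c"]) (simp_all add: mult.left_commute)
 qed
qed

lemma Id_mono: "n <= m ==> Id V m <= Id V n" unfolding Id_def by auto

lemma Id_0: "V : Pl ==> Id V 0 = V" using Id_eq[of V 0] by simp

lemma Id_mult: assumes V: "V : Pl" and "a : Id V n" "b : Id V m" shows "a * b : Id V (n + m)"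
proof (cases "a = 0 | b = 0")
 case True thus ?thesis using assms sf_mult[OF S] by (auto simp: Id_iff)
next
 case False thus ?thesis using assms val_mult[OF V, of a b] sf_mult[OF S, of a b] by (auto simp: Id_iff)
qed

lemma val_add: assumes V: "V : Pl" and z: "z : S" "w : S" "z ~= 0" "w ~= 0" "z + w ~= 0"
 shows "min (val V z) (val V w) <= val V (z + w)"
proof -
 have "z : Id V (min (val V z) (val V w))" "w : Id V (min (val V z) (val V w))" using z by (auto simp: Id_iff)
 from sub_add[OF ssp_Id[OF V] this] show ?thesis using z(5) by (simp add: Id_iff)
qed

lemma val_uminus: assumes V: "V : Pl" and z: "z : S" shows "val V (- z) = val V z"
proof (cases "z = 0")
 case False
 have "val V (-1) = 0" using val_const[OF V sf_uminus[OF k sf_1[OF k]]] by simp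
 thus ?thesis using val_mult[OF V sf_uminus[OF S sf_1[OF S]] _ z False] by simp
qed simp

lemma val_add_eq: assumes V: "V : Pl" and z: "z : S" "z ~= 0" "w : Id V (val V z + 1)"
 shows "z + w ~= 0 & val V (z + w) = val V z"
proof -
 have wS: "w : S" using z by (simp add: Id_iff)
 have z1: "z ~: Id V (val V z + 1)" using z by (simp add: Id_iff)
 have n: "z + w ~: Id V (val V z + 1)"
 proof
  assume "z + w : Id V (val V z + 1)"
  from sub_diff[OF ssp_Id[OF V] this z(3)] show False using z1 by simp
 qed
 have "z + w : Id V (val V z)"
  using sub_add[OF ssp_Id[OF V], of z "val V z" w] z Id_mono[of "val V z" "val V z + 1" V] by (auto simp: Id_iff)
 thus ?thesis using n by (auto simp: Id_iff)
qed

lemma pdeg: assumes V: "V : Pl" shows "rd k (mx V) (pdeg k V) V"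
proof -
 obtain m where m: "rd k (mx V) m V" using quotient_finite[OF V unif(1,3)[OF V]] unfolding unif(2)[OF V, symmetric] by blast
 hence "pdeg k V = m" unfolding pdeg_def using dm_unique[OF _ m ssp_mx[OF V]] by (intro the_equality) blast+
 thus ?thesis using m by simp
qed

lemma pdeg_pos: assumes V: "V : Pl" shows "pdeg k V > 0"
proof (rule ccontr)
 assume "~ pdeg k V > 0"
 hence "rd k (mx V) 0 V" using pdeg[OF V] by simp
 hence "V = mx V" by (blast elim: rdim.cases)
 thus False using mx_neq[OF V] by simp
qed

lemma Id_step: assumes V: "V : Pl" shows "rd k (Id V (n + 1)) (pdeg k V) (Id V n)"
proof -
 have "rd k ((*) (unif V powi n) ` mx V) (pdeg k V) ((*) (unif V powi n) ` V)"
  by (rule rd_mult_image[OF pdeg[OF V]]) (simp add: unif(3)[OF V])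
 moreover have e: "unif V powi (n + 1) = unif V powi n * unif V"
  using power_int_add[of "unif V" n 1] unif(3)[OF V] by (simp only: power_int_1_right simp_thms)
 have "(*) (unif V powi n) ` mx V = Id V (n + 1)"
  unfolding Id_eq[OF V] unif(2)[OF V] image_image e by (rule image_cong) (simp_all only: mult.assoc)
 ultimately show ?thesis using Id_eq[OF V] by simp
qed

text \<open>Rank one: an element of \<open>W\<close> outside \<open>V\<close> has negative value at
  \<open>V\<close>. Dividing an arbitrary \<open>z\<close> by a high power of it gives an element of
  \<open>V\<close>, hence of \<open>W\<close>, and multiplying back puts \<open>z\<close> into
  \<open>W\<close>.\<close>

lemma place_maximal: assumes V: "V : Pl" and W: "W : Pl" "V <= W" shows "V = W"
proof (rule ccontr)
 assume "V ~= W"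
 then obtain y where y: "y : W" "y ~: V" using W by blast
 obtain z where z: "z : S" "z ~: W" using PlD(3,4)[OF W(1)] by blast
 have yS: "y : S" using y PlD(3)[OF W(1)] by blast
 have y0: "y ~= 0" "z ~= 0" using y z sring_0[OF PlD(1)[OF V]] sring_0[OF PlD(1)[OF W(1)]] by blast+
 have neg: "val V y < 0" using val_ge_0[OF V yS y0(1)] y(2) by simp
 define m where "m = nat (- val V z)"
 have S1: "z * inverse y ^ m : S" using sf_mult[OF S] sf_power[OF S] sf_inv[OF S] yS z(1) by blast
 have nz: "z * inverse y ^ m ~= 0" using y0 by simp
 have "val V (z * inverse y ^ m) = val V z + int m * (- val V y)"
  using val_mult[OF V z(1) y0(2), of "inverse y ^ m"] val_power[OF V sf_inv[OF S yS], of m] val_inverse[OF V yS y0(1)]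
   sf_power[OF S sf_inv[OF S yS]] y0 by simp
 moreover have "int m * (- val V y) >= int m"
 proof -
  have "int m * 1 <= int m * (- val V y)" using neg by (intro mult_left_mono) simp_all
  thus ?thesis by (simp only: mult_1_right)
 qed
 ultimately have "val V (z * inverse y ^ m) >= 0" unfolding m_def by linarith
 hence "z * inverse y ^ m : W" using val_ge_0[OF V S1 nz] W(2) by blast
 hence "z * inverse y ^ m * y ^ m : W" using sring_mult[OF PlD(1)[OF W(1)]] sring_power[OF PlD(1)[OF W(1)] y(1)] by blast
 moreover have "z * inverse y ^ m * y ^ m = z" using y0(1) by (simp add: power_inverse[symmetric] field_simps)
 ultimately show False using z by simp
qed

text \<open>The inverse of a transcendental \<open>z\<close> is not a polynomial in
  \<open>z\<close>, so Chevalley's theorem applies to \<open>k[z]\<close>.\<close>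

lemma zero_exists: assumes z: "z : S" "z ~: k" shows "EX V:Pl. z : mx V"
proof -
 have z0: "z ~= 0" using z sf_0[OF k] by auto
 let ?R = "radj k z"
 have kr: "sring k" using sring_sf[OF k] .
 have "inverse z ~: ?R"
 proof
  assume "inverse z : ?R"
  then obtain p where p: "inverse z = poly p z" "pk k p" unfolding radj_def by blast
  have "poly (pCons (- 1) p) z = 0" using p(1) z0 by (simp flip: p(1))
  moreover have "pk k (pCons (-1) p)" using p(2) pk_pCons[OF k] sf_uminus[OF k sf_1[OF k]] by blast
  ultimately have "pCons (-1) p = 0" using full[OF z] unfolding transc_def by blast
  thus False by simp
 qed
 moreover have "?R <= S" unfolding radj_def using poly_in[OF S pk_mono[OF _ kS] z(1)] by blast
 ultimately obtain V where V: "sring V" "?R <= V" "V <= S" "inverse z ~: V" "ALL z:S. z : V | inverse z : V"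
  using chevalley[OF S sring_radj[OF kr] _ radj_sup(2)[OF kr]] by blast
 have "V ~= S" using V(4) sf_inv[OF S z(1)] by blast
 hence "V : Pl" unfolding places_def using V radj_sup(1)[OF kr, of z] by blast
 moreover have "z : mx V" unfolding mx_def using V(2,4) radj_sup(2)[OF kr, of z] by blast
 ultimately show ?thesis by blast
qed

end

section \<open>Weak approximation and the number of zeros of a function\<close>

context ff
begin

lemma places_separate2: assumes "V : Pl" "W : Pl" "V ~= W" shows "EX u:S. u ~= 0 & val V u > 0 & val W u < 0"
proof -
 have "~ V <= W" "~ W <= V" using place_maximal assms by blast+
 then obtain a b where ab: "a : V" "a ~: W" "b : W" "b ~: V" by blast
 have abS: "a : S" "b : S" using ab PlD(3)[OF assms(1)] PlD(3)[OF assms(2)] by blast+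
 have nz: "a ~= 0" "b ~= 0" using ab sring_0[OF PlD(1)[OF assms(1)]] sring_0[OF PlD(1)[OF assms(2)]] by blast+
 have "val V a >= 0" "val W a < 0" "val W b >= 0" "val V b < 0"
  using ab val_ge_0[OF assms(1) abS(1) nz(1)] val_ge_0[OF assms(2) abS(1) nz(1)]
   val_ge_0[OF assms(1) abS(2) nz(2)] val_ge_0[OF assms(2) abS(2) nz(2)] by linarith+
 hence "val V (a / b) > 0" "val W (a / b) < 0" using val_divide abS nz assms(1,2) by simp_all
 thus ?thesis using sf_divide[OF S abS] nz by (intro bexI[of _ "a / b"]) simp_all
qed

lemma places_separate:
 assumes "finite T" "T <= Pl" "V : Pl" "V ~: T"
 shows "EX u:S. u ~= 0 & val V u > 0 & (ALL W:T. val W u < 0)"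
 using assms
proof (induction T rule: finite_induct)
 case empty
 thus ?case using unif(3,4)[of V] val_unif[of V] by (intro bexI[of _ "unif V"]) simp_all
next
 case (insert W T)
 then obtain y where y: "y : S" "y ~= 0" "val V y > 0" "ALL W:T. val W y < 0" by blast
 obtain z where z: "z : S" "z ~= 0" "val V z > 0" "val W z < 0" using places_separate2[of V W] insert by blast
 have W: "W : Pl" using insert by blast
 show ?case
 proof (cases "val W y < 0")
  case True thus ?thesis using y by blast
 next
  case False
  text \<open>A high power \<^term>\<open>m\<close> for which \<^term>\<open>y\<close> and \<^term>\<open>z ^ m\<close> never have equal values, so no cancellation occurs in the sum.\<close>
  define m where "m = Suc (SUM Y:T. nat \<bar>val Y y\<bar>)"
  have m0: "int m > 0" unfolding m_def of_nat_0_less_iff by (rule zero_less_Suc)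
  have zm: "z ^ m : S" "z ^ m ~= 0" using sf_power[OF S z(1)] z(2) by simp_all
  have vzm: "val Y (z ^ m) = int m * val Y z" if "Y : Pl" for Y using val_power[OF that z(1,2)] .
  have neg: "y + z ^ m ~= 0 & val Y (y + z ^ m) < 0" if Y: "Y : insert W T" for Y
  proof -
   have YP: "Y : Pl" using Y insert by blast
   consider "val Y z < 0" "val Y (z ^ m) < val Y y" | "val Y y < 0" "val Y y < val Y (z ^ m)"
   proof (cases "Y = W")
   case True
   have "int m * val W z < 0" using mult_pos_neg[OF m0 z(4)] .
   thus ?thesis using that(1) True z(4) False vzm[OF W] by simp
   next
   case YW: False
   hence YT: "Y : T" using Y by blast
   have yY: "val Y y < 0" using y YT by blast
   show ?thesis
   proof (cases "val Y z < 0")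
   case True
   have "nat \<bar>val Y y\<bar> <= (SUM Y:T. nat \<bar>val Y y\<bar>)" using YT insert(1) by (intro member_le_sum) simp_all
   hence "int m > \<bar>val Y y\<bar>" unfolding m_def by linarith
   moreover have "int m * val Y z <= int m * (-1)" using True by (intro mult_left_mono) simp_all
   ultimately have "val Y (z ^ m) < val Y y" unfolding vzm[OF YP] by linarith
   thus ?thesis using that(1) True by blast
   next
   case False
   hence "int m * val Y z >= 0" by simp
   thus ?thesis using that(2) yY vzm[OF YP] by linarith
   qed
   qed
   thus ?thesis
   proof cases
   case 1
   have "y : Id Y (val Y (z ^ m) + 1)" using 1 y by (simp add: Id_iff)
   from val_add_eq[OF YP zm this] show ?thesis
   using mult_pos_neg[OF m0 1(1)] vzm[OF YP] by (simp only: add.commute[of y] simp_thms)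
   next
   case 2
   have "z ^ m : Id Y (val Y y + 1)" using 2 zm by (simp add: Id_iff)
   from val_add_eq[OF YP y(1,2) this] show ?thesis using 2 by simp
   qed
  qed
  have nz: "y + z ^ m ~= 0" using neg by blast
  have "int m * val V z > 0" using mult_pos_pos[OF m0 z(3)] .
  hence "val V (y + z ^ m) > 0" using val_add[OF insert.prems(2) y(1) zm(1) y(2) zm(2) nz] y(3) vzm[OF insert.prems(2)] by linarith
  thus ?thesis using neg nz sf_add[OF S y(1) zm(1)] by (intro bexI[of _ "y + z ^ m"]) simp_all
 qed
qed

text \<open>For \<open>u\<close> positive at \<open>V\<close> and negative on \<open>T\<close>, the
  element \<open>1 / (1 + u^s)\<close> tends to 1 at \<open>V\<close> and to 0 on \<open>T\<close>
  as \<open>s\<close> grows.\<close>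

lemma approx_one:
 assumes "finite T" "T <= Pl" "V : Pl" "V ~: T"
 shows "EX w:S. w - 1 : Id V N & (ALL W:T. w : Id W N)"
proof -
 obtain u where u: "u : S" "u ~= 0" "val V u > 0" "ALL W:T. val W u < 0" using places_separate[OF assms] by blast
 define s where "s = Suc (nat N)"
 have sN: "int s >= N" "int s > 0" unfolding s_def by auto
 have us: "u ^ s : S" "u ^ s ~= 0" using sf_power[OF S u(1)] u(2) by simp_all
 have v: "val W (u ^ s) = int s * val W u" if "W : Pl" for W using val_power[OF that u(1,2)] .
 have one: "1 : S" using sf_1[OF S] .
 have V1: "int s * 1 <= int s * val V u" using u(3) by (intro mult_left_mono) simp_all
 have V2: "int s * val V u >= int s" using V1 by linarith
 hence "u ^ s : Id V (val V 1 + 1)" unfolding Id_iff using v[OF assms(3)] val_1[OF assms(3)] sN us by linarith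
 from val_add_eq[OF assms(3) one _ this] have a: "1 + u ^ s ~= 0" "val V (1 + u ^ s) = 0" using val_1[OF assms(3)] by auto
 have b: "1 + u ^ s : S" using sf_add[OF S one us(1)] .
 define w where "w = 1 / (1 + u ^ s)"
 have w: "w : S" "w ~= 0" unfolding w_def using sf_divide[OF S one b] a by simp_all
 have "w - 1 = - (u ^ s) / (1 + u ^ s)" unfolding w_def using a by (simp add: field_simps)
 hence "val V (w - 1) = val V (u ^ s)"
  using val_divide[OF assms(3) sf_uminus[OF S us(1)] _ b a(1)] us a val_uminus[OF assms(3) us(1)] by simp
 hence 1: "w - 1 : Id V N" unfolding Id_iff using v[OF assms(3)] V2 sN sf_diff[OF S w(1) one] by linarith
 have 2: "w : Id W N" if W: "W : T" for W
 proof -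
  have WP: "W : Pl" using W assms by blast
  have neg: "int s * val W u <= int s * (-1)" using u(4) W by (intro mult_left_mono) auto
  have "1 : Id W (val W (u ^ s) + 1)" unfolding Id_iff using v[OF WP] neg sN val_1[OF WP] one by auto
  from val_add_eq[OF WP us this] have "val W (1 + u ^ s) = val W (u ^ s)" by (simp add: add.commute)
  hence "val W w = - val W (u ^ s)" unfolding w_def using val_divide[OF WP one _ b a(1)] val_1[OF WP] by simp
  thus ?thesis using w neg v[OF WP] sN by (simp add: Id_iff)
 qed
 show ?thesis using 1 2 w(1) by blast
qed

lemma Id_exists_bound:
 assumes "finite A" "A <= S" "finite T" "T <= Pl" shows "EX M::int. M >= 0 & (ALL a:A. ALL V:T. a : Id V (- M))"
proof -
 define M where "M = (SUM V:T. SUM a:A. \<bar>val V a\<bar>)"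
 have b: "\<bar>val V a\<bar> <= M" if "a : A" "V : T" for a V
 proof -
  have "\<bar>val V a\<bar> <= (SUM a:A. \<bar>val V a\<bar>)" using that assms by (intro member_le_sum) simp_all
  moreover have "(SUM a:A. \<bar>val V a\<bar>) <= M" unfolding M_def
   by (rule member_le_sum[OF that(2), of "%V. SUM a:A. \<bar>val V a\<bar>"]) (simp_all add: sum_nonneg assms)
  ultimately show ?thesis by linarith
 qed
 have "M >= 0" unfolding M_def by (simp add: sum_nonneg)
 moreover have "a : Id V (- M)" if "a : A" "V : T" for a V
  using b[OF that] that(1) assms(2) by (auto simp: Id_iff)
 ultimately show ?thesis by blast
qed

text \<open>The elements of \<open>approx_one\<close> act as a partition of unity. They are taken to
  precision \<open>N + M\<close> because the targets may have poles of order
  \<open>M\<close>.\<close>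

lemma weak_approx:
 assumes T: "finite T" "T <= Pl" and a: "!!V. V : T ==> a V : S"
 shows "EX z:S. ALL V:T. z - a V : Id V N"
proof -
 obtain M where M: "M >= 0" "ALL b:a ` T. ALL V:T. b : Id V (- M)" using Id_exists_bound[of "a ` T" T] T a by blast
 have "ALL V:T. EX w:S. w - 1 : Id V (N + M) & (ALL W:T - {V}. w : Id W (N + M))"
 proof
  fix V assume "V : T"
  thus "EX w:S. w - 1 : Id V (N + M) & (ALL W:T - {V}. w : Id W (N + M))"
   using approx_one[of "T - {V}" V "N + M"] T by blast
 qed
 then obtain w where w: "ALL V:T. w V : S & w V - 1 : Id V (N + M) & (ALL W:T - {V}. w V : Id W (N + M))" by metis
 define z where "z = (SUM V:T. a V * w V)"
 have zS: "z : S" unfolding z_def using a w by (intro sf_sum[OF S] sf_mult[OF S]) simp_all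
 have "z - a V : Id V N" if V: "V : T" for V
 proof -
  have VP: "V : Pl" using V T by blast
  have "z = a V * w V + (SUM W:T - {V}. a W * w W)" unfolding z_def using T(1) V by (rule sum.remove)
  hence e: "z - a V = a V * (w V - 1) + (SUM W:T - {V}. a W * w W)" by (simp add: right_diff_distrib)
  have 1: "a V * (w V - 1) : Id V N" using Id_mult[OF VP, of "a V" "- M" "w V - 1" "N + M"] M V w by simp
  have 2: "a W * w W : Id V N" if "W : T - {V}" for W
  proof -
   have "a W : Id V (- M)" "w W : Id V (N + M)" using M(2) V w that by blast+
   from Id_mult[OF VP this] show ?thesis by simp
  qed
  show ?thesis unfolding e using 1 2 by (intro sub_add[OF ssp_Id[OF VP]] sub_sum[OF ssp_Id[OF VP]])
 qed
 thus ?thesis using zS by blast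
qed

text \<open>An intersection of finitely many fractional ideals, with no condition outside
  \<open>T\<close>; for \<open>D = 0\<close> it is the semilocal ring of \<open>T\<close>.\<close>

definition RT :: "'a set set => ('a set => int) => 'a set" where
 "RT T D = {z : S. ALL V:T. z : Id V (D V)}"

lemma ssp_RT: assumes "T <= Pl" shows "ssp k (RT T D)"
 unfolding subsp_def RT_def
proof (intro conjI ballI CollectI)
 have I: "V : T ==> ssp k (Id V n)" for V n using ssp_Id assms by blast
 show "0 : S" using sf_0[OF S] .
 show "0 : Id V (D V)" if "V : T" for V using sub_0[OF I[OF that]] .
 fix x y assume "x : {z : S. ALL V:T. z : Id V (D V)}" "y : {z : S. ALL V:T. z : Id V (D V)}"
 hence h: "x : S" "y : S" "ALL V:T. x : Id V (D V)" "ALL V:T. y : Id V (D V)" by auto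
 show "x + y : S" using sf_add[OF S h(1,2)] .
 show "x + y : Id V (D V)" if "V : T" for V using sub_add[OF I[OF that]] h that by blast
next
 have I: "V : T ==> ssp k (Id V n)" for V n using ssp_Id assms by blast
 fix a x assume a: "a : k" and "x : {z : S. ALL V:T. z : Id V (D V)}"
 hence h: "x : S" "ALL V:T. x : Id V (D V)" by auto
 show "a * x : S" using sf_mult[OF S _ h(1)] a kS by blast
 show "a * x : Id V (D V)" if "V : T" for V using sub_scale[OF I[OF that] a] h that by blast
qed

text \<open>Weak approximation lifts each class of \<open>Id V (D V)\<close> modulo
  \<open>Id V (D V + 1)\<close> to an element respecting the other conditions, so intersecting with
  \<open>RT T D\<close> loses no dimension.\<close>

lemma RT_step:
 assumes T: "finite T" "T <= Pl" "V : T"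
 shows "rd k (RT T (D(V := D V + 1))) (pdeg k V) (RT T D)"
proof -
 have VP: "V : Pl" using T by blast
 have c: "ALL v:Id V (D V). EX w:RT T D. v - w : Id V (D V + 1)"
 proof
  fix v assume v: "v : Id V (D V)"
  define N where "N = (SUM W:T. \<bar>D W\<bar>) + 1"
  have N: "D W + 1 <= N" if "W : T" for W
   using member_le_sum[of W T "%W. \<bar>D W\<bar>"] that T(1) unfolding N_def by simp
  obtain z where z: "z : S" "ALL W:T. z - (if W = V then v else 0) : Id W N"
  proof -
   have "v : S" using v by (simp add: Id_iff)
   thus ?thesis using that weak_approx[OF T(1,2), of "%W. if W = V then v else 0" N] sf_0[OF S] by force
  qed
  have zv: "z - v : Id V (D V + 1)" using z(2) T(3) N[OF T(3)] Id_mono[of "D V + 1" N V] by auto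
  hence "z - v : Id V (D V)" using Id_mono[of "D V" "D V + 1" V] by auto
  hence "z - v + v : Id V (D V)" using sub_add[OF ssp_Id[OF VP]] v by blast
  hence "z : Id V (D V)" by simp
  moreover have "z : Id W (D W)" if "W : T" "W ~= V" for W
  proof -
   have "z - (if W = V then v else 0) : Id W N" using z(2) that(1) by blast
   hence "z : Id W N" using that(2) by (simp only: if_False diff_zero)
   moreover have "D W <= N" using N[OF that(1)] by simp
   ultimately show ?thesis using Id_mono by blast
  qed
  ultimately have "z : RT T D" unfolding RT_def using z(1) by auto
  moreover have "v - z : Id V (D V + 1)" using sub_uminus[OF ssp_Id[OF VP] zv] by simp
  ultimately show "EX w:RT T D. v - w : Id V (D V + 1)" by blast
 qed
 have "rd k (RT T D Int Id V (D V + 1)) (pdeg k V) (RT T D Int Id V (D V))"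
  by (rule dm_inter_eq[OF Id_step[OF VP] ssp_Id[OF VP] ssp_RT[OF T(2)] c])
 moreover have "RT T D Int Id V (D V) = RT T D" unfolding RT_def using T(3) by blast
 moreover have "RT T D Int Id V (D V + 1) = RT T (D(V := D V + 1))"
  unfolding RT_def using T(3) Id_mono[of "D V" "D V + 1" V] by auto
 ultimately show ?thesis by simp
qed

lemma RT_dim:
 assumes T: "finite T" "T <= Pl"
 shows "ALL V:T. D V >= 0 ==> rd k (RT T D) (SUM V:T. nat (D V) * pdeg k V) (RT T (%_. 0))"
proof (induction "SUM V:T. nat (D V)" arbitrary: D)
 case 0
 hence "ALL V:T. D V = 0" using T(1) by auto
 hence "RT T D = RT T (%_. 0)" "(SUM V:T. nat (D V) * pdeg k V) = 0" unfolding RT_def by auto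
 thus ?case using rdim.rZ[of "(*)" k "RT T D"] by metis
next
 case (Suc n)
 then obtain V where V: "V : T" "D V > 0"
 proof -
  have "EX V:T. nat (D V) ~= 0" using Suc.hyps(2) by (metis (mono_tags, lifting) Zero_not_Suc sum.neutral)
  thus ?thesis using that by auto
 qed
 define E where "E = D(V := D V - 1)"
 have sums: "(SUM W:T. g W (D W)) = g V (D V) + (SUM W:T - {V}. g W (D W))" "(SUM W:T. g W (E W)) = g V (D V - 1) + (SUM W:T - {V}. g W (D W))" for g :: "'a set => int => nat"
  using sum.remove[OF T(1) V(1), of "%W. g W (D W)"] sum.remove[OF T(1) V(1), of "%W. g W (E W)"] unfolding E_def by auto
 have "n = (SUM W:T. nat (E W))" using sums[of "%_. nat"] Suc.hyps(2) V(2) by simp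
 moreover have "ALL W:T. E W >= 0" using Suc.prems V(2) unfolding E_def by simp
 ultimately have IH: "rd k (RT T E) (SUM V:T. nat (E V) * pdeg k V) (RT T (%_. 0))" using Suc.hyps(1) by blast
 have "E(V := E V + 1) = D" unfolding E_def by auto
 hence "rd k (RT T D) (pdeg k V) (RT T E)" using RT_step[OF T V(1), of E] by simp
 hence "rd k (RT T D) (pdeg k V + (SUM V:T. nat (E V) * pdeg k V)) (RT T (%_. 0))" using dm_trans[OF IH] by blast
 moreover have "pdeg k V + (SUM V:T. nat (E V) * pdeg k V) = (SUM V:T. nat (D V) * pdeg k V)"
 proof -
  have "nat (D V) = Suc (nat (D V - 1))" using V(2) by simp
  thus ?thesis using sums[of "%W x. nat x * pdeg k W"] by simp
 qed
 ultimately show ?case by simp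
qed

text \<open>With \<open>R\<close> the semilocal ring of \<open>T\<close>, the ideal
  \<open>x R\<close> is cut out by the values of \<open>x\<close>. Its codimension is the left side
  by \<open>RT_dim\<close> and at most the degree over \<open>k(x)\<close> by
  \<open>quotient_dim_le\<close>.\<close>

lemma sum_zeros_le:
 assumes T: "finite T" "T <= Pl" and x: "x : S" "x ~: k" "!!V. V : T ==> val V x > 0"
 shows "(SUM V:T. nat (val V x) * pdeg k V) <= fdeg (adj k x) S"
proof -
 have x0: "x ~= 0" using x(2) sf_0[OF k] by auto
 let ?R = "RT T (%_. 0)"
 have R: "z : ?R \<longleftrightarrow> z : S & (ALL V:T. z : V)" for z unfolding RT_def using Id_0 T(2) by blast
 have eq: "(*) x ` ?R = RT T (%V. val V x)"
 proof
  show "(*) x ` ?R <= RT T (%V. val V x)"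
  proof
   fix y assume "y : (*) x ` ?R"
   then obtain z where z: "y = x * z" "z : S" "ALL V:T. z : Id V 0" unfolding RT_def by blast
   have "y : Id V (val V x)" if "V : T" for V
   using Id_mult[of V x "val V x" z 0] that T(2) z x(1) by (auto simp: Id_iff)
   thus "y : RT T (%V. val V x)" unfolding RT_def using z sf_mult[OF S x(1)] by simp
  qed
  show "RT T (%V. val V x) <= (*) x ` ?R"
  proof
   fix y assume "y : RT T (%V. val V x)"
   hence y: "y : S" "ALL V:T. y : Id V (val V x)" unfolding RT_def by auto
   have "inverse x * y : Id V 0" if "V : T" for V
   using Id_mult[of V "inverse x" "- val V x" y "val V x"] that T(2) y x(1) x0 val_inverse[of V x] sf_inv[OF S x(1)] by (auto simp: Id_iff)
   moreover have "inverse x * y : S" using sf_mult[OF S sf_inv[OF S x(1)] y(1)] .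
   ultimately have "inverse x * y : ?R" unfolding RT_def by simp
   moreover have "y = x * (inverse x * y)" using x0 by simp
   ultimately show "y : (*) x ` ?R" by blast
  qed
 qed
 have "rd k ((*) x ` ?R) (SUM V:T. nat (val V x) * pdeg k V) ?R"
  unfolding eq using RT_dim[OF T, of "%V. val V x"] x(3) by (simp add: order_less_imp_le)
 moreover have "x : ?R" unfolding RT_def using x by (simp add: Id_iff order_less_imp_le)
 moreover have "k <= ?R"
 proof
  fix a assume "a : k"
  thus "a : ?R" unfolding R using kS PlD(2) T(2) by blast
 qed
 moreover have "?R <= S" unfolding RT_def by blast
 moreover have "ALL a:?R. ALL b:?R. a + b : ?R & a * b : ?R"
 proof (intro ballI conjI)
  fix a b assume ab: "a : ?R" "b : ?R"
  show "a + b : ?R" using sub_add[OF ssp_RT[OF T(2)] ab] .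
  have "a * b : V" if "V : T" for V
  proof -
   have "V : Pl" "a : V" "b : V" using that T(2) ab R by blast+
   thus ?thesis using sring_mult[OF PlD(1)] by blast
  qed
  thus "a * b : ?R" unfolding R using ab sf_mult[OF S] unfolding R by simp
 qed
 ultimately show ?thesis
  using quotient_dim_le[OF k S ffin_rd[OF sf_adj[OF k] ffin_adj[OF x(1,2)]] x0, of ?R] by blast
qed

lemma finite_zeros: assumes x: "x : S" "x ~: k" shows "finite {V:Pl. val V x > 0}"
proof (rule ccontr)
 assume "infinite {V:Pl. val V x > 0}"
 then obtain T where T: "T <= {V:Pl. val V x > 0}" "finite T" "card T = Suc (fdeg (adj k x) S)"
  using infinite_arbitrarily_large by blast
 have TP: "T <= Pl" using T(1) by blast
 have p: "1 <= nat (val V x) * pdeg k V" if "V : T" for V using T(1) that pdeg_pos[of V] TP by (auto simp: Suc_le_eq)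
 have "card T = (SUM V:T. 1)" by simp
 also have "... <= (SUM V:T. nat (val V x) * pdeg k V)" using p by (rule sum_mono)
 also have "... <= fdeg (adj k x) S" using T(1) by (intro sum_zeros_le[OF T(2) TP x]) blast
 finally show False using T(3) by simp
qed

end

section \<open>Divisors, degrees of principal divisors and Riemann's inequality\<close>

context ff
begin

definition isdiv :: "('a set => int) => bool" where
 "isdiv A \<longleftrightarrow> finite {V. A V ~= 0} & (ALL V. V ~: Pl --> A V = 0)"

definition dg :: "('a set => int) => int" where
 "dg A = (SUM V | A V ~= 0. A V * int (pdeg k V))"

definition LL :: "('a set => int) => 'a set" where
 "LL A = {z : S. z = 0 | (ALL V:Pl. - A V <= val V z)}"

definition ll :: "('a set => int) => int" where
 "ll A = int (fdeg k (LL A))"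

lemma isdivD: "isdiv A ==> V ~: Pl ==> A V = 0" "isdiv A ==> finite {V. A V ~= 0}"
 unfolding isdiv_def by blast+

lemma isdivI: "finite T ==> (!!V. V ~: T ==> A V = 0) ==> (!!V. V ~: Pl ==> A V = 0) ==> isdiv A"
 unfolding isdiv_def by (auto intro: finite_subset)

lemma isdiv_pointwise2:
 assumes "isdiv A" "isdiv B" "f 0 0 = 0" shows "isdiv (%V. f (A V) (B V))"
 by (rule isdivI[of "{V. A V ~= 0} Un {V. B V ~= 0}"]) (use assms(3) isdivD(2)[OF assms(1)] isdivD(2)[OF assms(2)] isdivD(1)[OF assms(1)] isdivD(1)[OF assms(2)] in auto)

lemma isdiv_pointwise: "isdiv A ==> f 0 = 0 ==> isdiv (%V. f (A V))"
 using isdiv_pointwise2[of A A "%a b. f a"] by simp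

lemma isdiv_0: "isdiv (%_. 0)"
 by (rule isdivI[of "{}"]) simp_all

lemma isdiv_add: "isdiv A ==> isdiv B ==> isdiv (%V. A V + B V)"
 by (rule isdiv_pointwise2) simp_all

lemma isdiv_diff: "isdiv A ==> isdiv B ==> isdiv (%V. A V - B V)"
 by (rule isdiv_pointwise2) simp_all

lemma isdiv_scale: "isdiv A ==> isdiv (%V. r * A V)"
 by (rule isdiv_pointwise) simp_all

lemma isdiv_upd: "isdiv A ==> V : Pl ==> isdiv (A(V := n))"
 by (rule isdivI[of "insert V {V. A V ~= 0}"]) (auto simp: isdivD)

lemma dg_superset: "finite T ==> {V. A V ~= 0} <= T ==> dg A = (SUM V:T. A V * int (pdeg k V))"
 unfolding dg_def by (intro sum.mono_neutral_left) auto

lemma dg_pointwise2: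
 assumes "isdiv A" "isdiv B" "!!a b. f a b = p * a + q * b"
 shows "dg (%V. f (A V) (B V)) = p * dg A + q * dg B"
proof -
 let ?T = "{V. A V ~= 0} Un {V. B V ~= 0}"
 have T: "finite ?T" using isdivD(2) assms(1,2) by blast
 have "dg (%V. f (A V) (B V)) = (SUM V:?T. f (A V) (B V) * int (pdeg k V))" by (rule dg_superset[OF T]) (auto simp: assms(3))
 moreover have "dg A = (SUM V:?T. A V * int (pdeg k V))" by (rule dg_superset[OF T]) auto
 moreover have "dg B = (SUM V:?T. B V * int (pdeg k V))" by (rule dg_superset[OF T]) auto
 ultimately show ?thesis by (simp only: assms(3) sum_distrib_left sum.distrib[symmetric] distrib_right mult.assoc)
qed

lemma dg_add: "isdiv A ==> isdiv B ==> dg (%V. A V + B V) = dg A + dg B"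
 using dg_pointwise2[of A B "(+)" 1 1] by simp

lemma dg_diff: "isdiv A ==> isdiv B ==> dg (%V. A V - B V) = dg A - dg B"
 using dg_pointwise2[of A B "(-)" 1 "-1"] by simp

lemma dg_scale: "isdiv A ==> dg (%V. r * A V) = r * dg A"
 using dg_pointwise2[of A A "%a b. r * a" r 0] by simp

lemma dg_0: "dg (%_. 0) = 0" unfolding dg_def by simp

lemma dg_nonneg: "(!!V. A V >= 0) ==> dg A >= 0"
 unfolding dg_def by (simp add: sum_nonneg)

lemma dg_mono: "isdiv A ==> isdiv B ==> (!!V. A V <= B V) ==> dg A <= dg B"
 using dg_nonneg[of "%V. B V - A V"] dg_diff[of B A] by simp

lemma dg_upd: assumes "isdiv A" "V : Pl" shows "dg (A(V := A V + n)) = dg A + n * int (pdeg k V)"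
proof -
 define B where "B = (%W. if W = V then n else 0)"
 have B: "isdiv B" unfolding B_def by (rule isdivI[of "{V}"]) (use assms(2) in auto)
 have "{W. B W ~= 0} <= {V}" unfolding B_def by auto
 hence "dg B = (SUM W:{V}. B W * int (pdeg k W))" by (intro dg_superset) simp_all
 hence "dg B = n * int (pdeg k V)" by (simp add: B_def)
 moreover have "A(V := A V + n) = (%W. A W + B W)" unfolding B_def by auto
 ultimately show ?thesis using dg_add[OF assms(1) B] by simp
qed

lemma LL_iff: "z : LL A \<longleftrightarrow> z : S & (ALL V:Pl. z : Id V (- A V))"
 unfolding LL_def Id_iff by blast

lemma LL_S: "LL A <= S" unfolding LL_def by blast

lemma ssp_LL: "ssp k (LL A)"
 unfolding subsp_def
proof (intro conjI ballI)
 show "0 : LL A" unfolding LL_def using sf_0[OF S] by simp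
 fix x y assume h: "x : LL A" "y : LL A"
 show "x + y : LL A" unfolding LL_iff
 proof (intro conjI ballI)
  show "x + y : S" using h LL_S sf_add[OF S] by blast
  fix V assume V: "V : Pl"
  show "x + y : Id V (- A V)" using sub_add[OF ssp_Id[OF V]] h V unfolding LL_iff by blast
 qed
next
 fix a x assume h: "a : k" "x : LL A"
 show "a * x : LL A" unfolding LL_iff
 proof (intro conjI ballI)
  show "a * x : S" using h LL_S kS sf_mult[OF S] by blast
  fix V assume V: "V : Pl"
  show "a * x : Id V (- A V)" using sub_scale[OF ssp_Id[OF V] h(1)] h V unfolding LL_iff by blast
 qed
qed

lemma LL_mono: "(!!V. A V <= B V) ==> LL A <= LL B"
 unfolding LL_def by (auto intro: order_trans[rotated])

lemma LL_mult: assumes "x : LL A" "y : LL B" shows "x * y : LL (%V. A V + B V)"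
 unfolding LL_iff
proof (intro conjI ballI)
 show "x * y : S" using assms LL_S sf_mult[OF S] by blast
 fix V assume V: "V : Pl"
 show "x * y : Id V (- (A V + B V))" using Id_mult[OF V, of x "- A V" y "- B V"] assms V unfolding LL_iff by (simp add: add.commute)
qed

lemma LL_step: assumes V: "V : Pl" shows "EX m<=pdeg k V. rd k (LL A) m (LL (A(V := A V + 1)))"
proof -
 let ?B = "A(V := A V + 1)"
 have s: "rd k (Id V (- A V)) (pdeg k V) (Id V (- A V - 1))" using Id_step[OF V, of "- A V - 1"] by simp
 have m: "Id V (- A V) <= Id V (- A V - 1)" by (rule Id_mono) simp
 have Bi: "z : LL ?B \<longleftrightarrow> z : S & z : Id V (- A V - 1) & (ALL W:Pl - {V}. z : Id W (- A W))" for z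
  unfolding LL_iff using V by (simp add: Ball_def) (smt (verit, best))
 have "LL ?B Int Id V (- A V) = LL A"
 proof (rule Set.set_eqI)
  fix z show "z : LL ?B Int Id V (- A V) \<longleftrightarrow> z : LL A" unfolding Int_iff Bi LL_iff[of z A] using V m by blast
 qed
 moreover have "LL ?B Int Id V (- A V - 1) = LL ?B"
 proof (rule Set.set_eqI)
  fix z show "z : LL ?B Int Id V (- A V - 1) \<longleftrightarrow> z : LL ?B" unfolding Int_iff Bi by blast
 qed
 ultimately show ?thesis using dm_inter_le[OF s ssp_Id[OF V] ssp_LL[of ?B]] by simp
qed

lemma LL_chain:
 assumes "isdiv A" "isdiv B" "!!V. A V <= B V" shows "EX m. int m <= dg B - dg A & rd k (LL A) m (LL B)"
 using assms
proof (induction "nat (SUM V | B V - A V ~= 0. B V - A V)" arbitrary: A)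
 case 0
 have f: "finite {V. B V - A V ~= 0}" using isdivD(2)[OF isdiv_diff[OF 0(3,2)]] .
 have "(SUM V | B V - A V ~= 0. B V - A V) >= 0" using 0 by (intro sum_nonneg) simp
 hence "(SUM V | B V - A V ~= 0. B V - A V) = 0" using 0 by simp
 hence "B V - A V = 0" for V using sum_nonneg_eq_0_iff[OF f, of "%V. B V - A V"] 0(4) by (cases "B V - A V = 0") auto
 hence "A = B" by (intro ext) simp
 thus ?case using rdim.rZ[of "(*)" k "LL B"] by (intro exI[of _ 0]) simp
next
 case (Suc n)
 have f: "finite {V. B V - A V ~= 0}" using isdivD(2)[OF isdiv_diff[OF Suc(4,3)]] .
 have "{V. B V - A V ~= 0} ~= {}" using Suc(2) by (metis Zero_not_Suc sum.empty nat_0)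
 then obtain V where V: "B V - A V ~= 0" by blast
 hence VP: "V : Pl" using isdivD(1)[OF isdiv_diff[OF Suc(4,3)], of V] by blast
 have lt: "A V + 1 <= B V" using V Suc(5)[of V] by simp
 define A' where "A' = A(V := A V + 1)"
 have A': "isdiv A'" unfolding A'_def using isdiv_upd[OF Suc(3) VP] .
 have le: "A' W <= B W" for W unfolding A'_def using lt Suc(5) by simp
 have "(SUM W | B W - A' W ~= 0. B W - A' W) = (SUM W | B W - A W ~= 0. B W - A' W)"
 proof (rule sum.mono_neutral_left[OF f])
  show "{W. B W - A' W ~= 0} <= {W. B W - A W ~= 0}" using V by (auto simp: A'_def)
 qed simp
 also have "... = (B V - A' V) + (SUM W : {W. B W - A W ~= 0} - {V}. B W - A' W)" using sum.remove[OF f, of V] V by simp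
 also have "(SUM W : {W. B W - A W ~= 0} - {V}. B W - A' W) = (SUM W : {W. B W - A W ~= 0} - {V}. B W - A W)"
  by (rule sum.cong) (auto simp: A'_def)
 also have "(B V - A' V) + ... = (SUM W | B W - A W ~= 0. B W - A W) - 1" using sum.remove[OF f, of V "%W. B W - A W"] V by (simp add: A'_def)
 finally have "n = nat (SUM W | B W - A' W ~= 0. B W - A' W)" using Suc(2) by simp
 from Suc(1)[OF this A' Suc(4) le] obtain m where m: "int m <= dg B - dg A'" "rd k (LL A') m (LL B)" by blast
 obtain i where i: "i <= pdeg k V" "rd k (LL A) i (LL A')" using LL_step[OF VP, of A] unfolding A'_def by blast
 have "dg A' = dg A + int (pdeg k V)" unfolding A'_def using dg_upd[OF Suc(3) VP, of 1] by simp
 hence "int (i + m) <= dg B - dg A" using m(1) i(1) by simp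
 thus ?case using dm_trans[OF m(2) i(2)] by blast
qed

lemma no_poles_const: assumes z: "z : S" "z ~= 0" "!!V. V : Pl ==> val V z >= 0" shows "z : k"
proof (rule ccontr)
 assume nk: "z ~: k"
 have i: "inverse z : S" "inverse z ~: k" using sf_inv[OF S z(1)] sf_inv[OF k, of "inverse z"] nk by auto
 then obtain V where V: "V : Pl" "inverse z : mx V" using zero_exists by blast
 have "val V (inverse z) > 0" using val_gt_0[OF V(1) i(1)] V(2) z(2) by simp
 thus False using z(3)[OF V(1)] val_inverse[OF V(1) z(1,2)] by simp
qed

lemma Pl_nonempty: "EX V. V : Pl"
proof -
 obtain x where x: "x : S" "transc k x" using fin by blast
 have "x ~: k"
 proof
  assume "x : k"
  hence "pk k [:- x, 1:]" by (simp add: pk_pCons[OF k] pk_0[OF k] sf_uminus[OF k] sf_1[OF k])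
  moreover have "poly [:- x, 1:] x = 0" by simp
  ultimately show False using x(2) unfolding transc_def by fastforce
 qed
 thus ?thesis using zero_exists[OF x(1)] by blast
qed

lemma LL_0: "LL (%_. 0) = k"
proof
 show "LL (%_. 0) <= k"
 proof
  fix z assume "z : LL (%_. 0)"
  thus "z : k" using no_poles_const[of z] sf_0[OF k] unfolding LL_def by (cases "z = 0") auto
 qed
 show "k <= LL (%_. 0)" unfolding LL_def using kS val_const by auto
qed

lemma LL_neg:
 assumes "!!V. A V <= 0" "V : Pl" "A V < 0" shows "LL A = {0}"
proof -
 have "z = 0" if z: "z : LL A" for z
 proof (rule ccontr)
  assume z0: "z ~= 0"
  have "z : k" using z LL_mono[of A "%_. 0"] assms(1) LL_0 by blast
  moreover have "val V z > 0" using z z0 assms(2,3) unfolding LL_def by force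
  ultimately show False using val_const[OF assms(2) _ z0] by simp
 qed
 thus ?thesis using sub_0[OF ssp_LL[of A]] by blast
qed

text \<open>Below \<open>A\<close> lies a divisor that is nowhere positive and negative somewhere;
  its space is zero, and the chain from there up to \<open>A\<close> is finite.\<close>

lemma LL_finite: assumes "isdiv A" shows "EX n. rd k {0} n (LL A)"
proof -
 obtain V where V: "V : Pl" using Pl_nonempty by blast
 define B0 where "B0 = (%W. min 0 (A W))"
 have B0: "isdiv B0" unfolding B0_def by (rule isdiv_pointwise[OF assms]) simp
 define B where "B = B0(V := B0 V - 1)"
 have B: "isdiv B" unfolding B_def using isdiv_upd[OF B0 V] .
 have "LL B = {0}" by (rule LL_neg[OF _ V]) (auto simp: B_def B0_def)
 moreover have "!!W. B W <= A W" unfolding B_def B0_def by auto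
 ultimately show ?thesis using LL_chain[OF B assms] by metis
qed

lemma ll_rd: "isdiv A ==> rd k {0} (nat (ll A)) (LL A)"
 using ffin_rd[OF k] LL_finite unfolding ll_def ffin_def by auto

lemma ll_eq: "rd k {0} n (LL A) ==> ll A = int n"
 unfolding ll_def using fdeg_eq[OF k] by simp

lemma ll_nonneg: "ll A >= 0" unfolding ll_def by simp

lemma ll_ge: "isdiv A ==> rd k {0} n M ==> M <= LL A ==> int n <= ll A"
 using dm_mono[OF ll_rd _ _ sub_zero] ll_nonneg[of A] by fastforce

lemma ll_chain:
 assumes "isdiv A" "isdiv B" "!!V. A V <= B V"
 shows "ll A <= ll B" "ll B - ll A <= dg B - dg A"
proof -
 obtain m where m: "int m <= dg B - dg A" "rd k (LL A) m (LL B)" using LL_chain[OF assms] by blast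
 have "ll B = int (nat (ll A) + m)" using ll_eq[OF dm_trans[OF m(2) ll_rd[OF assms(1)]]] .
 hence "ll B = ll A + int m" using ll_nonneg[of A] by simp
 thus "ll A <= ll B" "ll B - ll A <= dg B - dg A" using m(1) by simp_all
qed

lemma ll_0: "ll (%_. 0) = 1"
proof -
 have "1 ~: {0::'a}" by simp
 from rdim.rS[OF rdim.rZ this] have "rd k {0} 1 (lext (*) k 1 {0})" by simp
 moreover have "lext (*) k 1 {0} = k" unfolding lext_def by auto
 ultimately show ?thesis using ll_eq[of 1 "%_. 0"] LL_0 by simp
qed

text \<open>The pole divisor of \<open>z\<close>; the principal divisor is
  \<open>pr\<close>.\<close>

definition pol :: "'a => 'a set => int" where
 "pol z V = (if V : Pl then max 0 (- val V z) else 0)"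

definition pr :: "'a => 'a set => int" where
 "pr z V = (if V : Pl then val V z else 0)"

lemma pol_nonneg: "pol z V >= 0" unfolding pol_def by simp

lemma adj_inverse: assumes "x : S" shows "adj k (inverse x) = adj k x"
proof -
 have *: "adj k (inverse x) <= adj k x" for x
  by (rule adj_le[OF sf_adj[OF k] adj_sup[OF k] sf_inv[OF sf_adj[OF k] adj_gen[OF k]]])
 show ?thesis using *[of x] *[of "inverse x"] by simp
qed

lemma isdiv_pol: assumes "z : S" "z ~= 0" shows "isdiv (pol z)"
proof (cases "z : k")
 case True
 have "pol z V = 0" for V unfolding pol_def using val_const[OF _ True assms(2)] by simp
 hence "pol z = (%_. 0)" by blast
 thus ?thesis using isdiv_0 by simp
next
 case False
 have i: "inverse z : S" "inverse z ~: k" using sf_inv[OF S assms(1)] sf_inv[OF k, of "inverse z"] False by auto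
 show ?thesis
 proof (rule isdivI[OF finite_zeros[OF i]])
  fix V assume "V ~: {V : Pl. 0 < val V (inverse z)}"
  thus "pol z V = 0" unfolding pol_def using val_inverse[OF _ assms, of V] by auto
 qed (simp add: pol_def)
qed

lemma pr_pol: assumes "z : S" "z ~= 0" shows "pr z = (%V. pol (inverse z) V - pol z V)"
proof
 fix V show "pr z V = pol (inverse z) V - pol z V"
  unfolding pr_def pol_def using val_inverse[OF _ assms, of V] by (cases "V : Pl") simp_all
qed

lemma isdiv_pr: assumes "z : S" "z ~= 0" shows "isdiv (pr z)"
proof -
 have i: "inverse z : S" "inverse z ~= 0" using sf_inv[OF S assms(1)] assms(2) by simp_all
 show ?thesis unfolding pr_pol[OF assms] using isdiv_diff[OF isdiv_pol[OF i] isdiv_pol[OF assms]] .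
qed

lemma dg_pol_le: assumes x: "x : S" "x ~: k" shows "dg (pol x) <= int (fdeg (adj k x) S)"
proof -
 have x0: "x ~= 0" using x sf_0[OF k] by blast
 have i: "inverse x : S" "inverse x ~: k" using sf_inv[OF S x(1)] sf_inv[OF k, of "inverse x"] x(2) by auto
 let ?T = "{V. pol x V ~= 0}"
 have T: "finite ?T" "?T <= Pl" using isdivD(2)[OF isdiv_pol[OF x(1) x0]] by (auto simp: pol_def)
 have v: "val V (inverse x) > 0 & pol x V = val V (inverse x)" if "V : ?T" for V
  using that val_inverse[OF _ x(1) x0, of V] unfolding pol_def by (auto split: if_splits simp: max_def)
 have "(SUM V:?T. nat (val V (inverse x)) * pdeg k V) <= fdeg (adj k (inverse x)) S"
  using v by (intro sum_zeros_le[OF T i]) blast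
 hence "int (SUM V:?T. nat (val V (inverse x)) * pdeg k V) <= int (fdeg (adj k x) S)"
  unfolding adj_inverse[OF x(1)] by (simp only: of_nat_le_iff)
 moreover have "int (SUM V:?T. nat (val V (inverse x)) * pdeg k V) = dg (pol x)"
  unfolding dg_def of_nat_sum of_nat_mult using v by (intro sum.cong) force+
 ultimately show ?thesis by simp
qed

lemma polys_LL:
 assumes x: "x : S" "x ~= 0" shows "plt k x (Suc r) <= LL (%V. int r * pol x V)"
proof
 fix z assume "z : plt k x (Suc r)"
 then obtain p where p: "z = poly p x" "pk k p" "ALL j>=Suc r. coeff p j = 0" unfolding plt_def by blast
 have dp: "degree p <= r" using p(3) by (intro degree_le) auto
 have xi: "x ^ i : LL (%V. int r * pol x V)" if i: "i <= r" for i
  unfolding LL_iff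
 proof (intro conjI ballI)
  show xS: "x ^ i : S" using sf_power[OF S x(1)] .
  fix V assume V: "V : Pl"
  have "- val V x <= pol x V" using V unfolding pol_def by simp
  hence "int i * - val V x <= int i * pol x V" by (intro mult_left_mono) simp_all
  moreover have "int i * pol x V <= int r * pol x V" using i pol_nonneg by (intro mult_right_mono) simp_all
  ultimately have "- (int r * pol x V) <= int i * val V x" by linarith
  thus "x ^ i : Id V (- (int r * pol x V))" using xS val_power[OF V x, of i] by (simp add: Id_iff)
 qed
 have "z = (SUM i<=r. coeff p i * x ^ i)" unfolding p(1) using poly_eq_sum_le[OF dp] .
 thus "z : LL (%V. int r * pol x V)"
  using xi pkD[OF p(2)] by (auto intro!: sub_sum[OF ssp_LL] sub_scale[OF ssp_LL])
qed

text \<open>The products of basis elements of \<open>S\<close> over \<open>k(x)\<close> with powers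
  of \<open>x\<close> up to \<open>r\<close> are independent over \<open>k\<close>. Their poles lie
  in \<open>r\<close> times the pole divisor of \<open>x\<close> plus \<open>C\<close>, which
  collects the poles of the basis.\<close>

lemma ll_growth:
 assumes x: "x : S" "x ~: k"
 shows "EX C. isdiv C & (ALL V. C V >= 0) & (ALL r. int (fdeg (adj k x) S * Suc r) <= ll (%V. int r * pol x V + C V))"
proof -
 have x0: "x ~= 0" using x sf_0[OF k] by blast
 let ?F = "adj k x"
 have F: "sf ?F" using sf_adj[OF k] .
 interpret F: klin "(*)" ?F by (rule klin_mult[OF F])
 have tx: "transc k x" using full[OF x] .
 have ind: "rd ?F {0} i E ==> E <= S ==> EX C. isdiv C & (ALL V. C V >= 0) &
  (ALL r. EX M. M <= E & M <= LL (%V. int r * pol x V + C V) & rd k {0} (i * Suc r) M & ssp k M)" for i E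
 proof (induction rule: rdim.induct)
  case rZ
  have "{0} <= LL A" for A using sub_0[OF ssp_LL] by blast
  thus ?case using isdiv_0 rdim.rZ[of "(*)" k "{0}"] sub_zero by (intro exI[of _ "%_. 0"]) auto
 next
  case (rS i E v)
  have sE: "F.sub E" using F.dm_sub[OF rS.hyps(1) F.sub_zero] .
  have ES: "E <= S" "v : S" using rS.prems F.ext_sup[of E v] F.ext_in[OF sE, of v] by blast+
  obtain C where C: "isdiv C" "ALL V. C V >= 0" "ALL r. EX M. M <= E & M <= LL (%V. int r * pol x V + C V) & rd k {0} (i * Suc r) M & ssp k M"
   using rS.IH[OF ES(1)] by blast
  have v0: "v ~= 0" using rS.hyps(2) F.sub_0[OF sE] by auto
  define D where "D = (%V. C V + pol v V)"
  have "isdiv D" "ALL V. D V >= 0" unfolding D_def using isdiv_add[OF C(1) isdiv_pol[OF ES(2) v0]] C(2) pol_nonneg by (simp_all add: add_nonneg_nonneg)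
  moreover have "EX M. M <= lext (*) ?F v E & M <= LL (%V. int r * pol x V + D V) & rd k {0} (Suc i * Suc r) M & ssp k M" for r
  proof -
   obtain M where M: "M <= E" "M <= LL (%V. int r * pol x V + C V)" "rd k {0} (i * Suc r) M" "ssp k M" using C(3) by blast
   let ?P = "plt k x (Suc r)"
   have P: "rd k {0} (Suc r) ((*) v ` ?P)" using rd_mult_image[OF rd_plt_transc[OF k tx] v0] by simp
   have sP: "ssp k ((*) v ` ?P)" using dm_sub[OF P sub_zero] .
   have PF: "?P <= ?F" unfolding plt_def using adj_poly[OF k] by blast
   have "M Int (*) v ` ?P = {0}"
   proof -
   have "v * p = 0" if "p : ?P" "v * p : E" for p
   proof (rule ccontr)
   assume n: "v * p ~= 0"
   hence "v = inverse p * (v * p)" by auto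
   moreover have "inverse p * (v * p) : E" using F.sub_scale[OF sE sf_inv[OF F] that(2)] that(1) PF by blast
   ultimately show False using rS.hyps(2) by metis
   qed
   thus ?thesis using M(1) sub_0[OF M(4)] sub_0[OF sP] by blast
   qed
   from dm_splus[OF P M(4) this] have "rd k {0} (i * Suc r + Suc r) (splus M ((*) v ` ?P))" using dm_trans[OF _ M(3)] by blast
   moreover have "splus M ((*) v ` ?P) <= lext (*) ?F v E"
   proof
   fix y assume "y : splus M ((*) v ` ?P)"
   then obtain m p where "y = m + v * p" "m : M" "p : ?P" unfolding splus_def by blast
   thus "y : lext (*) ?F v E" using F.extI[of p m E v] PF M(1) by (auto simp: add.commute mult.commute)
   qed
   moreover have "splus M ((*) v ` ?P) <= LL (%V. int r * pol x V + D V)"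
   proof
   fix y assume "y : splus M ((*) v ` ?P)"
   then obtain m p where y: "y = m + v * p" "m : M" "p : ?P" unfolding splus_def by blast
   have "v : LL (pol v)" unfolding LL_def pol_def using ES(2) by auto
   moreover have "p : LL (%V. int r * pol x V)" using polys_LL[OF x(1) x0] y(3) by blast
   ultimately have "v * p : LL (%V. pol v V + int r * pol x V)" by (rule LL_mult)
   moreover have "LL (%V. pol v V + int r * pol x V) <= LL (%V. int r * pol x V + D V)"
   unfolding D_def using C(2) by (intro LL_mono) simp
   moreover have "LL (%V. int r * pol x V + C V) <= LL (%V. int r * pol x V + D V)"
   unfolding D_def using pol_nonneg by (intro LL_mono) simp
   ultimately show "y : LL (%V. int r * pol x V + D V)" unfolding y(1) using y(2) M(2) sub_add[OF ssp_LL] by blast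
   qed
   moreover have "ssp k (splus M ((*) v ` ?P))" using sub_splus[OF M(4) sP] .
   moreover have "i * Suc r + Suc r = Suc i * Suc r" by simp
   ultimately show ?thesis by (intro exI[of _ "splus M ((*) v ` ?P)"]) (simp only:)
  qed
  ultimately show ?case by blast
 qed
 have "rd ?F {0} (fdeg ?F S) S" using ffin_rd[OF F ffin_adj[OF x]] .
 from ind[OF this order_refl] obtain C where C: "isdiv C" "ALL V. C V >= 0"
  "ALL r. EX M. M <= S & M <= LL (%V. int r * pol x V + C V) & rd k {0} (fdeg ?F S * Suc r) M & ssp k M"
  by (elim exE conjE)
 have "int (fdeg ?F S * Suc r) <= ll (%V. int r * pol x V + C V)" for r
  using C(3) ll_ge[OF isdiv_add[OF isdiv_scale[OF isdiv_pol[OF x(1) x0]] C(1)]] by blast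
 thus ?thesis using C by blast
qed

text \<open>\<open>ll\<close> of \<open>r * pol x + C\<close> grows at least with rate
  \<open>n\<close> in \<open>r\<close> by \<open>ll_growth\<close> and at most with rate
  \<open>dg (pol x)\<close>. Large \<open>r\<close> therefore gives the inequality opposite to
  \<open>dg_pol_le\<close>.\<close>

theorem dg_pol: assumes x: "x : S" "x ~: k" shows "dg (pol x) = int (fdeg (adj k x) S)"
proof -
 have x0: "x ~= 0" using x sf_0[OF k] by blast
 let ?n = "int (fdeg (adj k x) S)"
 obtain C where C: "isdiv C" "ALL V. C V >= 0" "!!r. int (fdeg (adj k x) S * Suc r) <= ll (%V. int r * pol x V + C V)"
  using ll_growth[OF x] by blast
 have b: "?n * int (Suc r) <= 1 + int r * dg (pol x) + dg C" for r
 proof -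
  have i: "isdiv (%V. int r * pol x V)" using isdiv_scale[OF isdiv_pol[OF x(1) x0]] .
  have "ll (%V. int r * pol x V + C V) - ll (%_. 0) <= dg (%V. int r * pol x V + C V) - dg (%_. 0)"
   using C(2) pol_nonneg by (intro ll_chain(2)[OF isdiv_0 isdiv_add[OF i C(1)]]) simp
  hence "ll (%V. int r * pol x V + C V) <= 1 + int r * dg (pol x) + dg C"
   unfolding dg_add[OF i C(1)] dg_scale[OF isdiv_pol[OF x(1) x0]] dg_0 ll_0 by linarith
  thus ?thesis using C(3)[of r] unfolding of_nat_mult by linarith
 qed
 have "~ dg (pol x) < ?n"
 proof
  assume "dg (pol x) < ?n"
  hence d: "dg (pol x) + 1 <= ?n" by simp
  define r where "r = nat (1 + dg C)"
  have r: "int r >= 1 + dg C" unfolding r_def by simp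
  have "(dg (pol x) + 1) * int (Suc r) <= ?n * int (Suc r)" using d by (intro mult_right_mono) simp_all
  moreover have "(dg (pol x) + 1) * int (Suc r) = int r * dg (pol x) + dg (pol x) + int r + 1" by (simp add: algebra_simps)
  ultimately have "dg (pol x) + int r + 1 <= 1 + dg C" using b[of r] by linarith
  moreover have "dg (pol x) >= 0" using dg_nonneg pol_nonneg by blast
  ultimately show False using r by simp
 qed
 thus ?thesis using dg_pol_le[OF x] by simp
qed

theorem dg_pr: assumes z: "z : S" "z ~= 0" shows "dg (pr z) = 0"
proof (cases "z : k")
 case True
 have "pr z V = 0" for V unfolding pr_def using val_const[OF _ True z(2)] by simp
 hence "pr z = (%_. 0)" by blast
 thus ?thesis using dg_0 by simp
next
 case False
 have i: "inverse z : S" "inverse z ~= 0" "inverse z ~: k" using sf_inv[OF S z(1)] sf_inv[OF k, of "inverse z"] z(2) False by auto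
 have "dg (pr z) = dg (pol (inverse z)) - dg (pol z)" unfolding pr_pol[OF z] using dg_diff[OF isdiv_pol[OF i(1,2)] isdiv_pol[OF z]] .
 thus ?thesis using dg_pol[OF z(1) False] dg_pol[OF i(1,3)] adj_inverse[OF z(1)] by simp
qed

lemma LL_equiv: assumes z: "z : S" "z ~= 0" shows "ll (%V. A V - pr z V) = ll A"
proof -
 have *: "(*) z ` LL A <= LL (%V. A V - pr z V)" if z: "z : S" "z ~= 0" for z A
 proof
  fix y assume "y : (*) z ` LL A"
  then obtain w where w: "y = z * w" "w : LL A" by blast
  have "z : LL (%V. - pr z V)" unfolding LL_def pr_def using z by simp
  from LL_mult[OF this w(2)] show "y : LL (%V. A V - pr z V)" unfolding w(1) by simp
 qed
 have i: "inverse z : S" "inverse z ~= 0" using sf_inv[OF S z(1)] z(2) by auto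
 have "(%V. A V - pr z V - pr (inverse z) V) = A" unfolding pr_def using val_inverse[OF _ z] by auto
 hence "(*) (inverse z) ` LL (%V. A V - pr z V) <= LL A" using *[OF i, of "%V. A V - pr z V"] by simp
 hence "(*) z ` ((*) (inverse z) ` LL (%V. A V - pr z V)) <= (*) z ` LL A" by (rule image_mono)
 moreover have "(*) z ` ((*) (inverse z) ` LL (%V. A V - pr z V)) = LL (%V. A V - pr z V)" using z(2) by (simp add: image_image)
 ultimately have e: "(*) z ` LL A = LL (%V. A V - pr z V)" using *[OF z, of A] by (intro equalityI) simp_all
 have "rd k {0} n (LL A) \<longleftrightarrow> rd k {0} n ((*) z ` LL A)" for n
 proof
  show "rd k {0} n (LL A) ==> rd k {0} n ((*) z ` LL A)" using rd_mult_image[OF _ z(2), of "{0}" n "LL A"] by simp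
  assume "rd k {0} n ((*) z ` LL A)"
  from rd_mult_image[OF this i(2)] show "rd k {0} n (LL A)" using z(2) by (simp add: image_image)
 qed
 thus ?thesis unfolding ll_def fdeg_def e by simp
qed

text \<open>Multiples of one pole divisor decide the bound. For large \<open>r\<close> the space of
  \<open>r * pol x - B\<close> is nonzero, and the divisor of a function in it moves
  \<open>B\<close> below \<open>r * pol x\<close>; the defect \<open>dg - ll\<close> is monotone and
  invariant under linear equivalence.\<close>

lemma riemann_reduction:
 assumes x: "x : S" "x ~: k" and g: "!!r::nat. int r * int (fdeg (adj k x) S) - ll (%V. int r * pol x V) <= g" and A: "isdiv A"
 shows "dg A - ll A <= g"
proof -
 have x0: "x ~= 0" using x sf_0[OF k] by blast
 define B where "B = (%V. max 0 (A V))"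
 have B: "isdiv B" "!!V. B V >= 0" "!!V. A V <= B V" unfolding B_def by (auto intro: isdiv_pointwise[OF A])
 let ?n = "int (fdeg (adj k x) S)"
 have n1: "?n >= 1"
 proof -
  obtain V where V: "V : Pl" "inverse x : mx V" using zero_exists[OF sf_inv[OF S x(1)]] x(2) sf_inv[OF k, of "inverse x"] by force
  hence "pol x V > 0" unfolding pol_def using val_gt_0[OF V(1) sf_inv[OF S x(1)]] val_inverse[OF V(1) x(1) x0] x0 by simp
  hence "pol x ~= (%_. 0)" by auto
  have "0 < pol x V * int (pdeg k V)" using \<open>pol x V > 0\<close> pdeg_pos[OF V(1)] by simp
  moreover have "pol x V * int (pdeg k V) <= dg (pol x)" unfolding dg_def
   by (rule member_le_sum[of V "{V. pol x V ~= 0}" "%V. pol x V * int (pdeg k V)"])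
   (use \<open>pol x V > 0\<close> pol_nonneg isdivD(2)[OF isdiv_pol[OF x(1) x0]] in simp_all)
  ultimately show ?thesis using dg_pol[OF x] by linarith
 qed
 define r where "r = nat (g + dg B + 1)"
 have r: "int r >= g + dg B + 1" unfolding r_def by simp
 let ?R = "%V. int r * pol x V"
 have R: "isdiv ?R" "dg ?R = int r * ?n" using isdiv_scale[OF isdiv_pol[OF x(1) x0]] dg_scale[OF isdiv_pol[OF x(1) x0]] dg_pol[OF x] by simp_all
 have RB: "isdiv (%V. ?R V - B V)" using isdiv_diff[OF R(1) B(1)] .
 have "ll ?R - ll (%V. ?R V - B V) <= dg ?R - dg (%V. ?R V - B V)" using B(2) by (intro ll_chain(2)[OF RB R(1)]) simp
 hence "ll ?R - ll (%V. ?R V - B V) <= dg B" using dg_diff[OF R(1) B(1)] by simp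
 moreover have "int r * ?n - ll ?R <= g" using g by blast
 moreover have "int r * 1 <= int r * ?n" using n1 by (intro mult_left_mono) simp_all
 ultimately have "ll (%V. ?R V - B V) > 0" using r by linarith
 hence "~ LL (%V. ?R V - B V) <= {0}" using ll_eq[of 0 "%V. ?R V - B V"] rdim.rZ[of "(*)" k "{0}"] sub_0[OF ssp_LL[of "%V. ?R V - B V"]]
  by (metis (no_types, lifting) less_irrefl of_nat_0 singletonD subset_antisym subsetI)
 then obtain z where z: "z : LL (%V. ?R V - B V)" "z ~= 0" by blast
 have zS: "z : S" using z LL_S by blast
 let ?D = "%V. B V - pr z V"
 have D: "isdiv ?D" using isdiv_diff[OF B(1) isdiv_pr[OF zS z(2)]] .
 have DR: "?D V <= ?R V" for V
 proof (cases "V : Pl")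
  case True thus ?thesis using z unfolding LL_def pr_def by auto
 next
  case False thus ?thesis using isdivD(1)[OF B(1) False] unfolding pr_def pol_def by simp
 qed
 have 1: "dg A - ll A <= dg B - ll B" using ll_chain(2)[OF A B(1) B(3)] by simp
 have 2: "dg B - ll B = dg ?D - ll ?D" using dg_diff[OF B(1) isdiv_pr[OF zS z(2)]] dg_pr[OF zS z(2)] LL_equiv[OF zS z(2), of B] by simp
 have 3: "dg ?D - ll ?D <= dg ?R - ll ?R" using ll_chain(2)[OF D R(1) DR] by simp
 have 4: "dg ?R - ll ?R <= g" using g[of r] R(2) by simp
 show ?thesis using 1 2 3 4 by linarith
qed

theorem riemann: "EX g. ALL A. isdiv A --> dg A - ll A <= g"
proof -
 obtain V where V: "V : Pl" using Pl_nonempty by blast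
 define x where "x = unif V"
 have x: "x : S" "x ~: k" unfolding x_def using unif[OF V] mx_k[OF V] by auto
 have x0: "x ~= 0" using x sf_0[OF k] by blast
 obtain C where C: "isdiv C" "ALL V. C V >= 0" "!!r. int (fdeg (adj k x) S * Suc r) <= ll (%V. int r * pol x V + C V)"
  using ll_growth[OF x] by blast
 have "int r * int (fdeg (adj k x) S) - ll (%V. int r * pol x V) <= dg C" for r
 proof -
  have i: "isdiv (%V. int r * pol x V)" using isdiv_scale[OF isdiv_pol[OF x(1) x0]] .
  have "ll (%V. int r * pol x V + C V) - ll (%V. int r * pol x V) <= dg (%V. int r * pol x V + C V) - dg (%V. int r * pol x V)"
   using C(2) by (intro ll_chain(2)[OF i isdiv_add[OF i C(1)]]) simp
  hence "ll (%V. int r * pol x V + C V) <= ll (%V. int r * pol x V) + dg C" using dg_add[OF i C(1)] by simp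
  moreover have "int (fdeg (adj k x) S * Suc r) >= int r * int (fdeg (adj k x) S)" by (simp add: algebra_simps)
  ultimately show ?thesis using C(3)[of r] by linarith
 qed
 thus ?thesis using riemann_reduction[OF x] by blast
qed

end

section \<open>Algebraically closed constants and finite extensions\<close>

lemma rd_1: "rdim s k U (Suc 0) V ==> EX v. v ~: U & V = lext s k v U"
 by (erule rdim.cases) (auto elim: rdim.cases)

text \<open>Rank and nullity in relative form: preimages under a linear map turn a chain above 0
  into a chain above the kernel.\<close>

lemma (in klin) dm_preimage:
 fixes f :: "'b => 'c::ab_group_add"
 assumes E: "rdim s' k {0} n E" "klin s' k" and W: "sub W" and f: "!!x y. f (x + y) = f x + f y" "!!a x. a : k ==> f (a *s x) = s' a (f x)"
  and onto: "E <= f ` W"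
 shows "dm {x : W. f x = 0} n {x : W. f x : E}"
proof -
 interpret E: klin s' k by (rule E(2))
 show ?thesis using E(1) onto
 proof (induction rule: rdim.induct)
  case rZ thus ?case using rdim.rZ by simp
 next
  case (rS n V v)
  have sV: "E.sub V" using E.dm_sub[OF rS.hyps(1) E.sub_zero] .
  have IH: "dm {x : W. f x = 0} n {x : W. f x : V}" using rS.IH rS.prems E.ext_sup[of V v] by blast
  obtain w where w: "w : W" "v = f w" using rS.prems E.ext_in[OF sV, of v] by blast
  have "{x : W. f x : lext s' k v V} = ext w {x : W. f x : V}"
  proof
   show "{x : W. f x : lext s' k v V} <= ext w {x : W. f x : V}"
   proof
   fix x assume "x : {x : W. f x : lext s' k v V}"
   then obtain a u where x: "x : W" "f x = s' a v + u" "a : k" "u : V" unfolding lext_def by blast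
   have xe: "x = a *s w + (x - a *s w)" by simp
   have "f x = f (a *s w) + f (x - a *s w)" using f(1)[of "a *s w" "x - a *s w"] by simp
   hence "f (x - a *s w) = u" using f(2)[OF x(3), of w] x(2) w(2) by simp
   moreover have "x - a *s w : W" using sub_diff[OF W x(1) sub_scale[OF W x(3) w(1)]] .
   ultimately show "x : ext w {x : W. f x : V}" using extI[OF x(3), of "x - a *s w" "{x : W. f x : V}" w] x(4) xe by simp
   qed
   show "ext w {x : W. f x : V} <= {x : W. f x : lext s' k v V}"
   proof
   fix x assume "x : ext w {x : W. f x : V}"
   then obtain a u where x: "x = a *s w + u" "a : k" "u : W" "f u : V" unfolding lext_def by blast
   have "x : W" unfolding x(1) using sub_add[OF W sub_scale[OF W x(2) w(1)] x(3)] .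
   moreover have "f x = s' a v + f u" unfolding x(1) f(1) f(2)[OF x(2)] w(2) ..
   ultimately show "x : {x : W. f x : lext s' k v V}" using E.extI[OF x(2,4), of v] by simp
   qed
  qed
  moreover have "w ~: {x : W. f x : V}" using rS.hyps(2) w(2) by simp
  ultimately show ?case using rdim.rS[OF IH, of w] by simp
 qed
qed

text \<open>\<open>S[z]\<close> is finite-dimensional, so multiplication by a nonzero element is
  injective and hence onto. Thus \<open>S[z]\<close> is a field already and equals
  \<open>S(z)\<close>.\<close>

lemma adj_algebraic:
 assumes S: "sf S" and G: "pk S G" "G ~= 0" "poly G z = 0" and y: "y : adj S z" shows "EX p. pk S p & y = poly p z"
proof -
 interpret klin "(*)" S by (rule klin_mult[OF S])
 define M where "M = radj S z"
 have MS: "M <= adj S z" unfolding M_def radj_def using adj_poly[OF S] by blast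
 have rM: "sring M" unfolding M_def using sring_radj[OF sring_sf[OF S]] .
 have SM: "S <= M" unfolding M_def by (rule radj_sup(1)[OF sring_sf[OF S]])
 have sM: "ssp S M" unfolding subsp_def using sring_simps[OF rM] subsetD[OF SM] by simp
 obtain m where m: "rd S {0} m (adj S z)" using finite_adj[OF S G] by blast
 obtain d where d: "rd S {0} d M" using dm_exists_between[OF m sub_zero sM _ MS] sub_0[OF sM] by blast
 have inv: "inverse u : M" if u: "u : M" "u ~= 0" for u
 proof -
  have "rd S ((*) u ` {0}) d ((*) u ` M)"
   by (rule rdim_image_inj[OF d]) (use u in \<open>simp_all add: inj_def distrib_left mult.left_commute\<close>)
  hence d2: "rd S {0} d ((*) u ` M)" by simp
  have "(*) u ` M <= M" using sring_mult[OF rM u(1)] by blast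
  then obtain i j where ij: "i + j = d" "rd S {0} i ((*) u ` M)" "rd S ((*) u ` M) j M"
   using dm_split[OF d sub_zero dm_sub[OF d2 sub_zero] dm_sup[OF d2]] by blast
  hence "j = 0" using dm_unique[OF d2 ij(2) sub_zero] by simp
  hence "M = (*) u ` M" using ij(3) by (blast elim: rdim.cases)
  then obtain w where "1 = u * w" "w : M" using sring_1[OF rM] by blast
  thus ?thesis using inverse_unique[of u w] by simp
 qed
 obtain p q where pq: "y = poly p z / poly q z" "pk S p" "pk S q" using y unfolding adj_def by blast
 have "y : M"
 proof (cases "poly q z = 0")
  case True thus ?thesis using pq sring_0[OF rM] by simp
 next
  case False
  thus ?thesis unfolding pq(1) divide_inverse
   using sring_mult[OF rM _ inv] radjI[OF pq(2), of z] radjI[OF pq(3), of z] unfolding M_def by blast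
 qed
 thus ?thesis unfolding M_def radj_def by blast
qed

definition acl :: "'a::field set => bool" where
 "acl k \<longleftrightarrow> sf k & (ALL p. pk k p --> degree p > 0 --> (EX a:k. poly p a = 0))"

lemma acl_factor: assumes k: "acl k" "pk k p" "degree p > 0"
 shows "EX a:k. EX q. pk k q & p = [:- a, 1:] * q & degree p = Suc (degree q) & (q = 0 \<longleftrightarrow> p = 0)"
proof -
 have s: "sf k" using k(1) by (simp add: acl_def)
 obtain a where a: "a : k" "poly p a = 0" using k unfolding acl_def by blast
 then obtain q where q: "p = [:- a, 1:] * q" using poly_eq_0_iff_dvd by blast
 have q0: "q ~= 0" using k(3) q by auto
 have dg: "degree p = Suc (degree q)" unfolding q using q0 by (subst degree_mult_eq) simp_all
 \<comment> \<open>Synthetic division, from the top coefficient downwards.\<close>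
 have "coeff q i : k" if "i + n = degree q + 1" for i n using that
 proof (induction n arbitrary: i)
  case 0
  thus ?case using sf_0[OF s] by (simp add: coeff_eq_0)
 next
  case (Suc n)
  have IH: "coeff q (Suc i) : k" using Suc.IH[of "Suc i"] Suc.prems by simp
  have "coeff p (Suc i) = coeff q i - a * coeff q (Suc i)" unfolding q by (simp add: algebra_simps)
  hence "coeff q i = coeff p (Suc i) + a * coeff q (Suc i)" by simp
  thus ?case using pkD[OF k(2)] a(1) IH sf_simps[OF s] by metis
 qed
 moreover have "coeff q i : k" if "i > degree q" for i using that sf_0[OF s] by (simp add: coeff_eq_0)
 ultimately have "pk k q" unfolding pk_def by (metis Suc_eq_plus1 le_add_diff_inverse not_less_eq_eq le_Suc_eq linorder_not_less)
 thus ?thesis using a q dg q0 k(3) by (intro bexI[of _ a] exI[of _ q]) auto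
qed

text \<open>A polynomial over \<open>k\<close> splits into linear factors, and the prime set
  \<open>M\<close> must contain the value at \<open>z\<close> of one of them. This is applied with
  \<open>M = {0}\<close> to algebraic elements and with the maximal ideal of a place to
  residues.\<close>

lemma acl_root:
 assumes k: "acl k" and p: "pk k p" "p ~= 0" "poly p z : M" and V: "sring V" "k <= V" "z : V"
  and M: "!!a b. a : V ==> b : V ==> a * b : M ==> a : M | b : M" "!!a. a : k ==> a ~= 0 ==> a ~: M"
 shows "EX a:k. z - a : M"
 using p
proof (induction "degree p" arbitrary: p)
 case 0
 hence "p = [:coeff p 0:]" by (metis degree_0_id)
 hence "poly p z = coeff p 0" "coeff p 0 ~= 0" using 0 by (metis poly_const_conv, metis pCons_0_0)
 thus ?case using M(2)[of "coeff p 0"] pkD[OF 0(2)] 0 by auto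
next
 case (Suc n)
 obtain a q where aq: "a : k" "pk k q" "p = [:- a, 1:] * q" "degree p = Suc (degree q)" "q = 0 \<longleftrightarrow> p = 0"
  using acl_factor[OF k Suc(3)] Suc(2) by auto
 have "z - a : V" using sring_diff[OF V(1,3)] aq(1) V(2) by blast
 moreover have "poly q z : V" using sring_poly[OF V(1) pk_mono[OF aq(2) V(2)] V(3)] .
 moreover have "poly p z = (z - a) * poly q z" unfolding aq(3) by (simp add: left_diff_distrib)
 hence "(z - a) * poly q z : M" using Suc(5) by metis
 ultimately have "z - a : M | poly q z : M" by (rule M(1))
 thus ?case using aq Suc by auto
qed

lemma acl_full:
 assumes k: "acl k" and z: "z ~: k" shows "transc k z"
 unfolding transc_def
proof (intro allI impI)
 fix p assume p: "pk k p" "poly p z = 0"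
 show "p = 0"
 proof (rule ccontr)
  assume "p ~= 0"
  then obtain a where "a : k" "z - a : {0}"
   using acl_root[OF k p(1) _ _ sring_sf, of z "{0}" UNIV] p(2) by (auto simp: sf_def)
  thus False using z by simp
 qed
qed

context ff
begin

lemma mx_prime: assumes V: "V : Pl" and "a : V" "b : V" "a * b : mx V" shows "a : mx V | b : mx V"
 using unit_mult[OF V, of a b] assms by blast

lemma pdeg_1_iff: assumes V: "V : Pl" shows "pdeg k V = 1 \<longleftrightarrow> (ALL z:V. EX a:k. z - a : mx V)"
proof
 have n1: "1 ~: mx V" using sring_1[OF PlD(1)[OF V]] by (simp add: mx_def)
 note m = ssp_mx[OF V]
 { assume "pdeg k V = 1"
  then obtain v where v: "V = lext (*) k v (mx V)" using rd_1[of "(*)" k "mx V" V] pdeg[OF V] by auto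
  have "1 : lext (*) k v (mx V)" using sring_1[OF PlD(1)[OF V]] v by simp
  then obtain b u where b: "b : k" "u : mx V" "1 = b * v + u" unfolding lext_def by blast
  show "ALL z:V. EX a:k. z - a : mx V"
  proof
   fix z assume "z : V"
   hence "z : lext (*) k v (mx V)" using v by simp
   then obtain d w where d: "d : k" "w : mx V" "z = d * v + w" unfolding lext_def by blast
   have "b ~= 0" using b n1 by auto
   have "d / b * (b * v + u) = d * v + d / b * u" using \<open>b ~= 0\<close> by (simp add: distrib_left)
   hence "d / b = d * v + d / b * u" by (simp only: b(3)[symmetric] mult_1_right)
   moreover have "z - x = w - y" if "x = d * v + y" for x y using that d(3) by simp
   ultimately have e: "z - d / b = w - d / b * u" by blast
   have "d / b : k" using sf_divide[OF k d(1) b(1)] .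
   thus "EX a:k. z - a : mx V" using sub_diff[OF m d(2) sub_scale[OF m _ b(2)]] by (intro bexI[of _ "d / b"]) (simp_all only: e)
  qed }
 assume "ALL z:V. EX a:k. z - a : mx V"
 hence "V <= lext (*) k 1 (mx V)" using extI[of _ _ "mx V" 1] by (metis diff_add_cancel add.commute mult.right_neutral subsetI)
 moreover have "lext (*) k 1 (mx V) <= V" by (rule ext_le[OF ssp_V[OF V]]) (use mxD sring_1[OF PlD(1)[OF V]] in blast)+
 moreover have "rd k (mx V) (Suc 0) (lext (*) k 1 (mx V))" by (rule rdim.rS[OF rdim.rZ n1])
 ultimately have "rd k (mx V) 1 V" by (metis One_nat_def subset_antisym)
 thus "pdeg k V = 1" using dm_unique[OF pdeg[OF V] _ m] by simp
qed

text \<open>The residue field is finite over \<open>k\<close>, so each residue is algebraic over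
  \<open>k\<close> and hence comes from \<open>k\<close>.\<close>

lemma acl_pdeg: assumes a: "acl k" and V: "V : Pl" shows "pdeg k V = 1"
proof -
 have "EX a:k. z - a : mx V" if z: "z : V" for z
 proof -
  obtain c where c: "ALL i<=pdeg k V. c i : k" "EX i<=pdeg k V. c i ~= 0" "(SUM i<=pdeg k V. c i * z ^ i) : mx V"
   using dm_dependent[OF pdeg[OF V] ssp_mx[OF V], of "%i. z ^ i"] sring_power[OF PlD(1)[OF V] z] by blast
  let ?p = "SUM i<=pdeg k V. monom (c i) i"
  have "pk k ?p" using c(1) by (intro pk_sum[OF k] pk_monom[OF k]) simp
  moreover have cf: "coeff ?p j = (if j <= pdeg k V then c j else 0)" for j by (simp add: coeff_sum coeff_monom)
  have "?p ~= 0" using c(2) cf by (metis coeff_0)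
  moreover have "poly ?p z : mx V" using c(3) by (simp add: poly_sum poly_monom)
  ultimately show ?thesis
   by (rule acl_root[OF a _ _ _ PlD(1)[OF V] PlD(2)[OF V] z]) (use mx_prime[OF V] mx_k[OF V] in blast)+
 qed
 thus ?thesis using pdeg_1_iff[OF V] by blast
qed

end

locale ffext = F: ff k S + E: ff k E for k S E :: "'a::field set" +
 assumes SE: "S <= E"
begin

text \<open>If \<open>S\<close> were inside \<open>W\<close>, its nonzero elements would be units of
  \<open>W\<close>. Arbitrarily many powers of a transcendental element would then stay independent
  in the residue field, whose dimension is the finite \<open>pdeg k W\<close>.\<close>

lemma place_below: assumes W: "W : places k E" shows "W Int S : places k S"
proof -
 have "~ S <= W"
 proof
  assume SW: "S <= W"
  obtain x where x: "x : S" "transc k x" using F.fin by blast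
  define n where "n = Suc (pdeg k W)"
  have P: "rd k {0} n (plt k x n)" by (rule rd_plt_transc[OF F.k x(2)])
  have PS: "plt k x n <= S" unfolding plt_def using poly_in[OF F.S pk_mono[OF _ F.kS] x(1)] by blast
  have "u = 0" if "u : S" "u : mx W" for u
   using that SW sf_inv[OF F.S that(1)] unfolding mx_def by blast
  hence "mx W Int plt k x n = {0}" using PS E.mx_0[OF W] F.sub_0[OF ssp_plt[OF F.k]] by blast
  from F.dm_splus[OF P E.ssp_mx[OF W] this] have d: "rd k (mx W) n (F.splus (mx W) (plt k x n))" .
  have "F.splus (mx W) (plt k x n) <= W"
   unfolding F.splus_def using PS SW E.mxD[of _ W] sring_add[OF E.PlD(1)[OF W]] by blast
  from F.dm_mono[OF E.pdeg[OF W] d this E.ssp_mx[OF W]] show False unfolding n_def by simp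
 qed
 moreover have "sring (W Int S)" using sring_simps[OF E.PlD(1)[OF W]] sf_simps[OF F.S] by (simp add: sring_def)
 moreover have "z : W Int S | inverse z : W Int S" if "z : S" for z
  using E.PlD(5)[OF W, of z] that SE sf_inv[OF F.S that] by blast
 moreover have "k <= W Int S" using E.PlD(2)[OF W] F.kS by blast
 ultimately show ?thesis unfolding places_def by blast
qed

text \<open>The ramification index of \<open>W\<close> over the place \<open>W Int S\<close> below
  it.\<close>

definition ram :: "'a set => int" where
 "ram W = val W (unif (W Int S))"

lemma ram_pos: assumes W: "W : places k E" shows "ram W > 0"
proof -
 have V: "W Int S : places k S" using place_below[OF W] .
 let ?t = "unif (W Int S)"
 have t: "?t : W Int S" "inverse ?t ~: W Int S" "?t ~= 0" "?t : S" using F.unif[OF V] unfolding mx_def by auto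
 have "inverse ?t ~: W" using t(2) sf_inv[OF F.S t(4)] by blast
 hence "?t : mx W" unfolding mx_def using t by blast
 thus ?thesis unfolding ram_def using E.val_gt_0[OF W _ t(3)] t(4) SE by blast
qed

lemma val_ram: assumes W: "W : places k E" and z: "z : S" "z ~= 0" shows "val W z = ram W * val (W Int S) z"
proof -
 have V: "W Int S : places k S" using place_below[OF W] .
 let ?t = "unif (W Int S)" let ?n = "val (W Int S) z"
 obtain u where u: "u : (W Int S) - mx (W Int S)" "z = ?t powi ?n * u" using F.val[OF V z] by blast
 have u': "u ~= 0" "inverse u : W" using F.unit_inverse[OF V u(1)] by auto
 hence "u : W - mx W" using u(1) unfolding mx_def by auto
 hence vu: "val W u = 0" using E.val_unit[OF W] by blast
 have t: "?t : E" "?t ~= 0" "?t powi ?n : E" "?t powi ?n ~= 0" using F.unif(3,4)[OF V] SE E.powi_S by auto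
 have vp: "val W (?t powi n) = n * ram W" for n :: int
 proof (cases "n >= 0")
  case True
  thus ?thesis using E.val_power[OF W t(1,2), of "nat n"] by (simp add: power_int_def ram_def)
 next
  case False
  thus ?thesis using E.val_power[OF W sf_inv[OF E.S t(1)], of "nat (- n)"] E.val_inverse[OF W t(1,2)] t(2)
   by (simp add: power_int_def ram_def)
 qed
 have uE: "u : E" using u(1) SE by blast
 have "val W (?t powi ?n * u) = val W (?t powi ?n) + val W u" using E.val_mult[OF W t(3,4) uE u'(1)] .
 thus ?thesis using u(2) vp vu by (metis add_0_right mult.commute)
qed

lemma Id_ram: assumes W: "W : places k E" and z: "z : F.Id (W Int S) n" shows "z : E.Id W (ram W * n)"
proof (cases "z = 0")
 case True thus ?thesis using F.sub_0[OF E.ssp_Id[OF W]] by simp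
next
 case False
 hence zS: "z : S" "n <= val (W Int S) z" using z by (auto simp: F.Id_iff)
 hence "ram W * n <= val W z" using val_ram[OF W zS(1) False] ram_pos[OF W] by (simp add: mult_left_mono)
 thus ?thesis using zS SE by (auto simp: E.Id_iff)
qed

lemma pol_ram: assumes W: "W : places k E" and z: "z : S" "z ~= 0" shows "E.pol z W = ram W * F.pol z (W Int S)"
 using val_ram[OF W z] ram_pos[OF W] place_below[OF W] W unfolding E.pol_def F.pol_def
 by (simp add: max_def zero_le_mult_iff mult_le_0_iff)

end

lemma acl_ff_adj:
 assumes F: "ff k S" and a: "acl k" and G: "pk S G" "G ~= 0" "poly G z = 0" shows "ff k (adj S z)"
proof -
 interpret F: ff k S by (rule F)
 have E: "sf (adj S z)" "S <= adj S z" using sf_adj[OF F.S] adj_sup[OF F.S] by auto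
 obtain x n where x: "x : S" "transc k x" "rd (adj k x) {0} n S" using F.fin unfolding ffin_def by blast
 obtain d where d: "rd S {0} d (adj S z)" using finite_adj[OF F.S G] by blast
 have "rd (adj k x) {0} (n * d) (adj S z)"
  by (rule rd_tower[OF sf_adj[OF F.k] F.S x(3) d klin.sub_zero[OF klin_mult[OF F.S]] adj_le[OF F.S F.kS x(1)]])
 thus ?thesis
  using E F.kS F.k x acl_full[OF a] unfolding ff_def ffin_def by blast
qed

section \<open>Stable defect and strong approximation away from the poles of a function\<close>

context ff
begin

lemma Id_power: assumes V: "V : Pl" and z: "z : Id V n" shows "z ^ i : Id V (int i * n)"
proof (induction i)
 case 0 thus ?case using Id_0[OF V] sring_1[OF PlD(1)[OF V]] by simp
next
 case (Suc i)
 have "z * z ^ i : Id V (n + int i * n)" using Id_mult[OF V z Suc] .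
 thus ?case by (simp add: algebra_simps)
qed

text \<open>The defects of the multiples of \<open>pol c\<close> are bounded by Riemann's
  inequality, so a largest one is attained at some \<open>r0\<close>. For divisors above
  \<open>r0 * pol c\<close> it is a lower bound by monotonicity and an upper bound by
  \<open>riemann_reduction\<close>.\<close>

lemma ll_stable:
 assumes c: "c : S" "c ~: k"
 shows "EX r0 g. ALL A. isdiv A --> (ALL V. int r0 * pol c V <= A V) --> dg A - ll A = g"
proof -
 have c0: "c ~= 0" using c sf_0[OF k] by blast
 define R where "R = (%r::nat. (%V. int r * pol c V))"
 have R: "isdiv (R r)" "dg (R r) = int r * int (fdeg (adj k c) S)" for r
  unfolding R_def using isdiv_scale[OF isdiv_pol[OF c(1) c0]] dg_scale[OF isdiv_pol[OF c(1) c0]] dg_pol[OF c] by simp_all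
 define h where "h = (%r. dg (R r) - ll (R r))"
 obtain g where g: "!!A. isdiv A ==> dg A - ll A <= g" using riemann by blast
 have mono: "h 0 <= h r" for r
 proof -
  have "ll (R r) - ll (R 0) <= dg (R r) - dg (R 0)"
   by (rule ll_chain(2)[OF R(1) R(1)]) (simp add: R_def pol_nonneg)
  thus ?thesis unfolding h_def by simp
 qed
 define H where "H = (%r. nat (h r - h 0))"
 have "ALL r. True --> H r < Suc (nat (g - h 0))"
 proof (intro allI impI)
  fix r have "h r <= g" unfolding h_def using g[OF R(1)] .
  thus "H r < Suc (nat (g - h 0))" unfolding H_def by simp
 qed
 then obtain r0 where r0: "!!r. H r <= H r0" using ex_has_greatest_nat[of "%_. True" 0 H "Suc (nat (g - h 0))"] by force
 have hr: "h r <= h r0" for r using r0[of r] mono[of r] mono[of r0] unfolding H_def by simp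
 have "dg A - ll A = h r0" if A: "isdiv A" "ALL V. int r0 * pol c V <= A V" for A
 proof (rule antisym)
  show "dg A - ll A <= h r0"
   by (rule riemann_reduction[OF c _ A(1)]) (use hr R(2) in \<open>simp add: h_def R_def\<close>)
  have "ll A - ll (R r0) <= dg A - dg (R r0)" by (rule ll_chain(2)[OF R(1) A(1)]) (use A(2) in \<open>simp add: R_def\<close>)
  thus "h r0 <= dg A - ll A" unfolding h_def by simp
 qed
 thus ?thesis by blast
qed

text \<open>Strong approximation away from the poles of \<^term>\<open>c\<close>: once \<^term>\<open>dg A - ll A\<close> has become constant, every admissible
 principal part at a single place is realised by a global element.\<close>

lemma strong_approx:
 assumes a: "acl k" and c: "c : S" "c ~: k"
 shows "EX r0. ALL r>=r0. ALL tau. (ALL V. tau V : S) --> (EX f:S. (ALL V:Pl. val V c < 0 --> f - tau V : Id V (- (int r * pol c V)))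
   & (ALL V:Pl. ~ val V c < 0 --> f : V))"
proof -
 have c0: "c ~= 0" using c sf_0[OF k] by blast
 obtain r0 g where st: "!!A. isdiv A ==> (ALL V. int r0 * pol c V <= A V) ==> dg A - ll A = g" using ll_stable[OF c] by blast
 \<comment> \<open>Equal defects force \<open>ll\<close> to grow by one with the degree, so some
   function has pole order exactly \<open>A V + 1\<close> at \<open>V\<close>. The quotient of the
   two fractional ideals being one-dimensional, a multiple of that function matches
   \<open>u\<close>.\<close>
 have step: "EX w:LL (A(V := A V + 1)). u - w : Id V (- A V)"
  if A: "isdiv A" "ALL V. int r0 * pol c V <= A V" and V: "V : Pl" and u: "u : Id V (- A V - 1)" for A V u
 proof -
  let ?A = "A(V := A V + 1)"
  have A': "isdiv ?A" using isdiv_upd[OF A(1) V] .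
  have "int r0 * pol c W <= ?A W" for W using A(2)[rule_format, of W] by (cases "W = V") simp_all
  hence "dg ?A - ll ?A = dg A - ll A" using st[OF A] st[OF A'] by simp
  moreover have "dg ?A = dg A + 1" using dg_upd[OF A(1) V, of 1] acl_pdeg[OF a V] by simp
  ultimately have "LL ?A ~= LL A" unfolding ll_def by auto
  moreover have "LL A <= LL ?A" by (rule LL_mono) simp
  ultimately obtain w where w: "w : LL ?A" "w ~: LL A" by blast
  have w1: "w : Id V (- A V - 1)" using w(1) V unfolding LL_iff by (metis add.commute fun_upd_same minus_add_distrib uminus_add_conv_diff diff_conv_add_uminus)
  have w2: "w ~: Id V (- A V)"
  proof
   assume h: "w : Id V (- A V)"
   have "w : Id W (- A W)" if "W : Pl" for W
   proof (cases "W = V")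
   case False thus ?thesis using w(1) that unfolding LL_iff by (metis fun_upd_other)
   qed (use h in simp)
   thus False using w LL_S unfolding LL_iff by blast
  qed
  have "rd k (Id V (- A V)) (Suc 0) (Id V (- A V - 1))" using Id_step[OF V, of "- A V - 1"] acl_pdeg[OF a V] by simp
  then obtain v where v: "Id V (- A V - 1) = lext (*) k v (Id V (- A V))" using rd_1 by blast
  have "lext (*) k w (Id V (- A V)) = lext (*) k v (Id V (- A V))"
   by (rule ext_exchange(1)[OF ssp_Id[OF V]]) (use w1 w2 v in auto)
  hence "u : lext (*) k w (Id V (- A V))" using u v by simp
  then obtain b u' where b: "u = b * w + u'" "b : k" "u' : Id V (- A V)" unfolding lext_def by blast
  thus ?thesis using sub_scale[OF ssp_LL b(2) w(1)] by (intro bexI[of _ "b * w"]) simp_all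
 qed
 define T where "T = {V : Pl. val V c < 0}"
 have polT: "pol c V = 0" if "V ~: T" for V using that unfolding T_def pol_def by auto
 have T: "finite T"
 proof -
  have "T <= {V. pol c V ~= 0}" unfolding T_def pol_def by auto
  thus ?thesis using isdivD(2)[OF isdiv_pol[OF c(1) c0]] finite_subset by blast
 qed
 \<comment> \<open>Induction on the total excess \<open>N\<close> of the pole orders of
   \<open>tau\<close> over \<open>r * pol c\<close>; each round removes one order at one
   place.\<close>
 have main: "EX f:S. (ALL V:T. f - tau V : Id V (- (int r * pol c V))) & (ALL V:Pl - T. f : V)"
  if r: "r >= r0" and "N = (SUM V:T. m V)" "ALL V:T. tau V : Id V (- (int r * pol c V) - int (m V))" for r N m tau
  using that(2,3)
 proof (induction N arbitrary: m tau)
  case 0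
  hence "ALL V:T. m V = 0" using T by simp
  hence "ALL V:T. 0 - tau V : Id V (- (int r * pol c V))" using 0(2) sub_uminus[OF ssp_Id] unfolding T_def by auto
  thus ?case using sf_0[OF S] sring_0[OF PlD(1)] by (intro bexI[of _ 0]) auto
 next
  case (Suc N)
  then obtain V where V: "V : T" "m V > 0" by (metis Zero_not_Suc gr0I sum.neutral)
  hence VP: "V : Pl" unfolding T_def by blast
  define m' where "m' = m(V := m V - 1)"
  define A where "A = (%W. int r * pol c W + (if W : T then int (m' W) else 0))"
  have A: "isdiv A" unfolding A_def
   by (rule isdiv_add[OF isdiv_scale[OF isdiv_pol[OF c(1) c0]]]) (rule isdivI[OF T], auto simp: T_def)
  have A2: "ALL W. int r0 * pol c W <= A W"
  proof
   fix W have "int r0 * pol c W <= int r * pol c W" using r pol_nonneg by (intro mult_right_mono) simp_all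
   thus "int r0 * pol c W <= A W" unfolding A_def by simp
  qed
  have AV: "A V = int r * pol c V + int (m V) - 1" unfolding A_def m'_def using V by simp
  have "- A V - 1 = - (int r * pol c V) - int (m V)" unfolding AV by simp
  hence "tau V : Id V (- A V - 1)" using Suc.prems(2) V(1) by metis
  from step[OF A A2 VP this] obtain w where w: "w : LL (A(V := A V + 1))" "tau V - w : Id V (- A V)" by blast
  have wI: "w : Id W (- (A(V := A V + 1)) W)" if "W : Pl" for W using w(1) that unfolding LL_iff by blast
  have wS: "w : S" using w(1) LL_S by blast
  have "ALL W:T. tau W - w : Id W (- (int r * pol c W) - int (m' W))"
  proof
   fix W assume W: "W : T"
   hence WP: "W : Pl" unfolding T_def by blast
   have e: "- (int r * pol c W) - int (m' W) = - A W" using W unfolding A_def by simp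
   show "tau W - w : Id W (- (int r * pol c W) - int (m' W))"
   proof (cases "W = V")
   case True thus ?thesis unfolding e using w(2) by simp
   next
   case False
   have "w : Id W (- A W)" using wI[OF WP] False by simp
   moreover have "tau W : Id W (- A W)" using Suc.prems(2) W False unfolding e[symmetric] m'_def by simp
   ultimately show ?thesis unfolding e using sub_diff[OF ssp_Id[OF WP]] by blast
   qed
  qed
  moreover have "N = (SUM V:T. m' V)"
   using Suc.prems(1) V sum.remove[OF T V(1), of m] sum.remove[OF T V(1), of m'] unfolding m'_def by simp
  ultimately obtain f where f: "f : S" "ALL W:T. f - (tau W - w) : Id W (- (int r * pol c W))" "ALL V:Pl - T. f : V"
   using Suc.IH[of m' "%W. tau W - w"] by blast
  have "w : W" if W: "W : Pl - T" for W
  proof -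
   have "W ~= V" using W V by blast
   hence "w : Id W (- A W)" using wI[of W] W by simp
   moreover have "A W = 0" unfolding A_def using W polT by simp
   ultimately show ?thesis using Id_0 W by simp
  qed
  hence "ALL V:Pl - T. f + w : V" using f(3) sring_add[OF PlD(1)] by blast
  moreover have "ALL W:T. (f + w) - tau W : Id W (- (int r * pol c W))" using f(2) by (simp add: algebra_simps)
  ultimately show ?case using sf_add[OF S f(1) wS] by blast
 qed
 have "EX f:S. (ALL V:Pl. val V c < 0 --> f - tau V : Id V (- (int r * pol c V))) & (ALL V:Pl. ~ val V c < 0 --> f : V)"
  if r: "r >= r0" and tau: "ALL V. tau V : S" for r tau
 proof -
  define m where "m = (%V. nat (- (int r * pol c V) - val V (tau V)))"
  have "ALL V:T. tau V : Id V (- (int r * pol c V) - int (m V))" unfolding Id_iff m_def using tau by auto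
  from main[OF r refl this] show ?thesis unfolding T_def by blast
 qed
 thus ?thesis by blast
qed

end

section \<open>Interpolation at conjugate roots and the averaged genus bound\<close>

definition PL :: "'a::field set => nat => 'a poly set" where
 "PL S N = {p. pk S p & (ALL j>=N. coeff p j = 0)}"

lemma subsp_PL: "sf S ==> k <= S ==> subsp smult k (PL S N)"
 by (simp add: PL_def subsp_def pk_0 pk_add pk_smult subset_iff)

lemma rd_PL:
 assumes S: "sf S" shows "rdim smult S {0} N (PL S N)"
proof (induction N)
 case 0
 have "PL S 0 = {0}" unfolding PL_def using pk_0[OF S] by (auto intro: poly_eqI)
 thus ?case using rdim.rZ[of smult S "{0}"] by simp
next
 case (Suc N)
 interpret klin smult S by (rule klin_smult[OF S])
 have "PL S (Suc N) = lext smult S (monom 1 N) (PL S N)"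
 proof
  show "PL S (Suc N) <= lext smult S (monom 1 N) (PL S N)"
  proof
   fix p assume p: "p : PL S (Suc N)"
   have "coeff (p - monom (coeff p N) N) j = 0" if "j >= N" for j
   using p that unfolding PL_def by (cases "j = N") simp_all
   moreover have "pk S (p - monom (coeff p N) N)"
   using p pk_diff[OF S _ pk_monom[OF S pkD]] unfolding PL_def by blast
   ultimately have "p - monom (coeff p N) N : PL S N" unfolding PL_def by blast
   moreover have "coeff p N : S" using p pkD unfolding PL_def by blast
   moreover have "p = smult (coeff p N) (monom 1 N) + (p - monom (coeff p N) N)" by (simp add: smult_monom)
   ultimately show "p : lext smult S (monom 1 N) (PL S N)" unfolding lext_def by blast
  qed
  show "lext smult S (monom 1 N) (PL S N) <= PL S (Suc N)"
   by (rule ext_le[OF subsp_PL[OF S order_refl]])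
   (auto simp: PL_def pk_monom[OF S sf_1[OF S]])
 qed
 moreover have "monom 1 N ~: PL S N" unfolding PL_def by auto
 ultimately show ?case using rdim.rS[OF Suc] by metis
qed

text \<open>Evaluation of polynomials over \<^term>\<open>S\<close> at the roots of \<^term>\<open>PROD z:Z. [:- z, 1:]\<close>. The set \<^term>\<open>R\<close> picks one root
 from each conjugacy class, so that the degrees of the corresponding extensions add up to \<^term>\<open>card Z\<close>.\<close>

definition KR :: "'a::field set => 'a set => 'a poly set" where
 "KR S R = {p. pk S p & (ALL z:R. poly p z = 0)}"

lemma subsp_KR: "sf S ==> k <= S ==> subsp smult k (KR S R)"
 by (simp add: KR_def subsp_def pk_0 pk_add pk_smult subset_iff)

lemma PL_roots: assumes "p : PL S (card Z)" "finite Z" "!!z. z : Z ==> poly p z = 0" shows "p = 0"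
proof (rule ccontr)
 assume p: "p ~= 0"
 have "Z <= {z. poly p z = 0}" using assms(3) by blast
 hence "card Z <= card {z. poly p z = 0}" by (intro card_mono poly_roots_finite p)
 also have "... <= degree p" by (rule card_poly_roots_bound[OF p])
 finally have "coeff p (degree p) = 0" using assms(1) unfolding PL_def by blast
 thus False using p by simp
qed

text \<open>Chinese remainders without factoring the polynomial: \<open>R\<close> is a largest set
  of roots at which the evaluations are jointly onto. A polynomial vanishing on \<open>R\<close> but
  not at a further root \<open>z\<close> would have multiples taking every value of
  \<open>adj S z\<close> there, so \<open>z\<close> could be added. Hence vanishing on
  \<open>R\<close> means vanishing on \<open>Z\<close>, and both counts equal
  \<open>card Z\<close>.\<close>

lemma representatives:
 assumes S: "sf S" and Z: "finite Z" and G: "pk S (PROD z:Z. [:- z, 1:])"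
 shows "EX R<=Z. KR S R = KR S Z & (SUM z:R. fdeg S (adj S z)) = card Z"
proof -
 interpret P: klin smult S by (rule klin_smult[OF S])
 let ?G = "PROD z:Z. [:- z, 1:]"
 have dG: "degree ?G = card Z" "lead_coeff ?G = 1"
  by (subst degree_prod_eq_sum_degree) (simp_all add: lead_coeff_prod)
 have G0: "?G ~= 0" using Z by simp
 have rG: "poly ?G z = 0 \<longleftrightarrow> z : Z" for z using Z by (simp add: poly_prod)
 have D: "rd S {0} (fdeg S (adj S z)) (adj S z)" if "z : Z" for z
  using ffin_rd[OF S] finite_adj[OF S G G0] rG[of z] that unfolding ffin_def by blast
 define good where "good = (%R. R <= Z & rdim smult S (KR S R) (SUM z:R. fdeg S (adj S z)) (KR S {}))"
 have "good {}" unfolding good_def using rdim.rZ[of smult S "KR S {}"] by simp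
 moreover have "ALL R. good R --> card R < Suc (card Z)" unfolding good_def using card_mono[OF Z] by (simp add: less_Suc_eq_le)
 ultimately obtain R where R: "good R" "!!R'. good R' ==> card R' <= card R" using ex_has_greatest_nat[of good "{}" card] by blast
 have RZ: "R <= Z" "finite R" using R(1) Z finite_subset unfolding good_def by auto
 have "KR S R <= KR S Z"
 proof
  fix p assume p: "p : KR S R"
  show "p : KR S Z"
  proof (rule ccontr)
   assume "p ~: KR S Z"
   then obtain z where z: "z : Z" "poly p z ~= 0" using p unfolding KR_def by blast
   hence zR: "z ~: R" using p unfolding KR_def by blast
   have pS: "pk S p" using p unfolding KR_def by blast
   have onto: "adj S z <= (%p. poly p z) ` KR S R"
   proof
   fix y assume y: "y : adj S z"
   have "y / poly p z : adj S z" using sf_divide[OF sf_adj[OF S] y adj_poly[OF S pS]] .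
   then obtain g where g: "pk S g" "y / poly p z = poly g z" using adj_algebraic[OF S G G0] rG[of z] z(1) by blast
   have "p * g : KR S R" using p pk_mult[OF S pS g(1)] unfolding KR_def by simp
   moreover have "y = poly (p * g) z" using g(2) z(2) by (simp add: field_simps)
   ultimately show "y : (%p. poly p z) ` KR S R" by blast
   qed
   have "rdim smult S {f : KR S R. poly f z = 0} (fdeg S (adj S z)) {f : KR S R. poly f z : adj S z}"
   by (rule P.dm_preimage[OF D[OF z(1)] klin_mult[OF S] subsp_KR[OF S order_refl] _ _ onto]) simp_all
   moreover have "{f : KR S R. poly f z = 0} = KR S (insert z R)" unfolding KR_def by blast
   moreover have "{f : KR S R. poly f z : adj S z} = KR S R" unfolding KR_def using adj_poly[OF S] by blast
   ultimately have "rdim smult S (KR S (insert z R)) (fdeg S (adj S z)) (KR S R)" by simp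
   from P.dm_trans[OF _ this] have "good (insert z R)" using R(1) z(1) zR RZ(2) unfolding good_def by simp
   from R(2)[OF this] show False using zR RZ(2) by simp
  qed
 qed
 hence KK: "KR S R = KR S Z" using RZ(1) unfolding KR_def by blast
 have inter: "KR S Z Int PL S (card Z) = {0}"
  using PL_roots[of _ S Z] Z P.sub_0[OF subsp_KR[OF S order_refl, of Z]] P.sub_0[OF subsp_PL[OF S order_refl, of "card Z"]]
  unfolding KR_def by blast
 have "rdim smult S (KR S Z) (card Z) (P.splus (KR S Z) (PL S (card Z)))"
  by (rule P.dm_splus[OF rd_PL[OF S] subsp_KR[OF S order_refl] inter])
 moreover have "P.splus (KR S Z) (PL S (card Z)) = KR S {}"
 proof
  show "P.splus (KR S Z) (PL S (card Z)) <= KR S {}" unfolding P.splus_def KR_def PL_def using pk_add[OF S] by blast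
  show "KR S {} <= P.splus (KR S Z) (PL S (card Z))"
  proof
   fix p assume "p : KR S {}"
   hence p: "pk S p" unfolding KR_def by blast
   obtain h where h: "pk S h" "ALL j>=degree ?G. coeff h j = 0" "ALL x. poly ?G x = 0 --> poly h x = poly p x"
   using poly_reduce[OF S G G0 p] by (elim exE conjE)
   have "p - h : KR S Z" unfolding KR_def using h(3) rG pk_diff[OF S p h(1)] by simp
   moreover have "h : PL S (card Z)" unfolding PL_def using h(1,2) dG(1) by simp
   moreover have "p = (p - h) + h" by simp
   ultimately show "p : P.splus (KR S Z) (PL S (card Z))" unfolding P.splus_def by blast
  qed
 qed
 ultimately have "rdim smult S (KR S Z) (card Z) (KR S {})" by simp
 hence "(SUM z:R. fdeg S (adj S z)) = card Z"
  using P.dm_unique[OF _ _ subsp_KR[OF S order_refl]] R(1) KK unfolding good_def by metis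
 thus ?thesis using RZ(1) KK by blast
qed

text \<open>Consider polynomials of degree below \<open>Q\<close> over \<open>S\<close> whose values
  at all roots lie in the space of \<open>r * pol c\<close>. Evaluation at representatives of the
  classes is injective on them, so their dimension is at most the sum of the \<open>ll\<close>
  upstairs. From below, the coefficient in degree \<open>d\<close> may be any function in the space
  of \<open>r * pol c - kap d\<close>: multiplied by the first \<open>d\<close> factors
  \<open>X - nu\<close> it has values with admissible poles, and strong approximation makes the
  lower coefficients global. Comparing both counts, some root has a defect not above the
  mean.\<close>

theorem (in ff) genus_step:
 fixes Z :: "'a set" and nu :: "'a set => nat => 'a" and kap :: "'a set => nat => int" and gam :: real
 assumes a: "acl k" and c: "c : S" "c ~: k"
  and Z: "finite Z" "Z ~= {}" and G: "pk S (PROD z:Z. [:- z, 1:])"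
  and integral: "!!z W. z : Z ==> W : places k (adj S z) ==> ~ val W c < 0 ==> z : W"
  and pole: "!!z W. z : Z ==> W : places k (adj S z) ==> val W c < 0 ==> z = 0 | val W c <= val W z"
  and nu: "!!V t. nu V t : S"
  and centers: "!!z W d. z : Z ==> W : places k (adj S z) ==> val W c < 0 ==> d < card Z ==>
   (PROD t<d. z - nu (W Int S) t) = 0 | - (val W (unif (W Int S)) * kap (W Int S) d) <= val W (PROD t<d. z - nu (W Int S) t)"
  and gam: "!!A. isdiv A ==> ri (dg A - ll A) <= gam"
 shows "EX z:Z. ff k (adj S z) & fdeg (adj k c) (adj S z) = fdeg (adj k c) S * fdeg S (adj S z) &
  (ALL A. ff.isdiv k (adj S z) A --> ri (ff.dg k A - ff.ll k (adj S z) A) <= real (fdeg S (adj S z)) *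
   (gam + (SUM V | V : Pl & val V c < 0. SUM d<card Z. ri (kap V d)) / real (card Z)))"
proof -
 have c0: "c ~= 0" using c sf_0[OF k] by blast
 interpret P: klin smult k by (rule klin_smult[OF k])
 let ?G = "PROD z:Z. [:- z, 1:]"
 define Q where "Q = card Z"
 define n where "n = fdeg (adj k c) S"
 define D where "D = (%z. fdeg S (adj S z))"
 define L where "L = (%z r. ff.LL k (adj S z) (%W. int r * ff.pol k (adj S z) c W))"
 define l where "l = (%z r. ff.ll k (adj S z) (%W. int r * ff.pol k (adj S z) c W))"
 have G0: "?G ~= 0" using Z by simp
 have rG: "poly ?G z = 0" if "z : Z" for z using Z that by (simp add: poly_prod)
 have E: "ff k (adj S z)" if "z : Z" for z using acl_ff_adj[OF ff_axioms a G G0 rG[OF that]] .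
 have cE: "c : adj S z" for z using adj_sup[OF S] c(1) by blast
 have X: "ffext k S (adj S z)" if "z : Z" for z
  unfolding ffext_def ffext_axioms_def using ff_axioms E[OF that] adj_sup[OF S] by blast
 have Drd: "rd S {0} (D z) (adj S z)" if "z : Z" for z
  using ffin_rd[OF S] finite_adj[OF S G G0 rG[OF that]] unfolding ffin_def D_def by blast
 have nrd: "rd (adj k c) {0} n S" unfolding n_def using ffin_rd[OF sf_adj[OF k] ffin_adj[OF c]] .
 have nD: "fdeg (adj k c) (adj S z) = n * D z" if "z : Z" for z
  by (rule fdeg_eq[OF sf_adj[OF k] rd_tower[OF sf_adj[OF k] S nrd Drd[OF that] klin.sub_zero[OF klin_mult[OF S]] adj_le[OF S kS c(1)]]])
 obtain R where R: "R <= Z" "KR S R = KR S Z" "(SUM z:R. D z) = Q"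
  using representatives[OF S Z(1) G] unfolding D_def Q_def by blast
 have fR: "finite R" using R(1) Z(1) finite_subset by blast
 define Tc where "Tc = {V : Pl. val V c < 0}"
 have Tc: "finite Tc"
 proof -
  have "Tc <= {V. pol c V ~= 0}" unfolding Tc_def pol_def by auto
  thus ?thesis using isdivD(2)[OF isdiv_pol[OF c(1) c0]] finite_subset by blast
 qed
 define kap' where "kap' = (%d V. if V : Tc then kap V d else 0)"
 define tau where "tau = (SUM V:Tc. SUM d<Q. kap V d)"
 have kdiv: "isdiv (kap' d)" "dg (kap' d) = (SUM V:Tc. kap V d)" for d
 proof -
  show "isdiv (kap' d)" by (rule isdivI[OF Tc]) (auto simp: kap'_def Tc_def)
  have "{V. kap' d V ~= 0} <= Tc" unfolding kap'_def by auto
  hence "dg (kap' d) = (SUM V:Tc. kap' d V * int (pdeg k V))" by (rule dg_superset[OF Tc])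
  also have "... = (SUM V:Tc. kap V d)" by (rule sum.cong) (auto simp: kap'_def Tc_def acl_pdeg[OF a])
  finally show "dg (kap' d) = (SUM V:Tc. kap V d)" .
 qed
 define A where "A = (%r d V. int r * pol c V - kap' d V)"
 have Adiv: "isdiv (A r d)" "dg (A r d) = int r * int n - (SUM V:Tc. kap V d)" for r d
  unfolding A_def n_def using isdiv_diff[OF isdiv_scale[OF isdiv_pol[OF c(1) c0]] kdiv(1)]
   dg_diff[OF isdiv_scale[OF isdiv_pol[OF c(1) c0]] kdiv(1)] dg_scale[OF isdiv_pol[OF c(1) c0]] dg_pol[OF c] kdiv(2) by simp_all
 obtain r0 where r0: "!!r tau. r >= r0 ==> (ALL V. tau V : S) ==> EX f:S. (ALL V:Pl. val V c < 0 --> f - tau V : Id V (- (int r * pol c V)))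
   & (ALL V:Pl. ~ val V c < 0 --> f : V)" using strong_approx[OF a c] by blast
 define I where "I = (%r. {f : PL S Q. ALL z:Z. poly f z : L z r})"
 have sL: "ssp k (L z r)" if "z : Z" for z r unfolding L_def using ff.ssp_LL[OF E[OF that]] .
 have sI: "subsp smult k (I r)" for r
  unfolding subsp_def
 proof (intro conjI ballI)
  note pl = subsp_PL[OF S kS, of Q]
  show "0 : I r" unfolding I_def using P.sub_0[OF pl] sub_0[OF sL] by simp
  fix f g assume "f : I r" "g : I r"
  thus "f + g : I r" unfolding I_def using P.sub_add[OF pl] sub_add[OF sL] by simp
 next
  note pl = subsp_PL[OF S kS, of Q]
  fix b f assume "b : k" "f : I r"
  thus "smult b f : I r" unfolding I_def using P.sub_scale[OF pl] sub_scale[OF sL] by simp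
 qed
 define J where "J = (%r R. {f : I r. ALL z:R. poly f z = 0})"
 have sJ: "subsp smult k (J r R')" for r R'
 proof -
  have "subsp smult k (I r Int KR S R')" by (rule P.sub_Int[OF sI subsp_KR[OF S kS]])
  moreover have "I r Int KR S R' = J r R'" unfolding I_def KR_def J_def PL_def by blast
  ultimately show ?thesis by simp
 qed
 \<comment> \<open>One representative at a time: the image of the evaluation at \<open>z\<close>
   lies in a space of dimension \<open>l z r\<close>.\<close>
 have upper: "EX m. int m <= (SUM z:R'. l z r) & rdim smult k (J r R') m (I r)" if "finite R'" "R' <= Z" for r R'
  using that
 proof (induction R' rule: finite_induct)
  case empty
  have "J r {} = I r" unfolding J_def by simp
  thus ?case using rdim.rZ[of smult k "I r"] by (intro exI[of _ 0]) simp
 next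
  case (insert z R')
  then obtain m where m: "int m <= (SUM z:R'. l z r)" "rdim smult k (J r R') m (I r)" by auto
  have z: "z : Z" using insert by blast
  interpret E: ff k "adj S z" by (rule E[OF z])
  let ?M = "(%f. poly f z) ` J r R'"
  have MLz: "?M <= L z r" unfolding J_def I_def using z by blast
  have sM: "ssp k ?M"
   unfolding subsp_def
  proof (intro conjI ballI)
   show "0 : ?M" using P.sub_0[OF sJ] by (intro image_eqI[of _ _ 0]) simp_all
   fix x y assume "x : ?M" "y : ?M"
   then obtain f g where "x = poly f z" "y = poly g z" "f : J r R'" "g : J r R'" by blast
   thus "x + y : ?M" using P.sub_add[OF sJ] by (intro image_eqI[of _ _ "f + g"]) simp_all
  next
   fix b x assume "b : k" "x : ?M"
   then obtain f where "x = poly f z" "f : J r R'" by blast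
   thus "b * x : ?M" using P.sub_scale[OF sJ `b : k`] by (intro image_eqI[of _ _ "smult b f"]) simp_all
  qed
  have "rd k {0} (nat (l z r)) (L z r)" unfolding L_def l_def
   by (rule E.ll_rd[OF E.isdiv_scale[OF E.isdiv_pol[OF cE c0]]])
  then obtain e where e: "e <= nat (l z r)" "rd k {0} e ?M"
   using dm_exists_between[OF _ sub_zero sM _ MLz] sub_0[OF sM] by blast
  have "rdim smult k {f : J r R'. poly f z = 0} e {f : J r R'. poly f z : ?M}"
   by (rule P.dm_preimage[OF e(2) klin_mult[OF k] sJ _ _ order_refl]) simp_all
  moreover have "{f : J r R'. poly f z = 0} = J r (insert z R')" unfolding J_def by blast
  moreover have "{f : J r R'. poly f z : ?M} = J r R'" by blast
  ultimately have "rdim smult k (J r (insert z R')) e (J r R')" by simp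
  hence "rdim smult k (J r (insert z R')) (e + m) (I r)" by (rule P.dm_trans[OF m(2)])
  moreover have "int (e + m) <= (SUM z:insert z R'. l z r)"
  proof -
   have "l z r >= 0" unfolding l_def by (rule E.ll_nonneg)
   thus ?thesis using m(1) e(1) insert(1,2) by simp
  qed
  ultimately show ?case by blast
 qed
 have J0: "J r R = {0}" for r
 proof -
  have "f = 0" if "f : J r R" for f
  proof -
   have f: "f : PL S (card Z)" "ALL z:R. poly f z = 0" using that unfolding J_def I_def Q_def by simp_all
   hence "f : KR S R" unfolding KR_def PL_def by simp
   hence "f : KR S Z" using R(2) by simp
   hence "!!z. z : Z ==> poly f z = 0" unfolding KR_def by blast
   thus ?thesis by (rule PL_roots[OF f(1) Z(1)])
  qed
  thus ?thesis using P.sub_0[OF sJ] by blast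
 qed
 have dimI: "EX m. int m <= (SUM z:R. l z r) & rdim smult k {0} m (I r)" for r
  using upper[OF fR R(1), of r] unfolding J0 .
 have onto: "EX f:I r Int PL S (Suc d). coeff f d = b" if r: "r >= r0 + Q" and d: "d < Q" and b: "b : LL (A r d)" for r d b
 proof -
  define H where "H = (%V. smult b (PROD t<d. [:- nu V t, 1:]))"
  have bS: "b : S" using b LL_S by blast
  have pkH: "pk S (H V)" for V unfolding H_def
   by (intro pk_smult[OF S bS] pk_prod[OF S]) (simp add: pk_pCons[OF S] pk_0[OF S] nu sf_uminus[OF S] sf_1[OF S])
  have degH: "coeff (H V) d = b" "degree (H V) <= d" for V
  proof -
   let ?p = "PROD t<d. [:- nu V t, 1:]"
   have "degree ?p = d" by (subst degree_prod_eq_sum_degree) simp_all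
   moreover have "lead_coeff ?p = 1" by (simp add: lead_coeff_prod)
   ultimately show "coeff (H V) d = b" "degree (H V) <= d" unfolding H_def by (simp_all add: degree_smult_le[THEN order_trans])
  qed
  \<comment> \<open>The local polynomials \<open>H V\<close> are replaced by one global polynomial.
    The precision is \<open>r - Q\<close> rather than \<open>r\<close> because the error in
    coefficient \<open>i < Q\<close> is multiplied by \<open>z^i\<close>, whose poles have up to
    \<open>i\<close> times the order of those of \<open>c\<close>.\<close>
  have "ALL i. EX f:S. (ALL V:Pl. val V c < 0 --> f - coeff (H V) i : Id V (- (int (r - Q) * pol c V)))
   & (ALL V:Pl. ~ val V c < 0 --> f : V)"
  proof
   fix i show "EX f:S. (ALL V:Pl. val V c < 0 --> f - coeff (H V) i : Id V (- (int (r - Q) * pol c V)))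
   & (ALL V:Pl. ~ val V c < 0 --> f : V)"
   by (rule r0) (use r pkD[OF pkH] in auto)
  qed
  then obtain g where g: "!!i. g i : S" "!!i V. V : Pl ==> val V c < 0 ==> g i - coeff (H V) i : Id V (- (int (r - Q) * pol c V))"
   "!!i V. V : Pl ==> ~ val V c < 0 ==> g i : V" by metis
  define f where "f = monom b d + (SUM i<d. monom (g i) i)"
  have pkf: "pk S f" unfolding f_def by (intro pk_add[OF S] pk_sum[OF S] pk_monom[OF S] bS g(1))
  have cf: "coeff f j = (if j = d then b else if j < d then g j else 0)" for j
   unfolding f_def by (auto simp: coeff_sum coeff_monom)
  have fPL: "f : PL S (Suc d)" unfolding PL_def using pkf cf by simp
  hence fQ: "f : PL S Q" unfolding PL_def using d by simp
  have fz: "poly f z = b * z ^ d + (SUM i<d. g i * z ^ i)" for z unfolding f_def by (simp add: poly_sum poly_monom)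
  have "poly f z : L z r" if z: "z : Z" for z
  proof -
   interpret X: ffext k S "adj S z" by (rule X[OF z])
   have zE: "z : adj S z" using adj_gen[OF S] .
   have "poly f z : X.E.Id W (- (int r * X.E.pol c W))" if W: "W : places k (adj S z)" for W
   proof -
   let ?V = "W Int S"
   have V: "?V : Pl" using X.place_below[OF W] .
   have vc: "val W c < 0 \<longleftrightarrow> val ?V c < 0" using X.val_ram[OF W c(1) c0] X.ram_pos[OF W] by (simp add: mult_less_0_iff)
   have bV: "b : Id ?V (- A r d ?V)" using b V unfolding LL_iff by blast
   show ?thesis
   proof (cases "val W c < 0")
   case False
   have p0: "X.E.pol c W = 0" "pol c ?V = 0" "?V ~: Tc" using False vc unfolding X.E.pol_def pol_def Tc_def by auto
   have "b : W" using bV Id_0[OF V] p0 unfolding A_def kap'_def by simp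
   moreover have "g i : W" for i using g(3)[OF V] False vc by blast
   moreover have zW: "z : W" using integral[OF z W False] .
   ultimately have "poly f z : W" unfolding fz
   by (intro sring_add[OF X.E.PlD(1)[OF W]] sring_mult[OF X.E.PlD(1)[OF W]] sring_sum[OF X.E.PlD(1)[OF W]] sring_power[OF X.E.PlD(1)[OF W]])
   thus ?thesis using X.E.Id_0[OF W] p0 by simp
   next
   case True
   hence VT: "?V : Tc" "val ?V c < 0" using vc V unfolding Tc_def by auto
   have pr: "X.E.pol c W = X.ram W * pol c ?V" by (rule X.pol_ram[OF W c(1) c0])
   note sE = X.E.ssp_Id[OF W]
   define w where "w = (PROD t<d. z - nu ?V t)"
   have wE: "w : adj S z" unfolding w_def using nu X.SE by (intro sf_prod[OF X.E.S] sf_diff[OF X.E.S] zE) blast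
   have "w : X.E.Id W (- (X.ram W * kap ?V d))"
   using centers[OF z W True, of d] d wE unfolding w_def[symmetric] X.E.Id_iff X.ram_def Q_def by simp
   moreover have "b : X.E.Id W (X.ram W * (- A r d ?V))" using X.Id_ram[OF W bV] .
   ultimately have "b * w : X.E.Id W (X.ram W * (- A r d ?V) + (- (X.ram W * kap ?V d)))" using X.E.Id_mult[OF W] by blast
   moreover have "X.ram W * (- A r d ?V) + (- (X.ram W * kap ?V d)) = - (int r * X.E.pol c W)"
   unfolding A_def kap'_def pr using VT by (simp add: algebra_simps)
   ultimately have 1: "b * w : X.E.Id W (- (int r * X.E.pol c W))" by simp
   have zI: "z : X.E.Id W (- X.E.pol c W)" using pole[OF z W True] True W zE unfolding X.E.Id_iff X.E.pol_def by auto
   have 2: "(g i - coeff (H ?V) i) * z ^ i : X.E.Id W (- (int r * X.E.pol c W))" if i: "i < d" for i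
   proof -
   have "g i - coeff (H ?V) i : X.E.Id W (X.ram W * (- (int (r - Q) * pol c ?V)))"
   using X.Id_ram[OF W g(2)[OF V VT(2)]] .
   moreover have "z ^ i : X.E.Id W (int i * (- X.E.pol c W))" using X.E.Id_power[OF W zI] .
   ultimately have m: "(g i - coeff (H ?V) i) * z ^ i : X.E.Id W (X.ram W * (- (int (r - Q) * pol c ?V)) + int i * (- X.E.pol c W))"
   using X.E.Id_mult[OF W] by blast
   have "X.ram W * (- (int (r - Q) * pol c ?V)) + int i * (- X.E.pol c W) = - (int (r - Q + i) * X.E.pol c W)"
   unfolding pr by (simp add: algebra_simps)
   moreover have "int (r - Q + i) * X.E.pol c W <= int r * X.E.pol c W"
   using r i d X.E.pol_nonneg by (intro mult_right_mono) simp_all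
   ultimately have "- (int r * X.E.pol c W) <= X.ram W * (- (int (r - Q) * pol c ?V)) + int i * (- X.E.pol c W)" by linarith
   from subsetD[OF X.E.Id_mono[OF this] m] show ?thesis .
   qed
   have "poly (H ?V) z = (SUM i<=d. coeff (H ?V) i * z ^ i)" using poly_eq_sum_le[OF degH(2)] .
   also have "... = (SUM i<d. coeff (H ?V) i * z ^ i) + b * z ^ d" using degH(1)[of ?V] by (simp add: lessThan_Suc_atMost[symmetric])
   finally have "b * w = (SUM i<d. coeff (H ?V) i * z ^ i) + b * z ^ d" unfolding H_def w_def by (simp add: poly_prod)
   hence "poly f z = b * w + (SUM i<d. (g i - coeff (H ?V) i) * z ^ i)"
   unfolding fz by (simp add: left_diff_distrib sum_subtractf)
   moreover have "(SUM i<d. (g i - coeff (H ?V) i) * z ^ i) : X.E.Id W (- (int r * X.E.pol c W))"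
   by (rule sub_sum[OF sE]) (simp add: 2)
   ultimately show ?thesis using sub_add[OF sE 1] by simp
   qed
   qed
   moreover have "poly f z : adj S z" using adj_poly[OF S pkf] .
   ultimately show ?thesis unfolding L_def X.E.LL_iff by blast
  qed
  hence "f : I r" unfolding I_def using fQ by blast
  moreover have "coeff f d = b" using cf by simp
  ultimately show ?thesis using fPL by blast
 qed
 \<comment> \<open>Filtration by degree: passing from \<open>PL S d\<close> to
   \<open>PL S (Suc d)\<close> contributes at least \<open>ll (A r d)\<close> through the
   coefficient in degree \<open>d\<close>.\<close>
 have lower: "(SUM i<d. ll (A r i)) <= int w" if r: "r >= r0 + Q" and d: "d <= Q" and w: "rdim smult k {0} w (I r Int PL S d)" for r d w
  using d w
 proof (induction d arbitrary: w)
  case (Suc d)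
  have pl: "subsp smult k (I r Int PL S d)" for d using P.sub_Int[OF sI subsp_PL[OF S kS]] .
  have mono: "PL S d <= PL S (Suc d)" unfolding PL_def by auto
  obtain w' where w': "rdim smult k {0} w' (I r Int PL S d)"
   using P.dm_exists_between[OF Suc.prems(2) P.sub_zero pl[of d]] mono P.sub_0[OF pl[of d]] by blast
  have IH: "(SUM i<d. ll (A r i)) <= int w'" using Suc.IH[OF _ w'] Suc.prems(1) by simp
  let ?W = "I r Int PL S (Suc d)"
  have rl: "rd k {0} (nat (ll (A r d))) (LL (A r d))" by (rule ll_rd[OF Adiv(1)])
  have on: "LL (A r d) <= (%f. coeff f d) ` ?W" using onto[OF r, of d] Suc.prems(1) by fastforce
  have "rdim smult k {f : ?W. coeff f d = 0} (nat (ll (A r d))) {f : ?W. coeff f d : LL (A r d)}"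
   by (rule P.dm_preimage[OF rl klin_mult[OF k] pl _ _ on]) simp_all
  moreover have "{f : ?W. coeff f d = 0} = I r Int PL S d"
  proof
   show "{f : ?W. coeff f d = 0} <= I r Int PL S d"
   proof
   fix f assume f: "f : {f : ?W. coeff f d = 0}"
   have "coeff f j = 0" if "j >= d" for j using f that unfolding PL_def by (cases "j = d") auto
   thus "f : I r Int PL S d" using f unfolding PL_def by auto
   qed
   show "I r Int PL S d <= {f : ?W. coeff f d = 0}" unfolding PL_def by auto
  qed
  ultimately have "rdim smult k (I r Int PL S d) (nat (ll (A r d))) {f : ?W. coeff f d : LL (A r d)}" by simp
  from P.dm_trans[OF this w'] have "rdim smult k {0} (w' + nat (ll (A r d))) {f : ?W. coeff f d : LL (A r d)}" .
  hence "w' + nat (ll (A r d)) <= w" by (rule P.dm_mono[OF Suc.prems(2) _ _ P.sub_zero]) blast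
  thus ?case using IH ll_nonneg[of "A r d"] by simp
 qed simp
 have sum_lower: "real r * real n * real Q - ri tau - real Q * gam <= ri (SUM z:R. l z r)" if r: "r >= r0 + Q" for r
 proof -
  obtain m where m: "int m <= (SUM z:R. l z r)" "rdim smult k {0} m (I r)" using dimI by blast
  have "I r Int PL S Q = I r" unfolding I_def by blast
  hence "(SUM i<Q. ll (A r i)) <= int m" using lower[OF r order_refl, of m] m(2) by simp
  hence 1: "ri (SUM i<Q. ll (A r i)) <= ri (SUM z:R. l z r)" using m(1) by linarith
  have 2: "real r * real n - ri (SUM V:Tc. kap V i) - gam <= ri (ll (A r i))" for i
   using gam[OF Adiv(1), of r i] unfolding Adiv(2) by simp
  have "(SUM i<Q. real r * real n - ri (SUM V:Tc. kap V i) - gam) <= ri (SUM i<Q. ll (A r i))"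
   unfolding of_int_sum[of _ "{..<Q}"] by (rule sum_mono) (rule 2)
  moreover have "(SUM i<Q. real r * real n - ri (SUM V:Tc. kap V i) - gam) = real r * real n * real Q - ri tau - real Q * gam"
  proof -
   have "ri tau = (SUM i<Q. ri (SUM V:Tc. kap V i))" unfolding tau_def by (subst sum.swap) simp
   thus ?thesis by (simp only: sum_subtractf sum_constant card_lessThan) (simp add: algebra_simps)
  qed
  ultimately show ?thesis using 1 by linarith
 qed
 define bet where "bet = gam + ri tau / real Q"
 have Q0: "real Q > 0" unfolding Q_def using Z by (simp add: card_gt_0_iff)
 \<comment> \<open>If every representative exceeded its share of the mean at some
   \<open>rh z\<close>, it would do so at every larger \<open>r\<close>, because the defect does not
   decrease with \<open>r\<close>; one common \<open>r\<close> then contradicts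
   \<open>sum_lower\<close>.\<close>
 have ex: "EX z:R. ALL r. ri (int r * int (n * D z) - l z r) <= real (D z) * bet"
 proof (rule ccontr)
  assume "~ ?thesis"
  hence "ALL z:R. EX r. real (D z) * bet < ri (int r * int (n * D z) - l z r)" by (simp add: not_le)
  then obtain rh where rh: "!!z. z : R ==> real (D z) * bet < ri (int (rh z) * int (n * D z) - l z (rh z))" by metis
  define r where "r = r0 + Q + (SUM z:R. rh z)"
  have *: "real (D z) * bet < ri (int r * int (n * D z) - l z r)" if z: "z : R" for z
  proof -
   have zZ: "z : Z" using z R(1) by blast
   interpret E: ff k "adj S z" by (rule E[OF zZ])
   have ck: "isdiv (%_. 0) ==> c ~: k" using c by blast
   have "rh z <= r" unfolding r_def using member_le_sum[OF z, of rh] fR by simp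
   hence le: "int (rh z) * E.pol c W <= int r * E.pol c W" for W using E.pol_nonneg by (intro mult_right_mono) simp_all
   note i = E.isdiv_scale[OF E.isdiv_pol[OF cE c0]]
   have dgE: "E.dg (%W. int r * E.pol c W) = int r * int (n * D z)" for r
   using E.dg_scale[OF E.isdiv_pol[OF cE c0]] E.dg_pol[OF cE c(2)] nD[OF zZ] by simp
   have "l z r - l z (rh z) <= int r * int (n * D z) - int (rh z) * int (n * D z)"
   using E.ll_chain(2)[OF i i le] unfolding l_def dgE .
   thus ?thesis using rh[OF z] by linarith
  qed
  have "R ~= {}" using R(3) Q0 by auto
  hence "(SUM z:R. real (D z) * bet) < (SUM z:R. ri (int r * int (n * D z) - l z r))" by (intro sum_strict_mono fR *)
  moreover have "(SUM z:R. real (D z) * bet) = real Q * bet" unfolding sum_distrib_right[symmetric] of_nat_sum[symmetric] R(3) ..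
  moreover have "(SUM z:R. ri (int r * int (n * D z) - l z r)) = real r * real n * real Q - ri (SUM z:R. l z r)"
  proof -
   have "(SUM z:R. ri (int r * int (n * D z) - l z r)) = (SUM z:R. real r * real n * real (D z)) - ri (SUM z:R. l z r)"
   by (simp add: sum_subtractf mult.assoc)
   also have "(SUM z:R. real r * real n * real (D z)) = real r * real n * real Q"
   unfolding sum_distrib_left[symmetric] of_nat_sum[symmetric] R(3) ..
   finally show ?thesis .
  qed
  moreover have "real Q * bet = real Q * gam + ri tau" unfolding bet_def using Q0 by (simp add: distrib_left)
  moreover have "r >= r0 + Q" unfolding r_def by simp
  ultimately show False using sum_lower[of r] by linarith
 qed
 then obtain z where z: "z : R" "!!r. ri (int r * int (n * D z) - l z r) <= real (D z) * bet" by blast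
 have zZ: "z : Z" using z R(1) by blast
 interpret E: ff k "adj S z" by (rule E[OF zZ])
 have "ri (E.dg B - E.ll B) <= real (D z) * bet" if B: "E.isdiv B" for B
 proof -
  have "E.dg B - E.ll B <= \<lfloor>real (D z) * bet\<rfloor>"
  proof (rule E.riemann_reduction[OF cE c(2) _ B])
   fix r show "int r * int (fdeg (adj k c) (adj S z)) - E.ll (%V. int r * E.pol c V) <= \<lfloor>real (D z) * bet\<rfloor>"
   unfolding nD[OF zZ] using z(2)[of r] unfolding l_def by (simp add: le_floor_iff)
  qed
  thus ?thesis by (simp add: le_floor_iff)
 qed
 moreover have "bet = gam + (SUM V | V : Pl & val V c < 0. SUM d<card Z. ri (kap V d)) / real (card Z)"
  unfolding bet_def tau_def Q_def Tc_def by simp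
 ultimately show ?thesis using zZ E[OF zZ] nD[OF zZ] unfolding D_def n_def by auto
qed

section \<open>The additive polynomial and its Newton polygon at a pole of c\<close>

lemma char2_add_self: fixes x :: "'a::comm_ring_1" assumes "1 + 1 = (0::'a)" shows "x + x = 0"
proof -
 have "x + x = (1 + 1) * x" by (simp only: distrib_right mult_1_left)
 thus ?thesis using assms by simp
qed

lemma char2_power_add:
 fixes x y :: "'a::comm_ring_1" assumes "1 + 1 = (0::'a)" shows "(x + y) ^ (2 ^ n) = x ^ (2 ^ n) + y ^ (2 ^ n)"
proof (induction n)
 case (Suc n)
 have sq: "(a + b) ^ 2 = a ^ 2 + (b::'a) ^ 2" for a b
 proof -
  have "(a + b) ^ 2 = a ^ 2 + b ^ 2 + (a * b + a * b)" by (simp add: power2_eq_square algebra_simps)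
  thus ?thesis by (simp add: char2_add_self[OF assms])
 qed
 have "(x + y) ^ (2 ^ Suc n) = ((x + y) ^ (2 ^ n)) ^ 2" by (simp add: power_mult[symmetric] mult.commute)
 also have "... = (x ^ (2 ^ n)) ^ 2 + (y ^ (2 ^ n)) ^ 2" unfolding Suc sq ..
 also have "... = x ^ (2 ^ Suc n) + y ^ (2 ^ Suc n)" by (simp add: power_mult[symmetric] mult.commute)
 finally show ?case .
qed simp

lemma poly_eq_prod_roots:
 fixes p :: "'a::field poly"
 assumes "finite Z" "degree p = card Z" "lead_coeff p = 1" "!!z. z : Z ==> poly p z = 0"
 shows "p = (PROD z:Z. [:- z, 1:])"
proof -
 let ?G = "PROD z:Z. [:- z, 1:]"
 have dG: "degree ?G = card Z" "lead_coeff ?G = 1"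
  by (subst degree_prod_eq_sum_degree) (simp_all add: lead_coeff_prod)
 show ?thesis
 proof (cases "Z = {}")
  case True
  thus ?thesis using assms(2,3) by (simp add: one_pCons) (metis degree_0_id lead_coeff_pCons(2) one_pCons pCons_0_0 degree_pCons_0)
 next
  case False
  have "p - ?G : PL UNIV (card Z)"
   unfolding PL_def pk_def
  proof (intro CollectI conjI allI impI)
   fix i assume i: "card Z <= i"
   show "coeff (p - ?G) i = 0"
   proof (cases "i = card Z")
   case True thus ?thesis using assms(2,3) dG by simp
   next
   case False thus ?thesis using i assms(2) dG(1) by (simp add: coeff_eq_0)
   qed
  qed simp
  moreover have "poly (p - ?G) z = 0" if "z : Z" for z using assms(1,4) that by (simp add: poly_prod)
  ultimately have "p - ?G = 0" using PL_roots[OF _ assms(1)] by blast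
  thus ?thesis by simp
 qed
qed

text \<open>From \<open>q >= 4\<close> and \<open>j >= 2\<close> come the estimates
  \<open>1 / (q - 1) <= 1 / 3\<close> and \<open>2 / q^j <= 1 / (q - 1)\<close>, which keep the cost
  of all levels together summable.\<close>

locale drin =
 fixes k :: "'a::field set" and c :: 'a and q j :: nat
 assumes acl: "acl k" and two: "1 + 1 = (0::'a)" and c: "c ~: k" and q: "EX h>=2. q = 2 ^ h" and j: "j >= 2"
  and Fqk: "{a. a ^ q = a} <= k" and Fq_card: "card {a::'a. a ^ q = a} = q"
begin

abbreviation (input) "qJ \<equiv> real q ^ j"

definition Fq :: "'a set" where "Fq = {a. a ^ q = a}"

text \<open>An additive polynomial of the kind met with Drinfeld modules: all exponents are powers
  of \<open>q\<close>, so it is linear over the field \<open>Fq\<close> of \<open>q\<close>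
  elements. This linearity allows roots to be corrected by \<open>Fq\<close>-combinations of earlier
  ones.\<close>

definition PP :: "'a => 'a" where "PP y = y ^ (q ^ (j + 1)) + c * y ^ (q ^ j) + y"

lemma k: "sf k" using acl by (simp add: acl_def)

lemma neg_eq: "- x = (x::'a)"
proof -
 have "x + x = (1 + 1) * x" by (simp only: distrib_right mult_1_left)
 hence "x + x = 0" using two by simp
 thus ?thesis by (rule minus_unique)
qed

lemma diff_eq: "x - y = x + (y::'a)" by (metis diff_conv_add_uminus neg_eq)

lemma add_self: "x + x = (0::'a)" by (metis neg_eq add.right_inverse)

lemma q4: "q >= 4"
proof -
 obtain h where "h >= 2" "q = 2 ^ h" using q by blast
 thus ?thesis using power_increasing[of 2 h "2::nat"] by simp
qed

lemma qr: "real q >= 4" using q4 by simp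

lemmas frob2 = char2_power_add[OF two]

lemma frobq: "(x + y) ^ (q ^ n) = x ^ (q ^ n) + (y::'a) ^ (q ^ n)"
proof -
 obtain h where "q = 2 ^ h" using q by blast
 thus ?thesis using frob2[of x y "h * n"] by (simp add: power_mult)
qed

lemma Fq_pow: "a : Fq ==> a ^ (q ^ n) = a"
 by (induction n) (simp_all add: Fq_def power_mult mult.commute[of q])

lemma Fq: "finite Fq" "card Fq = q" "Fq <= k"
proof -
 show "card Fq = q" "Fq <= k" using Fq_card Fqk by (simp_all add: Fq_def)
 thus "finite Fq" using q4 by (metis card.infinite not_numeral_le_zero)
qed

lemma sf_Fq: "sf Fq"
 unfolding sf_def Fq_def using frobq[of _ _ 1] q4 by (simp add: power_mult_distrib neg_eq power_inverse)

lemma PP_add: "PP (x + y) = PP x + PP y"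
 unfolding PP_def frobq by (simp add: algebra_simps)

lemma PP_scale: "a : Fq ==> PP (a * x) = a * PP x"
 unfolding PP_def power_mult_distrib by (simp add: Fq_pow algebra_simps del: power_Suc power_add)

lemma q0: "q > 0" "q ~= Suc 0" using q4 by simp_all

lemma PP_0: "PP 0 = 0" using q0 by (simp add: PP_def power_0_left)

lemma c0: "c ~= 0" using c sf_0[OF k] by blast

lemma PP_sum: "PP (sum f I) = (SUM i:I. PP (f i))"
proof (induction I rule: infinite_finite_induct)
 case (insert i I) thus ?case by (simp add: PP_add)
qed (simp_all add: PP_0)

lemma prod_Fq: "(PROD a:Fq. x - a) = x ^ q - x"
proof -
 let ?p = "monom 1 q - monom 1 1 :: 'a poly"
 have q1: "Suc 0 ~= q" using q4 by linarith
 have cf: "coeff ?p i = (if i = q then 1 else if i = 1 then - 1 else 0)" for i using q1 by simp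
 have q1': "q ~= 1" "q ~= Suc 0" using q1 by simp_all
 have dp: "degree ?p = q"
 proof (rule antisym)
  show "degree ?p <= q" using q4 by (intro degree_le) (auto simp: cf)
  show "q <= degree ?p" by (rule le_degree) (simp add: cf q1 q1')
 qed
 have "?p = (PROD a:Fq. [:- a, 1:])"
 proof (rule poly_eq_prod_roots)
  show "lead_coeff ?p = 1" unfolding dp cf by simp
  show "poly ?p z = 0" if "z : Fq" for z using that by (simp add: Fq_def poly_monom)
 qed (use Fq dp in simp_all)
 hence "poly ?p x = poly (PROD a:Fq. [:- a, 1:]) x" by simp
 thus ?thesis by (simp add: poly_monom poly_prod)
qed

end

locale drin_loc = drin k c q j + ff k E for k E :: "'a::field set" and c q j +
 fixes W assumes W: "W : Pl" and cE: "c : E" and cW: "val W c < 0"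
begin

text \<open>Values are compared with reals because the slopes \<open>D\<close> and \<open>B\<close>
  are fractions. \<open>vg\<close> treats 0 as having infinite value, whereas \<open>vq\<close>
  excludes it.\<close>

definition vg :: "'a => real => bool" where "vg x r \<longleftrightarrow> x : E & (x = 0 | r <= ri (val W x))"
definition vq :: "'a => real => bool" where "vq x r \<longleftrightarrow> x : E & x ~= 0 & ri (val W x) = r"

definition V :: real where "V = - ri (val W c)"
text \<open>The slopes of the Newton polygon of \<open>PP\<close>: its last two terms have equal
  value when \<open>y\<close> has value \<open>D\<close>, its first two when \<open>y\<close> has
  value \<open>- B\<close>. Accordingly a nonzero root of \<open>PP\<close> has value
  \<open>D\<close> or \<open>- B\<close>.\<close>

definition D :: real where "D = V / (qJ - 1)"
definition B :: real where "B = V / (qJ * (real q - 1))"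

lemma vg_Id: "vg x r \<longleftrightarrow> x : Id W \<lceil>r\<rceil>" unfolding vg_def Id_iff by (simp add: ceiling_le_iff)

lemma vg_add: "vg x r ==> vg y r ==> vg (x + y) r"
 unfolding vg_Id using sub_add[OF ssp_Id[OF W]] .

lemma vg_scale: "a : k ==> vg x r ==> vg (a * x) r"
 unfolding vg_Id using sub_scale[OF ssp_Id[OF W]] .

lemma vg_mono: "vg x r ==> s <= r ==> vg x s" unfolding vg_def by auto

lemma vg_0: "vg 0 r" unfolding vg_def using sf_0[OF S] by simp

lemma vg_E: "vg x r ==> x : E" unfolding vg_def by blast

lemma vq_vg: "vq x r ==> vg x r" unfolding vq_def vg_def by simp

lemma vg_mult: "vg x r ==> vg y s ==> vg (x * y) (r + s)"
 unfolding vg_def using val_mult[OF W, of x y] sf_mult[OF S, of x y] by (cases "x = 0"; cases "y = 0") simp_all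

lemma vq_mult: "vq x r ==> vq y s ==> vq (x * y) (r + s)"
 unfolding vq_def using val_mult[OF W, of x y] sf_mult[OF S, of x y] by auto

lemma vq_power: "vq x r ==> vq (x ^ n) (real n * r)"
 unfolding vq_def using val_power[OF W, of x n] sf_power[OF S, of x n] by auto

lemma vq_scale: "a : k ==> a ~= 0 ==> vq x r ==> vq (a * x) r"
 using vq_mult[of a 0 x r] val_const[OF W] kS unfolding vq_def[of a] by auto

lemma vq_divide: "vq x r ==> vq y s ==> vq (x / y) (r - s)"
 unfolding vq_def using val_divide[OF W, of x y] sf_divide[OF S, of x y] by auto

lemma vq_dom: assumes "vq x r" "vg y s" "r < s" shows "vq (x + y) r"
proof -
 have "y : Id W (val W x + 1)" using assms unfolding vq_def vg_def Id_iff by auto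
 thus ?thesis using val_add_eq[OF W, of x y] assms(1) sf_add[OF S] assms(2) unfolding vq_def vg_def by auto
qed

lemma vq_dom2: "vg y s ==> vq x r ==> r < s ==> vq (y + x) r"
 using vq_dom by (simp add: add.commute)

lemma vq_not_vg: "vq x r ==> r < s ==> ~ vg x s" unfolding vq_def vg_def by auto

lemma vc: "vq c (- V)" unfolding vq_def V_def using cE c0 by simp

lemma V1: "V >= 1" using cW unfolding V_def by linarith

lemma qj: "qJ >= 16"
proof -
 have "real q ^ 2 <= qJ" using qr j by (intro power_increasing) simp_all
 moreover have "real q ^ 2 >= 4 ^ 2" using qr by (intro power_mono) simp_all
 ultimately show ?thesis by simp
qed

lemma DB: "D > 0" "B > 0" "V = (qJ - 1) * D" "V = qJ * (real q - 1) * B" "D - (real q - 1) * B = D / qJ"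
proof -
 have a: "qJ - 1 > 0" "qJ > 0" "real q - 1 > 0" using qj qr by simp_all
 show "D > 0" "B > 0" unfolding D_def B_def using a V1 by simp_all
 show "V = (qJ - 1) * D" "V = qJ * (real q - 1) * B" unfolding D_def B_def using a by simp_all
 have "(real q - 1) * B = V / qJ" unfolding B_def using a by simp
 thus "D - (real q - 1) * B = D / qJ" unfolding D_def
 proof -
  have "V / (x - 1) - V / x = V / (x - 1) / x" if "x > 1" for x using that by (simp add: field_simps)
  thus "V / (qJ - 1) - (real q - 1) * B = V / (qJ - 1) / qJ" using a `(real q - 1) * B = V / qJ` by simp
 qed
qed

lemma B_le_D: "B <= D"
proof -
 have "D / qJ >= 0" by (rule divide_nonneg_nonneg) (use DB(1) in simp_all)
 hence "(real q - 1) * B <= D" using DB(5) by linarith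
 moreover have "1 * B <= (real q - 1) * B" using qr DB(2) by (intro mult_right_mono) simp_all
 ultimately show ?thesis by simp
qed

text \<open>The Newton polygon of \<^term>\<open>PP y = e\<close>: a root that is not of the slope \<^term>\<open>- B\<close> cannot have too small a value, since
 the term of least value would not cancel.\<close>

lemma dichotomy:
 assumes y: "y : E" and e: "vg (PP y) (D - m)" and m: "m >= 0" "m <= D + B"
 shows "vg y (D - m / qJ) | vq y (- B)"
proof (rule ccontr)
 assume n: "~ ?thesis"
 hence y0: "y ~= 0" using y unfolding vg_def by auto
 define w where "w = ri (val W y)"
 have yw: "vq y w" unfolding vq_def w_def using y y0 by simp
 have w: "w < D - m / qJ" "w ~= - B" using n y yw unfolding vg_def vq_def w_def by auto
 have qp: "qJ > 1" "real q ^ (j + 1) = qJ * real q" using qj by simp_all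
 have t1: "vq (y ^ (q ^ (j + 1))) (real q ^ (j + 1) * w)" using vq_power[OF yw, of "q ^ (j+1)"] by simp
 have t2: "vq (c * y ^ (q ^ j)) (- V + qJ * w)" using vq_mult[OF vc vq_power[OF yw, of "q ^ j"]] by simp
 have "qJ * w < qJ * (D - m / qJ)" using w(1) qp(1) by (intro mult_strict_left_mono) linarith+
 hence wq: "qJ * w < qJ * D - m" using qp(1) q0 by (simp add: right_diff_distrib)
 have t2lt: "- V + qJ * w < D - m" using wq DB(3) by (simp add: algebra_simps)
 have wD: "w < D" using w(1) m qp by (smt (verit) divide_nonneg_nonneg)
 have "(qJ - 1) * w < (qJ - 1) * D" using wD qp by (intro mult_strict_left_mono) simp_all
 hence t23: "- V + qJ * w < w" using DB(3) by (simp add: algebra_simps)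
 show False
 proof (cases "w > - B")
  case True
  have "qJ * (real q - 1) * w > qJ * (real q - 1) * (- B)" using True qp qr by (intro mult_strict_left_mono) simp_all
  hence "real q ^ (j + 1) * w > - V + qJ * w" using DB(4) qp(2) by (simp add: algebra_simps)
  hence "vq (y ^ (q ^ (j + 1)) + c * y ^ (q ^ j)) (- V + qJ * w)" using vq_dom2[OF vq_vg[OF t1] t2] by simp
  hence "vq (PP y) (- V + qJ * w)" unfolding PP_def using vq_dom[OF _ vq_vg[OF yw] t23] by simp
  thus False using vq_not_vg[OF _ t2lt] e by blast
 next
  case False
  hence wl: "w < - B" using w(2) by simp
  have "qJ * (real q - 1) * w < qJ * (real q - 1) * (- B)" using wl qp qr by (intro mult_strict_left_mono) simp_all
  hence l: "real q ^ (j + 1) * w < - V + qJ * w" using DB(4) qp(2) by (simp add: algebra_simps)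
  hence "vq (y ^ (q ^ (j + 1)) + c * y ^ (q ^ j)) (real q ^ (j + 1) * w)" using vq_dom[OF t1 vq_vg[OF t2]] by simp
  hence "vq (PP y) (real q ^ (j + 1) * w)" unfolding PP_def using vq_dom[OF _ vq_vg[OF yw]] l t23 by simp
  thus False using vq_not_vg[of "PP y" "real q ^ (j + 1) * w" "D - m"] e l t2lt by simp
 qed
qed

text \<open>At value \<open>D - m / q^j\<close> of \<open>y\<close> the middle term of
  \<open>PP y\<close> has value exactly \<open>D - m\<close>; a larger value of \<open>y\<close>
  would push all three terms above \<open>D - m\<close>.\<close>

lemma exact:
 assumes e: "vq (PP y) (D - m)" and m: "m >= 0" "m <= D + B" and y: "vg y (D - m / qJ)"
 shows "vq y (D - m / qJ)"
proof (rule ccontr)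
 assume n: "~ ?thesis"
 have qp: "qJ > 1" "real q ^ (j + 1) >= 1" using qj qr by (simp, intro one_le_power) simp
 have y0: "y ~= 0" using e PP_0 unfolding vq_def by auto
 define w where "w = ri (val W y)"
 have yw: "vq y w" unfolding vq_def w_def using y0 vg_E[OF y] by simp
 have w: "w > D - m / qJ" using n y y0 yw unfolding vg_def vq_def w_def by auto
 have "qJ * w > qJ * (D - m / qJ)" using w qp(1) by (intro mult_strict_left_mono) linarith+
 hence "qJ * w > qJ * D - m" using qp(1) q0 by (simp add: right_diff_distrib)
 hence 2: "- V + qJ * w > D - m" using DB(3) by (simp add: left_diff_distrib)
 have "m * 1 <= m * qJ" using m(1) qp(1) by (intro mult_left_mono) simp_all
 hence "m / qJ <= m" using qp(1) by (subst pos_divide_le_eq) linarith+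
 hence 3: "w > D - m" using w by simp
 have "m <= qJ * D"
 proof -
  have "m <= 2 * D" using m(2) B_le_D by simp
  also have "2 * D <= qJ * D" using DB(1) qj by (intro mult_right_mono) simp_all
  finally show ?thesis .
 qed
 hence "w > 0" using w qp by (smt (verit) pos_divide_le_eq mult.commute)
 hence "w <= real q ^ (j + 1) * w" using qp(2) by simp
 hence 1: "real q ^ (j + 1) * w > D - m" using 3 by simp
 define r where "r = min (min (real q ^ (j + 1) * w) (- V + qJ * w)) w"
 have "vg (y ^ (q ^ (j + 1))) r" using vg_mono[OF vq_vg[OF vq_power[OF yw, of "q ^ (j+1)"]], of r] unfolding r_def by simp
 moreover have "vg (c * y ^ (q ^ j)) r" using vg_mono[OF vq_vg[OF vq_mult[OF vc vq_power[OF yw, of "q ^ j"]]], of r] unfolding r_def by simp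
 moreover have "vg y r" using vg_mono[OF vq_vg[OF yw], of r] unfolding r_def by simp
 ultimately have "vg (PP y) r" unfolding PP_def by (intro vg_add)
 moreover have "r > D - m" unfolding r_def using 1 2 3 by simp
 ultimately show False using vq_not_vg[OF e] by blast
qed

text \<open>Two large roots differ by a factor in \<^term>\<open>Fq\<close> up to smaller terms, because
 \<^term>\<open>y ^ (q ^ j * (q - 1))\<close> is close to \<^term>\<open>- c\<close> for both of them.\<close>

lemma large_roots:
 assumes y: "vq y (- B)" "vg (PP y) (- B)" and x: "vq x (- B)" "vg (PP x) (- B)"
 shows "EX a:Fq. a ~= 0 & ~ vq (y - a * x) (- B)"
proof -
 define N where "N = q ^ j * (q - 1)"
 have Nq: "N + q ^ j = q ^ (j + 1)" unfolding N_def using q4 by (simp add: algebra_simps)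
 have q1: "real (q - Suc 0) = real q - 1" using q4 by simp
 \<comment> \<open>Dividing \<open>PP y - y\<close> by \<open>y^(q^j)\<close> isolates
   \<open>y^N + c\<close>, and the division gains the value \<open>q^j * B\<close>.\<close>
 have close: "vg (y ^ N + c) (- B + qJ * B)" if y: "vq y (- B)" "vg (PP y) (- B)" for y
 proof -
  have yq: "vq (y ^ (q ^ j)) (- (qJ * B))" using vq_power[OF y(1), of "q ^ j"] by simp
  hence y0: "y ^ (q ^ j) ~= 0" unfolding vq_def by blast
  have "(y ^ N + c) * y ^ (q ^ j) = PP y - y" unfolding PP_def Nq[symmetric] by (simp add: power_add algebra_simps)
  hence e: "y ^ N + c = (PP y + y) * inverse (y ^ (q ^ j))" using y0 diff_eq by (metis divide_inverse nonzero_mult_div_cancel_right)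
  have "vq (inverse (y ^ (q ^ j))) (qJ * B)"
   using yq val_inverse[OF W, of "y ^ (q ^ j)"] sf_inv[OF S] unfolding vq_def by auto
  thus ?thesis unfolding e using vg_mult[OF vg_add[OF y(2) vq_vg[OF y(1)]] vq_vg] by blast
 qed
 have xN: "vq (x ^ N) (- V)" using vq_power[OF x(1), of N] DB(4) unfolding N_def by (simp add: q1)
 hence x0: "x ^ N ~= 0" "x ~= 0" unfolding vq_def using x(1) unfolding vq_def by auto
 define u where "u = y / x"
 have u: "vq u 0" unfolding u_def using vq_divide[OF y(1) x(1)] by simp
 have uW: "u : W - mx W" using u val_ge_0[OF W, of u] val_gt_0[OF W, of u] unfolding vq_def by auto
 have "vg ((y ^ N + c) + (x ^ N + c)) (- B + qJ * B)" by (rule vg_add[OF close[OF y] close[OF x]])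
 moreover have "(y ^ N + c) + (x ^ N + c) = y ^ N + x ^ N" using add_self[of c] by (metis add.assoc add.left_commute add_0_right)
 moreover have "vq (inverse (x ^ N)) V"
  using xN val_inverse[OF W, of "x ^ N"] sf_inv[OF S] unfolding vq_def by auto
 ultimately have "vg ((y ^ N + x ^ N) * inverse (x ^ N)) (- B + qJ * B + V)" using vg_mult[OF _ vq_vg] by metis
 moreover have "(y ^ N + x ^ N) * inverse (x ^ N) = u ^ N + 1" unfolding u_def using x0 by (simp add: power_divide field_simps)
 moreover have "- B + qJ * B + V > 0"
 proof -
  have "1 * B <= qJ * B" using qj DB(2) by (intro mult_right_mono) simp_all
  thus ?thesis using V1 by simp
 qed
 ultimately have "u ^ N + 1 : mx W" using val_gt_0[OF W, of "u ^ N + 1"] mx_0[OF W] unfolding vg_def by (cases "u ^ N + 1 = 0") auto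
 \<comment> \<open>Frobenius strips the inseparable part \<open>q^j\<close> from \<open>N\<close>.
   What remains says that the residue of \<open>u\<close> is a \<open>(q - 1)\<close>-th root of
   unity, that is, a nonzero element of \<open>Fq\<close>.\<close>
 moreover have "u ^ N + 1 = (u ^ (q - 1) + 1) ^ (q ^ j)" unfolding N_def frobq by (simp add: power_mult[symmetric] mult.commute)
 ultimately have "(u ^ (q - 1) + 1) ^ (q ^ j) : mx W" by simp
 moreover have uV: "u ^ (q - 1) + 1 : W"
  using sring_add[OF PlD(1)[OF W] sring_power[OF PlD(1)[OF W]] sring_1[OF PlD(1)[OF W]]] uW by blast
 have pw: "b ^ n : mx W ==> b : mx W" if b: "b : W" for b n
 proof (induction n)
  case 0 thus ?case using sring_1[OF PlD(1)[OF W]] by (simp add: mx_def)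
 next
  case (Suc n) thus ?case using mx_prime[OF W b sring_power[OF PlD(1)[OF W] b, of n]] by auto
 qed
 ultimately have "u ^ (q - 1) + 1 : mx W" using pw[OF uV] by blast
 hence "(u ^ (q - 1) + 1) * u : mx W" using mx_mult[OF W] uW by blast
 moreover have "(u ^ (q - 1) + 1) * u = u ^ q - u"
 proof -
  have "u ^ q = u ^ (q - 1) * u" using q4 by (metis power_minus_mult zero_less_numeral less_le_trans)
  thus ?thesis by (simp add: distrib_right diff_eq)
 qed
 ultimately have pr: "(PROD a:Fq. u - a) : mx W" unfolding prod_Fq by simp
 have aW: "u - a : W" if "a : Fq" for a using sring_diff[OF PlD(1)[OF W]] uW that Fq(3) PlD(2)[OF W] by blast
 have "EX a:A. u - a : mx W" if "finite A" "A <= Fq" "(PROD a:A. u - a) : mx W" for A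
  using that
 proof (induction A rule: finite_induct)
  case empty thus ?case using sring_1[OF PlD(1)[OF W]] by (simp add: mx_def)
 next
  case (insert a A)
  have "(PROD a:A. u - a) : W" using aW insert by (intro sring_prod[OF PlD(1)[OF W]]) blast
  thus ?case using mx_prime[OF W aW[of a]] insert by auto
 qed
 from this[OF Fq(1) order_refl pr] obtain a where a: "a : Fq" "u - a : mx W" by blast
 have "a ~= 0" using a uW by auto
 moreover have "~ vq (y - a * x) (- B)"
 proof
  assume h: "vq (y - a * x) (- B)"
  have "y - a * x = (u - a) * x"
   using x0 by (simp only: u_def left_diff_distrib nonzero_eq_divide_eq times_divide_eq_left nonzero_mult_div_cancel_right not_False_eq_True)
  hence e: "u - a = (y - a * x) / x" using x0 by simp
  have "vq (u - a) 0" unfolding e using vq_divide[OF h x(1)] by simp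
  thus False using a(2) val_gt_0[OF W, of "u - a"] unfolding vq_def by auto
 qed
 ultimately show ?thesis using a(1) by blast
qed

end

section \<open>Chains of roots and their values at a pole of c\<close>

lemma prod_mod_div:
 fixes f :: "nat => 'a::comm_monoid_mult"
 assumes "i < q" shows "(PROD t<n * q + i. f (t mod q)) = (PROD t<q. f t) ^ n * (PROD t<i. f t)"
proof (induction n)
 case 0
 have "(PROD t<i. f (t mod q)) = (PROD t<i. f t)" using assms by (intro prod.cong) simp_all
 thus ?case by simp
next
 case (Suc n)
 have "(PROD t<Suc n * q + i. f (t mod q)) = (PROD t<q. f (t mod q)) * (PROD t:{q..<q + (n * q + i)}. f (t mod q))"
  by (subst prod.atLeastLessThan_concat[of 0 q, simplified atLeast0LessThan, symmetric]) (simp_all add: add_ac)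
 also have "(PROD t:{q..<q + (n * q + i)}. f (t mod q)) = (PROD t<n * q + i. f (t mod q))"
  using prod.shift_bounds_nat_ivl[of "%t. f (t mod q)" 0 q "n * q + i"] by (simp add: atLeast0LessThan add.commute)
 also have "(PROD t<q. f (t mod q)) = (PROD t<q. f t)" by (intro prod.cong) simp_all
 finally show ?case using Suc by (simp add: mult.assoc)
qed

lemma sum_mod_div:
 fixes f :: "nat => nat => 'b::comm_monoid_add"
 assumes "q > 0"
 shows "(SUM d<n * q. f (d div q) (d mod q)) = (SUM a<n. SUM i<q. f a i)"
proof (induction n)
 case (Suc n)
 have "(SUM d<Suc n * q. f (d div q) (d mod q)) = (SUM d<n * q. f (d div q) (d mod q)) + (SUM d:{n * q..<q + n * q}. f (d div q) (d mod q))"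
  by (subst sum.atLeastLessThan_concat[of 0 "n * q", simplified atLeast0LessThan, symmetric]) (simp_all add: add_ac)
 also have "(SUM d:{n * q..<q + n * q}. f (d div q) (d mod q)) = (SUM i<q. f ((i + n * q) div q) ((i + n * q) mod q))"
  using sum.shift_bounds_nat_ivl[of "%d. f (d div q) (d mod q)" 0 "n * q" q] by (simp add: atLeast0LessThan add.commute)
 also have "... = (SUM i<q. f n i)" using assms by (intro sum.cong) simp_all
 finally show ?case using Suc by simp
qed simp

context drin
begin

text \<open>\<open>eta 1 ~= 0\<close> makes the members \<open>eta 1, ..., eta l\<close> independent
  over \<open>Fq\<close>, since \<open>PP\<close> lowers every index by one.\<close>

definition chn :: "(nat => 'a) => nat => bool" where
 "chn eta l \<longleftrightarrow> eta 0 = 0 & eta 1 ~= 0 & (ALL i<l. PP (eta (Suc i)) = eta i)"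

text \<open>Recursive form of the product of all \<open>x + u\<close>, with \<open>u\<close> an
  \<open>Fq\<close>-combination of \<open>eta 1, ..., eta i\<close>. Its invariance under such
  shifts lets an argument be replaced by a representative whose value is known.\<close>

primrec Tp :: "(nat => 'a) => nat => 'a => 'a" where
 "Tp eta 0 x = x"
| "Tp eta (Suc i) x = (PROD a:Fq. Tp eta i (x + a * eta (Suc i)))"

lemma Tp_shift: "1 <= t ==> t <= i ==> b : Fq ==> Tp eta i (x + b * eta t) = Tp eta i x"
proof (induction i arbitrary: x)
 case (Suc i)
 show ?case
 proof (cases "t = Suc i")
  case True
  have "Tp eta (Suc i) (x + b * eta t) = (PROD a:Fq. Tp eta i (x + (b + a) * eta (Suc i)))"
   using True by (simp add: algebra_simps)
  also have "... = (PROD a:Fq. Tp eta i (x + a * eta (Suc i)))"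
  proof (rule prod.reindex_bij_betw[of "%a. b + a"])
   have "b + (b + a) = a" for a using add_self[of b] by (metis add.assoc add_0_left)
   thus "bij_betw (%a. b + a) Fq Fq"
   using sf_add[OF sf_Fq Suc.prems(3)] by (intro bij_betwI[of _ _ _ "%a. b + a"]) auto
  qed
  finally show ?thesis by simp
 next
  case False
  have "Tp eta i (x + b * eta t + a * eta (Suc i)) = Tp eta i (x + a * eta (Suc i))" for a
   using Suc.IH[of "x + a * eta (Suc i)"] Suc.prems False by (simp add: algebra_simps)
  thus ?thesis by simp
 qed
qed simp

lemma Tp_shift_sum: "s + h <= i ==> (!!m. b m : Fq) ==> Tp eta i (x + (SUM m<h. b m * eta (Suc (s + m)))) = Tp eta i x"
proof (induction h)
 case (Suc h)
 have "Tp eta i (x + (SUM m<Suc h. b m * eta (Suc (s + m)))) = Tp eta i ((x + (SUM m<h. b m * eta (Suc (s + m)))) + b h * eta (Suc (s + h)))"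
  by (simp add: add.assoc)
 also have "... = Tp eta i (x + (SUM m<h. b m * eta (Suc (s + m))))" using Suc.prems by (intro Tp_shift) simp_all
 finally show ?case using Suc by simp
qed simp

lemma Tp_zero: "Tp eta i x = 0 ==> EX b. (ALL m. b m : Fq) & x = (SUM m<i. b m * eta (Suc m))"
proof (induction i arbitrary: x)
 case 0 thus ?case using sf_0[OF sf_Fq] by (intro exI[of _ "%_. 0"]) simp
next
 case (Suc i)
 then obtain a where a: "a : Fq" "Tp eta i (x + a * eta (Suc i)) = 0" using Fq(1) by auto
 then obtain b where b: "ALL m. b m : Fq" "x + a * eta (Suc i) = (SUM m<i. b m * eta (Suc m))" using Suc.IH by blast
 have "x = (SUM m<i. b m * eta (Suc m)) + a * eta (Suc i)" unfolding b(2)[symmetric] by (simp add: add.assoc add_self)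
 thus ?case using a b by (intro exI[of _ "b(i := a)"]) simp
qed

text \<open>A vanishing factor would express \<open>eta (Suc i)\<close> through earlier members;
  applying \<open>PP\<close> repeatedly lowers all indices and ends with
  \<open>eta 1 = 0\<close>.\<close>

lemma Tp_nonzero: assumes "chn eta l" "i < l" shows "Tp eta i (eta (Suc i)) ~= 0"
proof
 assume "Tp eta i (eta (Suc i)) = 0"
 hence "EX b. (ALL m. b m : Fq) & eta (Suc i) = (SUM m<i. b m * eta (Suc m))" by (rule Tp_zero)
 thus False using assms(2)
 proof (induction i)
  case 0 thus ?case using assms(1) by (simp add: chn_def)
 next
  case (Suc i)
  then obtain b where b: "ALL m. b m : Fq" "eta (Suc (Suc i)) = (SUM m<Suc i. b m * eta (Suc m))" by blast
  have "eta (Suc i) = PP (eta (Suc (Suc i)))" using assms(1) Suc.prems(2) by (simp add: chn_def)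
  also have "... = (SUM m<Suc i. b m * eta m)" unfolding b(2) PP_sum using b(1) assms(1) Suc.prems(2)
   by (intro sum.cong) (simp_all add: PP_scale chn_def)
  also have "... = (SUM m<i. b (Suc m) * eta (Suc m))" unfolding sum.lessThan_Suc_shift using assms(1) by (simp add: chn_def)
  finally show ?case using Suc.IH Suc.prems(2) b(1) by (metis Suc_lessD)
 qed
qed

end

locale drin_chain = drin_loc +
 fixes eta :: "nat => 'a" and l :: nat
 assumes chain: "chn eta l" and l: "l >= 1" and etaE: "!!i. i <= l ==> eta i : E"
begin

text \<open>Suitably corrected members of the chain have values \<open>D - m h\<close>: starting
  from \<open>D - m 0 = - B\<close>, each preimage under \<open>PP\<close> divides the distance to
  \<open>D\<close> by \<open>q^j\<close>.\<close>

definition m :: "nat => real" where "m h = (D + B) / qJ ^ h"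

lemma m: "m h > 0" "m h <= D + B" "m (Suc h) = m h / qJ" "h < h' ==> m h' < m h" "m 0 = D + B"
proof -
 have p2: "qJ ^ h >= 1" by (rule one_le_power) (use qj in linarith)
 hence p: "qJ ^ h > 0" "qJ ^ h >= 1" by linarith+
 show "m h > 0" unfolding m_def using p DB by (intro divide_pos_pos) simp_all
 show "m h <= D + B" unfolding m_def using p(2) DB by (simp add: divide_le_eq mult_le_cancel_left1)
 show "m (Suc h) = m h / qJ" unfolding m_def by (simp add: mult.commute)
 show "m 0 = D + B" unfolding m_def by simp
 show "m h' < m h" if "h < h'"
 proof -
  have "qJ ^ h < qJ ^ h'" using that qj by (intro power_strict_increasing) simp_all
  thus ?thesis unfolding m_def using p DB by (intro divide_strict_left_mono mult_pos_pos) simp_all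
 qed
qed

text \<open>The type of a place: the chain stays at value \<open>D\<close> or above through
  \<open>eta s\<close>, and \<open>eta (Suc s)\<close> is the first member of value
  \<open>- B\<close>. From there on the values are forced up to \<open>Fq\<close>-corrections. Type
  \<open>l\<close> means that no large member occurs.\<close>

definition ty :: "nat => bool" where
 "ty s \<longleftrightarrow> s <= l & (ALL i<=s. vg (eta i) D) & (s < l --> vq (eta (Suc s)) (- B))"

lemma ty_exists: "EX s. ty s"
proof (cases "ALL i<=l. vg (eta i) D")
 case True thus ?thesis unfolding ty_def by (intro exI[of _ l]) simp
next
 case False
 define i where "i = (LEAST i. ~ vg (eta i) D)"
 have i: "~ vg (eta i) D" "!!t. t < i ==> vg (eta t) D" unfolding i_def using False by (metis LeastI, metis not_less_Least)
 have "i ~= 0" using i(1) chain vg_0 by (metis chn_def)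
 then obtain s where s: "i = Suc s" by (metis not0_implies_Suc)
 have il: "i <= l" using False i(2) by (metis leI order_le_less_trans)
 have "vg (PP (eta i)) (D - 0)" using chain il i(2)[of s] unfolding s chn_def by simp
 from dichotomy[OF etaE[OF il] this] have "vq (eta i) (- B)" using i(1) DB by simp
 thus ?thesis unfolding ty_def using il i(2) s by (intro exI[of _ s]) simp
qed

text \<open>Either \<open>y\<close> is on the small branch of \<open>dichotomy\<close>, or it is
  large and \<open>large_roots\<close> supplies a multiple of \<open>eta (Suc s)\<close> that
  cancels its leading part. The value of \<open>PP y\<close> is unaffected, because
  \<open>PP (eta (Suc s)) = eta s\<close> has value at least \<open>D\<close>.\<close>

lemma next_root:
 assumes s: "ty s" "s < l" and y: "y : E" "vq (PP y) (D - m h)"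
 shows "EX a:Fq. vq (y + a * eta (Suc s)) (D - m (Suc h))"
proof -
 have m': "0 <= m h" "m h <= D + B" using m(1,2)[of h] by auto
 let ?x = "eta (Suc s)"
 have x: "vq ?x (- B)" "vg (eta s) D" "PP ?x = eta s" using s chain unfolding ty_def chn_def by auto
 from dichotomy[OF y(1) vq_vg[OF y(2)] m'] show ?thesis
 proof
  assume "vg y (D - m h / qJ)"
  from exact[OF y(2) m' this] show ?thesis using sf_0[OF sf_Fq] m(3) by (intro bexI[of _ 0]) simp_all
 next
  assume yB: "vq y (- B)"
  have "vg (PP y) (- B)" using vg_mono[OF vq_vg[OF y(2)], of "- B"] m'(2) by simp
  moreover have "vg (PP ?x) (- B)" unfolding x(3) using vg_mono[OF x(2)] DB by simp
  ultimately obtain a where a: "a : Fq" "~ vq (y - a * ?x) (- B)" using large_roots[OF yB _ x(1)] by blast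
  let ?y = "y + a * ?x"
  have yE: "?y : E" using y(1) a(1) Fq(3) kS x(1) sf_add[OF S] sf_mult[OF S] unfolding vq_def by blast
  have "vg (a * eta s) D" using vg_scale[OF _ x(2)] a(1) Fq(3) by blast
  hence "vq (PP y + a * eta s) (D - m h)" using vq_dom[OF y(2)] m(1)[of h] by simp
  hence P: "vq (PP ?y) (D - m h)" unfolding PP_add PP_scale[OF a(1)] x(3) .
  have "vg ?y (D - m h / qJ)" using dichotomy[OF yE vq_vg[OF P] m'] a(2) diff_eq by metis
  from exact[OF P m' this] show ?thesis using a(1) m(3) by auto
 qed
qed

definition cl :: "nat => nat => (nat => 'a) => bool" where
 "cl s h b \<longleftrightarrow> (ALL i. b i : Fq) & vq (eta (Suc (s + h)) + (SUM i<h. b i * eta (Suc (s + i)))) (D - m h)"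

lemma comb_E: assumes "!!i. b i : Fq" "!!i. i < h ==> f i : E" shows "(SUM i<h. b i * f i) : E"
proof (rule sf_sum[OF S])
 fix i assume "i : {..<h}"
 thus "b i * f i : E" using assms Fq(3) kS sf_mult[OF S] by blast
qed

lemma PP_comb: assumes "!!i. b i : Fq" "s + h < l" "PP z = eta (Suc (s + h))"
 shows "PP (z + (SUM i<h. b i * eta (Suc (Suc s + i)))) = eta (Suc (s + h)) + (SUM i<h. b i * eta (Suc (s + i)))"
proof -
 have "PP (b i * eta (Suc (Suc s + i))) = b i * eta (Suc (s + i))" if "i < h" for i
  using chain that assms(2) PP_scale[OF assms(1)] unfolding chn_def by simp
 thus ?thesis unfolding PP_add PP_sum assms(3) by simp
qed

text \<open>Raising all indices of the previous combination by one gives a preimage under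
  \<open>PP\<close> of the previous corrected element. \<open>next_root\<close> then supplies the
  coefficient of \<open>eta (Suc s)\<close>, which takes the first position; hence
  \<open>case_nat a b\<close>.\<close>

lemma clean: assumes s: "ty s" "s + h < l" shows "EX b. cl s h b"
 using assms(2)
proof (induction h)
 case 0
 have "vq (eta (Suc s)) (- B)" using s unfolding ty_def by auto
 thus ?case unfolding cl_def m(5) using sf_0[OF sf_Fq] by (intro exI[of _ "%_. 0"]) simp
next
 case (Suc h)
 then obtain b where b: "!!i. b i : Fq" "vq (eta (Suc (s + h)) + (SUM i<h. b i * eta (Suc (s + i)))) (D - m h)" unfolding cl_def by auto
 let ?z = "eta (Suc (Suc (s + h)))"
 let ?y = "?z + (SUM i<h. b i * eta (Suc (Suc s + i)))"
 have "PP ?z = eta (Suc (s + h))" using chain Suc.prems unfolding chn_def by simp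
 from PP_comb[OF b(1) _ this] have P: "vq (PP ?y) (D - m h)" using b(2) Suc.prems by simp
 have yE: "?y : E" using Suc.prems by (intro sf_add[OF S] etaE comb_E b(1)) simp_all
 obtain a where a: "a : Fq" "vq (?y + a * eta (Suc s)) (D - m (Suc h))" using next_root[OF s(1) _ yE P] Suc.prems by auto
 define b' where "b' = case_nat a b"
 have e: "?y + a * eta (Suc s) = eta (Suc (s + Suc h)) + (SUM i<Suc h. b' i * eta (Suc (s + i)))"
  unfolding sum.lessThan_Suc_shift b'_def by (simp add: algebra_simps)
 have "vq (eta (Suc (s + Suc h)) + (SUM i<Suc h. b' i * eta (Suc (s + i)))) (D - m (Suc h))" using a(2) unfolding e .
 moreover have "ALL i. b' i : Fq" unfolding b'_def using a(1) b(1) by (simp split: nat.splits)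
 ultimately show ?case unfolding cl_def by blast
qed

text \<open>The value \<^term>\<open>D - m h\<close> is an integer, which forces a high power of \<^term>\<open>q ^ j\<close> to divide \<^term>\<open>V\<close>.\<close>

lemma V_large: assumes s: "ty s" "s < l" shows "qJ ^ (l - s) <= V"
proof -
 define h where "h = l - s - 1"
 have lh: "l - s = Suc h" unfolding h_def using s by simp
 have "s + h < l" unfolding h_def using s(2) by simp
 then obtain b where "vq (eta (Suc (s + h)) + (SUM i<h. b i * eta (Suc (s + i)))) (D - m h)"
  using clean[OF s(1), of h] unfolding cl_def by blast
 then obtain x :: int where x: "ri x = D - m h" unfolding vq_def by blast
 define A where "A = int q ^ j"
 define v where "v = - val W c"
 have A: "ri A = qJ" unfolding A_def by simp
 have v: "ri v = V" unfolding v_def V_def by simp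
 have pos: "qJ - 1 > 0" "qJ > 0" "real q - 1 > 0" "qJ ^ h > 0" using qj qr by simp_all
 have Dv: "(qJ - 1) * D = V" "qJ * (real q - 1) * B = V" using DB by simp_all
 \<comment> \<open>The equation \<open>x = D - m h\<close> with the denominators of
   \<open>D\<close>, \<open>B\<close> and \<open>m h\<close> cleared, so that it can be read in the
   integers.\<close>
 have "ri (x * (A ^ Suc h * (A - 1) * (int q - 1))) = ri (v * (A ^ Suc h * (int q - 1) - A * (int q - 1) - (A - 1)))"
 proof -
  let ?a = "qJ"
  have mh: "m h * ?a ^ h = D + B" unfolding m_def using pos by simp
  have "ri (x * (A ^ Suc h * (A - 1) * (int q - 1))) = (D - m h) * (?a ^ h * ?a * (?a - 1) * (real q - 1))"
   using x A by (simp add: mult_ac)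
  also have "... = ((?a - 1) * D) * (?a ^ h * ?a * (real q - 1)) - (m h * ?a ^ h) * (?a * (?a - 1) * (real q - 1))"
   by (simp add: algebra_simps)
  also have "... = V * (?a ^ h * ?a * (real q - 1)) - (((?a - 1) * D) * (?a * (real q - 1)) + (?a * (real q - 1) * B) * (?a - 1))"
   unfolding mh Dv(1) using Dv(1) by (simp add: algebra_simps)
  also have "... = V * (?a ^ h * ?a * (real q - 1)) - (V * (?a * (real q - 1)) + V * (?a - 1))" unfolding Dv ..
  also have "... = ri (v * (A ^ Suc h * (int q - 1) - A * (int q - 1) - (A - 1)))"
   unfolding v[symmetric] using A by (simp add: algebra_simps)
  finally show ?thesis .
 qed
 hence e: "x * (A ^ Suc h * (A - 1) * (int q - 1)) = v * (A ^ Suc h * (int q - 1) - A * (int q - 1) - (A - 1))" by (simp only: of_int_eq_iff)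
 have "A ^ Suc h dvd v * (A ^ Suc h * (int q - 1) - A * (int q - 1) - (A - 1))" unfolding e[symmetric] by simp
 \<comment> \<open>The cofactor of \<open>v\<close> is 1 modulo \<open>A\<close>, so the whole power
   of \<open>A\<close> must divide \<open>v\<close>.\<close>
 moreover have "coprime (A ^ Suc h) (A ^ Suc h * (int q - 1) - A * (int q - 1) - (A - 1))"
 proof -
  have "A ^ Suc h * (int q - 1) - A * (int q - 1) - (A - 1) = 1 + A * (A ^ h * (int q - 1) - int q)" by (simp add: algebra_simps)
  moreover have "coprime A (1 + A * (A ^ h * (int q - 1) - int q))"
   by (metis coprime_1_right coprime_iff_gcd_eq_1 gcd_add_mult mult.commute add.commute)
  ultimately show ?thesis by (simp only: coprime_power_left_iff simp_thms)
 qed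
 ultimately have "A ^ Suc h dvd v" by (simp only: coprime_dvd_mult_left_iff)
 moreover have "v > 0" unfolding v_def using cW by simp
 ultimately have "A ^ Suc h <= v" by (rule zdvd_imp_le)
 hence "ri (A ^ Suc h) <= ri v" by (simp only: of_int_le_iff)
 thus ?thesis unfolding lh using A v by simp
qed

lemma vq_prod: "finite A ==> (!!a. a : A ==> vq (f a) r) ==> vq (prod f A) (real (card A) * r)"
proof (induction A rule: finite_induct)
 case empty thus ?case unfolding vq_def using sf_1[OF S] val_1[OF W] by simp
next
 case (insert a A)
 from vq_mult[of "f a" r "prod f A" "real (card A) * r"] show ?case using insert by (simp add: algebra_simps)
qed

lemma vg_prod: "finite A ==> (!!a. a : A ==> vg (f a) r) ==> vg (prod f A) (real (card A) * r)"
proof (induction A rule: finite_induct)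
 case empty thus ?case unfolding vg_def using sf_1[OF S] val_1[OF W] by simp
next
 case (insert a A)
 from vg_mult[of "f a" r "prod f A" "real (card A) * r"] show ?case using insert by (simp add: algebra_simps)
qed

lemma Tp_small: "t <= l ==> (!!i. i <= t ==> vg (eta i) D) ==> vq x r ==> r < D ==> vq (Tp eta t x) (real q ^ t * r)"
proof (induction t arbitrary: x)
 case (Suc t)
 have "vq (Tp eta t (x + a * eta (Suc t))) (real q ^ t * r)" if "a : Fq" for a
  using Suc.prems that Fq(3) by (intro Suc.IH vq_dom[OF _ vg_scale]) auto
 from vq_prod[OF Fq(1) this] show ?case unfolding Fq(2) by (simp add: mult.assoc)
qed simp

lemma Tp_all_small: "t <= l ==> (!!i. i <= t ==> vg (eta i) D) ==> vg x D ==> vg (Tp eta t x) (real q ^ t * D)"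
proof (induction t arbitrary: x)
 case (Suc t)
 have "vg (Tp eta t (x + a * eta (Suc t))) (real q ^ t * D)" if "a : Fq" for a
  using Suc.prems that Fq(3) by (intro Suc.IH vg_add vg_scale) auto
 from vg_prod[OF Fq(1) this] show ?case unfolding Fq(2) by (simp add: mult.assoc)
qed simp

text \<open>In a new factor with \<open>a ~= 0\<close> the shift by \<open>a * eta\<close> may be
  replaced by its corrected version, which dominates \<open>x\<close>. These \<open>q - 1\<close>
  factors and the unshifted one combine through \<open>D - (q - 1) B = D / q^j\<close>.\<close>

lemma Tp_val:
 assumes s: "ty s" "s < l"
 shows "s + h < l ==> h <= i ==> vq x (D - m i) ==> vq (Tp eta (s + h) x) (real q ^ s * (D / qJ ^ h - m i))"
proof (induction h arbitrary: x i)
 case 0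
 thus ?case using Tp_small[of s x "D - m i"] s m(1)[of i] unfolding ty_def by simp
next
 case (Suc h)
 obtain b where b: "!!i. b i : Fq" "vq (eta (Suc (s + h)) + (SUM i<h. b i * eta (Suc (s + i)))) (D - m h)"
  using clean[OF s(1), of h] Suc.prems(1) unfolding cl_def by auto
 let ?c = "eta (Suc (s + h)) + (SUM i<h. b i * eta (Suc (s + i)))"
 define F where "F = (%a. Tp eta (s + h) (x + a * eta (Suc (s + h))))"
 have 0: "vq (F 0) (real q ^ s * (D / qJ ^ h - m i))" unfolding F_def using Suc.IH[of i x] Suc.prems by simp
 have 1: "vq (F a) (real q ^ s * (D / qJ ^ h - m h))" if a: "a : Fq" "a ~= 0" for a
 proof -
  have "vq (a * ?c) (D - m h)" using vq_scale[OF _ a(2) b(2)] a(1) Fq(3) by blast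
  moreover have "D - m h < D - m i" using m(4)[of h i] Suc.prems(2) by simp
  ultimately have "vq (x + a * ?c) (D - m h)" using vq_dom2[OF vq_vg[OF Suc.prems(3)]] by blast
  hence "vq (Tp eta (s + h) (x + a * ?c)) (real q ^ s * (D / qJ ^ h - m h))" using Suc.IH[of h] Suc.prems(1) by simp
  moreover have "x + a * ?c = (x + a * eta (Suc (s + h))) + (SUM i<h. (a * b i) * eta (Suc (s + i)))"
   by (simp only: distrib_left sum_distrib_left mult.assoc add.assoc)
  moreover have "Tp eta (s + h) ((x + a * eta (Suc (s + h))) + (SUM i<h. (a * b i) * eta (Suc (s + i)))) = F a"
   unfolding F_def by (rule Tp_shift_sum) (use b(1) a(1) sf_mult[OF sf_Fq] in auto)
  ultimately show ?thesis by simp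
 qed
 have "Tp eta (s + Suc h) x = (PROD a:Fq. F a)" unfolding F_def by simp
 also have "... = F 0 * (PROD a:Fq - {0}. F a)" using Fq(1) sf_0[OF sf_Fq] by (rule prod.remove)
 finally have e: "Tp eta (s + Suc h) x = F 0 * (PROD a:Fq - {0}. F a)" .
 have "card (Fq - {0}) = q - 1" using Fq sf_0[OF sf_Fq] by simp
 hence "vq (PROD a:Fq - {0}. F a) (real (q - 1) * (real q ^ s * (D / qJ ^ h - m h)))"
  using vq_prod[of "Fq - {0}" F] 1 Fq(1) by (metis Diff_iff finite_Diff singletonI)
 from vq_mult[OF 0 this] have "vq (Tp eta (s + Suc h) x)
  (real q ^ s * (D / qJ ^ h - m i) + real (q - 1) * (real q ^ s * (D / qJ ^ h - m h)))" unfolding e .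
 moreover have "real q ^ s * (D / qJ ^ h - m i) + real (q - 1) * (real q ^ s * (D / qJ ^ h - m h))
  = real q ^ s * (D / qJ ^ Suc h - m i)"
 proof -
  have q1: "real (q - 1) = real q - 1" using q4 by simp
  have "D / qJ ^ h - m h = - B / qJ ^ h" unfolding m_def by (simp add: diff_divide_distrib[symmetric])
  hence "D / qJ ^ h + (real q - 1) * (D / qJ ^ h - m h) = (D - (real q - 1) * B) / qJ ^ h"
   by (simp add: diff_divide_distrib)
  also have "... = D / qJ ^ Suc h" unfolding DB(5) by (simp add: mult.commute)
  finally have "D / qJ ^ h + (real q - 1) * (D / qJ ^ h - m h) = D / qJ ^ Suc h" .
  moreover have "S * (x - mi) + r * (S * (x - y)) = S * ((x + r * (x - y)) - mi)" for S x mi r y :: real by (simp add: algebra_simps)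
  ultimately show ?thesis unfolding q1 by (simp only:)
 qed
 ultimately show ?case by simp
qed

lemma Tp_chain_val:
 assumes s: "ty s" "s + h < l"
 shows "vq (Tp eta (s + h) (eta (Suc (s + h)))) (- (real q ^ s * B / qJ ^ h))"
proof -
 obtain b where b: "!!i. b i : Fq" "vq (eta (Suc (s + h)) + (SUM i<h. b i * eta (Suc (s + i)))) (D - m h)"
  using clean[OF s] unfolding cl_def by auto
 have "vq (Tp eta (s + h) (eta (Suc (s + h)) + (SUM i<h. b i * eta (Suc (s + i))))) (real q ^ s * (D / qJ ^ h - m h))"
  using Tp_val[OF s(1) _ s(2) order_refl b(2)] s(2) by simp
 moreover have "Tp eta (s + h) (eta (Suc (s + h)) + (SUM i<h. b i * eta (Suc (s + i)))) = Tp eta (s + h) (eta (Suc (s + h)))"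
  by (rule Tp_shift_sum) (use b(1) in auto)
 moreover have "real q ^ s * (D / qJ ^ h - m h) = - (real q ^ s * B / qJ ^ h)"
  unfolding m_def by (simp add: diff_divide_distrib[symmetric])
 ultimately show ?thesis by simp
qed

text \<open>Pole order allowed for a product of \<open>d\<close> centred factors. Below type
  \<open>l\<close> each full round of \<open>q\<close> factors has one close to the root and
  \<open>q - 1\<close> of value \<open>- B\<close>, and the \<open>d mod q\<close> remaining ones
  are estimated by \<open>- B\<close>. At type \<open>l\<close> every factor is estimated by
  \<open>- B\<close>.\<close>

definition Kd :: "nat => nat => real" where
 "Kd s d = (if s < l then real (d mod q) * B - real (d div q) * (D - m (l - s) - (real q - 1) * B) else real d * B)"

text \<open>The \<open>q\<close> centres of a round differ by \<open>Fq\<close>-multiples of the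
  large \<open>eta (Suc s)\<close>, and exactly one of them is the good approximation, whichever
  root \<open>z\<close> is. So the centres can be fixed in the lower field before a root is
  chosen.\<close>

lemma center_product:
 assumes s: "ty s" "s < l" and b: "cl s (l - s - 1) b" and z: "z : E" "PP z = eta l" and en: "bij_betw en {..<q} Fq"
 shows "vg (PROD t<d. z - ((SUM i<l - s - 1. b i * eta (Suc (Suc s + i))) + en (t mod q) * eta (Suc s))) (- Kd s d)"
proof -
 define h where "h = l - s - 1"
 have lh: "l - s = Suc h" "l = Suc (s + h)" unfolding h_def using s by simp_all
 have b': "!!i. b i : Fq" "vq (eta (Suc (s + h)) + (SUM i<h. b i * eta (Suc (s + i)))) (D - m h)" using b unfolding cl_def h_def by auto
 define y where "y = z + (SUM i<h. b i * eta (Suc (Suc s + i)))"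
 define x where "x = eta (Suc s)"
 have yE: "y : E" unfolding y_def using lh by (intro sf_add[OF S] z(1) comb_E b'(1) etaE) simp
 have "PP y = eta (Suc (s + h)) + (SUM i<h. b i * eta (Suc (s + i)))" unfolding y_def
  using PP_comb[OF b'(1), of s h z] z(2) lh by simp
 then obtain a where a: "a : Fq" "vq (y + a * x) (D - m (Suc h))" unfolding x_def using next_root[OF s yE] b'(2) by metis
 have x: "vq x (- B)" using s unfolding ty_def x_def by blast
 have mm: "m (Suc h) < D + B" using m(4)[of 0 "Suc h"] m(5) by simp
 have other: "vq (y + a' * x) (- B)" if a': "a' : Fq" "a' ~= a" for a'
 proof -
  have "a + a' : Fq" "a + a' ~= 0" using sf_add[OF sf_Fq a(1) a'(1)] a'(2) by (simp, metis diff_eq right_minus_eq)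
  hence "vq ((a + a') * x) (- B)" using vq_scale[OF _ _ x] Fq(3) by blast
  hence "vq ((y + a * x) + (a + a') * x) (- B)" using vq_dom2[OF vq_vg[OF a(2)]] mm by simp
  moreover have "(y + a * x) + (a + a') * x = y + a' * x + (a * x + a * x)" by (simp only: distrib_right add.assoc add.commute add.left_commute)
  ultimately show ?thesis by (simp add: add_self)
 qed
 define f where "f = (%t. y + en t * x)"
 have f: "z - ((SUM i<h. b i * eta (Suc (Suc s + i))) + en (t mod q) * eta (Suc s)) = f (t mod q)" for t
  unfolding f_def y_def x_def by (simp add: diff_eq add.assoc)
 have fB: "vg (f t) (- B)" if "t < q" for t
 proof (cases "en t = a")
  case True thus ?thesis unfolding f_def using vg_mono[OF vq_vg[OF a(2)], of "- B"] mm by simp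
 next
  case False thus ?thesis unfolding f_def using other[of "en t"] en that vq_vg by (auto simp: bij_betw_def)
 qed
 have full: "vq (PROD t<q. f t) (D - m (Suc h) - (real q - 1) * B)"
 proof -
  have "(PROD t<q. f t) = (PROD a':Fq. y + a' * x)" unfolding f_def using prod.reindex_bij_betw[OF en, of "%a'. y + a' * x"] .
  also have "... = (y + a * x) * (PROD a':Fq - {a}. y + a' * x)" using Fq(1) a(1) by (rule prod.remove)
  finally have e: "(PROD t<q. f t) = (y + a * x) * (PROD a':Fq - {a}. y + a' * x)" .
  have "vq (PROD a':Fq - {a}. y + a' * x) (real (card (Fq - {a})) * (- B))" using other Fq(1) by (intro vq_prod) auto
  moreover have "real (card (Fq - {a})) = real q - 1" using Fq a(1) q4 by simp
  ultimately have "vq (PROD a':Fq - {a}. y + a' * x) ((real q - 1) * - B)" by simp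
  from vq_mult[OF a(2) this] show ?thesis unfolding e by simp
 qed
 define n where "n = d div q" define i where "i = d mod q"
 have iq: "i < q" unfolding i_def using q0 by simp
 have d: "d = n * q + i" unfolding n_def i_def by simp
 have "(PROD t<d. f (t mod q)) = (PROD t<q. f t) ^ n * (PROD t<i. f t)" unfolding d by (rule prod_mod_div[OF iq])
 moreover have "vg (PROD t<i. f t) (real (card {..<i}) * (- B))" using fB iq by (intro vg_prod) simp_all
 moreover have "vq ((PROD t<q. f t) ^ n) (real n * (D - m (Suc h) - (real q - 1) * B))" by (rule vq_power[OF full])
 ultimately have "vg (PROD t<d. f (t mod q)) (real n * (D - m (Suc h) - (real q - 1) * B) + real i * (- B))"
  using vg_mult[OF vq_vg] by (metis card_lessThan)
 thus ?thesis unfolding Kd_def f[unfolded h_def] using s(2) lh by (simp add: n_def i_def algebra_simps)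
qed

lemma center_product_last:
 assumes s: "ty l" and z: "z : E" "PP z = eta l" shows "vg (PROD t<d. z - 0) (- Kd l d)"
proof -
 have "vg (PP z) (D - 0)" using s z(2) unfolding ty_def by simp
 from dichotomy[OF z(1) this] have "vg z (- B)" using DB vg_mono[of z D "- B"] vq_vg by auto
 hence "vg (PROD t<d. z) (real (card {..<d}) * (- B))" by (intro vg_prod) simp_all
 thus ?thesis unfolding Kd_def by simp
qed

text \<open>The extreme case \<open>m = D + B\<close> of \<open>dichotomy\<close>, where
  \<open>D - m = - B\<close>.\<close>

lemma PP_lower: assumes z: "z : E" "vg (PP z) (- B)" shows "vg z (- B)"
proof -
 have "vg (PP z) (D - (D + B))" using z(2) by simp
 from dichotomy[OF z(1) this] have "vg z (D - (D + B) / qJ) | vq z (- B)" using DB by simp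
 moreover have "(D + B) / qJ <= D + B" using m(2)[of 1] by (simp add: m_def)
 ultimately show ?thesis using vg_mono[of z "D - (D + B) / qJ" "- B"] vq_vg by auto
qed

lemma root_lower: assumes z: "z : E" "PP z = eta l" shows "vg z (- V)"
proof -
 have "i <= l ==> vg (eta i) (- B)" for i
 proof (induction i)
  case 0 thus ?case using chain vg_0 by (simp add: chn_def)
 next
  case (Suc i) thus ?case using chain PP_lower[OF etaE[of "Suc i"]] by (simp add: chn_def)
 qed
 hence "vg z (- B)" using PP_lower[OF z(1)] z(2) by simp
 moreover have "- V <= - B"
 proof -
  have "1 * B <= (qJ * (real q - 1)) * B"
  proof (intro mult_right_mono)
   have "1 * 1 <= qJ * (real q - 1)" using qj qr by (intro mult_mono) linarith+
   thus "1 <= qJ * (real q - 1)" by simp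
  qed (use DB in simp)
  thus ?thesis using DB(4) by simp
 qed
 ultimately show ?thesis using vg_mono by blast
qed

text \<open>For \<open>s < l\<close> the gains of full rounds nearly cancel the losses, leaving a
  main term of the order of \<open>V\<close> divided by \<open>q^j\<close> to the power
  \<open>l - s\<close>. Rounding up costs at most 1 for each \<open>d\<close>, which
  \<open>V_large\<close> (or \<open>V >= 1\<close> at type \<open>l\<close>) absorbs into a second
  term of that size; hence the factor 2.\<close>

lemma cost:
 assumes s: "ty s"
 shows "(SUM d<q ^ (j + 1). ri \<lceil>Kd s d\<rceil>) <= 2 * real (q ^ (j + 1)) * V / qJ ^ (l - s)"
proof -
 define Q where "Q = q ^ (j + 1)"
 have QA: "Q = q ^ j * q" "real Q = qJ * real q" unfolding Q_def by simp_all
 have "(SUM d<Q. ri \<lceil>Kd s d\<rceil>) <= (SUM d<Q. Kd s d + 1)" by (intro sum_mono) linarith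
 hence 1: "(SUM d<Q. ri \<lceil>Kd s d\<rceil>) <= (SUM d<Q. Kd s d) + real Q" by (simp add: sum.distrib)
 have gauss: "(SUM i<n. real i) = real n * (real n - 1) / 2" for n by (induction n) (simp_all add: field_simps)
 hence gc: "(SUM a<n. real a * x) = real n * (real n - 1) / 2 * x" for n x by (simp add: sum_distrib_right[symmetric])
 have A: "qJ > 0" "real q - 1 > 0" using qj qr by simp_all
 show ?thesis
 proof (cases "s < l")
  case False
  hence sl: "s = l" using s unfolding ty_def by simp
  have "(SUM d<Q. Kd s d) = real Q * (real Q - 1) / 2 * B" unfolding Kd_def sl using gauss[of Q] by (simp add: sum_distrib_right[symmetric])
  also have "... <= real Q * real Q / 2 * B" using DB(2) by (intro mult_right_mono) (simp_all add: algebra_simps)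
  also have "... = real Q * (qJ * (real q / 2) * B)" unfolding QA by simp
  also have "... <= real Q * (qJ * (real q - 1) * B)" using qr A DB(2) by (intro mult_left_mono mult_right_mono) simp_all
  finally have "(SUM d<Q. Kd s d) <= real Q * V" using DB(4) by simp
  moreover have "real Q <= real Q * V" using V1 by (simp add: mult_le_cancel_left1)
  ultimately show ?thesis using 1 unfolding sl Q_def[symmetric] by simp
 next
  case True
  define M where "M = qJ ^ (l - s)"
  have M: "M > 0" "M <= V" unfolding M_def using V_large[OF s True] qj by (simp_all add: q0)
  define Z where "Z = D - m (l - s) - (real q - 1) * B"
  have "(SUM d<Q. Kd s d) = (SUM d<q ^ j * q. (%a i. real i * B - real a * Z) (d div q) (d mod q))"
   unfolding Kd_def Z_def[symmetric] QA using True by simp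
  also have "... = (SUM a<q ^ j. SUM i<q. real i * B - real a * Z)" by (rule sum_mod_div[OF q0(1)])
  also have "... = (SUM a<q ^ j. (real q * (real q - 1) / 2 * B) - real a * (real q * Z))"
   by (rule sum.cong) (simp_all add: sum_subtractf gc)
  also have "... = qJ * (real q * (real q - 1) / 2 * B) - qJ * (qJ - 1) / 2 * (real q * Z)"
   by (simp only: sum_subtractf gc sum_constant card_lessThan of_nat_power)
  also have "... = real q / 2 * (qJ * (real q - 1) * B - (qJ - 1) * (qJ * Z))"
  proof -
   have "a * (r * (r - 1) / 2 * b) - a * (a - 1) / 2 * (r * y) = r / 2 * (a * (r - 1) * b - (a - 1) * (a * y))" for a b r y :: real
   by (simp add: field_simps)
   thus ?thesis .
  qed
  also have "qJ * Z = D - qJ * m (l - s)" unfolding Z_def using DB(5) A by (simp add: right_diff_distrib algebra_simps)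
  also have "qJ * (real q - 1) * B - (qJ - 1) * (D - qJ * m (l - s)) = (qJ - 1) * qJ * m (l - s)"
   using DB(3,4) by (simp add: algebra_simps)
  finally have 2: "(SUM d<Q. Kd s d) = real Q / 2 * ((qJ - 1) * m (l - s))" unfolding QA by (simp add: mult_ac)
  have "(qJ - 1) * (D + B) <= (qJ - 1) * (2 * D)" using qj B_le_D by (intro mult_left_mono) simp_all
  hence "(qJ - 1) * (D + B) <= 2 * V" using DB(3) by simp
  hence "(qJ - 1) * m (l - s) <= 2 * V / M" unfolding m_def M_def[symmetric] using M by (simp add: divide_right_mono)
  hence "real Q / 2 * ((qJ - 1) * m (l - s)) <= real Q / 2 * (2 * V / M)" by (intro mult_left_mono) simp_all
  hence k1: "(SUM d<Q. Kd s d) <= real Q * V / M" unfolding 2 by simp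
  have "real Q * 1 <= real Q * (V / M)" using M by (intro mult_left_mono) simp_all
  hence k2: "real Q <= real Q * V / M" by simp
  have k3: "2 * real Q * V / M = real Q * V / M + real Q * V / M" by simp
  have "(SUM d<Q. ri \<lceil>Kd s d\<rceil>) <= 2 * real Q * V / M"
   unfolding k3 using order_trans[OF 1 add_mono[OF k1 k2]] .
  thus ?thesis unfolding M_def[symmetric] Q_def[symmetric] .
 qed
qed

end

section \<open>Roots away from the poles of c\<close>

context drin
begin

lemma Q_gt: "1 < q ^ (j + 1)" "q ^ j < q ^ (j + 1)" "0 < q ^ j"
proof -
 have "1 < q" using q4 by simp
 thus "1 < q ^ (j + 1)" by (rule one_less_power) simp
 show "q ^ j < q ^ (j + 1)" using `1 < q` by (rule power_strict_increasing[rotated]) simp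
 show "0 < q ^ j" using q0 by simp
qed

text \<open>For \<open>z\<close> outside \<open>W\<close>, dividing the equation by
  \<open>z^(q^(j + 1))\<close> would express 1 through positive powers of \<open>inverse z\<close>
  and so place 1 in the maximal ideal.\<close>

lemma integral_root:
 assumes F: "ff k E" and W: "W : places k E" and cz: "c : W" "PP z : W" "z : E" shows "z : W"
proof (rule ccontr)
 interpret F: ff k E by (rule F)
 note r = sring_simps[OF F.PlD(1)[OF W]]
 assume z: "z ~: W"
 hence z0: "z ~= 0" using r(4) by auto
 define u where "u = inverse z"
 have uW: "u : W" using F.PlD(5)[OF W cz(3)] z unfolding u_def by blast
 have u: "u : mx W" unfolding mx_def u_def using uW z z0 unfolding u_def by simp
 have uz: "u * z = 1" "z * u = 1" unfolding u_def using z0 by simp_all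
 define N where "N = q ^ j * (q - 1)" define M where "M = q ^ (j + 1) - 1"
 have qp: "q ^ j > 0" "N > 0" "M > 0" "N + q ^ j = q ^ (j + 1)" "M + 1 = q ^ (j + 1)"
 proof -
  show a: "q ^ j > 0" using q0 by simp
  show "N > 0" unfolding N_def using a q4 by simp
  show "N + q ^ j = q ^ (j + 1)" unfolding N_def using q4 by (simp add: algebra_simps)
  show "M > 0" "M + 1 = q ^ (j + 1)" unfolding M_def using Q_gt(1) by linarith+
 qed
 have p1: "z ^ (q ^ (j + 1)) * u ^ (q ^ (j + 1)) = 1" by (simp only: power_mult_distrib[symmetric] uz power_one)
 have p2: "z ^ (q ^ j) * u ^ (q ^ (j + 1)) = u ^ N"
  unfolding power_add[of u N "q ^ j", unfolded qp(4)]
  by (simp only: mult.left_commute[of "z ^ (q ^ j)" "u ^ N"] power_mult_distrib[symmetric] uz power_one mult_1_right)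
 have p3: "z * u ^ (q ^ (j + 1)) = u ^ M"
  unfolding power_add[of u M 1, unfolded qp(5) power_one_right]
  by (simp only: mult.left_commute[of z "u ^ M"] uz mult_1_right)
 have "PP z * u ^ (q ^ (j + 1)) = 1 + c * u ^ N + u ^ M"
  unfolding PP_def distrib_right p1 p3 by (simp only: mult.assoc p2)
 hence e: "1 = PP z * u ^ (q ^ (j + 1)) - c * u ^ N - u ^ M" by simp
 have pw: "u ^ n : mx W" if "n > 0" for n
  using F.mx_mult[OF W u sring_power[OF F.PlD(1)[OF W] uW, of "n - 1"]] that by (metis power_eq_if not_gr_zero)
 note sm = F.ssp_mx[OF W]
 have "PP z * u ^ (q ^ (j + 1)) : mx W" "c * u ^ N : mx W" "u ^ M : mx W"
  using F.mx_mult[OF W pw cz(2), of "q ^ (j + 1)"] F.mx_mult[OF W pw[OF qp(2)] cz(1)] pw[OF qp(3)] Q_gt(1)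
  by (simp_all only: mult.commute[of "PP z"] mult.commute[of c])
 hence "1 : mx W" by (subst e) (intro F.sub_diff[OF sm])
 thus False using r(1) unfolding mx_def by simp
qed

lemma Fq_enum: "EX en. bij_betw en {..<q} Fq"
 using ex_bij_betw_nat_finite[OF Fq(1)] Fq(2) by (simp add: atLeast0LessThan)

text \<open>\<open>q^(j + 1)\<close> distinct roots exhaust the monic polynomial
  \<open>PP X - e\<close>, so the product of the linear factors has coefficients in the lower
  field.\<close>

lemma roots_poly:
 assumes S: "sf S" "c : S" "e : S" and Z: "card Z = q ^ (j + 1)" "!!z. z : Z ==> PP z = e"
 shows "pk S (PROD z:Z. [:- z, 1:])"
proof -
 let ?p = "monom 1 (q ^ (j + 1)) + (monom c (q ^ j) + monom 1 1 + [:- e:])"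
 have lt: "degree (monom c (q ^ j) + monom 1 1 + [:- e:]) < q ^ (j + 1)"
 proof -
  have "degree (monom c (q ^ j)) < q ^ (j + 1)" using degree_monom_le[of c "q ^ j"] Q_gt(2) by linarith
  moreover have "degree (monom 1 1 :: 'a poly) < q ^ (j + 1)" using degree_monom_le[of "1::'a" 1] Q_gt(1) by linarith
  moreover have "degree [:- e:] < q ^ (j + 1)" using Q_gt by simp
  ultimately show ?thesis by (intro degree_add_less)
 qed
 have d: "degree ?p = q ^ (j + 1)" using degree_add_eq_left[of "monom c (q ^ j) + monom 1 1 + [:- e:]" "monom 1 (q ^ (j + 1))"] lt by (simp add: degree_monom_eq)
 have "?p = (PROD z:Z. [:- z, 1:])"
 proof (rule poly_eq_prod_roots)
  show "finite Z" using Z(1) q0 by (metis card.infinite less_irrefl zero_less_power)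
  show "degree ?p = card Z" using d Z(1) by simp
  show "lead_coeff ?p = 1" unfolding d by (subst coeff_add) (simp only: coeff_eq_0[OF lt] coeff_monom, simp)
  show "poly ?p z = 0" if "z : Z" for z
  proof -
   have "poly ?p z = PP z - e" by (simp add: poly_monom PP_def add.assoc)
   thus ?thesis using Z(2)[OF that] by simp
  qed
 qed
 moreover have "pk S ?p"
  by (intro pk_add[OF S(1)] pk_monom[OF S(1)] pk_const[OF S(1)] sf_uminus[OF S(1)] sf_1[OF S(1)] S(2,3))
 ultimately show ?thesis by simp
qed

end

section \<open>Distribution of the types and total cost of one level\<close>

locale tow = drin k c q j + ff k S for k S :: "'a::field set" and c q j +
 fixes eta :: "nat => 'a" and l :: nat
 assumes cS: "c : S" and chain: "chn eta l" and l: "l >= 1" and etaS: "!!i. i <= l ==> eta i : S"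
begin

definition Tc :: "'a set set" where "Tc = {V : Pl. val V c < 0}"
definition vv :: "'a set => real" where "vv V = - ri (val V c)"
definition st :: "'a set => nat" where "st V = (SOME s. drin_chain.ty S c q j V eta l s)"
definition n :: real where "n = real (fdeg (adj k c) S)"
definition rh :: real where "rh = 1 / (real q - 1)"

lemma loc: "V : Tc ==> drin_chain k S c q j V eta l"
 unfolding drin_chain_def drin_loc_def drin_chain_axioms_def drin_loc_axioms_def Tc_def
 using drin_axioms ff_axioms cS chain l etaS by auto

lemma st: "V : Tc ==> drin_chain.ty S c q j V eta l (st V)"
 unfolding st_def by (rule someI_ex[OF drin_chain.ty_exists[OF loc]])

lemma st_le: "V : Tc ==> st V <= l" using st drin_chain.ty_def[OF loc] by blast

lemma vv: "V : Tc ==> drin_loc.V c V = vv V"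
 using drin_loc.V_def[of k S c q j V] loc unfolding vv_def drin_chain_def by blast

lemma finite_Tc: "finite Tc"
proof -
 have "Tc <= {V. pol c V ~= 0}" unfolding Tc_def pol_def by auto
 thus ?thesis using isdivD(2)[OF isdiv_pol[OF cS c0]] finite_subset by blast
qed

text \<open>All places have degree 1, so the pole orders of \<open>c\<close> add up to the degree of
  its pole divisor, which is the degree over \<open>k(c)\<close> by \<open>dg_pol\<close>.\<close>

lemma sum_vv: "(SUM V:Tc. vv V) = n"
proof -
 have "dg (pol c) = (SUM V:Tc. pol c V * int (pdeg k V))" by (rule dg_superset[OF finite_Tc]) (auto simp: Tc_def pol_def split: if_splits)
 also have "... = (SUM V:Tc. - val V c)" by (rule sum.cong) (auto simp: Tc_def pol_def acl_pdeg[OF acl])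
 finally have "int (fdeg (adj k c) S) = (SUM V:Tc. - val V c)" using dg_pol[OF cS c] by simp
 hence "n = ri (SUM V:Tc. - val V c)" unfolding n_def by (metis of_int_of_nat_eq)
 thus ?thesis unfolding vv_def of_int_sum of_int_minus by simp
qed

lemma vv_pos: "V : Tc ==> vv V >= 1" unfolding vv_def Tc_def by auto

lemma eta_integral: assumes "V : Pl" "V ~: Tc" shows "i <= l ==> eta i : V"
proof (induction i)
 case 0 thus ?case using chain sring_0[OF PlD(1)[OF assms(1)]] by (simp add: chn_def)
next
 case (Suc i)
 have "c : V" using val_ge_0[OF assms(1) cS c0] assms unfolding Tc_def by simp
 moreover have "PP (eta (Suc i)) = eta i" using chain Suc by (simp add: chn_def)
 ultimately show ?case using integral_root[OF ff_axioms assms(1)] Suc etaS by simp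
qed

lemma Tp_in: assumes R: "sring R" "Fq <= R" shows "(!!t. t <= i ==> eta t : R) ==> x : R ==> Tp eta i x : R"
proof (induction i arbitrary: x)
 case (Suc i)
 have "Tp eta i (x + a * eta (Suc i)) : R" if "a : Fq" for a
  by (rule Suc.IH) (use Suc.prems that R(2) sring_add[OF R(1)] sring_mult[OF R(1)] in auto)
 thus ?case by (simp add: sring_prod[OF R(1)])
qed simp

lemma rho: "rh > 0" "rh <= 1 / 3" "1 / real q <= rh" "2 / qJ <= rh"
proof -
 show "rh > 0" "rh <= 1 / 3" "1 / real q <= rh" unfolding rh_def using qr by (simp_all add: field_simps)
 have "real q ^ 2 <= qJ" using qr j by (intro power_increasing) simp_all
 hence "2 / qJ <= 2 / real q ^ 2" using qr by (intro divide_left_mono) simp_all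
 also have "... <= rh"
 proof -
  have g: "2 / x ^ 2 <= 1 / (x - 1)" if "x > 1" for x :: real
  proof -
   have "0 <= (x - 1) * (x - 1)" by simp
   hence "2 * (x - 1) <= x ^ 2" by (simp add: algebra_simps power2_eq_square)
   thus ?thesis using that by (simp add: divide_le_eq le_divide_eq mult.commute)
  qed
  show ?thesis unfolding rh_def by (rule g) (use qr in simp)
 qed
 finally show "2 / qJ <= rh" .
qed

text \<open>The product of all \<^term>\<open>eta (Suc s) + u\<close>, \<^term>\<open>u\<close> in the span of \<^term>\<open>eta 1\<close>, ..., \<^term>\<open>eta s\<close>, is integral outside the poles of \<^term>\<open>c\<close>;
 since its divisor has degree zero, the zeros at the places of type above \<^term>\<open>s\<close> are outweighed by the poles at the others.\<close>

lemma type_balance: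
 assumes s: "s < l"
 shows "real q ^ s / (qJ - 1) * (SUM V | V : Tc & s < st V. vv V)
  <= (SUM V | V : Tc & st V <= s. real q ^ st V / (qJ ^ (s - st V) * (qJ * (real q - 1))) * vv V)"
proof -
 define f where "f = Tp eta s (eta (Suc s))"
 have f0: "f ~= 0" unfolding f_def using Tp_nonzero[OF chain s] .
 have fS: "f : S" unfolding f_def by (rule Tp_in[OF sring_sf[OF S]]) (use Fq(3) kS etaS s in auto)
 have hi: "real q ^ s / (qJ - 1) * vv V <= ri (val V f)" if V: "V : Tc" "s < st V" for V
 proof -
  interpret L: drin_chain k S c q j V eta l by (rule loc[OF V(1)])
  have "L.vg (eta i) L.D" if "i <= Suc s" for i using st[OF V(1)] V(2) that unfolding L.ty_def by auto
  hence "L.vg f (real q ^ s * L.D)" unfolding f_def using s by (intro L.Tp_all_small) auto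
  thus ?thesis using f0 unfolding L.vg_def L.D_def vv[OF V(1)] by simp
 qed
 have lo: "- (real q ^ st V / (qJ ^ (s - st V) * (qJ * (real q - 1))) * vv V) <= ri (val V f)" if V: "V : Tc" "st V <= s" for V
 proof -
  interpret L: drin_chain k S c q j V eta l by (rule loc[OF V(1)])
  have "L.vq (Tp eta (st V + (s - st V)) (eta (Suc (st V + (s - st V))))) (- (real q ^ st V * L.B / qJ ^ (s - st V)))"
   by (rule L.Tp_chain_val[OF st[OF V(1)]]) (use V s in simp)
  hence "L.vq f (- (real q ^ st V * L.B / qJ ^ (s - st V)))" unfolding f_def using V(2) by simp
  thus ?thesis unfolding L.vq_def L.B_def vv[OF V(1)] by (simp add: mult.commute)
 qed
 let ?T = "{V. pr f V ~= 0} Un Tc"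
 have T: "finite ?T" using finite_Tc isdivD(2)[OF isdiv_pr[OF fS f0]] by simp
 have TP: "?T <= Pl" unfolding pr_def Tc_def by auto
 have "0 = dg (pr f)" using dg_pr[OF fS f0] by simp
 also have "... = (SUM V:?T. pr f V * int (pdeg k V))" by (rule dg_superset[OF T]) auto
 also have "... = (SUM V:?T. val V f)" by (rule sum.cong) (use TP in "auto simp: pr_def acl_pdeg[OF acl]")
 finally have z: "(SUM V:?T. val V f) = 0" by simp
 have "(SUM V:Tc. val V f) <= (SUM V:?T. val V f)"
 proof (rule sum_mono2[OF T])
  fix V assume V: "V : ?T - Tc"
  hence VP: "V : Pl" "V ~: Tc" using TP by auto
  have "f : V" unfolding f_def
   by (rule Tp_in[OF PlD(1)[OF VP(1)]]) (use Fq(3) PlD(2)[OF VP(1)] eta_integral[OF VP] s in auto)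
  thus "0 <= val V f" using val_ge_0[OF VP(1) fS f0] by simp
 qed simp
 hence "(SUM V:Tc. val V f) <= 0" using z by simp
 hence le: "(SUM V:Tc. ri (val V f)) <= 0" by (metis of_int_sum of_int_le_0_iff)
 define T1 where "T1 = {V. V : Tc & s < st V}"
 define T2 where "T2 = {V. V : Tc & st V <= s}"
 have T12: "T1 Un T2 = Tc" "T1 Int T2 = {}" unfolding T1_def T2_def by auto
 have T12': "finite T1" "finite T2" using T12(1) finite_Tc by (metis finite_Un)+
 have "(SUM V:Tc. ri (val V f)) = (SUM V | V : Tc & s < st V. ri (val V f)) + (SUM V | V : Tc & st V <= s. ri (val V f))"
  using sum.union_disjoint[OF T12' T12(2), of "%V. ri (val V f)"] unfolding T12(1) unfolding T1_def T2_def .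
 moreover have "(SUM V | V : Tc & s < st V. real q ^ s / (qJ - 1) * vv V) <= (SUM V | V : Tc & s < st V. ri (val V f))"
  by (rule sum_mono) (use hi in auto)
 moreover have "(SUM V | V : Tc & st V <= s. - (real q ^ st V / (qJ ^ (s - st V) * (qJ * (real q - 1))) * vv V)) <= (SUM V | V : Tc & st V <= s. ri (val V f))"
  by (rule sum_mono) (use lo in auto)
 ultimately show ?thesis using le by (simp add: sum_negf sum_distrib_left)
qed

text \<open>The factor \<open>1 - 1 / q^j\<close> comes from \<open>(q^j - 1) / q^j\<close> in
  \<open>type_fraction\<close>; together with \<open>1 / q <= rh\<close> it is just enough for the
  induction.\<close>

lemma geometric_bound:
 "(1 - 1 / qJ) * (SUM t<=s. (1 / (real q * qJ)) ^ (s - t) * rh ^ t) <= rh ^ s"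
proof (induction s)
 case 0
 show ?case by simp
next
 case (Suc s)
 let ?y = "1 / (real q * qJ)"
 let ?G = "%s. SUM t<=s. ?y ^ (s - t) * rh ^ t"
 have "?G (Suc s) = ?y * ?G s + rh ^ Suc s"
  unfolding sum_distrib_left by (simp add: Suc_diff_le mult.assoc)
 hence "(1 - 1 / qJ) * ?G (Suc s) = ?y * ((1 - 1 / qJ) * ?G s) + (1 - 1 / qJ) * rh ^ Suc s" by (simp only: distrib_left mult.left_commute)
 also have "... <= ?y * rh ^ s + (1 - 1 / qJ) * rh ^ Suc s" using Suc by (intro add_right_mono mult_left_mono) simp_all
 also have "... <= rh ^ Suc s"
 proof -
  have "?y * rh ^ s = (1 / real q) * (1 / qJ * rh ^ s)" by simp
  also have "... <= rh * (1 / qJ * rh ^ s)" using rho by (intro mult_right_mono) simp_all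
  finally have "?y * rh ^ s <= 1 / qJ * rh ^ Suc s" by (simp add: mult.left_commute)
  thus ?thesis by (simp add: left_diff_distrib)
 qed
 finally show ?case .
qed

text \<open>Each further small member of the chain costs a factor \<open>1 / (q - 1)\<close> in
  weight: \<open>type_balance\<close> bounds the places of type above \<open>s\<close> by those of
  type at most \<open>s\<close>, which are under control by induction. Those of type exactly
  \<open>t\<close> are counted crudely among all of type at least \<open>t\<close>.\<close>

lemma type_fraction: "s <= l ==> (SUM V | V : Tc & s <= st V. vv V) <= n * rh ^ s"
proof (induction s rule: less_induct)
 case (less s)
 show ?case
 proof (cases s)
  case 0
  thus ?thesis using sum_vv by simp
 next
  case (Suc s')
  define a where "a = qJ"
  have a: "a >= 16" "a > 0" unfolding a_def
  proof -
   have "real q ^ 2 <= qJ" using qr j by (intro power_increasing) simp_all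
   moreover have "real q ^ 2 >= 4 ^ 2" using qr by (intro power_mono) simp_all
   ultimately show "qJ >= 16" by simp
   thus "qJ > 0" by linarith
  qed
  have n0: "n >= 0" unfolding n_def by simp
  have fib: "(SUM V | V : Tc & st V = t. vv V) <= n * rh ^ t" if "t <= s'" for t
  proof -
   have "(SUM V | V : Tc & st V = t. vv V) <= (SUM V | V : Tc & t <= st V. vv V)"
   by (rule sum_mono2) (use finite_Tc vv_pos in "auto intro: order.trans[OF zero_le_one]")
   thus ?thesis using less.IH[of t] that Suc less.prems by simp
  qed
  have coef: "real q ^ t / (a ^ (s' - t) * (a * (real q - 1))) >= 0" for t using a qr by simp
  have "real q ^ s' / (a - 1) * (SUM V | V : Tc & s' < st V. vv V)
   <= (SUM V | V : Tc & st V <= s'. real q ^ st V / (a ^ (s' - st V) * (a * (real q - 1))) * vv V)"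
   unfolding a_def using type_balance[of s'] less.prems Suc by simp
  also have "... = (SUM t<=s'. SUM V | V : {V. V : Tc & st V <= s'} & st V = t. real q ^ st V / (a ^ (s' - st V) * (a * (real q - 1))) * vv V)"
   by (rule sum.group[symmetric]) (use finite_Tc in auto)
  also have "... = (SUM t<=s'. real q ^ t / (a ^ (s' - t) * (a * (real q - 1))) * (SUM V | V : Tc & st V = t. vv V))"
   unfolding sum_distrib_left by (intro sum.cong) auto
  also have "... <= (SUM t<=s'. real q ^ t / (a ^ (s' - t) * (a * (real q - 1))) * (n * rh ^ t))"
   using fib coef by (intro sum_mono mult_left_mono) auto
  also have "... = (SUM t<=s'. real q ^ s' * rh * n / a * ((1 / (real q * a)) ^ (s' - t) * rh ^ t))"
  proof (rule sum.cong)
   fix t assume "t : {..s'}"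
   hence e: "real q ^ s' = real q ^ t * real q ^ (s' - t)" by (simp flip: power_add)
   have "real q ^ t / (a ^ (s' - t) * (a * (real q - 1))) = real q ^ s' * rh / a * (1 / (real q * a)) ^ (s' - t)"
   unfolding e rh_def power_one_over power_mult_distrib using qr a by (simp add: field_simps)
   thus "real q ^ t / (a ^ (s' - t) * (a * (real q - 1))) * (n * rh ^ t) = real q ^ s' * rh * n / a * ((1 / (real q * a)) ^ (s' - t) * rh ^ t)"
   by simp
  qed simp
  also have "... = real q ^ s' * rh * n / a * (SUM t<=s'. (1 / (real q * a)) ^ (s' - t) * rh ^ t)" by (simp add: sum_distrib_left)
  finally have "real q ^ s' * ((SUM V | V : Tc & s <= st V. vv V) / (a - 1)) <= real q ^ s' * (rh * n / a * (SUM t<=s'. (1 / (real q * a)) ^ (s' - t) * rh ^ t))"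
   unfolding Suc by (simp add: Suc_le_eq)
  hence "(SUM V | V : Tc & s <= st V. vv V) / (a - 1) <= rh * n / a * (SUM t<=s'. (1 / (real q * a)) ^ (s' - t) * rh ^ t)"
   using q0 by (simp only: mult_le_cancel_left_pos[of "real q ^ s'"] zero_less_power of_nat_0_less_iff)
  hence "(SUM V | V : Tc & s <= st V. vv V) <= (rh * n / a * (SUM t<=s'. (1 / (real q * a)) ^ (s' - t) * rh ^ t)) * (a - 1)"
   using a by (simp only: pos_divide_le_eq[of "a - 1"])
  also have "... = rh * n * ((1 - 1 / a) * (SUM t<=s'. (1 / (real q * a)) ^ (s' - t) * rh ^ t))"
  proof -
   have "(x / a * y) * (a - 1) = x * ((1 - 1 / a) * y)" for x y using a by (simp add: field_simps)
   thus ?thesis .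
  qed
  also have "... <= rh * n * rh ^ s'" using geometric_bound[of s'] rho n0 unfolding a_def by (intro mult_left_mono) simp_all
  finally show ?thesis using Suc by (simp add: mult_ac)
 qed
qed

text \<open>As \<open>rh <= 1 / 3\<close>, not all poles of \<open>c\<close> have type at least 1.
  At a pole of type 0 \<open>V_large\<close> makes the order at least \<open>q^(j l)\<close>, and
  \<open>n\<close> is the sum of all orders. This lower bound takes the place of irreducibility of
  the steps.\<close>

lemma n_large: "real q ^ (j * l) <= n"
proof -
 have "n > 0"
 proof -
  obtain V where "V : Pl" "inverse c : mx V" using zero_exists[of "inverse c"] sf_inv[OF S cS] c sf_inv[OF drin.k[OF drin_axioms], of "inverse c"] by force
  hence "V : Tc" unfolding Tc_def using val_gt_0[of V "inverse c"] val_inverse[of V c] sf_inv[OF S cS] cS c0 by simp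
  hence "vv V <= n" unfolding sum_vv[symmetric] using finite_Tc vv_pos by (intro member_le_sum) (auto intro: order.trans[OF zero_le_one])
  thus ?thesis using vv_pos[OF `V : Tc`] by simp
 qed
 have "EX V:Tc. st V = 0"
 proof (rule ccontr)
  assume "~ ?thesis"
  hence "{V. V : Tc & 1 <= st V} = Tc" by (auto simp: Suc_le_eq)
  hence "n <= n * rh" using type_fraction[of 1] l sum_vv by simp
  moreover have "n * rh <= n * (1 / 3)" using `n > 0` rho by (intro mult_left_mono) simp_all
  ultimately show False using `n > 0` by simp
 qed
 then obtain V where V: "V : Tc" "st V = 0" by blast
 interpret L: drin_chain k S c q j V eta l by (rule loc[OF V(1)])
 have "qJ ^ (l - 0) <= L.V" using L.V_large[of 0] st[OF V(1)] V(2) l by simp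
 moreover have "vv V <= n" unfolding sum_vv[symmetric] using finite_Tc vv_pos V(1) by (intro member_le_sum) (auto intro: order.trans[OF zero_le_one])
 ultimately show ?thesis using vv[OF V(1)] by (simp add: power_mult)
qed

definition kap :: "'a set => nat => int" where
 "kap V d = \<lceil>drin_chain.Kd c q j V l (st V) d\<rceil>"

text \<open>Poles are grouped by type: \<open>type_fraction\<close> bounds the weight of type
  \<open>s\<close> by \<open>n * rh^s\<close>, and \<open>cost\<close> charges it with the factor
  \<open>(1 / q^j)^(l - s)\<close>.\<close>

lemma cost_total:
 "(SUM V:Tc. SUM d<q ^ (j + 1). ri (kap V d)) <= 2 * real (q ^ (j + 1)) * (n * (SUM s<=l. rh ^ s * (1 / qJ) ^ (l - s)))"
proof -
 let ?Q = "real (q ^ (j + 1))"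
 have "(SUM V:Tc. SUM d<q ^ (j + 1). ri (kap V d)) <= (SUM V:Tc. 2 * ?Q * (vv V * (1 / qJ) ^ (l - st V)))"
 proof (rule sum_mono)
  fix V assume V: "V : Tc"
  have "(SUM d<q ^ (j + 1). ri (kap V d)) <= 2 * ?Q * vv V / qJ ^ (l - st V)"
   unfolding kap_def using drin_chain.cost[OF loc[OF V] st[OF V]] vv[OF V] by simp
  thus "(SUM d<q ^ (j + 1). ri (kap V d)) <= 2 * ?Q * (vv V * (1 / qJ) ^ (l - st V))" by (simp add: power_one_over)
 qed
 also have "... = 2 * ?Q * (SUM V:Tc. vv V * (1 / qJ) ^ (l - st V))" by (simp add: sum_distrib_left)
 also have "(SUM V:Tc. vv V * (1 / qJ) ^ (l - st V)) = (SUM s<=l. SUM V | V : Tc & st V = s. vv V * (1 / qJ) ^ (l - st V))"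
  by (rule sum.group[symmetric]) (use finite_Tc st_le in auto)
 also have "... = (SUM s<=l. (SUM V | V : Tc & st V = s. vv V) * (1 / qJ) ^ (l - s))"
  unfolding sum_distrib_right by (intro sum.cong) auto
 also have "2 * ?Q * ... <= 2 * ?Q * (SUM s<=l. (n * rh ^ s) * (1 / qJ) ^ (l - s))"
 proof (intro mult_left_mono sum_mono mult_right_mono)
  fix s assume s: "s : {..l}"
  have "(SUM V | V : Tc & st V = s. vv V) <= (SUM V | V : Tc & s <= st V. vv V)"
   by (rule sum_mono2) (use finite_Tc vv_pos in "auto intro: order.trans[OF zero_le_one]")
  thus "(SUM V | V : Tc & st V = s. vv V) <= n * rh ^ s" using type_fraction[of s] s by simp
 qed simp_all
 also have "... = 2 * ?Q * (n * (SUM s<=l. rh ^ s * (1 / qJ) ^ (l - s)))" by (simp add: sum_distrib_left mult.assoc)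
 finally show ?thesis .
qed

end

text \<open>All local quantities at \<open>W\<close> are those at the place below times the
  ramification index, so types and correcting coefficients found in \<open>S\<close> remain valid in
  the extension.\<close>

locale drin_above = ffext k S E + drin k c q j for k S E :: "'a::field set" and c q j +
 fixes eta :: "nat => 'a" and l W
 assumes cS: "c : S" and chain: "chn eta l" and l: "l >= 1" and etaS: "!!i. i <= l ==> eta i : S"
  and W: "W : places k E" "val W c < 0"
begin

lemma val_below: "val (W Int S) c < 0"
 using val_ram[OF W(1) cS c0] ram_pos[OF W(1)] W(2) by (simp add: mult_less_0_iff)

sublocale Lo: drin_chain k S c q j "W Int S" eta l
 using val_below place_below[OF W(1)] cS chain l etaS by unfold_locales auto

sublocale Up: drin_chain k E c q j W eta l
 using W cS SE chain l etaS by unfold_locales auto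

abbreviation "e \<equiv> ri (ram W)"

lemma e: "e > 0" using ram_pos[OF W(1)] by simp

lemma scale: "Up.V = e * Lo.V" "Up.D = e * Lo.D" "Up.B = e * Lo.B" "Up.m h = e * Lo.m h" "Up.Kd s d = e * Lo.Kd s d"
proof -
 show V: "Up.V = e * Lo.V" unfolding Up.V_def Lo.V_def using val_ram[OF W(1) cS c0] by simp
 show D: "Up.D = e * Lo.D" unfolding Up.D_def Lo.D_def V by simp
 show B: "Up.B = e * Lo.B" unfolding Up.B_def Lo.B_def V by simp
 show m: "Up.m h = e * Lo.m h" for h unfolding Up.m_def Lo.m_def D B by (simp add: distrib_left)
 show "Up.Kd s d = e * Lo.Kd s d" unfolding Up.Kd_def Lo.Kd_def D B m by (simp add: algebra_simps)
qed

lemma vq_up: "Lo.vq x r ==> Up.vq x (e * r)"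
 unfolding Lo.vq_def Up.vq_def using val_ram[OF W(1), of x] SE by auto

lemma vg_up: "Lo.vg x r ==> Up.vg x (e * r)"
 unfolding Lo.vg_def Up.vg_def using val_ram[OF W(1), of x] SE e by (cases "x = 0") (auto simp: mult_left_mono)

lemma ty_up: "Lo.ty s ==> Up.ty s"
 unfolding Lo.ty_def Up.ty_def scale using vq_up[of "eta (Suc s)" "- Lo.B"] vg_up by auto

lemma cl_up: "Lo.cl s h b ==> Up.cl s h b"
 unfolding Lo.cl_def Up.cl_def scale using vq_up[of _ "Lo.D - Lo.m h"] by (auto simp: right_diff_distrib)

end

context tow
begin

definition bb :: "'a set => nat => 'a" where "bb V = (SOME b. drin_chain.cl S c q j V eta (st V) (l - st V - 1) b)"
definition en :: "nat => 'a" where "en = (SOME en. bij_betw en {..<q} Fq)"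
text \<open>Raising the indices in the correction of \<open>eta l\<close> gives the correction of an
  unknown next root, except for its coefficient at \<open>eta (Suc s)\<close>; that one runs through
  \<open>Fq\<close> cyclically. At type \<open>l\<close> the centre is 0.\<close>

definition ctr :: "'a set => nat => 'a" where
 "ctr V t = (if V : Tc & st V < l then (SUM i<l - st V - 1. bb V i * eta (Suc (Suc (st V) + i))) + en (t mod q) * eta (Suc (st V)) else 0)"

lemma en: "bij_betw en {..<q} Fq" unfolding en_def by (rule someI_ex[OF Fq_enum])

lemma bb: assumes V: "V : Tc" "st V < l" shows "drin_chain.cl S c q j V eta (st V) (l - st V - 1) (bb V)"
proof -
 interpret L: drin_chain k S c q j V eta l by (rule loc[OF V(1)])
 have "st V + (l - st V - 1) < l" using V(2) by simp
 from someI_ex[OF L.clean[OF st[OF V(1)] this]] show ?thesis unfolding bb_def .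
qed

lemma ctr_in: "ctr V t : S"
proof (cases "V : Tc & st V < l")
 case True
 hence V: "V : Tc" "st V < l" by auto
 interpret L: drin_chain k S c q j V eta l by (rule loc[OF V(1)])
 have b: "bb V i : Fq" for i using bb[OF V] unfolding L.cl_def by blast
 have e: "en (t mod q) : Fq" using bij_betwE[OF en] q0 by simp
 have "(SUM i<l - st V - 1. bb V i * eta (Suc (Suc (st V) + i))) : S" by (rule L.comb_E[OF b]) (use etaS in simp)
 moreover have "en (t mod q) * eta (Suc (st V)) : S" using e Fq(3) kS etaS[of "Suc (st V)"] V(2) by (intro sf_mult[OF S]) auto
 ultimately show ?thesis unfolding ctr_def using True sf_add[OF S] by simp
next
 case False thus ?thesis unfolding ctr_def using sf_0[OF S] by auto
qed

text \<open>\<open>genus_step\<close> with the centres \<open>ctr\<close> and the orders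
  \<open>kap\<close>; the factor \<open>q^(j + 1)\<close> of \<open>cost_total\<close> cancels
  against the number of roots in the mean.\<close>

lemma genus_increment:
 assumes Z: "card Z = q ^ (j + 1)" "!!z. z : Z ==> PP z = eta l"
  and gam: "!!A. isdiv A ==> ri (dg A - ll A) <= gam"
 shows "EX z:Z. ff k (adj S z) & fdeg (adj k c) (adj S z) = fdeg (adj k c) S * fdeg S (adj S z) &
  (ALL A. ff.isdiv k (adj S z) A --> ri (ff.dg k A - ff.ll k (adj S z) A) <= real (fdeg S (adj S z)) *
   (gam + 2 * (n * (SUM s<=l. rh ^ s * (1 / qJ) ^ (l - s)))))"
proof -
 have Zf: "finite Z" "Z ~= {}" using Z(1) Q_gt(1) by (metis card.infinite not_less_zero, metis card.empty not_less_zero)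
 have G: "pk S (PROD z:Z. [:- z, 1:])" by (rule roots_poly[OF S cS etaS[OF order_refl] Z])
 have G0: "(PROD z:Z. [:- z, 1:]) ~= 0" using Zf by simp
 have rG: "poly (PROD z:Z. [:- z, 1:]) z = 0" if "z : Z" for z using Zf that by (simp add: poly_prod)
 have E: "ff k (adj S z)" if "z : Z" for z using acl_ff_adj[OF ff_axioms acl G G0 rG[OF that]] .
 have zE: "z : adj S z" for z by (rule adj_gen[OF S])
 have X: "ffext k S (adj S z)" if "z : Z" for z
  unfolding ffext_def ffext_axioms_def using ff_axioms E[OF that] adj_sup[OF S] by blast
 have Ab: "drin_above k S (adj S z) c q j eta l W" if "z : Z" "W : places k (adj S z)" "val W c < 0" for z W
  unfolding drin_above_def drin_above_axioms_def using X[OF that(1)] drin_axioms cS chain l etaS that(2,3) by blast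
 have inTc: "W Int S : Tc" if "z : Z" "W : places k (adj S z)" "val W c < 0" for z W
  unfolding Tc_def using ffext.place_below[OF X[OF that(1)] that(2)] drin_above.val_below[OF Ab[OF that]] by simp
 have g: "EX z:Z. ff k (adj S z) & fdeg (adj k c) (adj S z) = fdeg (adj k c) S * fdeg S (adj S z) &
  (ALL A. ff.isdiv k (adj S z) A --> ri (ff.dg k A - ff.ll k (adj S z) A) <= real (fdeg S (adj S z)) *
   (gam + (SUM V | V : Pl & val V c < 0. SUM d<card Z. ri (kap V d)) / real (card Z)))"
 proof (rule genus_step[OF acl cS c Zf G _ _ ctr_in _ gam])
  fix z W assume z: "z : Z" and W: "W : places k (adj S z)"
  interpret X: ffext k S "adj S z" by (rule X[OF z])
  {
   assume n: "~ val W c < 0"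
   have cW: "c : W" using X.E.val_ge_0[OF W _ c0] n adj_sup[OF S] cS by fastforce
   have "~ val (W Int S) c < 0" using X.val_ram[OF W cS c0] X.ram_pos[OF W] n by (simp add: mult_less_0_iff)
   hence "eta l : W" using eta_integral[OF X.place_below[OF W], of l] unfolding Tc_def by auto
   thus "z : W" using integral_root[OF E[OF z] W cW _ zE] Z(2)[OF z] by simp
  }
  assume n: "val W c < 0"
  interpret A: drin_above k S "adj S z" c q j eta l W by (rule Ab[OF z W n])
  have "A.Up.vg z (- A.Up.V)" by (rule A.Up.root_lower[OF zE Z(2)[OF z]])
  thus "z = 0 | val W c <= val W z" unfolding A.Up.vg_def A.Up.V_def by simp
  fix d
  have V: "W Int S : Tc" by (rule inTc[OF z W n])
  have ty: "A.Up.ty (st (W Int S))" by (rule A.ty_up[OF st[OF V]])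
  have "A.Up.vg (PROD t<d. z - ctr (W Int S) t) (- A.Up.Kd (st (W Int S)) d)"
  proof (cases "st (W Int S) < l")
   case True
   show ?thesis using A.Up.center_product[OF ty True A.cl_up[OF bb[OF V True]] zE Z(2)[OF z] en] V True
   by (simp add: ctr_def)
  next
   case False
   hence sl: "st (W Int S) = l" using st_le[OF V] by simp
   show ?thesis using A.Up.center_product_last[OF ty[unfolded sl] zE Z(2)[OF z]] sl by (simp add: ctr_def)
  qed
  moreover have "A.Up.Kd (st (W Int S)) d <= ri (X.ram W) * ri (kap (W Int S) d)"
   unfolding A.scale kap_def using X.ram_pos[OF W] by (intro mult_left_mono) simp_all
  ultimately have "(PROD t<d. z - ctr (W Int S) t) = 0 | - ri (X.ram W * kap (W Int S) d) <= ri (val W (PROD t<d. z - ctr (W Int S) t))"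
   unfolding A.Up.vg_def of_int_mult by linarith
  thus "(PROD t<d. z - ctr (W Int S) t) = 0 | - (val W (unif (W Int S)) * kap (W Int S) d) <= val W (PROD t<d. z - ctr (W Int S) t)"
   unfolding X.ram_def by linarith
 qed
 have "(SUM V | V : Pl & val V c < 0. SUM d<card Z. ri (kap V d)) / real (card Z) <= 2 * (n * (SUM s<=l. rh ^ s * (1 / qJ) ^ (l - s)))"
 proof -
  have "real (card Z) > 0" using Zf by (simp add: card_gt_0_iff)
  thus ?thesis using cost_total unfolding Z(1) Tc_def by (simp add: divide_le_eq mult_ac)
 qed
 note le = this
 obtain z where z: "z : Z" "ff k (adj S z)" "fdeg (adj k c) (adj S z) = fdeg (adj k c) S * fdeg S (adj S z)"
  "ALL A. ff.isdiv k (adj S z) A --> ri (ff.dg k A - ff.ll k (adj S z) A) <= real (fdeg S (adj S z)) *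
   (gam + (SUM V | V : Pl & val V c < 0. SUM d<card Z. ri (kap V d)) / real (card Z))" using g by blast
 have "real (fdeg S (adj S z)) * (gam + (SUM V | V : Pl & val V c < 0. SUM d<card Z. ri (kap V d)) / real (card Z))
  <= real (fdeg S (adj S z)) * (gam + 2 * (n * (SUM s<=l. rh ^ s * (1 / qJ) ^ (l - s))))"
  using le by (intro mult_left_mono add_left_mono) simp_all
 thus ?thesis using z by (intro bexI[OF _ z(1)] conjI allI impI) (auto intro: order_trans)
qed

end

section \<open>The tower over algebraically closed constants\<close>

lemma acl_ff_rational:
 assumes a: "acl k" and x: "x ~: k"
 shows "ff k (adj k x)" "fdeg (adj k x) (adj k x) = 1"
proof -
 have k: "sf k" using a by (simp add: acl_def)
 have K: "sf (adj k x)" by (rule sf_adj[OF k])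
 interpret K: klin "(*)" "adj k x" by (rule klin_mult[OF K])
 have "rd (adj k x) {0} (Suc 0) (lext (*) (adj k x) 1 {0})"
  by (rule rdim.rS[OF rdim.rZ]) simp
 moreover have "lext (*) (adj k x) 1 {0} = adj k x" unfolding lext_def by simp
 ultimately have r: "rd (adj k x) {0} 1 (adj k x)" by simp
 thus "fdeg (adj k x) (adj k x) = 1" by (rule fdeg_eq[OF K])
 show "ff k (adj k x)"
 proof
  show "EX y:adj k x. transc k y & ffin (adj k y) (adj k x)"
   using adj_gen[OF k] acl_full[OF a x] r unfolding ffin_def by blast
 qed (use k K adj_sup[OF k] acl_full[OF a] in auto)
qed

text \<open>Genus 0, as the powers of \<open>x\<close> up to \<open>r\<close> already give
  \<open>ll\<close> at least \<open>r + 1\<close>. The bound is -1 because \<open>dg - ll\<close> is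
  compared with the genus minus 1.\<close>

lemma acl_rational_genus:
 assumes a: "acl k" and x: "x ~: k" and A: "ff.isdiv k (adj k x) A"
 shows "ff.dg k A - ff.ll k (adj k x) A <= -1"
proof -
 interpret F: ff k "adj k x" by (rule acl_ff_rational[OF a x])
 have x1: "x : adj k x" by (rule adj_gen[OF F.k])
 have x0: "x ~= 0" using x sf_0[OF F.k] by blast
 show ?thesis
 proof (rule F.riemann_reduction[OF x1 x _ A])
  fix r :: nat
  have i: "F.isdiv (%V. int r * F.pol x V)" using F.isdiv_scale[OF F.isdiv_pol[OF x1 x0]] .
  have "int (Suc r) <= F.ll (%V. int r * F.pol x V)"
   by (rule F.ll_ge[OF i rd_plt_transc[OF F.k acl_full[OF a x]] F.polys_LL[OF x1 x0]])
  thus "int r * int (fdeg (adj k x) (adj k x)) - F.ll (%V. int r * F.pol x V) <= - 1"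
   unfolding acl_ff_rational(2)[OF a x] by simp
 qed
qed

text \<open>In the application \<open>I\<close> is the ring of power series in \<open>c\<close>;
  \<open>split\<close> lets every chain in \<open>I\<close> be continued inside \<open>I\<close>,
  with all roots of each step available there.\<close>

locale tower = drin k c q j for k :: "'a::field set" and c q j +
 fixes I :: "'a set"
 assumes I0: "0 : I" and split: "!!e. e : I ==> EX Z<=I. card Z = q ^ (j + 1) & (ALL z:Z. PP z = e)"
begin

definition Lf :: "'a => 'a set" where "Lf z = adj (adj k c) z"

lemma Kc: "sf (adj k c)" "k <= adj k c" "c : adj k c"
 using sf_adj[OF k] adj_sup[OF k] adj_gen[OF k] by auto

lemma Lf: "sf (Lf z)" "adj k c <= Lf z" "k <= Lf z" "c : Lf z" "z : Lf z"
 unfolding Lf_def using sf_adj[OF Kc(1)] adj_sup[OF Kc(1), of z] adj_gen[OF Kc(1)] Kc(2,3) by (simp_all, blast+)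

lemma PP_in: "sf S ==> c : S ==> y : S ==> PP y : S"
 unfolding PP_def by (intro sf_add sf_mult sf_power)

lemma chn_in: assumes "chn eta l" "i <= l" shows "eta i : Lf (eta l)"
 using assms(2)
proof (induction "l - i" arbitrary: i)
 case 0 thus ?case using Lf(5) by simp
next
 case (Suc h)
 hence "eta (Suc i) : Lf (eta l)" by simp
 from PP_in[OF Lf(1) Lf(4) this] show ?case using assms(1) Suc(2,3) by (simp add: chn_def)
qed

text \<open>\<open>y\<close> is a polynomial in \<open>c\<close> and \<open>z\<close>, so the top
  root alone generates the whole tower over \<open>k(c)\<close>.\<close>

lemma Lf_step: assumes "PP z = y" shows "adj (Lf y) z = Lf z"
proof
 have "y : Lf z" using PP_in[OF Lf(1,4,5), of z] assms by simp
 hence "Lf y <= Lf z" using adj_le[OF Lf(1) Lf(2)] unfolding Lf_def[of y] by blast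
 thus "adj (Lf y) z <= Lf z" by (rule adj_le[OF Lf(1) _ Lf(5)])
 show "Lf z <= adj (Lf y) z" unfolding Lf_def[of z] by (rule adj_mono[OF Lf(2)])
qed

definition rho :: real where "rho = 1 / (real q - 1)"
text \<open>Bound for the defect divided by the degree over \<open>k(c)\<close> at level
  \<open>l\<close>; each step adds its mean cost from \<open>genus_increment\<close>.\<close>

definition Cb :: "nat => real" where "Cb l = (SUM i:{1..<l}. 2 * (SUM s<=i. rho ^ s * (1 / qJ) ^ (i - s)))"

lemma towI: assumes "ff k (Lf (eta l))" "chn eta l" "l >= 1" shows "tow k (Lf (eta l)) c q j eta l"
 unfolding tow_def tow_axioms_def using assms drin_axioms Lf(4) chn_in[OF assms(2)] by blast

lemma tower_exists:
 "l >= 1 ==> EX eta. chn eta l & (ALL i<=l. eta i : I) & ff k (Lf (eta l)) &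
  (ALL A. ff.isdiv k (Lf (eta l)) A --> ri (ff.dg k A - ff.ll k (Lf (eta l)) A) <= real (fdeg (adj k c) (Lf (eta l))) * Cb l)"
proof (induction l rule: dec_induct)
 case base
 obtain Z where Z: "Z <= I" "card Z = q ^ (j + 1)" "ALL z:Z. PP z = 0" using split[OF I0] by blast
 have "~ Z <= {0}" using card_mono[of "{0}" Z] Z(2) Q_gt(1) by auto
 then obtain z where z: "z : Z" "z ~= 0" by blast
 define eta where "eta = (%i::nat. if i = 0 then 0 else z)"
 have ch: "chn eta 1" unfolding chn_def eta_def using z Z(3) by simp
 \<comment> \<open>The first equation is linear in \<open>c\<close>, so level 1 is the rational
   field \<open>k(eta 1)\<close> and the recursion starts with genus 0.\<close>
 have cz: "c = - (z ^ (q ^ (j + 1)) + z) / z ^ (q ^ j)"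
 proof -
  have "z ^ (q ^ (j + 1)) + c * z ^ (q ^ j) + z = 0" using Z(3) z(1) unfolding PP_def by simp
  hence "c * z ^ (q ^ j) = - (z ^ (q ^ (j + 1)) + z)" by (simp add: eq_neg_iff_add_eq_0 algebra_simps)
  thus ?thesis using z(2) by (simp add: eq_divide_eq)
 qed
 have cin: "c : S" if S: "sf S" "z : S" for S
  unfolding cz by (intro sf_divide[OF S(1)] sf_uminus[OF S(1)] sf_add[OF S(1)] sf_power[OF S(1)] S(2))
 have zk: "z ~: k" using cin[OF k] c by blast
 have A: "sf (adj k z)" "k <= adj k z" "z : adj k z" using sf_adj[OF k] adj_sup[OF k] adj_gen[OF k] by auto
 have "Lf z <= adj k z" unfolding Lf_def by (rule adj_le[OF A(1) adj_le[OF A(1,2) cin[OF A(1,3)]] A(3)])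
 moreover have "adj k z <= Lf z" unfolding Lf_def by (rule adj_mono[OF Kc(2)])
 ultimately have L: "Lf (eta 1) = adj k z" unfolding eta_def by simp
 have "ri (ff.dg k A - ff.ll k (adj k z) A) <= real (fdeg (adj k c) (adj k z)) * Cb 1" if "ff.isdiv k (adj k z) A" for A
  using acl_rational_genus[OF acl zk that] by (simp add: Cb_def)
 moreover have "ALL i<=1. eta i : I" unfolding eta_def using I0 z(1) Z(1) by auto
 ultimately show ?case using ch acl_ff_rational(1)[OF acl zk] unfolding L[symmetric] by blast
next
 case (step l)
 then obtain eta where eta: "chn eta l" "ALL i<=l. eta i : I" "ff k (Lf (eta l))"
  "!!A. ff.isdiv k (Lf (eta l)) A ==> ri (ff.dg k A - ff.ll k (Lf (eta l)) A) <= real (fdeg (adj k c) (Lf (eta l))) * Cb l" by blast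
 interpret T: tow k "Lf (eta l)" c q j eta l by (rule towI[OF eta(3,1)]) (use step in simp)
 obtain Z where Z: "Z <= I" "card Z = q ^ (j + 1)" "!!z. z : Z ==> PP z = eta l" using split[of "eta l"] eta(2) by blast
 from T.genus_increment[OF Z(2,3) eta(4)] obtain z where z: "z : Z" "ff k (adj (Lf (eta l)) z)"
  "fdeg (adj k c) (adj (Lf (eta l)) z) = fdeg (adj k c) (Lf (eta l)) * fdeg (Lf (eta l)) (adj (Lf (eta l)) z)"
  "!!A. ff.isdiv k (adj (Lf (eta l)) z) A ==> ri (ff.dg k A - ff.ll k (adj (Lf (eta l)) z) A) <= real (fdeg (Lf (eta l)) (adj (Lf (eta l)) z)) *
   (real (fdeg (adj k c) (Lf (eta l))) * Cb l + 2 * (T.n * (SUM s<=l. T.rh ^ s * (1 / qJ) ^ (l - s))))" by blast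
 note z = z[unfolded Lf_step[OF Z(3)[OF z(1)]]]
 define eta' where "eta' = eta(Suc l := z)"
 have "chn eta' (Suc l)" unfolding chn_def eta'_def using eta(1)[unfolded chn_def] Z(3)[OF z(1)] step(1) by (auto simp: less_Suc_eq)
 moreover have "ALL i<=Suc l. eta' i : I" unfolding eta'_def using eta(2) z(1) Z(1) by (auto simp: le_Suc_eq)
 moreover have e: "eta' (Suc l) = z" unfolding eta'_def by simp
 moreover have "ri (ff.dg k A - ff.ll k (Lf z) A) <= real (fdeg (adj k c) (Lf z)) * Cb (Suc l)" if A: "ff.isdiv k (Lf z) A" for A
 proof -
  have "Cb (Suc l) = Cb l + 2 * (SUM s<=l. T.rh ^ s * (1 / qJ) ^ (l - s))"
   unfolding Cb_def T.rh_def rho_def using step(1) by (simp add: atLeastLessThanSuc)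
  thus ?thesis using z(4)[OF A] unfolding z(3) T.n_def by (simp add: algebra_simps)
 qed
 ultimately show ?case using z(2) by (intro exI[of _ eta']) simp
qed

lemma rho: "rho > 0" "rho <= 1 / 3" "1 / qJ <= rho / 2"
proof -
 show "rho > 0" "rho <= 1 / 3" unfolding rho_def using qr by (simp_all add: field_simps)
 have "real q ^ 2 <= qJ" using qr j by (intro power_increasing) simp_all
 hence "1 / qJ <= 1 / real q ^ 2" using qr by (intro divide_left_mono) simp_all
 also have "... <= rho / 2"
 proof -
  have g: "1 / x ^ 2 <= 1 / (x - 1) / 2" if "x > 1" for x :: real
  proof -
   have "0 <= (x - 1) * (x - 1)" by simp
   hence "2 * (x - 1) <= x ^ 2" by (simp add: algebra_simps power2_eq_square)
   thus ?thesis using that by (simp add: divide_le_eq le_divide_eq mult.commute)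
  qed
  show ?thesis unfolding rho_def by (rule g) (use qr in simp)
 qed
 finally show "1 / qJ <= rho / 2" .
qed

lemma convolution_le:
 fixes a r :: real assumes "0 <= a" "a <= r / 2" shows "(SUM s<=i. r ^ s * a ^ (i - s)) <= 2 * r ^ i"
proof (induction i)
 case (Suc i)
 have r: "0 <= r" using assms by linarith
 have "(SUM s<=Suc i. r ^ s * a ^ (Suc i - s)) = a * (SUM s<=i. r ^ s * a ^ (i - s)) + r ^ Suc i"
  unfolding sum_distrib_left by (simp add: Suc_diff_le mult_ac)
 also have "... <= (r / 2) * (2 * r ^ i) + r ^ Suc i" using Suc assms r by (intro add_right_mono mult_mono sum_nonneg) simp_all
 finally show ?case by simp
qed simp

text \<open>The 6 is a product: 2 from the cost of a step, 2 from the convolution of two geometric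
  series, and 3/2 from summing powers of \<open>rho <= 1 / 3\<close>.\<close>

lemma Cb_le: "Cb l <= 6 / (real q - 1)"
proof -
 have tel: "(SUM i:{1..<l}. rho ^ i) * (1 - rho) <= rho"
 proof (cases "l <= 1")
  case False
  have "m >= 1 ==> (SUM i:{1..<m}. rho ^ i) * (1 - rho) = rho - rho ^ m" for m
  proof (induction m rule: dec_induct)
   case (step m)
   have "(SUM i:{1..<Suc m}. rho ^ i) = (SUM i:{1..<m}. rho ^ i) + rho ^ m" using step(1) by simp
   hence "(SUM i:{1..<Suc m}. rho ^ i) * (1 - rho) = rho - rho ^ m + rho ^ m * (1 - rho)" by (simp only: distrib_right step.IH)
   thus ?case by (simp add: algebra_simps)
  qed simp
  from this[of l] show ?thesis using False rho(1) by simp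
 qed (use rho in simp)
 have s0: "(SUM i:{1..<l}. rho ^ i) >= 0" using rho(1) by (intro sum_nonneg) simp
 have "(SUM i:{1..<l}. rho ^ i) * (2 / 3) <= (SUM i:{1..<l}. rho ^ i) * (1 - rho)" using s0 rho(2) by (intro mult_left_mono) simp_all
 hence "4 * (SUM i:{1..<l}. rho ^ i) <= 6 * rho" using tel by linarith
 moreover have "Cb l <= (SUM i:{1..<l}. 4 * rho ^ i)"
  unfolding Cb_def
 proof (rule sum_mono)
  fix i show "2 * (SUM s<=i. rho ^ s * (1 / qJ) ^ (i - s)) <= 4 * rho ^ i"
   using convolution_le[OF _ rho(3), of i] by simp
 qed
 ultimately show ?thesis unfolding rho_def by (simp add: sum_distrib_left)
qed

end

section \<open>Roots as power series over an algebraic closure of the field with two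
  elements\<close>

type_synonym cl = "bit alg_closure"

lemma cl_two: "1 + 1 = (0::cl)"
proof -
 have "to_ac (1 + 1 :: bit) = 1 + 1" by (simp only: to_ac_add to_ac_1)
 thus ?thesis by simp
qed

lemma card_roots_separable:
 fixes p :: "'a::alg_closed_field poly"
 assumes "p ~= 0" "!!a. poly p a = 0 ==> poly (pderiv p) a ~= 0"
 shows "card {a. poly p a = 0} = degree p"
 using assms
proof (induction "degree p" arbitrary: p)
 case 0
 then obtain b where "p = [:b:]" by (metis degree_eq_zeroE)
 thus ?case using 0 by simp
next
 case (Suc n)
 then obtain a where a: "poly p a = 0" using alg_closed_imp_poly_has_root[of p] by auto
 then obtain r where r: "p = [:- a, 1:] * r" using poly_eq_0_iff_dvd by (metis dvdE)
 have r0: "r ~= 0" using r Suc.prems(1) by auto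
 have d: "degree p = Suc (degree r)" unfolding r using r0 by (subst degree_mult_eq) auto
 have pd: "poly (pderiv p) b = poly r b + (b - a) * poly (pderiv r) b" for b
  unfolding r pderiv_mult by (simp add: pderiv_pCons algebra_simps)
 have ra: "poly r a ~= 0" using Suc.prems(2)[OF a] pd[of a] by simp
 have "card {b. poly r b = 0} = degree r"
 proof (rule Suc.hyps(1)[OF _ r0])
  show "n = degree r" using Suc.hyps(2) d by simp
  fix b assume b: "poly r b = 0"
  hence "poly p b = 0" unfolding r by simp
  thus "poly (pderiv r) b ~= 0" using Suc.prems(2)[of b] pd[of b] b by auto
 qed
 moreover have "{b. poly p b = 0} = insert a {b. poly r b = 0}" unfolding r by auto
 ultimately show ?case using ra d poly_roots_finite[OF r0] by simp
qed

lemma fps_char2_power_nth: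
 fixes f :: "'a::comm_ring_1 fps" assumes two: "1 + 1 = (0::'a)"
 shows "(f ^ (2 ^ h)) $ n = (if 2 ^ h dvd n then (f $ (n div 2 ^ h)) ^ (2 ^ h) else 0)"
proof (induction h arbitrary: n)
 case (Suc h)
 have sq: "(g ^ 2) $ n = (if even n then (g $ (n div 2)) ^ 2 else 0)" for g :: "'a fps" and n
 proof -
  let ?t = "%i. g $ i * g $ (n - i)"
  have "(g ^ 2) $ n = (SUM i:{0..n}. ?t i)" by (simp add: power2_eq_square fps_mult_nth)
  \<comment> \<open>The terms off the diagonal are equal in pairs and cancel in characteristic 2;
    only the middle one, if any, survives.\<close>
  also have "... = (SUM i:{i. i <= n & i = n - i}. ?t i) + ((SUM i:{i. i <= n & i < n - i}. ?t i) + (SUM i:{i. i <= n & n - i < i}. ?t i))"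
   by (subst sum.union_disjoint[symmetric], simp, simp, force, subst sum.union_disjoint[symmetric], simp, simp, force, rule sum.cong, force, simp)
  also have "(SUM i:{i. i <= n & n - i < i}. ?t i) = (SUM i:{i. i <= n & i < n - i}. ?t i)"
   by (rule sum.reindex_bij_witness[of _ "%i. n - i" "%i. n - i"]) (auto simp: mult.commute)
  also have "(SUM i:{i. i <= n & i < n - i}. ?t i) + (SUM i:{i. i <= n & i < n - i}. ?t i) = 0" by (rule char2_add_self[OF two])
  also have "{i. i <= n & i = n - i} = (if even n then {n div 2} else {})" by (auto; presburger)
  finally show ?thesis by (cases "even n") (auto elim!: evenE simp: power2_eq_square)
 qed
 have e: "(f ^ (2 ^ Suc h)) = (f ^ (2 ^ h)) ^ 2" by (simp add: power_mult[symmetric] mult.commute)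
 show ?case
 proof (cases "even n")
  case True
  then obtain m where m: "n = 2 * m" by blast
  have "(f ^ (2 ^ Suc h)) $ n = ((f ^ (2 ^ h)) $ m) ^ 2" unfolding e sq m by simp
  also have "... = (if 2 ^ h dvd m then (f $ (m div 2 ^ h)) ^ (2 ^ Suc h) else 0)"
   unfolding Suc by (simp add: power_mult[symmetric] mult.commute)
  also have "2 ^ h dvd m \<longleftrightarrow> 2 ^ Suc h dvd n" unfolding m power_Suc by (simp only: dvd_times_left_cancel_iff[of 2] numeral_neq_zero not_False_eq_True)
  also have "m div 2 ^ h = n div 2 ^ Suc h" unfolding m power_Suc by (simp only: div_mult_mult1[of 2] numeral_neq_zero not_False_eq_True)
  finally show ?thesis .
 next
  case False
  moreover have "~ 2 ^ Suc h dvd n" using False by (metis dvd_trans dvd_triv_left power_Suc)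
  ultimately show ?thesis unfolding e sq by simp
 qed
qed simp

notation fls_nth (infixl "$$" 75)

locale conc =
 fixes q j :: nat
 assumes q: "EX h>=2. q = 2 ^ h" and j: "j >= 2"
begin

definition Q :: nat where "Q = q ^ (j + 1)"
definition kk :: "cl fls set" where "kk = range fC"

lemma q4: "q >= 4"
proof -
 obtain h where "h >= 2" "q = 2 ^ h" using q by blast
 thus ?thesis using power_increasing[of 2 h "2::nat"] by simp
qed

lemma qpow: "EX h. q ^ n = 2 ^ h" using q by (metis power_mult)

lemma frob_add: fixes x y :: "'a::comm_ring_1" assumes "1 + 1 = (0::'a)" shows "(x + y) ^ (q ^ n) = x ^ (q ^ n) + y ^ (q ^ n)"
 using qpow[of n] char2_power_add[OF assms] by auto

lemma neg_cl: "- x = (x::cl)" using char2_add_self[OF cl_two, of x] by (metis minus_unique)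

lemma fls_two: "1 + 1 = (0::cl fls)" using cl_two by (metis fls_const_0 fls_const_1 fls_plus_const)

lemma qn: "q ^ n > 0" using q4 by simp

lemma qn2: "n > 0 ==> q ^ n > 1" using q4 by (intro one_less_power) simp_all

lemma Q1: "Q > 1" unfolding Q_def by (rule qn2) simp

lemma of_nat_q: "n > 0 ==> (of_nat (q ^ n) :: cl) = 0"
proof -
 assume "n > 0"
 obtain h where h: "h >= 2" "q = 2 ^ h" using q by blast
 have two: "(2::cl) = 0" using cl_two by (simp add: one_add_one)
 show ?thesis unfolding h(2) using h(1) `n > 0` by (simp add: two)
qed

text \<open>The polynomial \<open>y^(q^n) + y - e\<close> has derivative 1 in characteristic 2, so
  all its roots are simple.\<close>

lemma card_AS: assumes "n > 0" shows "card {y::cl. y ^ (q ^ n) + y = e} = q ^ n"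
proof -
 let ?p = "monom (1::cl) (q ^ n) + [:- e, 1:]"
 have d1: "degree [:- e, 1:] < q ^ n" using qn2[OF assms] by simp
 have d: "degree ?p = q ^ n" using degree_add_eq_left[of "[:- e, 1:]" "monom (1::cl) (q ^ n)"] d1 by (simp add: degree_monom_eq)
 have "pderiv ?p = 1" unfolding pderiv_add pderiv_monom of_nat_q[OF assms] by (simp add: pderiv_pCons)
 hence "card {a. poly ?p a = 0} = degree ?p" using d qn[of n] by (intro card_roots_separable) auto
 moreover have "poly ?p y = 0 \<longleftrightarrow> y ^ (q ^ n) + y = e" for y
 proof -
  have "poly ?p y = y ^ (q ^ n) + y - e" by (simp add: poly_monom)
  thus ?thesis by (simp only: eq_iff_diff_eq_0[of "y ^ (q ^ n) + y"])
 qed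
 ultimately show ?thesis using d by simp
qed

lemma card_fixed: "n > 0 ==> card {a::cl. a ^ (q ^ n) = a} = q ^ n"
proof -
 assume n: "n > 0"
 have "a ^ (q ^ n) = a \<longleftrightarrow> a ^ (q ^ n) + a = 0" for a :: cl by (metis neg_cl add_eq_0_iff)
 thus ?thesis using card_AS[OF n, of 0] by simp
qed

lemma fls_const_power: "fC (x::cl) ^ n = fC (x ^ n)" by (induction n) simp_all

lemma fls_const_sum: "(SUM i:A. fC (f i :: cl)) = fC (sum f A)"
 by (induction A rule: infinite_finite_induct) (simp_all add: fls_plus_const)

lemma sf_kk: "sf kk"
 unfolding sf_def kk_def
proof (intro conjI ballI)
 show "0 : range fC" by (rule image_eqI[of _ _ 0]) simp_all
 show "1 : range fC" by (rule image_eqI[of _ _ 1]) simp_all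
 fix x y :: "cl fls" assume "x : range fC" "y : range fC"
 then obtain a b where ab: "x = fC a" "y = fC b" by blast
 show "x + y : range fC" "x * y : range fC" unfolding ab by (simp_all add: fls_plus_const)
next
 fix x :: "cl fls" assume "x : range fC"
 then obtain a where ab: "x = fC a" by blast
 show "- x : range fC" unfolding ab by (simp flip: fls_const_uminus)
 show "inverse x : range fC" unfolding ab by (simp add: fls_inverse_const)
qed

lemma acl_kk: "acl kk"
 unfolding acl_def
proof (intro conjI allI impI sf_kk)
 fix p assume p: "pk kk p" "degree p > 0"
 have c: "coeff p i = fC (coeff p i $$ 0)" for i using pkD[OF p(1), of i] unfolding kk_def by auto
 have "coeff p (degree p) $$ 0 ~= 0" using c[of "degree p"] p(2) by (metis fls_const_0 leading_coeff_0_iff degree_0 less_irrefl)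
 from alg_closed[OF p(2), of "%i. coeff p i $$ 0", OF this] obtain x where x: "(SUM i<=degree p. coeff p i $$ 0 * x ^ i) = 0" by blast
 have "poly p (fC x) = (SUM i<=degree p. coeff p i * fC x ^ i)" by (rule poly_eq_sum_le) simp
 also have "... = (SUM i<=degree p. fC (coeff p i $$ 0 * x ^ i))"
  by (rule sum.cong[OF refl], subst c) (simp add: fls_const_power)
 also have "... = 0" unfolding fls_const_sum x by simp
 finally show "EX a:kk. poly p a = 0" unfolding kk_def by blast
qed

lemma X_notin: "fls_X ~: kk"
proof
 assume "fls_X : kk"
 then obtain a :: cl where "fls_X = fC a" unfolding kk_def by blast
 hence "(fls_X :: cl fls) $$ 1 = fC a $$ 1" by simp
 thus False by simp
qed

text \<open>The order of a fixed series is annihilated by \<open>q^n - 1\<close> and hence is 0.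
  Subtracting the constant term leaves a fixed series, again of order 0 but with vanishing constant
  term, so it is 0.\<close>

lemma fixed_const: assumes n: "n > 0" and a: "(a::cl fls) ^ (q ^ n) = a" shows "a : kk" "(a $$ 0) ^ (q ^ n) = a $$ 0"
proof -
 have ge0: "fls_subdegree b = 0" if "b ^ (q ^ n) = b" for b :: "cl fls"
 proof -
  have "int (q ^ n) * fls_subdegree b = fls_subdegree b" using that fls_subdegree_pow[of b "q ^ n"] by simp
  hence "(int (q ^ n) - 1) * fls_subdegree b = 0" by (simp add: left_diff_distrib)
  moreover have "int (q ^ n) > 1" using qn2[OF n] by linarith
  ultimately show ?thesis by (simp only: mult_eq_0_iff, linarith)
 qed
 have f: "a = fps_to_fls (fls_regpart a)" using fls_regpart_to_fls_trivial[of a] ge0[OF a] by simp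
 have "fls_regpart a ^ (q ^ n) = fls_regpart a" using a f by (metis fps_to_fls_power fps_to_fls_eq_iff)
 hence "(fls_regpart a $ 0) ^ (q ^ n) = fls_regpart a $ 0" by (metis fps_power_zeroth)
 thus a0: "(a $$ 0) ^ (q ^ n) = a $$ 0" by simp
 define b where "b = a + fC (a $$ 0)"
 have "b ^ (q ^ n) = b" unfolding b_def frob_add[OF fls_two] a fls_const_power a0 ..
 hence s: "fls_subdegree b = 0" by (rule ge0)
 have "b $$ 0 = 0" unfolding b_def using char2_add_self[OF cl_two] by simp
 hence "b = 0" using s nth_fls_subdegree_nonzero[of b] by auto
 hence "a = - fC (a $$ 0)" unfolding b_def by (simp only: eq_neg_iff_add_eq_0)
 hence "a = fC (a $$ 0)" unfolding fls_const_uminus[symmetric] neg_cl .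
 thus "a : kk" unfolding kk_def by blast
qed

lemma fixed_image: "n > 0 ==> {a::cl fls. a ^ (q ^ n) = a} = fC ` {a. a ^ (q ^ n) = a}"
proof (intro equalityI subsetI)
 fix a :: "cl fls" assume n: "n > 0" and "a : {a. a ^ (q ^ n) = a}"
 hence a: "a ^ (q ^ n) = a" by simp
 obtain b where b: "a = fC b" using fixed_const(1)[OF n a] unfolding kk_def by blast
 show "a : fC ` {a. a ^ (q ^ n) = a}" using fixed_const(2)[OF n a] b by simp
qed (auto simp: fls_const_power)

lemma inj_fls_const: "inj (fC :: cl => cl fls)"
proof (rule injI)
 fix x y :: cl assume "fC x = fC y"
 hence "fC x $$ 0 = fC y $$ 0" by simp
 thus "x = y" by simp
qed

sublocale drin kk "fls_X :: cl fls" q j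
proof
 have e: "{a::cl fls. a ^ q = a} = fC ` {a. a ^ q = a}" using fixed_image[of 1] by simp
 show "{a. a ^ q = a} <= kk" unfolding e kk_def by blast
 have "card {a::cl. a ^ q = a} = q" using card_fixed[of 1] by simp
 thus "card {a::cl fls. a ^ q = a} = q" unfolding e using inj_fls_const by (metis card_image inj_on_subset subset_UNIV)
qed (use acl_kk fls_two X_notin q j in auto)

text \<open>Solving \<^term>\<open>y ^ Q + fps_X * y ^ (q ^ j) + y = e\<close> coefficient by coefficient: the two nonlinear terms only involve
 coefficients of lower index.\<close>

function sol :: "cl fps => cl => nat => cl" where
 "sol e y0 n = (if n = 0 then y0 else e $ n
   + (if Q dvd n then sol e y0 (n div Q) ^ Q else 0)
   + (if q ^ j dvd n - 1 then sol e y0 ((n - 1) div q ^ j) ^ (q ^ j) else 0))"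
 by auto
termination
proof (relation "measure (%(e, y0, n). n)", goal_cases)
 case (2 e y0 n)
 thus ?case using Q1 by (simp add: div_less_dividend)
next
 case (3 e y0 n)
 hence "(n - 1) div q ^ j < n" using div_le_dividend[of "n - 1" "q ^ j"] by linarith
 thus ?case by simp
qed simp

declare sol.simps[simp del]

lemma pw_nth: "((f::cl fps) ^ (q ^ n)) $ m = (if q ^ n dvd m then (f $ (m div q ^ n)) ^ (q ^ n) else 0)"
proof -
 obtain h where "q ^ n = 2 ^ h" using qpow by blast
 thus ?thesis using fps_char2_power_nth[OF cl_two] by simp
qed

lemma op_nth: "((f::cl fps) ^ Q + fps_X * f ^ (q ^ j) + f) $ n = (if Q dvd n then (f $ (n div Q)) ^ Q else 0)
 + (if n = 0 then 0 else if q ^ j dvd n - 1 then (f $ ((n - 1) div q ^ j)) ^ (q ^ j) else 0) + f $ n"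
 unfolding fps_add_nth fps_X_mult_nth Q_def pw_nth by simp

lemma sol_solves: assumes "y0 ^ Q + y0 = e $ 0"
 shows "Abs_fps (sol e y0) ^ Q + fps_X * Abs_fps (sol e y0) ^ (q ^ j) + Abs_fps (sol e y0) = e"
proof (rule fps_ext)
 fix n
 have d: "x + (x::cl) = 0" for x by (rule char2_add_self[OF cl_two])
 have c: "a + b + (e' + a + b) = (e'::cl)" for a b e'
 proof -
  have "a + b + (e' + a + b) = e' + (a + a) + (b + b)" by (simp add: add_ac)
  thus ?thesis unfolding d by simp
 qed
 show "(Abs_fps (sol e y0) ^ Q + fps_X * Abs_fps (sol e y0) ^ (q ^ j) + Abs_fps (sol e y0)) $ n = e $ n"
 proof (cases "n = 0")
  case True
  thus ?thesis unfolding op_nth using assms by (simp add: sol.simps[of e y0 0])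
 next
  case False
  hence "sol e y0 n = e $ n + (if Q dvd n then sol e y0 (n div Q) ^ Q else 0)
   + (if q ^ j dvd n - 1 then sol e y0 ((n - 1) div q ^ j) ^ (q ^ j) else 0)" by (subst sol.simps) simp
  thus ?thesis unfolding op_nth using False by (simp only: if_False fps_nth_Abs_fps c)
 qed
qed

text \<open>The recursion leaves only the constant term free, so each solution of
  \<open>y^Q + y = e $ 0\<close> carries exactly one power series root.\<close>

lemma sol_unique:
 assumes "(f::cl fps) ^ Q + fps_X * f ^ (q ^ j) + f = g ^ Q + fps_X * g ^ (q ^ j) + g" "f $ 0 = g $ 0" shows "f = g"
proof (rule fps_ext)
 fix n show "f $ n = g $ n"
 proof (induction n rule: less_induct)
  case (less n)
  show ?case
  proof (cases "n = 0")
   case False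
   have "n div Q < n" using False Q1 by (simp add: div_less_dividend)
   moreover have "(n - 1) div q ^ j < n" using div_le_dividend[of "n - 1" "q ^ j"] False by linarith
   ultimately have "f $ (n div Q) = g $ (n div Q)" "f $ ((n - 1) div q ^ j) = g $ ((n - 1) div q ^ j)" using less by blast+
   thus ?thesis using op_nth[of f n] op_nth[of g n] by (simp only: assms(1) add_left_cancel)
  qed (use assms(2) in simp)
 qed
qed

definition I :: "cl fls set" where "I = range fps_to_fls"

lemma PP_fps: "PP (fps_to_fls f) = fps_to_fls (f ^ Q + fps_X * f ^ (q ^ j) + f)"
 unfolding PP_def Q_def by (simp add: fps_to_fls_power fls_times_fps_to_fls)

sublocale tower kk "fls_X :: cl fls" q j I
proof
 show "0 : I" unfolding I_def by (rule image_eqI[of _ _ 0]) simp_all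
 fix e :: "cl fls" assume "e : I"
 then obtain e' where e: "e = fps_to_fls e'" unfolding I_def by blast
 let ?Y = "{y. y ^ Q + y = e' $ 0}" let ?s = "%y. fps_to_fls (Abs_fps (sol e' y))"
 have "inj_on ?s ?Y"
 proof (rule inj_onI)
  fix x y assume "?s x = ?s y"
  hence "Abs_fps (sol e' x) $ 0 = Abs_fps (sol e' y) $ 0" by simp
  thus "x = y" by (simp add: sol.simps[of _ _ 0])
 qed
 hence "card (?s ` ?Y) = q ^ (j + 1)" using card_AS[of "j + 1" "e' $ 0"] unfolding Q_def by (simp add: card_image)
 moreover have "ALL z:?s ` ?Y. PP z = e" using sol_solves unfolding e by (auto simp: PP_fps)
 moreover have "?s ` ?Y <= I" unfolding I_def by blast
 ultimately show "EX Z<=I. card Z = q ^ (j + 1) & (ALL z:Z. PP z = e)" by blast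
qed

end

section \<open>Frobenius on coefficients and semilinear descent\<close>

context conc
begin

text \<open>The \<open>Q\<close>-Frobenius applied to coefficients only; unlike \<open>f^Q\<close>
  it fixes \<open>c\<close>. Its fixed field \<open>Fx\<close> consists of the Laurent series over
  the field with \<open>Q\<close> elements, of which \<open>KK\<close> is the copy among the
  constants.\<close>

definition phi :: "cl fls => cl fls" where "phi f = Abs_fls (%n. (f $$ n) ^ Q)"
definition Fx :: "cl fls set" where "Fx = {f. phi f = f}"
definition KK :: "cl fls set" where "KK = {a. a ^ Q = a}"

lemma Q0: "Q > 0" using Q1 by simp

lemma cl_frob: "(x + y) ^ Q = x ^ Q + (y::cl) ^ Q" unfolding Q_def by (rule frob_add[OF cl_two])

lemma phi_nth: "phi f $$ n = (f $$ n) ^ Q"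
 unfolding phi_def by (subst nth_Abs_fls_lower_bound[of "fls_subdegree f"]) (use Q0 in simp_all)

lemma phi_eqI: "(!!n. (f $$ n) ^ Q = g $$ n) ==> phi f = g" by (rule fls_eqI) (simp add: phi_nth)

lemma phi_add: "phi (f + g) = phi f + phi g" by (rule phi_eqI) (simp add: phi_nth cl_frob)

lemma phi_0: "phi 0 = 0" and phi_1: "phi 1 = 1" and phi_X: "phi fls_X = fls_X"
 and phi_const: "phi (fC a) = fC (a ^ Q)"
 by (rule phi_eqI; use Q0 in simp)+

lemma phi_eq_0: "phi f = 0 \<longleftrightarrow> f = 0"
proof
 assume f: "phi f = 0"
 show "f = 0"
 proof (rule fls_eqI)
  fix n
  have "(f $$ n) ^ Q = 0" using f phi_nth[of f n] by simp
  thus "f $$ n = 0 $$ n" using Q0 by simp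
 qed
qed (simp add: phi_0)

lemma phi_subdegree: "fls_subdegree (phi f) = fls_subdegree f"
proof (cases "f = 0")
 case False
 show ?thesis by (rule fls_subdegree_eqI) (use False Q0 in "simp_all add: phi_nth")
qed (simp add: phi_0)

lemma cl_sum_power: "(SUM i:A. g i :: cl) ^ Q = (SUM i:A. g i ^ Q)"
 by (induction A rule: infinite_finite_induct) (use Q0 in "simp_all add: cl_frob")

lemma phi_mult: "phi (f * g) = phi f * phi g"
proof (rule phi_eqI)
 fix n
 show "((f * g) $$ n) ^ Q = (phi f * phi g) $$ n"
  unfolding fls_times_nth(2)[of f g] fls_times_nth(2)[of "phi f" "phi g"] phi_subdegree cl_sum_power
  by (simp add: phi_nth power_mult_distrib)
qed

lemma phi_uminus: "phi (- f) = - phi f" using phi_add[of f "- f"] by (simp add: phi_0 eq_neg_iff_add_eq_0 add.commute)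

lemma phi_diff: "phi (f - g) = phi f - phi g" unfolding diff_conv_add_uminus phi_add phi_uminus ..

lemma phi_inverse: "phi (inverse f) = inverse (phi f)"
proof (cases "f = 0")
 case False
 have "phi (inverse f) * phi f = 1" unfolding phi_mult[symmetric] using False by (simp add: phi_1)
 thus ?thesis by (metis inverse_unique mult.commute)
qed (simp add: phi_0)

lemma phi_power: "phi (f ^ n) = phi f ^ n" by (induction n) (simp_all add: phi_1 phi_mult)

lemma phi_sum: "phi (SUM i:A. f i) = (SUM i:A. phi (f i))"
 by (induction A rule: infinite_finite_induct) (simp_all add: phi_0 phi_add)

lemma phi_kk: "a : kk ==> phi a = a ^ Q" unfolding kk_def by (auto simp: phi_const fls_const_power)

lemma phi_PP: "phi (PP y) = PP (phi y)" unfolding PP_def by (simp add: phi_add phi_mult phi_power phi_X)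

lemma sf_Fx: "sf Fx"
 unfolding sf_def Fx_def by (simp add: phi_0 phi_1 phi_add phi_mult phi_uminus phi_inverse)

lemma X_Fx: "fls_X : Fx" unfolding Fx_def by (simp add: phi_X)

lemma KK_kk: "KK <= kk" using fixed_const(1)[of "j + 1"] unfolding KK_def Q_def by auto

lemma KK_Fx: "KK = kk Int Fx" using KK_kk phi_kk unfolding KK_def Fx_def by auto

lemma sf_KK: "sf KK"
 using sf_Fx sf_kk unfolding KK_Fx sf_def by simp

lemma card_KK: "card KK = Q" "finite KK"
proof -
 have "KK = fC ` {a. a ^ Q = a}" unfolding KK_def Q_def by (rule fixed_image) simp
 hence "card KK = card {a::cl. a ^ Q = a}" using card_image[OF inj_on_subset[OF inj_fls_const subset_UNIV]] by simp
 thus "card KK = Q" using card_fixed[of "j + 1"] unfolding Q_def by simp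
 thus "finite KK" using Q0 by (metis card.infinite less_irrefl)
qed

lemma solve_AS: assumes "b : kk" shows "EX a:kk. a ^ Q + a = b"
proof -
 obtain b' where b: "b = fC b'" using assms unfolding kk_def by blast
 have "card {y. y ^ Q + y = b'} ~= 0" using card_AS[of "j + 1" b'] Q0 unfolding Q_def by simp
 hence "{y. y ^ Q + y = b'} ~= {}" by (metis card.empty)
 then obtain a where "a ^ Q + a = b'" by blast
 thus ?thesis unfolding b kk_def by (intro bexI[of _ "fC a"]) (auto simp: fls_const_power fls_plus_const)
qed

text \<open>Artin's shortening argument: normalise one coefficient to 1, apply \<open>phi\<close>
  and subtract. The relation loses that term, and its new coefficients \<open>d^Q - d\<close> all
  vanish only if every \<open>d\<close> is already in \<open>KK\<close>.\<close>

lemma fixed_relation: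
 assumes "finite J" "!!i. i : J ==> w i : Fx" "!!i. i : J ==> a i : kk" "(SUM i:J. a i * w i) = 0" "EX i:J. a i ~= 0"
 shows "EX b. (ALL i:J. b i : KK) & (EX i:J. b i ~= 0) & (SUM i:J. b i * w i) = 0"
 using assms
proof (induction "card J" arbitrary: J a)
 case 0 thus ?case by simp
next
 case (Suc n)
 obtain t where t: "t : J" "a t ~= 0" using Suc.prems(5) by blast
 define d where "d = (%i. a i / a t)"
 have dk: "d i : kk" if "i : J" for i unfolding d_def using sf_divide[OF sf_kk] Suc.prems(3) that t(1) by blast
 have dt: "d t = 1" unfolding d_def using t(2) by simp
 have s: "(SUM i:J. d i * w i) = 0"
 proof -
  have "(SUM i:J. d i * w i) = (SUM i:J. a i * w i) / a t" unfolding d_def sum_divide_distrib by (intro sum.cong) simp_all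
  thus ?thesis using Suc.prems(4) by simp
 qed
 show ?case
 proof (cases "ALL i:J. d i : KK")
  case True
  thus ?thesis using s dt t(1) by (intro exI[of _ d] conjI bexI[of _ t]) auto
 next
  case False
  define e where "e = (%i. d i ^ Q - d i)"
  have "phi (SUM i:J. d i * w i) = (SUM i:J. d i ^ Q * w i)"
   unfolding phi_sum phi_mult using Suc.prems(2) by (intro sum.cong refl) (simp add: phi_kk dk Fx_def)
  hence "(SUM i:J. d i ^ Q * w i) = 0" using s by (simp add: phi_0)
  hence "(SUM i:J. e i * w i) = 0" unfolding e_def left_diff_distrib sum_subtractf using s by simp
  moreover have "e t = 0" unfolding e_def dt by simp
  ultimately have "(SUM i:J - {t}. e i * w i) = 0" using Suc.prems(1) t(1) by (simp add: sum.remove[of J t])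
  moreover obtain i where "i : J" "d i ~: KK" using False by blast
  hence "EX i:J - {t}. e i ~= 0" using `e t = 0` unfolding e_def KK_def by (intro bexI[of _ i]) auto
  moreover have "n = card (J - {t})" using Suc.hyps(2) Suc.prems(1) t(1) by simp
  moreover have "e i : kk" if "i : J" for i unfolding e_def using dk[OF that] sf_diff[OF sf_kk] sf_power[OF sf_kk] by blast
  ultimately obtain b where b: "ALL i:J - {t}. b i : KK" "EX i:J - {t}. b i ~= 0" "(SUM i:J - {t}. b i * w i) = 0"
   using Suc.hyps(1)[of "J - {t}" e] Suc.prems(1,2) by auto
  let ?b = "b(t := 0)"
  have "(SUM i:J. ?b i * w i) = (SUM i:J - {t}. ?b i * w i)" using Suc.prems(1) t(1) by (simp add: sum.remove[of J t])
  also have "... = (SUM i:J - {t}. b i * w i)" by (rule sum.cong) auto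
  also note b(3)
  finally show ?thesis using b(1,2) sf_0[OF sf_KK] by (intro exI[of _ ?b]) auto
 qed
qed

text \<open>A semilinear descent: the coefficient functional at a suitable exponent splits off one dimension, and the defect
 \<^term>\<open>phi w - w\<close> is removed by solving \<^term>\<open>a ^ Q + a = b\<close> in the algebraically closed field of constants.\<close>

lemma fixed_basis:
 "rd kk {0} n W ==> phi ` W <= W ==> EX v. (ALL i<n. v i : W & v i : Fx) &
  (ALL w:W. EX a. (ALL i. a i : kk) & w = (SUM i<n. a i * v i)) &
  (ALL a. (ALL i<n. a i : kk) --> (SUM i<n. a i * v i) = 0 --> (ALL i<n. a i = 0))"
proof (induction n arbitrary: W)
 case 0
 hence "W = {0}" by (auto elim: rdim.cases)
 thus ?case using sf_0[OF sf_kk] by (intro exI[of _ "%_. 0"]) auto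
next
 case (Suc n)
 interpret klin "(*)" kk by (rule klin_mult[OF sf_kk])
 have sW: "ssp kk W" using dm_sub[OF Suc.prems(1) sub_zero] .
 have "W ~= {0}" using dm_unique[OF Suc.prems(1) _ sub_zero, of 0] rdim.rZ[of "(*)" kk "{0}"] by auto
 then obtain w1 where w1: "w1 : W" "w1 ~= 0" using sub_0[OF sW] by blast
 \<comment> \<open>An exponent at which \<open>W\<close> does not vanish identically. Taking the
   coefficient there is compatible with \<open>phi\<close>, so the kernel \<open>W'\<close> is again
   stable.\<close>
 then obtain ex where ex: "w1 $$ ex ~= 0" by (metis fls_eqI fls_zero_nth)
 define W' where "W' = {w : W. w $$ ex = 0}"
 have cmul: "(fC a * f) $$ n = a * f $$ n" for a n and f :: "cl fls" by simp
 have sc: "EX a'. a = fC a'" if "a : kk" for a using that unfolding kk_def by blast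
 have sW': "ssp kk W'" unfolding subsp_def W'_def
  using sub_0[OF sW] sub_add[OF sW] sW[unfolded subsp_def] by (auto dest!: sc)
 define w0 where "w0 = fC (1 / w1 $$ ex) * w1"
 have w0: "w0 : W" "w0 $$ ex = 1" unfolding w0_def using ex w1 sW[unfolded subsp_def] by (auto simp: kk_def)
 have dec: "w - fC (w $$ ex) * w0 : W'" if "w : W" for w
  unfolding W'_def using that w0 sub_diff[OF sW] sW[unfolded subsp_def] by (auto simp: kk_def)
 have WW: "W = lext (*) kk w0 W'"
 proof
  show "W <= lext (*) kk w0 W'"
  proof
   fix w assume "w : W"
   hence "fC (w $$ ex) * w0 + (w - fC (w $$ ex) * w0) : lext (*) kk w0 W'"
   by (intro extI dec) (simp_all add: kk_def)
   thus "w : lext (*) kk w0 W'" by simp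
  qed
  show "lext (*) kk w0 W' <= W" by (rule ext_le[OF sW _ w0(1)]) (auto simp: W'_def)
 qed
 have "w0 ~: W'" using w0 unfolding W'_def by simp
 obtain n' where n': "rd kk {0} n' W'"
  using dm_exists_between[OF Suc.prems(1) sub_zero sW'] sub_0[OF sW'] by (auto simp: W'_def)
 have "rd kk {0} (Suc n') W" unfolding WW by (rule rdim.rS[OF n' `w0 ~: W'`])
 hence "n' = n" using dm_unique[OF Suc.prems(1) _ sub_zero] by blast
 moreover have "phi ` W' <= W'" using Suc.prems(2) Q0 unfolding W'_def by (auto simp: phi_nth)
 ultimately obtain v where v: "!!i. i < n ==> v i : W' & v i : Fx"
  "!!w. w : W' ==> EX a. (ALL i. a i : kk) & w = (SUM i<n. a i * v i)"
  "!!a. (ALL i<n. a i : kk) ==> (SUM i<n. a i * v i) = 0 ==> (ALL i<n. a i = 0)"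
  using Suc.IH[of W'] n' by blast
 have "phi w0 - w0 : W'" unfolding W'_def using sub_diff[OF sW, of "phi w0" w0] Suc.prems(2) w0 by (auto simp: phi_nth)
 then obtain b where b: "ALL i. b i : kk" "phi w0 - w0 = (SUM i<n. b i * v i)" using v(2) by blast
 \<comment> \<open>An additive Hilbert 90: adding \<open>SUM i<n. a i * v i\<close> to
   \<open>w0\<close> changes \<open>phi w0 - w0\<close> by the combination with coefficients
   \<open>a i ^ Q + a i\<close> (characteristic 2), which cancels the defect.\<close>
 have "ALL i. EX a:kk. a ^ Q + a = b i" using b(1) solve_AS by blast
 then obtain a where a: "!!i. a i : kk" "!!i. a i ^ Q + a i = b i" by metis
 define u where "u = w0 + (SUM i<n. a i * v i)"
 have sW'': "(SUM i<n. a i * v i) : W'" if "ALL i<n. a i : kk" for a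
  using that v(1) sW'[unfolded subsp_def] by (intro sub_sum[OF sW']) auto
 have uW: "u : W" "u $$ ex = 1" unfolding u_def using w0 sW''[of a] a(1) sub_add[OF sW] by (auto simp: W'_def)
 have "phi u = phi w0 + (SUM i<n. a i ^ Q * v i)"
  unfolding u_def phi_add phi_sum phi_mult using v(1) a(1) by (simp add: phi_kk Fx_def)
 also have "phi w0 = w0 + (SUM i<n. b i * v i)" using b(2) by (simp add: diff_eq_eq add.commute)
 also have "w0 + (SUM i<n. b i * v i) + (SUM i<n. a i ^ Q * v i) = w0 + (SUM i<n. (b i + a i ^ Q) * v i)"
  by (simp add: sum.distrib distrib_right add.assoc)
 also have "... = u"
 proof -
  have "b i + a i ^ Q = a i" for i unfolding a(2)[symmetric] by (metis add_self add.commute add.left_commute add_0_right)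
  thus ?thesis unfolding u_def by simp
 qed
 finally have uF: "u : Fx" unfolding Fx_def by simp
 let ?v = "v(n := u)"
 have sv: "(SUM i<Suc n. a i * ?v i) = (SUM i<n. a i * v i) + a n * u" for a by simp
 have "EX a. (ALL i. a i : kk) & w = (SUM i<Suc n. a i * ?v i)" if w: "w : W" for w
 proof -
  have "w - fC (w $$ ex) * u : W'"
   unfolding W'_def using w uW sub_diff[OF sW] sW[unfolded subsp_def] by (auto simp: kk_def)
  then obtain d where d: "ALL i. d i : kk" "w - fC (w $$ ex) * u = (SUM i<n. d i * v i)" using v(2) by blast
  have "w = (SUM i<Suc n. (d(n := fC (w $$ ex))) i * ?v i)" unfolding sv using d(2) by (simp add: diff_eq_eq)
  thus ?thesis using d(1) by (intro exI[of _ "d(n := fC (w $$ ex))"]) (auto simp: kk_def)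
 qed
 moreover have "ALL i<Suc n. d i = 0" if d: "ALL i<Suc n. d i : kk" "(SUM i<Suc n. d i * ?v i) = 0" for d
 proof -
  obtain d' where d': "d n = fC d'" using d(1) sc by blast
  have "(SUM i<n. d i * v i) $$ ex = 0" using sW''[of d] d(1) unfolding W'_def by simp
  moreover have "((SUM i<n. d i * v i) + d n * u) $$ ex = 0" using d(2) unfolding sv by simp
  ultimately have "d' = 0" unfolding d' using uW(2) by simp
  hence "d n = 0" using d' by simp
  moreover have "ALL i<n. d i = 0" using v(3)[of d] d unfolding sv `d n = 0` by simp
  ultimately show ?thesis by (simp add: less_Suc_eq)
 qed
 moreover have "ALL i<Suc n. ?v i : W & ?v i : Fx" using v(1) uW uF unfolding W'_def by (auto simp: less_Suc_eq)
 ultimately show ?case by (intro exI[of _ ?v]) blast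
qed

end

text \<open>Each \<open>x\<close> is algebraic over the prime field. If \<open>x\<close> were
  outside \<open>R\<close>, its inverse would be inside, and the reversed equation would express
  \<open>x\<close> as a polynomial in \<open>inverse x\<close>.\<close>

lemma cl_valuation_ring:
 assumes R: "sring (R :: cl set)" "!!a. a : R | inverse a : R" shows "R = UNIV"
proof (rule ccontr)
 assume "R ~= UNIV"
 then obtain x where x: "x ~: R" by blast
 hence x0: "x ~= 0" using sring_0[OF R(1)] by auto
 define u where "u = inverse x"
 have u: "u : R" "u ~= 0" unfolding u_def using R(2) x x0 by auto
 obtain p :: "bit poly" where p: "p ~= 0" "poly (map_poly to_ac p) x = 0" using alg_closure_algebraic[of x] by blast
 let ?P = "map_poly to_ac p"
 have cR: "coeff ?P i : R" for i
  using sring_0[OF R(1)] sring_1[OF R(1)] by (cases "coeff p i" rule: bit.exhaust) (simp_all add: coeff_map_poly)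
 have dP: "lead_coeff ?P = 1"
 proof -
  have "degree ?P = degree p" by (rule degree_map_poly) simp
  moreover have "lead_coeff p = 1" using p(1) by (cases "lead_coeff p" rule: bit.exhaust) simp_all
  ultimately show ?thesis by (simp add: coeff_map_poly)
 qed
 obtain s a where s: "reflect_poly ?P = pCons a s" by (metis pCons_cases)
 have "a = 1" using dP s by (metis coeff_0_reflect_poly coeff_pCons_0)
 have "poly (reflect_poly ?P) u = 0" using u(2) p(2) by (simp add: poly_reflect_poly_nz u_def)
 hence "1 + u * poly s u = 0" unfolding s `a = 1` by simp
 hence "x = - poly s u" unfolding u_def using x0 by (simp add: field_simps eq_neg_iff_add_eq_0)
 moreover have "pk R s"
 proof -
  have "coeff s i = coeff (reflect_poly ?P) (Suc i)" for i unfolding s by simp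
  thus ?thesis unfolding pk_def using cR sring_0[OF R(1)] by (simp add: coeff_reflect_poly)
 qed
 hence "poly s u : R" unfolding poly_altdef using pkD u(1)
  by (intro sring_sum[OF R(1)] sring_mult[OF R(1)] sring_power[OF R(1)]) auto
 ultimately show False using x sring_uminus[OF R(1)] by auto
qed

text \<open>A description by membership in valuation rings, free of values. In this form the space
  can be pulled back along \<open>phi\<close> and restricted to a subfield, where values would
  change with ramification.\<close>

lemma (in ff) LL_pol_iff:
 assumes x: "x : S" "x ~= 0"
 shows "z : LL (%V. int r * pol x V) \<longleftrightarrow> z : S & (ALL V:Pl. (x : V --> z : V) & (x ~: V --> z / x ^ r : V))"
proof (cases "z : S & z ~= 0")
 case True
 hence z: "z : S" "z ~= 0" by auto
 have "- (int r * pol x V) <= val V z \<longleftrightarrow> (x : V --> z : V) & (x ~: V --> z / x ^ r : V)" if V: "V : Pl" for V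
 proof (cases "x : V")
  case True
  hence "pol x V = 0" unfolding pol_def using val_ge_0[OF V x] by simp
  thus ?thesis using True val_ge_0[OF V z] by simp
 next
  case False
  hence p: "pol x V = - val V x" unfolding pol_def using val_ge_0[OF V x] V by simp
  have xr: "x ^ r : S" "x ^ r ~= 0" using sf_power[OF S x(1)] x(2) by auto
  have "z / x ^ r : V \<longleftrightarrow> 0 <= val V z - int r * val V x"
   using val_ge_0[OF V sf_divide[OF S z(1) xr(1)]] z(2) xr(2) unfolding val_divide[OF V z xr] val_power[OF V x] by simp
  thus ?thesis unfolding p using False by simp
 qed
 thus ?thesis unfolding LL_def using z by blast
next
 case False
 thus ?thesis unfolding LL_def using sring_0[OF PlD(1)] by auto
qed

section \<open>Descent of the tower to finite constants\<close>

locale desc = conc +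
 fixes eta :: "nat => cl fls" and l :: nat
 assumes l1: "l >= 1" and chain: "chn eta l" and etaI: "!!i. i <= l ==> eta i : I" and ffL: "ff kk (Lf (eta l))"
begin

abbreviation "c \<equiv> fls_X :: cl fls"
definition K0 :: "cl fls set" where "K0 = adj kk c"
definition Lm :: "cl fls set" where "Lm = Lf (eta l)"
definition EE :: "cl fls set" where "EE = Lm Int Fx"
definition nn :: nat where "nn = fdeg K0 Lm"

sublocale L: ff kk Lm unfolding Lm_def by (rule ffL)

lemma Lm: "Lm = adj K0 (eta l)" "c : Lm" "eta l : Lm" "K0 <= Lm" "kk <= Lm"
 unfolding Lm_def K0_def using Lf(2-5) by (auto simp: Lf_def)

lemma K0: "sf K0" "kk <= K0" "c : K0" unfolding K0_def using Kc by auto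

lemma I_iff: "f : I \<longleftrightarrow> fls_subdegree f >= 0"
 unfolding I_def using fls_regpart_to_fls_trivial[of f] fls_subdegree_fls_to_fps_gt0 by (metis rangeE rangeI)

lemma PP_inj_I:
 assumes "x : I" "y : I" "PP x = PP y" "x $$ 0 = y $$ 0" shows "x = y"
proof -
 obtain f g where "x = fps_to_fls f" "y = fps_to_fls g" using assms(1,2) unfolding I_def by blast
 note fg = this
 have "f ^ Q + fps_X * f ^ (q ^ j) + f = g ^ Q + fps_X * g ^ (q ^ j) + g"
  using assms(3) unfolding fg PP_fps fps_to_fls_eq_iff .
 moreover have "f $ 0 = g $ 0" using assms(4) unfolding fg by simp
 ultimately show ?thesis unfolding fg using sol_unique by blast
qed

lemma I_add: "x : I ==> y : I ==> x + y : I" and I_PP: "x : I ==> PP x : I"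
 unfolding I_def by (auto simp: PP_fps simp flip: fps_to_fls_plus)

lemma PP_0_coeff: assumes "z : I" shows "PP z $$ 0 = (z $$ 0) ^ Q + z $$ 0"
proof -
 obtain f where f: "z = fps_to_fls f" using assms unfolding I_def by blast
 have "(f ^ Q) $ 0 = (f $ 0) ^ Q" by (rule fps_power_zeroth)
 thus ?thesis unfolding f PP_fps by simp
qed

text \<open>\<open>phi z\<close> and \<open>z + PP z\<close> have the same image under
  \<open>PP\<close> by induction, and the same constant term because
  \<open>a^Q = a + (a^Q + a)\<close>; these data determine a power series. It follows that
  \<open>phi\<close> maps the tower into itself.\<close>

lemma phi_root: "z : I ==> (PP ^^ i) z = 0 ==> phi z = z + PP z"
proof (induction i arbitrary: z)
 case 0
 have "PP 0 = PP 0 + PP 0" using PP_add[of 0 0] by (simp only: add_0_right)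
 hence "PP 0 = 0" unfolding add_self .
 thus ?case using 0 by (simp add: phi_0)
next
 case (Suc i)
 have "phi (PP z) = PP z + PP (PP z)" using Suc.IH[OF I_PP[OF Suc.prems(1)]] Suc.prems(2) by (simp add: funpow_swap1)
 hence e: "PP (phi z) = PP (z + PP z)" unfolding phi_PP PP_add .
 have e0: "phi z $$ 0 = (z + PP z) $$ 0"
 proof -
  have "(z + PP z) $$ 0 = (z $$ 0) ^ Q + (z $$ 0 + z $$ 0)" by (simp add: PP_0_coeff[OF Suc.prems(1)] add_ac)
  thus ?thesis by (simp add: phi_nth char2_add_self[OF cl_two])
 qed
 have "phi z : I" using Suc.prems(1) by (simp add: I_iff phi_subdegree)
 thus ?case by (rule PP_inj_I[OF _ I_add[OF Suc.prems(1) I_PP[OF Suc.prems(1)]] e e0])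
qed

lemma PP_iter: "i <= l ==> (PP ^^ i) (eta i) = 0"
proof (induction i)
 case (Suc i)
 thus ?case using chain by (simp add: funpow_swap1 chn_def)
qed (use chain in "simp add: chn_def")

lemma phi_eta: assumes "i <= l" shows "phi (eta i) = eta i + PP (eta i)"
 using phi_root[OF etaI PP_iter] assms by blast

lemma phi_sub: "sf S ==> sf {y. phi y : S}"
 unfolding sf_def by (simp add: phi_0 phi_1 phi_add phi_mult phi_uminus phi_inverse)

lemma phi_in_kk: "a : kk ==> phi a : kk" using phi_kk sf_power[OF sf_kk] by simp

lemma phi_K0: "a : K0 ==> phi a : K0"
 using adj_le[OF phi_sub[OF K0(1)], of kk c] phi_in_kk K0 unfolding K0_def by (auto simp: phi_X)

lemma phi_Lm: "a : Lm ==> phi a : Lm"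
proof -
 have "phi (eta l) : Lm" unfolding phi_eta[OF order_refl] using Lm(2,3) PP_in[OF L.S] sf_add[OF L.S] by blast
 hence "adj K0 (eta l) <= {y. phi y : Lm}" using phi_K0 Lm(4) by (intro adj_le phi_sub L.S) auto
 thus "a : Lm ==> phi a : Lm" using Lm(1) by auto
qed

lemma EE: "sf EE" "KK <= EE" "c : EE" "EE <= Lm" "EE <= Fx"
 unfolding EE_def using L.S sf_Fx KK_Fx Lm X_Fx unfolding sf_def by auto

lemma transc_KK: assumes "z ~: kk" shows "transc KK z"
 using acl_full[OF acl_kk assms] pk_mono[OF _ KK_kk] unfolding transc_def by blast

lemma rd_nn: "rd K0 {0} nn Lm" unfolding nn_def using ffin_rd[OF K0(1)] L.ffin_adj[OF Lm(2) X_notin] unfolding K0_def by blast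

lemma KKc: "sf (adj KK c)" "adj KK c <= EE" "c : adj KK c" "KK <= adj KK c"
 using sf_adj[OF sf_KK] adj_le[OF EE(1-3)] adj_gen[OF sf_KK] adj_sup[OF sf_KK] by auto

text \<open>After clearing denominators, a relation over \<open>kk(c)\<close> is a relation over
  \<open>kk\<close> among the fixed elements \<open>c^t * w i\<close>, to which
  \<open>fixed_relation\<close> applies.\<close>

lemma independent_lift:
 fixes m :: nat
 assumes w: "ALL i<m. w i : Fx" and ind: "ALL a. (ALL i<m. a i : adj KK c) --> (SUM i<m. a i * w i) : {0} --> (ALL i<m. a i = 0)"
 shows "ALL a. (ALL i<m. a i : K0) --> (SUM i<m. a i * w i) : {0} --> (ALL i<m. a i = 0)"
proof (intro allI impI, rule ccontr)
 fix a i0 assume a: "ALL i<m. a i : K0" "(SUM i<m. a i * w i) : {0}" "i0 < m" "a i0 ~= 0"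
 obtain g p where g: "pk kk g" "poly g c ~= 0" "ALL i<m. pk kk (p i) & a i * poly g c = poly (p i) c"
  using adj_common_denominator[OF sf_kk a(1)[unfolded K0_def]] by blast
 define N where "N = Suc (Max (degree ` p ` {..<m}))"
 have N: "degree (p i) <= N" if "i < m" for i
 proof -
  have "degree (p i) <= Max (degree ` p ` {..<m})" using that by (intro Max_ge) auto
  thus ?thesis unfolding N_def by simp
 qed
 let ?J = "{..<m} \<times> {..N}"
 have s: "(SUM (i, t):?J. coeff (p i) t * (c ^ t * w i)) = 0"
 proof -
  have "(SUM (i, t):?J. coeff (p i) t * (c ^ t * w i)) = (SUM i<m. poly (p i) c * w i)"
   unfolding sum.cartesian_product[symmetric]
  proof (intro sum.cong refl)
   fix i assume "i : {..<m}"
   hence "poly (p i) c = (SUM t<=N. coeff (p i) t * c ^ t)" by (intro poly_eq_sum_le N) simp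
   thus "(SUM t<=N. coeff (p i) t * (c ^ t * w i)) = poly (p i) c * w i" by (simp only: sum_distrib_right mult.assoc)
  qed
  also have "... = (SUM i<m. poly g c * (a i * w i))" by (intro sum.cong refl) (use g(3) in "simp add: mult_ac")
  also have "... = 0" unfolding sum_distrib_left[symmetric] using a(2) by simp
  finally show ?thesis .
 qed
 have "p i0 ~= 0" using g(2,3) a(3,4) by fastforce
 hence nz: "coeff (p i0) (degree (p i0)) ~= 0" by simp
 have "EX b. (ALL x:?J. b x : KK) & (EX x:?J. b x ~= 0) & (SUM x:?J. b x * (case x of (i, t) => c ^ t * w i)) = 0"
 proof (rule fixed_relation[where a = "%(i, t). coeff (p i) t"])
  fix x assume "x : ?J"
  then obtain i t where x: "x = (i, t)" "i < m" by auto
  show "(case x of (i, t) => c ^ t * w i) : Fx" unfolding x using w x(2) sf_mult[OF sf_Fx sf_power[OF sf_Fx X_Fx]] by simp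
  show "(case x of (i, t) => coeff (p i) t) : kk" unfolding x using g(3) x(2) pkD[of kk "p i" t] by simp
 next
  show "(SUM x:?J. (case x of (i, t) => coeff (p i) t) * (case x of (i, t) => c ^ t * w i)) = 0"
   using s by (simp add: case_prod_unfold)
  show "EX x:?J. (case x of (i, t) => coeff (p i) t) ~= 0"
   using nz a(3) N[OF a(3)] by (intro bexI[of _ "(i0, degree (p i0))"]) auto
 qed simp
 then obtain b where b: "!!i t. i < m ==> t <= N ==> b (i, t) : KK" "EX x:?J. b x ~= 0"
  "(SUM x:?J. b x * (case x of (i, t) => c ^ t * w i)) = 0" by auto
 define B where "B = (%i. SUM t<=N. monom (b (i, t)) t)"
 have Bp: "pk KK (B i)" if "i < m" for i unfolding B_def using b(1)[OF that] by (intro pk_sum[OF sf_KK] pk_monom[OF sf_KK]) simp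
 have "(SUM i<m. poly (B i) c * w i) = (SUM x:?J. b x * (case x of (i, t) => c ^ t * w i))"
  unfolding B_def case_prod_unfold poly_sum sum_distrib_right poly_monom mult.assoc
  by (simp add: sum.cartesian_product case_prod_unfold)
 hence "(SUM i<m. poly (B i) c * w i) : {0}" using b(3) by simp
 moreover have "ALL i<m. poly (B i) c : adj KK c" using adj_poly[OF sf_KK Bp] by blast
 ultimately have "ALL i<m. poly (B i) c = 0" by (intro ind[THEN spec, THEN mp, THEN mp])
 hence B0: "B i = 0" if "i < m" for i using transc_KK[OF X_notin, unfolded transc_def, rule_format, OF Bp[OF that]] that by simp
 obtain i t where it: "i < m" "t <= N" "b (i, t) ~= 0" using b(2) by auto
 have "coeff (B i) t = b (i, t)" unfolding B_def coeff_sum using it(2) by simp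
 thus False using B0[OF it(1)] it(3) by simp
qed

lemma EE_degree: "EX m<=nn. rd (adj KK c) {0} m EE"
proof -
 interpret A: klin "(*)" "adj KK c" by (rule klin_mult[OF KKc(1)])
 interpret K: klin "(*)" K0 by (rule klin_mult[OF K0(1)])
 show ?thesis
 proof (rule A.dm_bounded[OF A.sub_zero ssp_sf[OF EE(1) KKc(2)]])
  show "{0} <= EE" using sf_0[OF EE(1)] by simp
  fix m W assume W: "rd (adj KK c) {0} m W" "W <= EE"
  obtain w where w: "ALL i<m. w i : W" "ALL a. (ALL i<m. a i : adj KK c) --> (SUM i<m. a i * w i) : {0} --> (ALL i<m. a i = 0)"
   using A.dm_basis[OF W(1) A.sub_zero] by blast
  show "m <= nn"
   by (rule K.dm_independent_le[OF rd_nn K.sub_zero _ independent_lift[OF _ w(2)]]) (use w(1) W(2) EE in auto)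
 qed
qed

lemma ff_EE: "ff KK EE"
proof
 show "EX x:EE. transc KK x & ffin (adj KK x) EE"
  using EE(3) transc_KK[OF X_notin] EE_degree unfolding ffin_def by blast
 fix z assume "z : EE" "z ~: KK"
 thus "transc KK z" using transc_KK EE(5) KK_Fx by blast
qed (use sf_KK EE in auto)

sublocale E: ff KK EE by (rule ff_EE)

lemma fdeg_EE: "fdeg (adj KK c) EE <= nn"
 using EE_degree fdeg_eq[OF KKc(1)] by blast

text \<open>Chevalley's theorem gives a valuation ring of \<open>Lm\<close> over \<open>V\<close>.
  It contains the constants because their field has no valuation ring other than itself
  (\<open>cl_valuation_ring\<close>).\<close>

lemma place_lift: assumes V: "V : places KK EE" shows "EX W:places kk Lm. W Int EE = V"
proof -
 let ?t = "unif V"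
 have t: "?t : V" "inverse ?t ~: V" "?t ~= 0" "?t : EE" using E.unif[OF V] unfolding mx_def by auto
 obtain W where W: "sring W" "V <= W" "W <= Lm" "inverse ?t ~: W" "ALL z:Lm. z : W | inverse z : W"
  using chevalley[OF L.S E.PlD(1)[OF V] _ t(1,2)] E.PlD(3)[OF V] EE(4) by blast
 have "sring {a. fC a : W}"
 proof -
  have h: "fC (x * y) = fC x * fC y" "fC (x - y) = fC x - fC y" for x y :: cl by (simp_all add: fls_minus_const)
  show ?thesis unfolding sring_def mem_Collect_eq fls_const_1 h using W(1) unfolding sring_def by blast
 qed
 moreover have "a : {a. fC a : W} | inverse a : {a. fC a : W}" for a
 proof -
  have "fC a : Lm" using Lm(5) unfolding kk_def by blast
  thus ?thesis using W(5) by (auto simp: fls_inverse_const)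
 qed
 ultimately have "{a. fC a : W} = UNIV" by (rule cl_valuation_ring)
 hence kW: "kk <= W" unfolding kk_def by blast
 have it: "inverse ?t : EE" using sf_inv[OF EE(1) t(4)] .
 have WP: "W : places kk Lm" unfolding places_def using W kW it EE(4) by blast
 have "W Int EE : places KK EE"
  unfolding places_def sring_def using W(1)[unfolded sring_def] W(4,5) it kW KK_kk EE sf_1[OF EE(1)] sf_diff[OF EE(1)] sf_mult[OF EE(1)] sf_inv[OF EE(1)] by auto
 moreover have "V <= W Int EE" using W(2) E.PlD(3)[OF V] by blast
 ultimately have "V = W Int EE" by (rule E.place_maximal[OF V])
 thus ?thesis using WP by blast
qed

lemma phi_LL: assumes z: "z : L.LL (%V. int r * L.pol c V)" shows "phi z : L.LL (%V. int r * L.pol c V)"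
proof -
 have c0: "c ~= 0" by simp
 note iff = L.LL_pol_iff[OF Lm(2) c0]
 have zL: "z : Lm" using z unfolding iff by blast
 show ?thesis unfolding iff
 proof (intro conjI ballI phi_Lm zL)
  fix V assume V: "V : L.Pl"
  define V' where "V' = {x : Lm. phi x : V}"
  have zV: "phi (z / c ^ r) = phi z / c ^ r" by (simp add: divide_inverse phi_mult phi_inverse phi_power phi_X)
  have zr: "z / c ^ r : Lm" using sf_divide[OF L.S zL sf_power[OF L.S Lm(2)]] .
  have cV: "c : V' \<longleftrightarrow> c : V" unfolding V'_def using Lm(2) by (simp add: phi_X)
  have "(c : V' --> z : V') & (c ~: V' --> z / c ^ r : V')"
  \<comment> \<open>\<open>phi\<close> is not known to map \<open>Lm\<close> onto itself, so the
    preimage of a valuation ring could be all of \<open>Lm\<close>; the claim is then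
    immediate.\<close>
  proof (cases "V' = Lm")
   case True thus ?thesis using zL zr by simp
  next
   case False
   have "V' : places kk Lm"
   unfolding places_def
   proof (intro CollectI conjI ballI False)
   show "sring V'" unfolding sring_def V'_def using L.PlD(1)[OF V, unfolded sring_def] sf_1[OF L.S] sf_diff[OF L.S] sf_mult[OF L.S]
   by (simp add: phi_1 phi_diff phi_mult)
   show "kk <= V'" unfolding V'_def using L.PlD(2)[OF V] phi_in_kk Lm(5) by blast
   show "V' <= Lm" unfolding V'_def by blast
   fix x assume x: "x : Lm"
   thus "x : V' | inverse x : V'" unfolding V'_def using L.PlD(5)[OF V phi_Lm[OF x]] sf_inv[OF L.S x] by (auto simp: phi_inverse)
   qed
   thus ?thesis using z unfolding iff by blast
  qed
  thus "c : V --> phi z : V" "c ~: V --> phi z / c ^ r : V" unfolding cV unfolding V'_def mem_Collect_eq zV by blast+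
 qed
qed

text \<open>A \<open>kk\<close>-basis of fixed functions upstairs stays independent over
  \<open>KK\<close>, and its members satisfy the pole conditions in \<open>EE\<close> because every
  place of \<open>EE\<close> lies below one of \<open>Lm\<close>.\<close>

lemma ll_descent: "L.ll (%V. int r * L.pol c V) <= E.ll (%V. int r * E.pol c V)"
proof -
 have c0: "c ~= 0" by simp
 let ?A = "%V. int r * L.pol c V" let ?B = "%V. int r * E.pol c V"
 have iA: "L.isdiv ?A" using L.isdiv_scale[OF L.isdiv_pol[OF Lm(2) c0]] .
 have iB: "E.isdiv ?B" using E.isdiv_scale[OF E.isdiv_pol[OF EE(3) c0]] .
 define n where "n = nat (L.ll ?A)"
 obtain v where v: "ALL i<n. v i : L.LL ?A & v i : Fx" "ALL a. (ALL i<n. a i : kk) --> (SUM i<n. a i * v i) = 0 --> (ALL i<n. a i = 0)"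
  using fixed_basis[OF L.ll_rd[OF iA]] phi_LL unfolding n_def by blast
 have vE: "v i : E.LL ?B" if "i < n" for i
  unfolding E.LL_pol_iff[OF EE(3) c0]
 proof (intro conjI ballI)
  have v': "v i : L.LL ?A" "v i : Fx" using v(1) that by auto
  thus vE: "v i : EE" unfolding EE_def L.LL_def by blast
  have vr: "v i / c ^ r : EE" using sf_divide[OF EE(1) vE sf_power[OF EE(1,3)]] .
  fix V assume "V : places KK EE"
  then obtain W where W: "W : places kk Lm" "W Int EE = V" using place_lift by blast
  have "(c : W --> v i : W) & (c ~: W --> v i / c ^ r : W)" using v'(1) W(1) unfolding L.LL_pol_iff[OF Lm(2) c0] by blast
  thus "c : V --> v i : V" "c ~: V --> v i / c ^ r : V" using W(2) vE vr EE(3) by blast+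
 qed
 obtain W where W: "W <= E.LL ?B" "rd KK {0} n W"
 proof -
  have "EX W. W <= E.LL ?B & rd KK {0} n W & (ALL x:W. EX a. (ALL i. a i : KK) & x - (SUM i<n. a i * v i) : {0})"
  proof (rule E.dm_of_indep[OF E.sub_zero E.ssp_LL])
   show "ALL a. (ALL i<n. a i : KK) --> (SUM i<n. a i * v i) : {0} --> (ALL i<n. a i = 0)"
   proof (intro allI impI)
   fix a i assume a: "ALL i<n. a i : KK" "(SUM i<n. a i * v i) : {0}" "i < n"
   have "ALL i<n. a i : kk" using a(1) KK_kk by blast
   from v(2)[rule_format, OF this[rule_format]] a(2,3) show "a i = 0" by simp
   qed
  qed (use vE E.sub_0[OF E.ssp_LL] in auto)
  thus ?thesis using that by blast
 qed
 have "int n <= E.ll ?B" by (rule E.ll_ge[OF iB W(2,1)])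
 thus ?thesis unfolding n_def by linarith
qed

text \<open>Two inequalities suffice: \<open>EE\<close> has degree at most \<open>nn\<close> over
  \<open>KK(c)\<close>, and at least as large an \<open>ll\<close> on multiples of
  \<open>pol c\<close>. By \<open>riemann_reduction\<close> these multiples decide the
  bound.\<close>

lemma genus_EE:
 assumes g: "!!A. L.isdiv A ==> L.dg A - L.ll A <= g" and A: "E.isdiv A"
 shows "E.dg A - E.ll A <= g"
proof (rule E.riemann_reduction[OF EE(3) _ _ A])
 have c0: "c ~= 0" by simp
 show "c ~: KK" using X_notin KK_kk by blast
 fix r :: nat
 have i: "L.isdiv (L.pol c)" using L.isdiv_pol[OF Lm(2) c0] .
 have "L.dg (%V. int r * L.pol c V) = int r * int nn"
  unfolding L.dg_scale[OF i] L.dg_pol[OF Lm(2) X_notin] nn_def K0_def ..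
 hence "int r * int nn - L.ll (%V. int r * L.pol c V) <= g" using g[OF L.isdiv_scale[OF i], of "int r"] by simp
 moreover have "int r * int (fdeg (adj KK c) EE) <= int r * int nn" using fdeg_EE by (intro mult_left_mono) simp_all
 ultimately show "int r * int (fdeg (adj KK c) EE) - E.ll (%V. int r * E.pol c V) <= g" using ll_descent[of r] by linarith
qed

end

section \<open>Rational places from conjugate power series\<close>

context desc
begin

definition Rt :: "nat => cl fls set" where "Rt i = {z : I. (PP ^^ i) z = 0}"

primrec Pt :: "nat => cl fls poly" where
 "Pt 0 = [:0, 1:]"
| "Pt (Suc i) = Pt i ^ Q + (smult c (Pt i ^ (q ^ j)) + Pt i)"

lemma poly_Pt: "poly (Pt i) z = (PP ^^ i) z"
 by (induction i) (simp_all add: PP_def Q_def add.assoc)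

lemma pk_Pt: "pk K0 (Pt i)"
proof (induction i)
 case 0 thus ?case using K0(1) by (simp add: pk_pCons pk_0 sf_0 sf_1)
next
 case (Suc i)
 thus ?case unfolding Pt.simps by (intro pk_add pk_power pk_smult K0)
qed

lemma degree_Pt: "degree (Pt i) = Q ^ i"
proof (induction i)
 case (Suc i)
 have Qj: "q ^ j < Q" unfolding Q_def by (rule Q_gt(2))
 have Qi: "Q ^ i > 0" using Q0 by simp
 have P0: "Pt i ~= 0" using Suc Qi by auto
 have "degree (smult c (Pt i ^ (q ^ j)) + Pt i) < degree (Pt i ^ Q)"
 proof (rule degree_add_less)
  show "degree (smult c (Pt i ^ (q ^ j))) < degree (Pt i ^ Q)" using Qj Qi by (simp add: degree_power_eq[OF P0] Suc)
  show "degree (Pt i) < degree (Pt i ^ Q)" using Q1 Qi by (simp add: degree_power_eq[OF P0] Suc)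
 qed
 hence "degree (Pt (Suc i)) = degree (Pt i ^ Q)" unfolding Pt.simps by (rule degree_add_eq_left)
 thus ?case by (simp add: degree_power_eq[OF P0] Suc)
qed simp

lemma Pt_nz: "Pt i ~= 0" using degree_Pt[of i] Q0 by auto

lemma finite_Rt: "finite (Rt i)"
 unfolding Rt_def poly_Pt[symmetric] by (rule finite_subset[OF _ poly_roots_finite[OF Pt_nz[of i]]]) blast

lemma card_Rt: "Q ^ i <= card (Rt i)"
proof (induction i)
 case 0
 have "Rt 0 = {0}" unfolding Rt_def using I0 by auto
 thus ?case by simp
next
 case (Suc i)
 define Y where "Y = (%e. {z : I. PP z = e})"
 have un: "Rt (Suc i) = (UN e:Rt i. Y e)"
  unfolding Rt_def Y_def using I_PP by (auto simp: funpow_swap1)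
 have fY: "finite (Y e)" if "e : Rt i" for e using finite_subset[OF _ finite_Rt[of "Suc i"]] that unfolding un by blast
 have cY: "Q <= card (Y e)" if e: "e : Rt i" for e
 proof -
  obtain Z where Z: "Z <= I" "card Z = Q" "ALL z:Z. PP z = e" using split[of e] e unfolding Rt_def Q_def by blast
  hence "Z <= Y e" unfolding Y_def by blast
  from card_mono[OF fY[OF e] this] show ?thesis using Z(2) by simp
 qed
 have "card (Rt (Suc i)) = (SUM e:Rt i. card (Y e))"
  unfolding un by (rule card_UN_disjoint[OF finite_Rt]) (use fY in "auto simp: Y_def")
 moreover have "card (Rt i) * Q <= (SUM e:Rt i. card (Y e))" using cY sum_bounded_below[of "Rt i" Q "%e. card (Y e)"] by simp
 moreover have "Q ^ i * Q <= card (Rt i) * Q" using Suc by (rule mult_right_mono) simp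
 moreover have "Q ^ Suc i = Q ^ i * Q" by simp
 ultimately show ?case by linarith
qed

text \<open>The conjugates of \<open>eta l\<close> over \<open>kk(c)\<close> among the power series
  roots, described by all polynomial relations of \<open>eta l\<close> instead of by a minimal
  polynomial.\<close>

definition Cj :: "cl fls set" where
 "Cj = {z : Rt l. ALL h. pk K0 h --> poly h (eta l) = 0 --> poly h z = 0}"

lemma Pt_eta: "poly (Pt l) (eta l) = 0" unfolding poly_Pt by (rule PP_iter) simp

text \<open>The minimal polynomial \<open>mu\<close> of \<open>eta l\<close> divides
  \<open>Pt l\<close>, which has as many power series roots as its degree \<open>Q^l\<close>. At
  most \<open>degree g\<close> of them are roots of the cofactor \<open>g\<close>, which leaves
  \<open>degree mu >= nn\<close> conjugates.\<close>

lemma card_Cj: "nn <= card Cj" "finite Cj"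
proof -
 interpret K: klin "(*)" K0 by (rule klin_mult[OF K0(1)])
 show "finite Cj" unfolding Cj_def using finite_Rt by simp
 define P where "P = (%h. pk K0 h & h ~= 0 & poly h (eta l) = 0)"
 have "P (Pt l)" unfolding P_def using pk_Pt Pt_nz Pt_eta by blast
 then obtain mu where mu: "P mu" "!!h. P h ==> degree mu <= degree h" using ex_has_least_nat[of P "Pt l" degree] by blast
 have mu': "pk K0 mu" "mu ~= 0" "poly mu (eta l) = 0" using mu(1) unfolding P_def by auto
 have dvd: "mu dvd h" if h: "pk K0 h" "poly h (eta l) = 0" for h
 proof -
  obtain r where r: "pk K0 r" "ALL i>=degree mu. coeff r i = 0" "mu dvd h - r" using poly_reduce_dvd[OF K0(1) mu'(1,2) h(1)] by (elim exE conjE)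
  obtain g where g: "h - r = mu * g" using r(3) by (rule dvdE)
  have "poly (h - r) (eta l) = 0" unfolding g using mu'(3) by simp
  hence "poly r (eta l) = 0" using h(2) by simp
  moreover have "r = 0 | degree r < degree mu" using r(2) by (metis leading_coeff_0_iff not_le)
  ultimately have "r = 0" using mu(2)[of r, unfolded P_def] r(1) by (meson not_le)
  thus ?thesis using r(3) by simp
 qed
 have nd: "nn <= degree mu"
 proof -
  obtain m where m: "m <= degree mu" "rd K0 {0} m (plt K0 (eta l) (degree mu))" using rd_plt[OF K0(1)] by blast
  have "Lm <= plt K0 (eta l) (degree mu)"
  proof
   fix y assume "y : Lm"
   then obtain h where h: "pk K0 h" "y = poly h (eta l)" using adj_algebraic[OF K0(1) mu'(1-3)] unfolding Lm(1) by blast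
   obtain r where r: "pk K0 r" "ALL i>=degree mu. coeff r i = 0" "ALL x. poly mu x = 0 --> poly r x = poly h x"
   using poly_reduce[OF K0(1) mu'(1,2) h(1)] by (elim exE conjE)
   have "y = poly r (eta l)" using h(2) r(3) mu'(3) by simp
   thus "y : plt K0 (eta l) (degree mu)" unfolding plt_def using r(1,2) by blast
  qed
  thus ?thesis using K.dm_mono[OF m(2) rd_nn _ K.sub_zero] m(1) by simp
 qed
 obtain g where g: "Pt l = mu * g" using dvd[OF pk_Pt Pt_eta] by (rule dvdE)
 have g0: "g ~= 0" using g Pt_nz[of l] by auto
 have "Rt l <= Cj Un {z. poly g z = 0}"
 proof
  fix z assume z: "z : Rt l"
  hence "poly (Pt l) z = 0" unfolding Rt_def poly_Pt by blast
  hence "poly mu z = 0 | poly g z = 0" unfolding g by simp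
  moreover have "z : Cj" if "poly mu z = 0"
   unfolding Cj_def
  proof (intro CollectI conjI allI impI z)
   fix h assume "pk K0 h" "poly h (eta l) = 0"
   then obtain u where "h = mu * u" using dvd by (meson dvdE)
   thus "poly h z = 0" using that by simp
  qed
  ultimately show "z : Cj Un {z. poly g z = 0}" by blast
 qed
 hence "card (Rt l) <= card Cj + card {z. poly g z = 0}"
  using card_mono[of "Cj Un {z. poly g z = 0}" "Rt l"] `finite Cj` poly_roots_finite[OF g0] card_Un_le order_trans by blast
 also have "card {z. poly g z = 0} <= degree g" by (rule card_poly_roots_bound[OF g0])
 finally have "Q ^ l <= card Cj + degree g" using card_Rt[of l] by linarith
 moreover have "Q ^ l = degree mu + degree g" using degree_Pt[of l] degree_mult_eq[OF mu'(2) g0] g by simp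
 ultimately show "nn <= card Cj" using nd by linarith
qed

text \<open>For \<open>z : Cj\<close> this is the embedding of \<open>Lm\<close> over
  \<open>kk(c)\<close> into Laurent series that sends \<open>eta l\<close> to \<open>z\<close>; by
  \<open>sg_poly\<close> the value does not depend on the polynomial chosen.\<close>

definition sg :: "cl fls => cl fls => cl fls" where
 "sg z y = poly (SOME h. pk K0 h & poly h (eta l) = y) z"

lemma Lm_poly: assumes "y : Lm" shows "EX h. pk K0 h & y = poly h (eta l)"
 using adj_algebraic[OF K0(1) pk_Pt Pt_nz Pt_eta] assms unfolding Lm(1) by blast

context
 fixes z assumes z: "z : Cj"
begin

lemma sg_poly: assumes h: "pk K0 h" shows "sg z (poly h (eta l)) = poly h z"
proof -
 let ?h = "SOME h'. pk K0 h' & poly h' (eta l) = poly h (eta l)"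
 have "pk K0 ?h & poly ?h (eta l) = poly h (eta l)" by (rule someI[of _ h]) (use h in simp)
 hence "pk K0 (h - ?h)" "poly (h - ?h) (eta l) = 0" using pk_diff[OF K0(1) h] by auto
 hence "poly (h - ?h) z = 0" using z unfolding Cj_def by blast
 thus ?thesis unfolding sg_def by simp
qed

lemma sg_add: assumes "x : Lm" "y : Lm" shows "sg z (x + y) = sg z x + sg z y"
proof -
 obtain f g where fg: "pk K0 f" "x = poly f (eta l)" "pk K0 g" "y = poly g (eta l)" using Lm_poly[OF assms(1)] Lm_poly[OF assms(2)] by blast
 have "sg z (poly (f + g) (eta l)) = poly (f + g) z" by (rule sg_poly[OF pk_add[OF K0(1) fg(1,3)]])
 thus ?thesis unfolding fg(2,4) sg_poly[OF fg(1)] sg_poly[OF fg(3)] by simp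
qed

lemma sg_mult: assumes "x : Lm" "y : Lm" shows "sg z (x * y) = sg z x * sg z y"
proof -
 obtain f g where fg: "pk K0 f" "x = poly f (eta l)" "pk K0 g" "y = poly g (eta l)" using Lm_poly[OF assms(1)] Lm_poly[OF assms(2)] by blast
 have "sg z (poly (f * g) (eta l)) = poly (f * g) z" by (rule sg_poly[OF pk_mult[OF K0(1) fg(1,3)]])
 thus ?thesis unfolding fg(2,4) sg_poly[OF fg(1)] sg_poly[OF fg(3)] by simp
qed

lemma sg_K0: "a : K0 ==> sg z a = a" using sg_poly[OF pk_const[OF K0(1), of a]] by simp

lemma sg_eta: "sg z (eta l) = z"
 using sg_poly[of "[:0, 1:]"] K0(1) by (simp add: pk_pCons pk_0 sf_0 sf_1)

lemma sg_0: "sg z 0 = 0" and sg_1: "sg z 1 = 1" using sg_K0 sf_0[OF K0(1)] sf_1[OF K0(1)] by auto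

lemma sg_uminus: "x : Lm ==> sg z (- x) = - sg z x"
 using sg_add[of x "- x"] sf_uminus[OF L.S] by (simp add: sg_0 eq_neg_iff_add_eq_0 add.commute)

lemma sg_diff: "x : Lm ==> y : Lm ==> sg z (x - y) = sg z x - sg z y"
 using sg_add[of x "- y"] sg_uminus[of y] sf_uminus[OF L.S, of y] by simp

lemma sg_nz: assumes "x : Lm" "x ~= 0" shows "sg z x ~= 0"
 using sg_mult[OF assms(1) sf_inv[OF L.S assms(1)]] assms(2) sg_1 by auto

lemma sg_inverse: assumes "x : Lm" shows "sg z (inverse x) = inverse (sg z x)"
proof (cases "x = 0")
 case False
 hence "sg z x * sg z (inverse x) = 1" using sg_mult[OF assms sf_inv[OF L.S assms]] sg_1 by simp
 thus ?thesis by (rule inverse_unique[symmetric])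
qed (simp add: sg_0)

lemma sg_power: "x : Lm ==> sg z (x ^ n) = sg z x ^ n"
 by (induction n) (simp_all add: sg_1 sg_mult sf_power[OF L.S])

lemma sg_sum: "(!!i. i : A ==> f i : Lm) ==> sg z (SUM i:A. f i) = (SUM i:A. sg z (f i))"
 by (induction A rule: infinite_finite_induct) (simp_all add: sg_0 sg_add sf_sum[OF L.S])

lemma sg_poly_Lm: assumes "pk K0 h" "x : Lm" shows "sg z (poly h x) = poly h (sg z x)"
proof -
 have "coeff h i : K0" for i using pkD[OF assms(1)] .
 hence m: "coeff h i : Lm" "sg z (coeff h i) = coeff h i" for i using Lm(4) sg_K0 by auto
 have "sg z (poly h x) = (SUM i<=degree h. sg z (coeff h i * x ^ i))"
  unfolding poly_altdef by (rule sg_sum) (use sf_mult[OF L.S m(1) sf_power[OF L.S assms(2)]] in simp)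
 also have "... = poly h (sg z x)" unfolding poly_altdef
  by (intro sum.cong refl) (simp add: sg_mult[OF m(1) sf_power[OF L.S assms(2)]] m(2) sg_power[OF assms(2)])
 finally show ?thesis .
qed

lemma sg_PP: assumes "x : Lm" shows "sg z (PP x) = PP (sg z x)"
 unfolding PP_def using assms Lm(2) sg_K0[OF K0(3)]
 by (simp add: sg_add sg_mult sg_power sf_add[OF L.S] sf_mult[OF L.S] sf_power[OF L.S])

text \<open>\<open>phi_root\<close> holds for every conjugate, so \<open>phi z\<close> is obtained
  from \<open>z\<close> in the same way as \<open>phi (eta l)\<close> from \<open>eta l\<close>. The
  embeddings thus commute with \<open>phi\<close> and map \<open>EE\<close> into
  \<open>Fx\<close>.\<close>

lemma phi_sg: assumes "y : Lm" shows "phi (sg z y) = sg z (phi y)"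
proof -
 obtain h where h: "pk K0 h" "y = poly h (eta l)" using Lm_poly[OF assms] by blast
 let ?h = "map_poly phi h"
 have e: "phi (poly h x) = poly ?h (phi x)" for x
 proof -
  have "degree ?h = degree h" by (rule degree_map_poly) (simp add: phi_eq_0)
  thus ?thesis unfolding poly_altdef phi_sum phi_mult phi_power by (simp add: coeff_map_poly phi_0)
 qed
 have ph: "pk K0 ?h" using pkD[OF h(1)] phi_K0 unfolding pk_def by (simp add: coeff_map_poly phi_0)
 have "z : I" "(PP ^^ l) z = 0" using z unfolding Cj_def Rt_def by auto
 hence "phi z = z + PP z" by (rule phi_root)
 moreover have "sg z (phi (eta l)) = z + PP z" unfolding phi_eta[OF order_refl]
  using sg_add[OF Lm(3) PP_in[OF L.S Lm(2,3)]] sg_PP[OF Lm(3)] sg_eta by simp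
 ultimately have "sg z (phi (eta l)) = phi z" by simp
 hence "sg z (phi y) = poly ?h (phi z)" unfolding h(2) e using sg_poly_Lm[OF ph phi_Lm[OF Lm(3)]] by simp
 thus ?thesis unfolding h(2) sg_poly[OF h(1)] e by simp
qed

text \<open>The valuation ring cut out of \<open>EE\<close> by the power series ring under
  \<open>sg z\<close>; since \<open>sg z\<close> fixes \<open>c\<close>, it is a place over
  \<open>c = 0\<close>.\<close>

definition Vz :: "cl fls set" where "Vz = {x : EE. sg z x : I}"

lemma sg_Fx: "x : EE ==> sg z x : Fx"
 using phi_sg[OF subsetD[OF EE(4)]] subsetD[OF EE(5)] unfolding Fx_def by simp

lemma I_ring: "sring I" unfolding sring_def
proof (intro conjI ballI)
 show "1 : I" by (simp add: I_iff)
 fix x y assume "x : I" "y : I"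
 then obtain f g where fg: "x = fps_to_fls f" "y = fps_to_fls g" unfolding I_def by blast
 have "x - y = fps_to_fls (f - g)" "x * y = fps_to_fls (f * g)" unfolding fg by (simp_all add: fls_times_fps_to_fls)
 thus "x - y : I" "x * y : I" unfolding I_def by blast+
qed

lemma kk_I: "kk <= I" unfolding kk_def by (auto simp: I_iff)

lemma Vz_place: "Vz : places KK EE"
 unfolding places_def
proof (intro CollectI conjI ballI)
 show "sring Vz" unfolding sring_def Vz_def
 proof (intro conjI ballI)
  show "1 : {x : EE. sg z x : I}" using sf_1[OF EE(1)] sring_1[OF I_ring] sg_1 by simp
  fix x y assume xy: "x : {x : EE. sg z x : I}" "y : {x : EE. sg z x : I}"
  hence L: "x : Lm" "y : Lm" using EE(4) by auto
  show "x - y : {x : EE. sg z x : I}" using xy sg_diff[OF L] sf_diff[OF EE(1)] sring_diff[OF I_ring] by simp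
  show "x * y : {x : EE. sg z x : I}" using xy sg_mult[OF L] sf_mult[OF EE(1)] sring_mult[OF I_ring] by simp
 qed
 show "KK <= Vz" unfolding Vz_def using EE(2) KK_kk kk_I K0(2) sg_K0 by (auto simp: subset_iff)
 show "Vz <= EE" unfolding Vz_def by blast
 have "inverse c : EE" "inverse c : K0" using sf_inv[OF EE(1,3)] sf_inv[OF K0(1,3)] by auto
 moreover have "inverse c ~: I" unfolding I_iff by (simp add: fls_inverse_subdegree)
 ultimately have "inverse c : EE - Vz" unfolding Vz_def using sg_K0[of "inverse c"] by simp
 thus "Vz ~= EE" by blast
 fix x assume x: "x : EE"
 hence "sg z (inverse x) = inverse (sg z x)" using sg_inverse EE(4) by blast
 moreover have "y : I | inverse y : I" for y unfolding I_iff by (cases "y = 0") (simp_all add: fls_inverse_subdegree, linarith)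
 ultimately show "x : Vz | inverse x : Vz" unfolding Vz_def using x sf_inv[OF EE(1) x] by simp
qed

lemma mx_Vz: "x : Vz ==> x : mx Vz \<longleftrightarrow> sg z x $$ 0 = 0"
proof -
 assume x: "x : Vz"
 hence xE: "x : EE" and sI: "sg z x : I" unfolding Vz_def by auto
 have xL: "x : Lm" using xE EE(4) by blast
 show ?thesis
 proof (cases "x = 0")
  case True thus ?thesis using x unfolding mx_def by (simp add: sg_0)
 next
  case False
  have "sg z x ~= 0" using sg_nz[OF xL False] .
  hence "inverse (sg z x) : I \<longleftrightarrow> fls_subdegree (sg z x) <= 0" unfolding I_iff by (simp add: fls_inverse_subdegree)
  also have "... \<longleftrightarrow> fls_subdegree (sg z x) = 0" using sI unfolding I_iff by linarith
  also have "... \<longleftrightarrow> sg z x $$ 0 ~= 0"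
   using sI nth_fls_subdegree_nonzero[OF `sg z x ~= 0`] fls_subdegree_leI[of "sg z x" 0] unfolding I_iff by auto
  finally have "inverse x : Vz \<longleftrightarrow> sg z x $$ 0 ~= 0" unfolding Vz_def using sg_inverse[OF xL] sf_inv[OF EE(1) xE] by simp
  thus ?thesis unfolding mx_def using x False by simp
 qed
qed

text \<open>The constant term is fixed by the \<open>Q\<close>-Frobenius, so residues come from
  \<open>KK\<close>; this makes the place rational.\<close>

lemma residue: assumes "x : Vz" shows "fC (sg z x $$ 0) : KK" "x - fC (sg z x $$ 0) : mx Vz"
proof -
 let ?a = "fC (sg z x $$ 0)"
 have xE: "x : EE" using assms unfolding Vz_def by blast
 have "phi (sg z x) $$ 0 = sg z x $$ 0" using sg_Fx[OF xE] unfolding Fx_def by simp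
 hence "(sg z x $$ 0) ^ Q = sg z x $$ 0" by (simp add: phi_nth)
 thus a: "?a : KK" unfolding KK_def by (simp add: fls_const_power)
 hence aV: "?a : Vz" using E.PlD(2)[OF Vz_place] by blast
 have "x - ?a : Vz" by (rule sring_diff[OF E.PlD(1)[OF Vz_place] assms aV])
 moreover have "sg z (x - ?a) $$ 0 = 0"
 proof -
  have "?a : K0" using a KK_kk K0(2) by blast
  hence "sg z (x - ?a) = sg z x - ?a" using sg_diff[of x ?a] xE EE(4) Lm(4) sg_K0 by auto
  thus ?thesis by simp
 qed
 ultimately show "x - ?a : mx Vz" using mx_Vz by blast
qed

lemma pdeg_Vz: "pdeg KK Vz = 1"
 unfolding E.pdeg_1_iff[OF Vz_place] using residue by blast

end

text \<open>The embedding attached to a conjugate is recovered from its valuation ring: the coefficients of the power series are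
 the successive residues.\<close>

lemma Vz_residue:
 assumes z: "z : Cj" "z' : Cj" and V: "Vz z = Vz z'" and x: "x : Vz z"
 shows "sg z x $$ 0 = sg z' x $$ 0"
proof -
 let ?a = "fC (sg z x $$ 0)" let ?b = "fC (sg z' x $$ 0)"
 note a = residue[OF z(1) x] residue[OF z(2) x[unfolded V], folded V]
 have "(x - ?a) - (x - ?b) : mx (Vz z)" by (rule E.sub_diff[OF E.ssp_mx[OF Vz_place[OF z(1)]] a(2,4)])
 moreover have "(x - ?a) - (x - ?b) = ?b - ?a" by (simp only: diff_diff_eq2 diff_add_cancel add_diff_cancel_left add_diff_eq) simp
 ultimately have "?b - ?a : mx (Vz z)" by simp
 moreover have "?b - ?a : KK" using a sf_diff[OF sf_KK] by blast
 ultimately have "?b - ?a = 0" using E.mx_k[OF Vz_place[OF z(1)]] by blast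
 hence "?b $$ 0 = ?a $$ 0" by simp
 thus ?thesis by simp
qed

lemma Vz_coeff:
 assumes z: "z : Cj" "z' : Cj" and V: "Vz z = Vz z'"
 shows "x : Vz z ==> sg z x $$ int n = sg z' x $$ int n"
proof (induction n arbitrary: x)
 case 0
 thus ?case using Vz_residue[OF z V] by simp
next
 case (Suc n)
 define a where "a = fC (sg z x $$ 0)"
 have xE: "x : EE" using Suc.prems unfolding Vz_def[OF z(1)] by blast
 have aE: "a : EE" "a : K0" using residue(1)[OF z(1) Suc.prems] EE(2) KK_kk K0(2) unfolding a_def by auto
 define y where "y = (x - a) * inverse c"
 have yE: "y : EE" unfolding y_def using sf_mult[OF EE(1) sf_diff[OF EE(1) xE aE(1)] sf_inv[OF EE(1,3)]] .
 have sy: "sg w y = fls_shift 1 (sg w x - a)" if w: "w : Cj" for w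
 proof -
  have L: "x : Lm" "a : Lm" "inverse c : Lm" "inverse c : K0" using xE aE EE(4) sf_inv[OF EE(1,3)] sf_inv[OF K0(1,3)] by auto
  have "sg w y = (sg w x - a) * inverse c"
   unfolding y_def using sg_mult[OF w sf_diff[OF L.S L(1,2)] L(3)] sg_diff[OF w L(1,2)] sg_K0[OF w aE(2)] sg_K0[OF w L(4)] by simp
  thus ?thesis by (simp add: fls_inverse_X fls_X_inv_times_conv_shift)
 qed
 have yV: "y : Vz z"
 proof -
  have "(sg z x - a) $$ 0 = 0" unfolding a_def by simp
  moreover have "sg z x - a : I" using Suc.prems sring_diff[OF I_ring[OF z(1)]] kk_I[OF z(1)] residue(1)[OF z(1) Suc.prems] KK_kk unfolding a_def Vz_def[OF z(1)] by blast
  ultimately have "fls_shift 1 (sg z x - a) : I"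
  proof -
   assume a0: "(sg z x - a) $$ 0 = 0" "sg z x - a : I"
   have "fls_shift 1 (sg z x - a) $$ n = 0" if "n < 0" for n
   proof (cases "n = -1")
   case True thus ?thesis using a0(1) by simp
   next
   case False
   hence "n + 1 < fls_subdegree (sg z x - a)" using that a0(2) unfolding I_iff[of "sg z x - a"] by linarith
   thus ?thesis by (metis fls_shift_nth fls_eq0_below_subdegree)
   qed
   thus ?thesis unfolding I_iff by (rule fls_subdegree_ge0I)
  qed
  thus ?thesis unfolding Vz_def[OF z(1)] using yE sy[OF z(1)] by simp
 qed
 have "fls_shift 1 (sg z x - a) $$ int n = fls_shift 1 (sg z' x - a) $$ int n" using Suc.IH[OF yV] unfolding sy[OF z(1)] sy[OF z(2)] .
 hence "(sg z x - a) $$ (int n + 1) = (sg z' x - a) $$ (int n + 1)" unfolding fls_shift_nth .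
 thus ?case by (simp add: add.commute)
qed

text \<open>\<open>phi (eta (Suc i)) = eta (Suc i) + eta i\<close> makes the \<open>kk\<close>-span
  of the chain stable under \<open>phi\<close>, so it has a basis of fixed elements. Hence an
  embedding over \<open>kk\<close> is determined by its restriction to \<open>EE\<close>.\<close>

lemma Lm_span: "EX n v a. (ALL i<(n::nat). v i : EE & a i : kk) & eta l = (SUM i<n. a i * v i)"
proof -
 have "m <= l ==> EX n W. rd kk {0} n W & phi ` W <= W & W <= Lm & (ALL i<=m. eta i : W)" for m
 proof (induction m)
  case 0
  show ?case using rdim.rZ[of "(*)" kk "{0}"] chain sf_0[OF L.S] by (intro exI[of _ 0] exI[of _ "{0}"]) (auto simp: phi_0 chn_def)
 next
  case (Suc m)
  then obtain n W where W: "rd kk {0} n W" "phi ` W <= W" "W <= Lm" "ALL i<=m. eta i : W" by auto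
  have sW: "ssp kk W" using L.dm_sub[OF W(1) L.sub_zero] .
  show ?case
  proof (cases "eta (Suc m) : W")
   case True thus ?thesis using W by (metis le_Suc_eq)
  next
   case False
   let ?W = "lext (*) kk (eta (Suc m)) W"
   have sW': "ssp kk ?W" using L.sub_ext[OF sW] .
   have r: "rd kk {0} (Suc n) ?W" by (rule rdim.rS[OF W(1) False])
   have etaL: "eta (Suc m) : Lm" unfolding Lm_def by (rule chn_in[OF chain Suc.prems])
   have "?W <= Lm" using L.ext_le[OF ssp_sf[OF L.S Lm(5)] W(3) etaL] .
   moreover have "phi x : ?W" if xW: "x : ?W" for x
   proof -
   obtain a u where x: "a : kk" "u : W" "x = a * eta (Suc m) + u" using xW unfolding lext_def by blast
   have "phi (eta (Suc m)) = eta (Suc m) + eta m" using phi_eta[OF Suc.prems] chain Suc.prems by (simp add: chn_def)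
   hence "phi x = phi a * eta (Suc m) + (phi a * eta m + phi u)" unfolding x(3) phi_add phi_mult by (simp add: distrib_left add.assoc)
   moreover have "phi a * eta m + phi u : W" using W(2,4) x(2) phi_in_kk[OF x(1)] L.sub_add[OF sW] L.sub_scale[OF sW] by blast
   ultimately show ?thesis using L.extI[OF phi_in_kk[OF x(1)]] by simp
   qed
   moreover have "ALL i<=Suc m. eta i : ?W" using W(4) L.ext_sup[of W "eta (Suc m)"] L.ext_in[OF sW] by (auto simp: le_Suc_eq)
   ultimately show ?thesis using r by (intro exI[of _ "Suc n"] exI[of _ ?W]) auto
  qed
 qed
 from this[of l] obtain n W where W: "rd kk {0} n W" "phi ` W <= W" "W <= Lm" "eta l : W" by auto
 obtain v where v: "ALL i<n. v i : W & v i : Fx" "ALL w:W. EX a. (ALL i. a i : kk) & w = (SUM i<n. a i * v i)" using fixed_basis[OF W(1,2)] by blast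
 then obtain a where "ALL i. a i : kk" "eta l = (SUM i<n. a i * v i)" using W(4) by blast
 moreover have "ALL i<n. v i : EE" unfolding EE_def using v(1) W(3) by blast
 ultimately show ?thesis by blast
qed

lemma Vz_inj: "inj_on Vz Cj"
proof (rule inj_onI)
 fix z z' assume z: "z : Cj" "z' : Cj" and V: "Vz z = Vz z'"
 have 1: "sg z x = sg z' x" if x: "x : Vz z" for x
 proof (rule fls_eqI)
  fix n
  have s: "sg z x : I" "sg z' x : I" using x V unfolding Vz_def[OF z(1)] Vz_def[OF z(2)] by auto
  show "sg z x $$ n = sg z' x $$ n"
  proof (cases "n < 0")
   case True
   thus ?thesis using s unfolding I_iff by simp
  next
   case False
   thus ?thesis using Vz_coeff[OF z V x, of "nat n"] by simp
  qed
 qed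
 \<comment> \<open>Agreement on the valuation ring extends to \<open>EE\<close> through inverses,
   and then to \<open>eta l\<close> by \<open>Lm_span\<close>.\<close>
 have 2: "sg z x = sg z' x" if x: "x : EE" for x
 proof (cases "x : Vz z")
  case False
  hence "inverse x : Vz z" using E.PlD(5)[OF Vz_place[OF z(1)] x] by blast
  from 1[OF this] show ?thesis using x EE(4) sg_inverse[OF z(1), of x] sg_inverse[OF z(2), of x] by (auto simp: subset_iff)
 qed (rule 1)
 obtain n v a where v: "ALL i<(n::nat). v i : EE & a i : kk" "eta l = (SUM i<n. a i * v i)" using Lm_span by blast
 have e: "sg w (eta l) = (SUM i<n. a i * sg w (v i))" if w: "w : Cj" for w
 proof -
  have L: "a i : Lm" "v i : Lm" "a i : K0" if "i < n" for i using v(1) that EE(4) Lm(5) K0(2) by auto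
  have "sg w (eta l) = (SUM i<n. sg w (a i * v i))" unfolding v(2) by (rule sg_sum[OF w]) (use L sf_mult[OF L.S] in simp)
  also have "... = (SUM i<n. a i * sg w (v i))" by (rule sum.cong) (use sg_mult[OF w L(1,2)] sg_K0[OF w L(3)] in simp_all)
  finally show ?thesis .
 qed
 have "sg z (eta l) = sg z' (eta l)" unfolding e[OF z(1)] e[OF z(2)] by (rule sum.cong) (use 2 v(1) in simp_all)
 thus "z = z'" unfolding sg_eta[OF z(1)] sg_eta[OF z(2)] .
qed

theorem rational_places_EE: "EX P. P <= {V : places KK EE. pdeg KK V = 1} & finite P & nn <= card P"
proof (intro exI[of _ "Vz ` Cj"] conjI)
 show "Vz ` Cj <= {V : places KK EE. pdeg KK V = 1}" using Vz_place pdeg_Vz by blast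
 show "finite (Vz ` Cj)" using card_Cj(2) by simp
 show "nn <= card (Vz ` Cj)" using card_Cj(1) card_image[OF Vz_inj] by simp
qed

end

section \<open>An elementary upper bound for the number of rational places\<close>

context ff
begin

lemma rd_const: "rd k {0} 1 k"
proof -
 have "rd k {0} (Suc 0) (lext (*) k 1 {0})" by (rule rdim.rS[OF rdim.rZ]) simp
 moreover have "lext (*) k 1 {0} = k" unfolding lext_def by simp
 ultimately show ?thesis by simp
qed

lemma genus_nonneg: "(!!A. isdiv A ==> dg A - ll A + 1 <= g) ==> 0 <= g"
 using isdiv_0 ll_0 dg_0 by fastforce

text \<open>The bound \<open>g\<close> yields a nonconstant \<open>x\<close> whose only pole is a
  chosen rational place \<open>V0\<close>, of order at most \<open>g + 1\<close>. Every other
  rational place is a zero of some \<open>x - a\<close> with \<open>a : k\<close>, and each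
  \<open>x - a\<close> has at most \<open>g + 1\<close> zeros.\<close>

theorem rational_places_bound:
 assumes fin: "finite k" and g: "!!A. isdiv A ==> dg A - ll A + 1 <= g"
  and P: "finite P" "P <= {V : Pl. pdeg k V = 1}"
 shows "int (card P) <= 1 + int (card k) * (g + 1)"
proof (cases "P = {}")
 case True
 thus ?thesis using genus_nonneg[OF g] by simp
next
 case False
 then obtain V0 where V0: "V0 : P" by blast
 hence V0': "V0 : Pl" "pdeg k V0 = 1" using P(2) by auto
 have g0: "0 <= g" by (rule genus_nonneg[OF g])
 define A where "A = (%_. 0::int)(V0 := g + 1)"
 have A: "isdiv A" "dg A = g + 1" unfolding A_def using isdiv_upd[OF isdiv_0 V0'(1)] dg_upd[OF isdiv_0 V0'(1), of "g + 1"] V0'(2) dg_0 by simp_all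
 have "2 <= ll A" using g[OF A(1)] A(2) by linarith
 have "~ LL A <= k"
 proof
  assume "LL A <= k"
  from dm_mono[OF rd_const ll_rd[OF A(1)] this sub_zero] show False using `2 <= ll A` by linarith
 qed
 then obtain x where x: "x : LL A" "x ~: k" by blast
 have kA: "k <= LL A" unfolding LL_def A_def using kS g0 val_const by auto
 have xS: "x : S" using x(1) LL_S by blast
 define Z where "Z = (%a. {V : P. x - a : mx V})"
 have Za: "card (Z a) <= nat (g + 1)" if a: "a : k" for a
 proof -
  have y: "x - a : LL A" "x - a : S" using sub_diff[OF ssp_LL x(1)] a kA LL_S by blast+
  have yk: "x - a ~: k" using x(2) sf_add[OF k _ a, of "x - a"] by auto
  hence y0: "x - a ~= 0" using sf_0[OF k] by auto
  have v: "0 < val V (x - a)" if "V : Z a" for V using that val_gt_0[OF _ y(2) y0] P(2) unfolding Z_def by blast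
  have "card (Z a) = (SUM V:Z a. 1)" by simp
  also have "... <= (SUM V:Z a. nat (val V (x - a)) * pdeg k V)"
  proof (rule sum_mono)
   fix V assume V: "V : Z a"
   hence "pdeg k V = 1" using P(2) unfolding Z_def by blast
   thus "1 <= nat (val V (x - a)) * pdeg k V" using v[OF V] by simp
  qed
  also have "... <= fdeg (adj k (x - a)) S"
   by (rule sum_zeros_le[OF _ _ y(2) yk v]) (use P in "auto simp: Z_def")
  finally have "int (card (Z a)) <= dg (pol (x - a))" unfolding dg_pol[OF y(2) yk] by simp
  also have "dg (pol (x - a)) <= dg A"
  proof (rule dg_mono[OF isdiv_pol[OF y(2) y0] A(1)])
   fix V
   have "V : Pl ==> - A V <= val V (x - a)" using y(1) y0 unfolding LL_def by blast
   moreover have "0 <= A V" unfolding A_def using g0 by simp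
   ultimately show "pol (x - a) V <= A V" unfolding pol_def by auto
  qed
  finally show ?thesis unfolding A(2) by simp
 qed
 have "P - {V0} <= (UN a:k. Z a)"
 proof
  fix V assume V: "V : P - {V0}"
  hence V': "V : Pl" "pdeg k V = 1" "V ~= V0" using P(2) by auto
  have "x ~= 0" using x(2) sf_0[OF k] by auto
  hence "- A V <= val V x" using x(1) V'(1) unfolding LL_def by blast
  hence "0 <= val V x" using V'(3) unfolding A_def by simp
  hence "x : V" using val_ge_0[OF V'(1) xS `x ~= 0`] by simp
  thus "V : (UN a:k. Z a)" using pdeg_1_iff[OF V'(1)] V'(2) V unfolding Z_def by blast
 qed
 hence "card (P - {V0}) <= card (UN a:k. Z a)" using P(1) fin by (intro card_mono) (auto simp: Z_def)
 also have "... <= (SUM a:k. card (Z a))" by (rule card_UN_le[OF fin])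
 also have "... <= card k * nat (g + 1)" using sum_bounded_above[of k "%a. card (Z a)" "nat (g + 1)"] Za by simp
 finally have "card (P - {V0}) <= card k * nat (g + 1)" .
 hence "card P <= 1 + card k * nat (g + 1)" using V0 P(1) by (simp add: card_Diff_singleton)
 hence "int (card P) <= int (1 + card k * nat (g + 1))" by (simp only: of_nat_le_iff)
 thus ?thesis using g0 by simp
qed

end

section \<open>Comparison with function fields given as records\<close>

text \<open>\<open>psi\<close> is a semilinear surjection with kernel \<open>M\<close>, so chains
  above \<open>M\<close> correspond to chains above zero in \<open>R\<close>. \<open>M = {0}\<close>
  serves for ordinary dimensions, \<open>M = mx W\<close> for residue fields.\<close>

lemma dimension_transport:
 fixes R :: "('c, 'd) ring_scheme" and psi :: "'a::field => 'c"
 assumes R: "ring R" and k: "sf k" and V: "ssp k V" and onto: "psi ` V = carrier R"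
  and add: "!!x y. x : V ==> y : V ==> psi (x + y) = psi x \<oplus>\<^bsub>R\<^esub> psi y"
  and scale: "!!a x. a : k ==> x : V ==> psi (a * x) = kap a \<otimes>\<^bsub>R\<^esub> psi x"
  and M: "M = {x : V. psi x = \<zero>\<^bsub>R\<^esub>}"
  and W: "ssp k W" "M <= W" "W <= V"
 shows "ring.dimension R n (kap ` k) (psi ` W) \<longleftrightarrow> rd k M n W"
proof -
 interpret R: ring R by (rule R)
 interpret klin "(*)" k by (rule klin_mult[OF k])
 have c: "x : V ==> psi x : carrier R" for x using onto by blast
 have ker: "x - y : M" if xy: "x : V" "y : V" "psi x = psi y" for x y
 proof -
  have d: "x - y : V" using sub_diff[OF V xy(1,2)] .
  have "psi y = psi (x - y) \<oplus>\<^bsub>R\<^esub> psi y" using add[OF d xy(2)] xy(3) by simp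
  hence "psi (x - y) = \<zero>\<^bsub>R\<^esub>" using R.add.l_cancel_one'[OF c[OF xy(2)] c[OF d]] R.a_comm[OF c[OF xy(2)] c[OF d]] by simp
  thus ?thesis unfolding M using d by simp
 qed
 have sM: "ssp k M"
 proof -
  have "psi 0 \<oplus>\<^bsub>R\<^esub> psi 0 = psi 0" using add[OF sub_0[OF V] sub_0[OF V]] by simp
  hence z: "psi 0 = \<zero>\<^bsub>R\<^esub>" using R.add.r_cancel_one[OF c c] sub_0[OF V] by simp
  moreover have "kap a \<otimes>\<^bsub>R\<^esub> \<zero>\<^bsub>R\<^esub> = \<zero>\<^bsub>R\<^esub>" if "a : k" for a using scale[OF that sub_0[OF V]] z by simp
  ultimately show ?thesis unfolding M subsp_def using sub_0[OF V] add sub_add[OF V] scale sub_scale[OF V] by simp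
 qed
 have line: "psi ` lext (*) k v U = R.line_extension (kap ` k) (psi v) (psi ` U)" if v: "v : V" "U <= V" for v U
 proof (rule Set.set_eqI)
  fix w
  have e: "psi (a * v + u) = kap a \<otimes>\<^bsub>R\<^esub> psi v \<oplus>\<^bsub>R\<^esub> psi u" if "a : k" "u : U" for a u
   using add[OF sub_scale[OF V that(1) v(1)], of u] scale[OF that(1) v(1)] that(2) v(2) by auto
  have "w : psi ` lext (*) k v U \<longleftrightarrow> (EX a:k. EX u:U. w = psi (a * v + u))" unfolding lext_def by blast
  thus "w : psi ` lext (*) k v U \<longleftrightarrow> w : R.line_extension (kap ` k) (psi v) (psi ` U)"
   unfolding R.line_extension_mem_iff using e by simp
 qed
 have pull: "x : U" if x: "x : V" "psi x : psi ` U" "ssp k U" "M <= U" "U <= V" for x U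
 proof -
  obtain y where y: "y : U" "psi x = psi y" using x(2) by blast
  hence "x - y : U" using ker[OF x(1) _ y(2)] x(4,5) by blast
  from sub_add[OF x(3) this y(1)] show ?thesis by simp
 qed
 show ?thesis
 proof
  have "rd k M n W ==> W <= V ==> R.dimension n (kap ` k) (psi ` W)" for W
  proof (induction rule: rdim.induct)
   case rZ
   have "psi ` M = {\<zero>\<^bsub>R\<^esub>}" using sub_0[OF sM] unfolding M by force
   thus ?case using R.zero_dim by simp
  next
   case (rS n U v)
   have U: "ssp k U" "M <= U" using dm_sub[OF rS.hyps(1) sM] dm_sup[OF rS.hyps(1)] .
   have UV: "U <= V" "v : V" using rS.prems ext_sup[of U v] ext_in[OF U(1)] by blast+
   have "psi v ~: psi ` U" using pull[OF UV(2) _ U UV(1)] rS.hyps(2) by blast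
   thus ?case unfolding line[OF UV(2,1)] by (intro R.Suc_dim c UV(2) rS.IH UV(1))
  qed
  thus "rd k M n W ==> R.dimension n (kap ` k) (psi ` W)" using W(3) by blast
  have fwd: "R.dimension n (kap ` k) E ==> EX U. rd k M n U & U <= V & E = psi ` U" for n E
  proof (induction n "kap ` k" E rule: R.dimension.induct)
   case zero_dim
   have "psi ` M = {\<zero>\<^bsub>R\<^esub>}" using sub_0[OF sM] unfolding M by force
   thus ?case using rdim.rZ[of "(*)" k M] W by (intro exI[of _ M]) auto
  next
   case (Suc_dim v E n)
   then obtain U where U: "rd k M n U" "U <= V" "E = psi ` U" by blast
   obtain v' where v: "v' : V" "v = psi v'" using Suc_dim.hyps(1) onto by blast
   have "v' ~: U" using Suc_dim.hyps(2) U(3) v(2) by blast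
   hence "rd k M (Suc n) (lext (*) k v' U)" by (rule rdim.rS[OF U(1)])
   thus ?case using line[OF v(1) U(2)] ext_le[OF V U(2) v(1)] U(3) v(2) by metis
  qed
  show "rd k M n W" if d: "R.dimension n (kap ` k) (psi ` W)"
  proof -
   obtain U where U: "rd k M n U" "U <= V" "psi ` W = psi ` U" using fwd[OF d] by blast
   have sU: "ssp k U" "M <= U" using dm_sub[OF U(1) sM] dm_sup[OF U(1)] .
   have "U = W"
   proof
   show "U <= W" using pull[OF _ _ W] U(2,3) by blast
   show "W <= U" using pull[OF _ _ sU U(2)] W(3) U(3) by blast
   qed
   thus ?thesis using U(1) by simp
  qed
 qed
qed

text \<open>A record field \<^term>\<open>F\<close> realised by \<^term>\<open>h\<close> inside a field given as a type class.\<close>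

locale tr = field F for F :: "('n, 'm) ring_scheme" (structure) +
 fixes h :: "'n => 'a::field" and K :: "'n set"
 assumes h_mult: "!!x y. x : carrier F ==> y : carrier F ==> h (x \<otimes> y) = h x * h y"
  and h_add: "!!x y. x : carrier F ==> y : carrier F ==> h (x \<oplus> y) = h x + h y"
  and h_1: "h \<one> = 1" and h_inj: "inj_on h (carrier F)" and KF: "K <= carrier F"
begin

definition SS :: "'a set" where "SS = h ` carrier F"
definition kk :: "'a set" where "kk = h ` K"
definition pre :: "'a set => 'n set" where "pre W = {x : carrier F. h x : W}"

lemma h_eq: "x : carrier F ==> y : carrier F ==> h x = h y \<longleftrightarrow> x = y" using h_inj by (auto dest: inj_onD)

lemma h_0: "h \<zero> = 0"
proof -
 have "h \<zero> = h \<zero> + h \<zero>" using h_add[of \<zero> \<zero>] by (simp only: zero_closed l_zero)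
 thus ?thesis using add_cancel_right_left by blast
qed

lemma h_eq_0: "x : carrier F ==> h x = 0 \<longleftrightarrow> x = \<zero>" using h_eq[of x \<zero>] h_0 by simp

lemma h_uminus: "x : carrier F ==> h (\<ominus> x) = - h x"
 using h_add[of "\<ominus> x" x] by (simp add: l_neg h_0 eq_neg_iff_add_eq_0)

lemma h_minus: "x : carrier F ==> y : carrier F ==> h (x \<ominus> y) = h x - h y"
 unfolding a_minus_def by (simp add: h_add h_uminus)

lemma F_inv: "x : carrier F ==> x ~= \<zero> ==> inv x : carrier F & x \<otimes> inv x = \<one> & inv x ~= \<zero>"
 using field_Units[unfolded set_eq_iff, rule_format, of x] Units_r_inv[of x] by (auto, metis r_null zero_not_one)

lemma h_inv: assumes "x : carrier F" "x ~= \<zero>" shows "h (inv x) = inverse (h x)"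
proof -
 have "h x * h (inv x) = 1" using F_inv[OF assms] h_mult[of x "inv x"] assms(1) h_1 by simp
 thus ?thesis by (rule inverse_unique[symmetric])
qed

lemma h_pow: "x : carrier F ==> h (x [^] (n::nat)) = h x ^ n"
 by (induction n) (simp_all add: h_1 h_mult mult.commute)

lemma h_int_pow: assumes "x : carrier F" "x ~= \<zero>" shows "h (x [^] (n::int)) = h x powi n" "x [^] (n::int) : carrier F"
proof -
 have nz: "x [^] m ~= \<zero>" for m :: nat using h_pow[OF assms(1)] h_eq_0[OF assms(1)] h_eq_0[of "x [^] m"] assms by simp
 hence "h (inv (x [^] m)) = inverse (h x) ^ m" for m :: nat
  using h_pow[OF assms(1)] h_inv[of "x [^] m"] assms(1) by (simp add: power_inverse)
 thus "h (x [^] n) = h x powi n" unfolding int_pow_def2 power_int_def using h_pow[OF assms(1)]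
  by (cases "n < 0") (simp_all only: if_True if_False not_less[symmetric] not_True_eq_False not_False_eq_True)
 have "inv (x [^] m) : carrier F" "x [^] m : carrier F" for m :: nat using F_inv[OF _ nz] assms(1) by simp_all
 thus "x [^] n : carrier F" unfolding int_pow_def2 by (cases "n < 0") (simp_all only: if_True if_False)
qed

lemma pre_h: "A <= carrier F ==> pre (h ` A) = A" unfolding pre_def using h_eq by (auto simp: subset_iff)

lemma h_pre: "W <= SS ==> h ` pre W = W" unfolding pre_def SS_def by blast

lemma pre_carrier: "pre W <= carrier F" unfolding pre_def by blast

lemma mem_h: "A <= carrier F ==> x : carrier F ==> h x : h ` A \<longleftrightarrow> x : A" using pre_h unfolding pre_def by blast

lemma subring_iff: assumes V: "V <= carrier F" shows "subring V F \<longleftrightarrow> sring (h ` V)"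
proof
 assume s: "subring V F"
 note e = subringE[OF s]
 have "h x - h y : h ` V" "h x * h y : h ` V" if "x : V" "y : V" for x y
 proof -
  have c: "x : carrier F" "y : carrier F" using that V by auto
  have "x \<ominus> y : V" unfolding a_minus_def using e(5,7) that by blast
  thus "h x - h y : h ` V" using h_minus[OF c] by (metis imageI)
  show "h x * h y : h ` V" using h_mult[OF c] e(6) that by (metis imageI)
 qed
 moreover have "1 : h ` V" using e(3) h_1 by (metis imageI)
 ultimately show "sring (h ` V)" unfolding sring_def by blast
next
 assume s: "sring (h ` V)"
 have m: "x : carrier F ==> h x : h ` V ==> x : V" for x using mem_h[OF V] by blast
 show "subring V F"
 proof (rule subringI[OF V])
  show "\<one> : V" using m[of \<one>] h_1 sring_1[OF s] by simp
  fix x assume x: "x : V"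
  hence xc: "x : carrier F" using V by blast
  show "\<ominus> x : V" using m[of "\<ominus> x"] h_uminus[OF xc] sring_uminus[OF s imageI[OF x]] xc by simp
  fix y assume y: "y : V"
  hence yc: "y : carrier F" using V by blast
  show "x \<otimes> y : V" using m[of "x \<otimes> y"] h_mult[OF xc yc] sring_mult[OF s imageI[OF x] imageI[OF y]] xc yc by simp
  show "x \<oplus> y : V" using m[of "x \<oplus> y"] h_add[OF xc yc] sring_add[OF s imageI[OF x] imageI[OF y]] xc yc by simp
 qed
qed

lemma sf_iff_sring: "sf k \<longleftrightarrow> sring k & (ALL x:k. inverse x : k)" for k :: "'a set"
proof
 show "sf k ==> sring k & (ALL x:k. inverse x : k)" using sring_sf sf_inv by blast
 assume "sring k & (ALL x:k. inverse x : k)"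
 thus "sf k" unfolding sf_def using sring_simps[of k] by simp
qed

lemma subfield_iff: assumes V: "V <= carrier F" shows "subfield V F \<longleftrightarrow> sf (h ` V)"
proof
 assume s: "subfield V F"
 have "inverse (h x) : h ` V" if x: "x : V" for x
 proof (cases "x = \<zero>")
  case True thus ?thesis using x by (simp add: h_0 image_iff) (metis h_0)
 next
  case False
  hence "inv x : V" using subfield_m_inv(1)[OF s] x by blast
  thus ?thesis using h_inv[of x] False x V by (metis imageI subsetD)
 qed
 thus "sf (h ` V)" unfolding sf_iff_sring using subring_iff[OF V] subfieldE(1)[OF s] by blast
next
 assume s: "sf (h ` V)"
 show "subfield V F"
 proof (rule subfieldI')
  show "subring V F" using subring_iff[OF V] sring_sf[OF s] by blast
  fix x assume x: "x : V - {\<zero>}"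
  hence xc: "x : carrier F" "x ~= \<zero>" using V by auto
  show "inv x : V" using mem_h[OF V, of "inv x"] F_inv[OF xc] h_inv[OF xc] sf_inv[OF s, of "h x"] x by auto
 qed
qed

lemma sf_SS: "sf SS"
 unfolding SS_def subfield_iff[OF order_refl, symmetric]
 by (rule subfieldI'[OF subringI]) (auto simp: F_inv)

lemma kkSS: "kk <= SS" unfolding kk_def SS_def using KF by blast

end

context tr
begin

definition gi :: "'a => 'n" where "gi = the_inv_into (carrier F) h"

lemma gi: "x : SS ==> gi x : carrier F" "x : SS ==> h (gi x) = x" "y : carrier F ==> gi (h y) = y"
 unfolding gi_def SS_def using the_inv_into_into[OF h_inj] f_the_inv_into_f[OF h_inj] the_inv_into_f_f[OF h_inj] by auto

lemma gi_image: assumes "A <= carrier F" shows "gi ` h ` A = A"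
proof -
 have "(%x. gi (h x)) ` A = (%x. x) ` A" by (rule image_cong) (use assms gi(3) in auto)
 thus ?thesis by (simp add: image_image)
qed

lemma gi_eq: "x : SS ==> y : carrier F ==> h y = x ==> gi x = y" using gi(3) by blast

lemma dimension_iff:
 assumes L: "L <= carrier F" "sf (h ` L)" and A: "A <= carrier F" "ssp (h ` L) (h ` A)"
 shows "dimension n L A \<longleftrightarrow> rd (h ` L) {0} n (h ` A)"
proof -
 have LS: "h ` L <= SS" "h ` A <= SS" unfolding SS_def using L(1) A(1) by auto
 have s: "ssp (h ` L) SS" by (rule ssp_sf[OF sf_SS LS(1)])
 have "dimension n (gi ` h ` L) (gi ` h ` A) \<longleftrightarrow> rd (h ` L) {0} n (h ` A)"
 proof (rule dimension_transport[OF ring_axioms L(2) s _ _ _ _ A(2) _ LS(2)])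
  show "gi ` SS = carrier F" unfolding SS_def by (rule gi_image) simp
  fix x y assume xy: "x : SS" "y : SS"
  show "gi (x + y) = gi x \<oplus> gi y" by (rule gi_eq) (use xy gi sf_add[OF sf_SS] h_add in simp_all)
 next
  fix a x assume "a : h ` L" "x : SS"
  thus "gi (a * x) = gi a \<otimes> gi x" using LS(1) by (intro gi_eq) (use gi sf_mult[OF sf_SS] h_mult in "auto simp: subset_iff")
 next
  show "{0} = {x : SS. gi x = \<zero>}" using gi(2)[of 0] gi(2) gi(3)[of \<zero>] h_0 sf_0[OF sf_SS] by force
  show "{0} <= h ` A" using A(2) unfolding subsp_def by simp
 qed
 thus ?thesis unfolding gi_image[OF L(1)] gi_image[OF A(1)] .
qed

lemma h_generate: assumes k: "sf kk" and x: "x : carrier F" shows "h ` generate_field F (K Un {x}) = adj kk (h x)"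
proof -
 have Kx: "K Un {x} <= carrier F" using KF x by simp
 have G: "generate_field F (K Un {x}) <= carrier F" using generate_field_in_carrier[OF Kx] by blast
 have hx: "h x : SS" unfolding SS_def using x by blast
 have A: "adj kk (h x) <= SS" by (rule adj_le[OF sf_SS kkSS hx])
 have "subfield (pre (adj kk (h x))) F" unfolding subfield_iff[OF pre_carrier] h_pre[OF A] by (rule sf_adj[OF k])
 moreover have "K Un {x} <= pre (adj kk (h x))" using Kx adj_sup[OF k, of "h x"] adj_gen[OF k, of "h x"] unfolding pre_def kk_def by auto
 ultimately have "generate_field F (K Un {x}) <= pre (adj kk (h x))" by (rule generate_field_min_subfield1[OF Kx])
 moreover have "adj kk (h x) <= h ` generate_field F (K Un {x})"
  by (rule adj_le) (use subfield_iff[OF G] generate_field_is_subfield[OF Kx] generate_field.incl[of _ "K Un {x}" F] in "auto simp: kk_def")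
 ultimately show ?thesis unfolding pre_def by blast
qed

lemma h_eval: "set p <= carrier F ==> x : carrier F ==> eval p x : carrier F & h (eval p x) = poly (Poly (rev (map h p))) (h x)"
 by (induction p) (simp_all add: h_0 h_add h_mult h_pow Poly_append poly_monom)

lemma transcendental_iff: assumes k: "sf kk" and x: "x : carrier F" shows "transcendental K x \<longleftrightarrow> transc kk (h x)"
proof
 assume t: "transcendental K x"
 show "transc kk (h x)" unfolding transc_def
 proof (intro allI impI, rule ccontr)
  fix P assume P: "pk kk P" "poly P (h x) = 0" "P ~= 0"
  \<comment> \<open>Record polynomials are lists with the leading coefficient first, hence the
    reversal.\<close>
  define p where "p = map gi (rev (coeffs P))"
  have c: "set (coeffs P) <= kk"
  proof
   fix a assume "a : set (coeffs P)"
   hence "a : range (poly.coeff P)" unfolding range_coeff by simp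
   thus "a : kk" using pkD[OF P(1)] by auto
  qed
  have hp: "map h p = rev (coeffs P)" unfolding p_def using c kkSS gi(2) by (auto intro!: map_idI simp: subset_iff)
  have "set p <= gi ` kk" unfolding p_def using c by auto
  hence sp: "set p <= K" unfolding kk_def gi_image[OF KF] .
  have ne: "p ~= []" unfolding p_def using P(3) by simp
  have "h (hd p) = hd (map h p)" using ne by (simp add: hd_map)
  also have "... ~= 0" unfolding hp using P(3) by (simp add: hd_rev last_coeffs_eq_coeff_degree)
  finally have "hd p ~= \<zero>" using h_0 by auto
  hence "polynomial K p" unfolding polynomial_def using sp by simp
  hence "p : carrier (K[X])" by (simp add: univ_poly_carrier)
  moreover have "eval p x = \<zero>" using h_eval[of p x] sp KF x h_eq_0[of "eval p x"] P(2) hp by auto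
  ultimately show False using eval_transcendental[of K x p] t ne unfolding over_def by simp
 qed
next
 assume t: "transc kk (h x)"
 have s: "subring K F" using subfield_iff[OF KF] k subfieldE(1) unfolding kk_def by blast
 have "p = []" if p: "p : carrier (K[X])" "eval p x = \<zero>" for p
 proof (rule ccontr)
  assume ne: "p ~= []"
  have pp: "set p <= K" "hd p ~= \<zero>" using p(1) ne unfolding univ_poly_carrier[symmetric] polynomial_def by auto
  let ?P = "Poly (rev (map h p))"
  have cf: "poly.coeff ?P i = nth_default 0 (rev (map h p)) i" for i by simp
  have m: "rev (map h p) ! i : kk" if "i < length p" for i using nth_mem[of i "rev (map h p)"] that pp(1) unfolding kk_def by auto
  have "pk kk ?P" unfolding pk_def cf nth_default_def using m sf_0[OF k] by simp
  moreover have "poly ?P (h x) = 0" using h_eval[of p x] pp(1) KF x p(2) h_0 by auto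
  ultimately have "?P = 0" using t unfolding transc_def by blast
  hence "poly.coeff ?P (length p - 1) = 0" by simp
  hence "h (hd p) = 0" unfolding cf using ne by (simp add: nth_default_def rev_nth hd_conv_nth)
  moreover have "hd p : carrier F" using pp(1) KF hd_in_set[OF ne] by blast
  ultimately show False using h_eq_0 pp(2) by blast
 qed
 moreover have "[] : carrier (K[X])" unfolding univ_poly_carrier[symmetric] polynomial_def by simp
 ultimately have "a_kernel (K[X]) F (%p. eval p x) = {[]}" unfolding a_kernel_def' by auto
 thus "transcendental K x" using trivial_ker_imp_transcendental[OF s x] unfolding over_def by simp
qed

theorem global_iff: "global_function_field K F \<longleftrightarrow> ff kk SS & finite K"
proof -
 have G: "K Un {x} <= carrier F" "generate_field F (K Un {x}) <= carrier F" if "x : carrier F" for x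
  using KF that generate_field_in_carrier[of "K Un {x}"] by auto
 have fin: "finite_dimension (generate_field F (K Un {x})) (carrier F) \<longleftrightarrow> ffin (adj kk (h x)) SS" if k: "sf kk" and x: "x : carrier F" for x
 proof -
  note hG = h_generate[OF k x]
  have "adj kk (h x) <= SS" by (rule adj_le[OF sf_SS kkSS]) (use x in "simp add: SS_def")
  hence s: "ssp (adj kk (h x)) (h ` carrier F)" using ssp_sf[OF sf_SS] unfolding SS_def by blast
  show ?thesis unfolding finite_dimension_def ffin_def
   using dimension_iff[OF G(2)[OF x], unfolded hG, OF sf_adj[OF k] order_refl s] unfolding SS_def by simp
 qed
 have k: "subfield K F \<longleftrightarrow> sf kk" unfolding kk_def by (rule subfield_iff[OF KF])
 have full: "{z : carrier F. algebraic K z} = K \<longleftrightarrow> (ALL z:SS. z ~: kk --> transc kk z)" if k: "sf kk"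
 proof -
  have alg: "algebraic K z" if "z : K" for z
  proof -
   have "~ transc kk (h z)"
   proof
   assume "transc kk (h z)"
   moreover have "pk kk [:- h z, 1:]" using k that by (simp add: pk_pCons pk_0 sf_1 sf_uminus kk_def)
   ultimately show False unfolding transc_def by fastforce
   qed
   thus ?thesis using transcendental_iff[OF k] that KF by blast
  qed
  have "{z : carrier F. algebraic K z} = K \<longleftrightarrow> (ALL z:carrier F. z ~: K --> transcendental K z)" using alg KF by blast
  also have "... \<longleftrightarrow> (ALL z:SS. z ~: kk --> transc kk z)" unfolding SS_def kk_def
   using transcendental_iff[OF k] mem_h[OF KF] unfolding kk_def by auto
  finally show ?thesis .
 qed
 have tr: "(EX x:carrier F. transcendental K x & finite_dimension (generate_field F (K Un {x})) (carrier F))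
  \<longleftrightarrow> (EX x:SS. transc kk x & ffin (adj kk x) SS)" if k: "sf kk"
  using transcendental_iff[OF k] fin[OF k] unfolding SS_def by auto
 show ?thesis
 proof
  assume "global_function_field K F"
  then interpret G: global_function_field K F .
  have s: "sf kk" using k G.subfield_axioms by blast
  show "ff kk SS & finite K"
   unfolding ff_def using s sf_SS kkSS tr[OF s] G.finite_over_rational_subfield full[OF s] G.full_constant_field G.finite_constants by blast
 next
  assume a: "ff kk SS & finite K"
  then interpret E: ff kk SS by blast
  have "ALL z:SS. z ~: kk --> transc kk z" using E.full by blast
  thus "global_function_field K F"
   unfolding global_function_field_def function_field_def function_field_axioms_def global_function_field_axioms_def
   using a field_axioms k E.k tr[OF E.k] E.fin full[OF E.k] by blast
 qed
qed

end

locale tr_global = tr F h K + E: ff kk SS for F :: "('n, 'm) ring_scheme" (structure) and h :: "'n => 'a::field" and K +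
 assumes finK: "finite K"
begin

sublocale G: global_function_field K F using global_iff E.ff_axioms finK by blast

definition vr :: "'a set => ('n, 'm) ring_scheme" where "vr W = F\<lparr>carrier := pre W\<rparr>"
text \<open>Passage from a valuation ring of the image field to a place in the sense of the record
  definition, which is a maximal ideal.\<close>

definition pl :: "'a set => 'n set" where "pl W = pre (mx W)"

lemma vr_simps: "carrier (vr W) = pre W" "monoid.mult (vr W) = monoid.mult F" "ring.add (vr W) = ring.add F" "\<one>\<^bsub>vr W\<^esub> = \<one>" "\<zero>\<^bsub>vr W\<^esub> = \<zero>"
 unfolding vr_def by simp_all

lemma pre_iff: "x : pre W \<longleftrightarrow> x : carrier F & h x : W" unfolding pre_def by simp

lemma valuation_ring_iff: assumes V: "V <= carrier F" shows "G.valuation_ring V \<longleftrightarrow> h ` V : E.Pl"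
proof
 assume v: "G.valuation_ring V"
 note v = v[unfolded G.valuation_ring_def]
 have s: "sring (h ` V)" using v subring_iff[OF V] by blast
 show "h ` V : E.Pl" unfolding places_def
 proof (intro CollectI conjI ballI s)
  show "kk <= h ` V" "h ` V <= SS" unfolding kk_def SS_def using v by auto
  obtain x where "x : carrier F" "x ~: V" using v by blast
  thus "h ` V ~= SS" unfolding SS_def using mem_h[OF V] by blast
  fix z assume "z : SS"
  then obtain x where x: "x : carrier F" "z = h x" unfolding SS_def by blast
  show "z : h ` V | inverse z : h ` V"
  proof (cases "x = \<zero>")
   case True thus ?thesis using x(2) h_0 sring_0[OF s] by simp
  next
   case False
   hence "x : V | inv x : V" using v x(1) by blast
   thus ?thesis using h_inv[OF x(1) False] x(2) by (metis imageI)
  qed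
 qed
next
 assume p: "h ` V : E.Pl"
 note d = E.PlD[OF p]
 have KV: "K <= V" using d(2) mem_h[OF V] KF unfolding kk_def by blast
 have "unif (h ` V) : h ` V" "unif (h ` V) ~: kk" using E.unif[OF p] E.mx_k[OF p] unfolding mx_def by blast+
 hence "K ~= V" unfolding kk_def by blast
 moreover have "V ~= carrier F" using p unfolding places_def SS_def by blast
 moreover have "z : V | inv z : V" if "z : carrier F - {\<zero>}" for z
  using d(5)[of "h z"] that h_inv[of z] F_inv[of z] mem_h[OF V] unfolding SS_def by force
 ultimately show "G.valuation_ring V" unfolding G.valuation_ring_def using KV V subring_iff[OF V] d(1) by blast
qed

context
 fixes W assumes W: "W : E.Pl"
begin

lemma W_SS: "W <= SS" using E.PlD(3)[OF W] .

lemma mxW: "mx W <= SS" using W_SS unfolding mx_def by blast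

lemma cring_vr: "cring (vr W)"
proof -
 have "subring (pre W) F" using subring_iff[OF pre_carrier] h_pre[OF W_SS] E.PlD(1)[OF W] by simp
 thus ?thesis unfolding vr_def using subcringI' subcring_iff[OF pre_carrier] by blast
qed

interpretation R: cring "vr W" by (rule cring_vr)

lemma pl_gen: assumes t: "t : carrier F" shows "pl W = PIdl\<^bsub>vr W\<^esub> t \<longleftrightarrow> mx W = (*) (h t) ` W"
proof -
 have e: "PIdl\<^bsub>vr W\<^esub> t = pre ((*) (h t) ` W)"
 proof (rule Set.set_eqI)
  fix x
  have "x : PIdl\<^bsub>vr W\<^esub> t \<longleftrightarrow> (EX y:pre W. x = y \<otimes> t)" unfolding cgenideal_def vr_simps by blast
  also have "... \<longleftrightarrow> (EX y:pre W. x : carrier F & h x = h t * h y)"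
  proof (rule bex_cong[OF refl])
   fix y assume "y : pre W"
   hence y: "y : carrier F" unfolding pre_iff by blast
   show "x = y \<otimes> t \<longleftrightarrow> x : carrier F & h x = h t * h y" using h_eq[of x "y \<otimes> t"] h_mult[OF y t] y t by (auto simp: mult.commute)
  qed
  also have "... \<longleftrightarrow> x : pre ((*) (h t) ` W)" using h_pre[OF W_SS] unfolding pre_iff by (metis (no_types, lifting) image_iff)
  finally show "x : PIdl\<^bsub>vr W\<^esub> t \<longleftrightarrow> x : pre ((*) (h t) ` W)" .
 qed
 have "(*) (h t) ` W <= SS" using W_SS t sf_mult[OF sf_SS, of "h t"] unfolding SS_def by blast
 thus ?thesis unfolding e pl_def using h_pre[OF mxW] h_pre by metis
qed

lemma ideal_pl: "ideal (pl W) (vr W)"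
proof -
 have u: "unif W : SS" "unif W : W" using E.unif[OF W] by (auto simp: mx_def)
 have "pl W = PIdl\<^bsub>vr W\<^esub> (gi (unif W))" using pl_gen[OF gi(1)[OF u(1)]] gi(2)[OF u(1)] E.unif(2)[OF W] by simp
 moreover have "gi (unif W) : carrier (vr W)" unfolding vr_simps pre_iff using gi u by simp
 ultimately show ?thesis using R.cgenideal_ideal by simp
qed

lemma pl_mem: "x : carrier F ==> x ~= \<zero> ==> inv x ~: pl W \<longleftrightarrow> h x : W"
 using h_inv[of x] F_inv[of x] h_eq_0[of x] E.PlD(5)[OF W, of "h x"] unfolding pl_def pre_iff mx_def SS_def by auto

lemma unit_ideal: assumes J: "ideal J (vr W)" and x: "x : J" "x : pre W" "x ~: pl W" shows "J = pre W"
proof -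
 have xc: "x : carrier F" "h x : W" "h x ~: mx W" using x unfolding pl_def pre_iff by auto
 hence x0: "x ~= \<zero>" using h_0 unfolding mx_def by auto
 have "inverse (h x) : W" using xc h_eq_0 x0 unfolding mx_def by blast
 hence "inv x : carrier (vr W)" unfolding vr_simps pre_iff using F_inv[OF xc(1) x0] h_inv[OF xc(1) x0] by simp
 from ideal.I_r_closed[OF J x(1) this] have "\<one>\<^bsub>vr W\<^esub> : J" unfolding vr_simps using F_inv[OF xc(1) x0] by simp
 from ideal.one_imp_carrier[OF J this] show ?thesis unfolding vr_simps .
qed

lemma pl_not_all: "pl W ~= pre W"
proof
 assume "pl W = pre W"
 hence "\<one> : pl W" using sring_1[OF E.PlD(1)[OF W]] h_1 by (simp add: pre_iff)
 thus False using sring_1[OF E.PlD(1)[OF W]] h_1 by (simp add: pl_def pre_iff mx_def)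
qed

lemma pl_sub: "pl W <= pre W" unfolding pl_def pre_def mx_def by blast

text \<open>An ideal with an element outside \<open>pl W\<close> contains a unit, so the ring is
  local and \<open>pl W\<close> its only maximal ideal.\<close>

lemma maximal_iff: "maximalideal P (vr W) \<longleftrightarrow> P = pl W"
proof
 assume m: "maximalideal P (vr W)"
 then interpret m: maximalideal P "vr W" .
 have P: "ideal P (vr W)" "P <= pre W" "pre W ~= P" using m.ideal_axioms m.a_subset m.I_notcarr unfolding vr_simps by auto
 have "P <= pl W" using unit_ideal[OF P(1)] P(2,3) by blast
 hence "pl W = P | pl W = pre W" using m.I_maximal[OF ideal_pl] pl_sub unfolding vr_simps by blast
 thus "P = pl W" using pl_not_all by blast
next
 assume P: "P = pl W"
 show "maximalideal P (vr W)" unfolding P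
 proof (rule maximalidealI[OF ideal_pl])
  show "carrier (vr W) ~= pl W" unfolding vr_simps using pl_not_all by blast
  fix J assume J: "ideal J (vr W)" "pl W <= J" "J <= carrier (vr W)"
  thus "J = pl W | J = carrier (vr W)" using unit_ideal[OF J(1)] unfolding vr_simps by blast
 qed
qed

lemma place_ring_pl: "G.place_ring (pl W) = vr W"
proof -
 have "{z : carrier F. z = \<zero> | inv z ~: pl W} = pre W"
 proof (rule Set.set_eqI)
  fix z show "z : {z : carrier F. z = \<zero> | inv z ~: pl W} \<longleftrightarrow> z : pre W"
   using pl_mem[of z] h_0 sring_0[OF E.PlD(1)[OF W]] unfolding mem_Collect_eq pre_iff by (cases "z = \<zero>") (simp_all cong: conj_cong)
 qed
 thus ?thesis unfolding G.place_ring_def vr_def by simp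
qed

text \<open>\<open>dimension_transport\<close> along the residue map, whose kernel is
  \<open>mx W\<close>.\<close>

lemma place_degree_pl: "G.place_degree (pl W) = pdeg kk W"
proof -
 interpret I: ideal "pl W" "vr W" by (rule ideal_pl)
 let ?Q = "vr W Quot pl W" let ?c = "a_r_coset (vr W) (pl W)"
 have s: "gi x : carrier (vr W)" if "x : W" for x unfolding vr_simps pre_iff using that W_SS gi by auto
 have q: "ring.add ?Q = set_add (vr W)" "monoid.mult ?Q = rcoset_mult (vr W) (pl W)" "\<zero>\<^bsub>?Q\<^esub> = pl W" "carrier ?Q = a_rcosets\<^bsub>vr W\<^esub> (pl W)" unfolding FactRing_def by simp_all
 have onto: "(%x. ?c (gi x)) ` W = carrier ?Q"
 proof -
  have "carrier (vr W) = gi ` W" using gi_image[OF pre_carrier[of W]] h_pre[OF W_SS] unfolding vr_simps by simp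
  thus ?thesis unfolding q A_RCOSETS_def' by auto
 qed
 have ker: "mx W = {x : W. ?c (gi x) = \<zero>\<^bsub>?Q\<^esub>}"
 proof -
  have "?c (gi x) = pl W \<longleftrightarrow> x : mx W" if x: "x : W" for x
  proof -
   have "?c (gi x) = pl W \<longleftrightarrow> gi x : pl W" using I.rcos_const_imp_mem[OF s[OF x]] I.a_rcos_const by blast
   also have "... \<longleftrightarrow> x : mx W" unfolding pl_def pre_iff using gi x W_SS by auto
   finally show ?thesis .
  qed
  thus ?thesis unfolding q(3) mx_def by auto
 qed
 have "ring.dimension ?Q n ((%a. ?c (gi a)) ` kk) ((%x. ?c (gi x)) ` W) \<longleftrightarrow> rd kk (mx W) n W" for n
 proof (rule dimension_transport[OF I.quotient_is_ring E.k E.ssp_V[OF W] onto _ _ ker E.ssp_V[OF W] _ order_refl])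
  fix x y assume xy: "x : W" "y : W"
  have "gi (x + y) = gi x \<oplus> gi y" by (rule gi_eq) (use xy W_SS gi sf_add[OF sf_SS] h_add in "auto simp: subset_iff")
  thus "?c (gi (x + y)) = ?c (gi x) \<oplus>\<^bsub>?Q\<^esub> ?c (gi y)" unfolding q I.a_rcos_sum[OF s[OF xy(1)] s[OF xy(2)]] vr_simps by simp
 next
  fix a x assume ax: "a : kk" "x : W"
  hence aW: "a : W" using E.PlD(2)[OF W] by blast
  have "gi (a * x) = gi a \<otimes> gi x" by (rule gi_eq) (use aW ax(2) W_SS gi sf_mult[OF sf_SS] h_mult in "auto simp: subset_iff")
  thus "?c (gi (a * x)) = ?c (gi a) \<otimes>\<^bsub>?Q\<^esub> ?c (gi x)" unfolding q I.rcoset_mult_add[OF s[OF aW] s[OF ax(2)]] vr_simps by simp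
 qed (simp add: mx_def)
 moreover have "(%a. ?c (gi a)) ` kk = ?c ` K" using gi_image[OF KF] unfolding kk_def by (metis image_image)
 ultimately show ?thesis unfolding G.place_degree_def place_ring_pl Let_def ring.dim_def[OF I.quotient_is_ring] onto pdeg_def by simp
qed

lemma place_val_pl: assumes z: "z : carrier F" "z ~= \<zero>" shows "G.place_val (pl W) z = val W (h z)"
proof -
 have hz: "h z : SS" "h z ~= 0" using z h_eq_0 unfolding SS_def by auto
 have U: "u : Units (vr W) \<longleftrightarrow> u : carrier F & h u : W - mx W" for u
 proof
  assume "u : Units (vr W)"
  then obtain y where y: "u : pre W" "y : pre W" "u \<otimes> y = \<one>" unfolding Units_def vr_simps by blast
  hence "h u * h y = 1" using h_mult h_1 unfolding pre_iff by metis
  hence "h u ~= 0" "inverse (h u) = h y" by (auto intro: inverse_unique)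
  thus "u : carrier F & h u : W - mx W" using y(1,2) unfolding pre_iff mx_def by simp
 next
  assume u: "u : carrier F & h u : W - mx W"
  hence u0: "u ~= \<zero>" using h_0 unfolding mx_def by auto
  have "inv u : pre W" "u : pre W" using u u0 h_inv[of u] F_inv[of u] h_eq_0[of u] unfolding pre_iff mx_def by auto
  thus "u : Units (vr W)" unfolding Units_def vr_simps using F_inv[of u] u u0 m_comm[of u "inv u"] by auto
 qed
 define t where "t = gi (unif W)"
 have t: "t : carrier F" "h t = unif W" "t ~= \<zero>" "t : pre W"
 proof -
  have u: "unif W : SS" "unif W : W" using E.unif[OF W] by (auto simp: mx_def)
  show "t : carrier F" "h t = unif W" unfolding t_def using gi u by auto
  thus "t ~= \<zero>" "t : pre W" using E.unif(3)[OF W] h_0 u unfolding pre_iff by auto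
 qed
 have hp: "h (s [^] n \<otimes> u) = h s powi n * h u" "s [^] n : carrier F" if s: "s : carrier F" "s ~= \<zero>" "u : carrier F" for s u and n :: int
 proof -
  show c: "s [^] n : carrier F" by (rule h_int_pow(2)[OF s(1,2)])
  show "h (s [^] n \<otimes> u) = h s powi n * h u" unfolding h_mult[OF c s(3)] h_int_pow(1)[OF s(1,2)] ..
 qed
 obtain w where u: "w : W - mx W" "h z = unif W powi val W (h z) * w" using E.val[OF W hz] by blast
 have uS: "w : SS" using u(1) W_SS by blast
 have ex: "EX t:carrier (G.place_ring (pl W)). EX u:Units (G.place_ring (pl W)). pl W = PIdl\<^bsub>G.place_ring (pl W)\<^esub> t & z = t [^] val W (h z) \<otimes> u"
  unfolding place_ring_pl
 proof (intro bexI conjI)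
  show "pl W = PIdl\<^bsub>vr W\<^esub> t" using pl_gen[OF t(1)] t(2) E.unif(2)[OF W] by simp
  have "h (t [^] val W (h z) \<otimes> gi w) = h z" using hp(1)[OF t(1,3) gi(1)[OF uS], of "val W (h z)"] t(2) gi(2)[OF uS] u(2) by simp
  thus "z = t [^] val W (h z) \<otimes> gi w" using h_eq z(1) hp(2)[OF t(1,3) gi(1)[OF uS]] gi(1)[OF uS] by (metis m_closed)
  show "t : carrier (vr W)" unfolding vr_simps by (rule t(4))
  show "gi w : Units (vr W)" unfolding U using gi(1,2)[OF uS] u(1) by simp
 qed
 show ?thesis unfolding G.place_val_def
 proof (rule the_equality, rule ex)
  fix n :: int assume "EX t:carrier (G.place_ring (pl W)). EX u:Units (G.place_ring (pl W)). pl W = PIdl\<^bsub>G.place_ring (pl W)\<^esub> t & z = t [^] n \<otimes> u"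
  then obtain s u where su: "s : pre W" "u : Units (vr W)" "pl W = PIdl\<^bsub>vr W\<^esub> s" "z = s [^] n \<otimes> u" unfolding place_ring_pl vr_simps by (elim bexE conjE)
  have sc: "s : carrier F" "h s : W" using su(1) unfolding pre_iff by auto
  have uc: "u : carrier F" "h u : W - mx W" using su(2) unfolding U by auto
  have mx: "mx W = (*) (h s) ` W" using su(3) pl_gen[OF sc(1)] by blast
  have s0: "s ~= \<zero>"
  proof
   assume "s = \<zero>"
   hence "mx W <= {0}" unfolding mx using h_0 by auto
   thus False using E.unif(1,3)[OF W] by blast
  qed
  have hs: "h s : SS" "h s ~= 0" using sc h_eq_0 s0 W_SS by auto
  have "h s : mx W" unfolding mx using sring_1[OF E.PlD(1)[OF W]] by force
  hence v1: "val W (h s) >= 1" using E.val_gt_0[OF W hs] by simp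
  \<comment> \<open>Any other generator of the ideal differs from the uniformiser by a unit, here
    \<open>x\<close>, so the exponent does not depend on the generator.\<close>
  obtain x where x: "x : W" "unif W = h s * x" using E.unif(1)[OF W] unfolding mx by blast
  have xS: "x : SS" "x ~= 0" using x W_SS E.unif(3)[OF W] by auto
  have "1 = val W (h s) + val W x" using E.val_mult[OF W hs xS] E.val_unif[OF W] x(2) by simp
  moreover have "val W x >= 0" using E.val_ge_0[OF W xS] x(1) by simp
  ultimately have v: "val W x = 0" using v1 by linarith
  hence "x ~: mx W" using E.val_gt_0[OF W xS] by simp
  have "unif W powi n * (inverse x powi n * h u) = h z"
   unfolding su(4) hp(1)[OF sc(1) s0 uc(1)] x(2) using xS(2) by (simp add: power_int_mult_distrib power_int_inverse field_simps)
  moreover have "inverse x powi n * h u : W - mx W"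
  proof -
   have i: "inverse x : SS" "inverse x ~= 0" "val W (inverse x) = 0" using sf_inv[OF sf_SS xS(1)] xS(2) E.val_inverse[OF W xS] v by auto
   have uS: "h u : SS" "h u ~= 0" "val W (h u) = 0" using uc W_SS E.val_ge_0[OF W, of "h u"] E.val_gt_0[OF W, of "h u"] unfolding mx_def by force+
   have ip: "y powi n : SS & y powi n ~= 0 & val W (y powi n) = 0" if y: "y : SS" "y ~= 0" "val W y = 0" for y
   proof -
   have "inverse y : SS" "val W (inverse y) = 0" using sf_inv[OF sf_SS y(1)] E.val_inverse[OF W y(1,2)] y(3) by auto
   thus ?thesis unfolding power_int_def using y E.val_power[OF W] sf_power[OF sf_SS] by simp
   qed
   have "inverse x powi n * h u : SS" "inverse x powi n * h u ~= 0" "val W (inverse x powi n * h u) = 0"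
   using ip[OF i] uS E.val_mult[OF W _ _ uS(1,2)] sf_mult[OF sf_SS _ uS(1)] by auto
   thus ?thesis using E.val_ge_0[OF W] E.val_gt_0[OF W] by simp
  qed
  ultimately show "n = val W (h z)" using E.val_eqI[OF W, of "inverse x powi n * h u" "h z" n] by simp
 qed
qed

end

end

context tr_global
begin

lemma places_eq: "G.places = pl ` E.Pl"
proof
 show "G.places <= pl ` E.Pl"
 proof
  fix P assume "P : G.places"
  then obtain V where V: "G.valuation_ring V" "maximalideal P (F\<lparr>carrier := V\<rparr>)" unfolding G.places_def by blast
  have Vc: "V <= carrier F" using V(1) unfolding G.valuation_ring_def by blast
  have W: "h ` V : E.Pl" using V(1) valuation_ring_iff[OF Vc] by blast
  have "vr (h ` V) = F\<lparr>carrier := V\<rparr>" unfolding vr_def pre_h[OF Vc] ..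
  hence "P = pl (h ` V)" using maximal_iff[OF W] V(2) by simp
  thus "P : pl ` E.Pl" using W by blast
 qed
 show "pl ` E.Pl <= G.places"
 proof
  fix P assume "P : pl ` E.Pl"
  then obtain W where W: "W : E.Pl" "P = pl W" by blast
  have "G.valuation_ring (pre W)" using valuation_ring_iff[OF pre_carrier] h_pre[OF W_SS[OF W(1)]] W(1) by simp
  moreover have "maximalideal P (F\<lparr>carrier := pre W\<rparr>)" using maximal_iff[OF W(1)] W(2) unfolding vr_def by simp
  ultimately show "P : G.places" unfolding G.places_def by blast
 qed
qed

lemma ring_of_pl: "W : E.Pl ==> h ` carrier (G.place_ring (pl W)) = W"
 unfolding place_ring_pl vr_simps using h_pre[OF W_SS] .

lemma pl_inj: "inj_on pl E.Pl" by (rule inj_onI) (metis ring_of_pl)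

lemma rational_places_eq: "G.rational_places = pl ` {W : E.Pl. pdeg kk W = 1}"
 unfolding G.rational_places_def places_eq using place_degree_pl by auto

lemma card_rational_places: "card G.rational_places = card {W : E.Pl. pdeg kk W = 1}"
 unfolding rational_places_eq by (rule card_image[OF inj_on_subset[OF pl_inj]]) blast

text \<open>Transport of divisors along \<open>pl\<close>, with the valuation ring recovered from
  the place; the value 0 outside the places is required of a divisor of records.\<close>

definition dv :: "('a set => int) => 'n set => int" where
 "dv A P = (if P : pl ` E.Pl then A (h ` carrier (G.place_ring P)) else 0)"

lemma dv_pl: "W : E.Pl ==> dv A (pl W) = A W" unfolding dv_def using ring_of_pl by simp

lemma dv_supp: assumes "E.isdiv A" shows "{P. dv A P ~= 0} = pl ` {W. A W ~= 0}" "{W. A W ~= 0} <= E.Pl"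
proof -
 show s: "{W. A W ~= 0} <= E.Pl" using E.isdivD(1)[OF assms] by blast
 have "P : pl ` {W. A W ~= 0}" if P: "dv A P ~= 0" for P
 proof -
  have "P : pl ` E.Pl" using P unfolding dv_def by (simp split: if_splits)
  then obtain W where W: "W : E.Pl" "P = pl W" by blast
  thus ?thesis using P dv_pl by auto
 qed
 moreover have "dv A (pl W) ~= 0" if "A W ~= 0" for W using that dv_pl s by auto
 ultimately show "{P. dv A P ~= 0} = pl ` {W. A W ~= 0}" by blast
qed

lemma divisors_eq: "G.divisors = dv ` {A. E.isdiv A}"
proof
 have "finite {P. dv A P ~= 0} & {P. dv A P ~= 0} <= pl ` E.Pl" if A: "E.isdiv A" for A
  unfolding dv_supp(1)[OF A] using dv_supp(2)[OF A] E.isdivD(2)[OF A] by blast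
 thus "dv ` {A. E.isdiv A} <= G.divisors" unfolding G.divisors_def places_eq by blast
 show "G.divisors <= dv ` {A. E.isdiv A}"
 proof
  fix D assume "D : G.divisors"
  hence D: "finite {P. D P ~= 0}" "{P. D P ~= 0} <= pl ` E.Pl" unfolding G.divisors_def places_eq by auto
  define A where "A = (%W. if W : E.Pl then D (pl W) else 0)"
  have "pl ` {W. A W ~= 0} <= {P. D P ~= 0}" "{W. A W ~= 0} <= E.Pl" unfolding A_def by (auto split: if_splits)
  hence "finite {W. A W ~= 0}" using D(1) finite_imageD[OF finite_subset inj_on_subset[OF pl_inj]] by blast
  hence "E.isdiv A" unfolding E.isdiv_def A_def by (simp add: if_split_asm)
  moreover have "D = dv A"
  proof
   fix P show "D P = dv A P"
   proof (cases "P : pl ` E.Pl")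
   case True thus ?thesis using dv_pl[of _ A] unfolding A_def by auto
   next
   case False thus ?thesis using D(2) unfolding dv_def by auto
   qed
  qed
  ultimately show "D : dv ` {A. E.isdiv A}" by blast
 qed
qed

lemma divisor_degree_dv: assumes A: "E.isdiv A" shows "G.divisor_degree (dv A) = E.dg A"
proof -
 have "G.divisor_degree (dv A) = (SUM W:{W. A W ~= 0}. dv A (pl W) * int (G.place_degree (pl W)))"
  unfolding G.divisor_degree_def dv_supp(1)[OF A] by (rule sum.reindex[unfolded o_def, OF inj_on_subset[OF pl_inj dv_supp(2)[OF A]]])
 also have "... = E.dg A" unfolding E.dg_def
  by (rule sum.cong) (use dv_supp(2)[OF A] dv_pl place_degree_pl in auto)
 finally show ?thesis .
qed

lemma riemann_roch_dv: "G.riemann_roch_space (dv A) = pre (E.LL A)"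
proof (rule Set.set_eqI)
 fix z
 have "h z : SS" if "z : carrier F" using that unfolding SS_def by blast
 thus "z : G.riemann_roch_space (dv A) \<longleftrightarrow> z : pre (E.LL A)"
  unfolding G.riemann_roch_space_def places_eq pre_iff E.LL_def mem_Collect_eq
  using h_eq_0 dv_pl place_val_pl by (cases "z = \<zero>") (auto simp: h_0)
qed

lemma dim_dv: "int (dim K (G.riemann_roch_space (dv A))) = E.ll A"
proof -
 have "dimension n K (pre (E.LL A)) \<longleftrightarrow> rd kk {0} n (E.LL A)" for n
  using dimension_iff[OF KF _ pre_carrier] E.k E.ssp_LL h_pre[OF E.LL_S] unfolding kk_def by simp
 thus ?thesis unfolding riemann_roch_dv dim_def E.ll_def fdeg_def by simp
qed

lemma genus_eq: "G.genus = (GREATEST i. EX A. E.isdiv A & i = E.dg A - E.ll A + 1)"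
proof -
 have "(EX D:dv ` {A. E.isdiv A}. i = G.divisor_degree D - int (dim K (G.riemann_roch_space D)) + 1) \<longleftrightarrow> (EX A. E.isdiv A & i = E.dg A - E.ll A + 1)" for i
  using divisor_degree_dv dim_dv by auto
 thus ?thesis unfolding G.genus_def divisors_eq by simp
qed

text \<open>\<open>GREATEST\<close> needs an attained maximum. The zero divisor gives the value 0
  and Riemann's inequality an upper bound, so it is enough to maximise the nonnegative part; hence
  \<open>nat\<close> and \<open>max m 0\<close>.\<close>

lemma genus_bounds: "E.isdiv A ==> E.dg A - E.ll A + 1 <= G.genus" "EX A. E.isdiv A & G.genus = E.dg A - E.ll A + 1"
proof -
 define T where "T = (%i. EX A. E.isdiv A & i = E.dg A - E.ll A + 1)"
 obtain g where g: "!!A. E.isdiv A ==> E.dg A - E.ll A <= g" using E.riemann by blast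
 have "T 0" unfolding T_def using E.isdiv_0 E.dg_0 E.ll_0 by (intro exI[of _ "%_. 0"]) simp
 moreover have "ALL i. T i --> nat i < nat (g + 2)"
 proof (intro allI impI)
  fix i assume "T i"
  then obtain A where "E.isdiv A" "i = E.dg A - E.ll A + 1" unfolding T_def by blast
  moreover have "0 <= g + 1" using g[OF E.isdiv_0] E.dg_0 E.ll_0 by simp
  ultimately show "nat i < nat (g + 2)" using g[of A] by simp
 qed
 ultimately obtain m where m: "T m" "!!i. T i ==> nat i <= nat m" using ex_has_greatest_nat[of T 0 nat] by blast
 have le: "i <= max m 0" if "T i" for i using m(2)[OF that] by linarith
 have "T (max m 0)" using m(1) `T 0` unfolding max_def by simp
 hence e: "G.genus = max m 0" unfolding genus_eq T_def[symmetric] using le by (rule Greatest_equality)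
 show "E.isdiv A ==> E.dg A - E.ll A + 1 <= G.genus" unfolding e by (rule le) (auto simp: T_def)
 show "EX A. E.isdiv A & G.genus = E.dg A - E.ll A + 1" using `T (max m 0)` unfolding e T_def .
qed

lemma genus_ge_0: "0 <= G.genus" by (rule E.genus_nonneg[OF genus_bounds(1)])

lemma card_kk: "card kk = card K" "finite kk"
 unfolding kk_def using card_image[OF inj_on_subset[OF h_inj KF]] finK by auto

lemma rational_places_le: "finite G.rational_places" "int (card G.rational_places) <= 1 + int (card K) * (G.genus + 1)"
proof -
 let ?R = "{W : E.Pl. pdeg kk W = 1}"
 have b: "int (card P) <= 1 + int (card K) * (G.genus + 1)" if "finite P" "P <= ?R" for P
  using E.rational_places_bound[OF card_kk(2) genus_bounds(1) that] unfolding card_kk(1) .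
 have f: "finite ?R"
 proof (rule ccontr)
  assume i: "infinite ?R"
  obtain P where P: "finite P" "card P = nat (1 + int (card K) * (G.genus + 1)) + 1" "P <= ?R"
   using infinite_arbitrarily_large[OF i, of "nat (1 + int (card K) * (G.genus + 1)) + 1"] by (elim exE conjE)
  from b[OF P(1,3)] P(2) show False by linarith
 qed
 show "finite G.rational_places" unfolding rational_places_eq using f by simp
 show "int (card G.rational_places) <= 1 + int (card K) * (G.genus + 1)" unfolding card_rational_places by (rule b[OF f order_refl])
qed

end

section \<open>The bound for all global function fields on the naturals\<close>

definition exceeds_bound :: "nat ring => bool" where
 "exceeds_bound F \<longleftrightarrow> (EX K. global_function_field K F &
  ~ int (card (function_field.rational_places K F)) <= 1 + int (card K) * (function_field.genus K F + 1))"

text \<open>The bound on rational places is available for type class fields only. A record field violating it is therefore turned into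
 a type, which then contradicts the bound; the choice makes the type definition unconditional.\<close>

definition Gf :: "nat ring" where
 "Gf = (SOME F. Ring.field F & ((EX F. exceeds_bound F) --> exceeds_bound F))"

lemma Gf: "Ring.field Gf" "(EX F. exceeds_bound F) ==> exceeds_bound Gf"
proof -
 have "EX F :: nat ring. Ring.field F & ((EX F. exceeds_bound F) --> exceeds_bound F)"
 proof (cases "EX F. exceeds_bound F")
  case True
  then obtain F where F: "exceeds_bound F" by blast
  hence "Ring.field F" unfolding exceeds_bound_def global_function_field_def function_field_def by blast
  thus ?thesis using F by blast
 next
  case False
  \<comment> \<open>If no field violates the bound, any field on \<open>nat\<close> will do; a copy
    of the field with two elements is taken.\<close>
  interpret B: Ring.field "ring_of_type_algebra :: bit ring" by (rule field_from_type_algebra)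
  have "inj (%x::bit. if x = 0 then 0 else 1 :: nat)" by (auto simp: inj_def split: if_splits)
  from B.inj_imp_image_ring_is_field[OF inj_on_subset[OF this subset_UNIV]] show ?thesis using False by blast
 qed
 from someI_ex[OF this] show "Ring.field Gf" "(EX F. exceeds_bound F) ==> exceeds_bound Gf" unfolding Gf_def by blast+
qed

typedef gf = "carrier Gf"
proof -
 interpret gf: Ring.field Gf by (rule Gf(1))
 show ?thesis using gf.zero_closed by blast
qed

setup_lifting type_definition_gf

instantiation gf :: field
begin

context
begin

interpretation gf: Ring.field Gf by (rule Gf(1))

lift_definition zero_gf :: gf is "\<zero>\<^bsub>Gf\<^esub>" by simp
lift_definition one_gf :: gf is "\<one>\<^bsub>Gf\<^esub>" by simp
lift_definition plus_gf :: "gf => gf => gf" is "ring.add Gf" by simp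
lift_definition uminus_gf :: "gf => gf" is "a_inv Gf" by simp
lift_definition minus_gf :: "gf => gf => gf" is "a_minus Gf" by simp
lift_definition times_gf :: "gf => gf => gf" is "monoid.mult Gf" by simp
lift_definition inverse_gf :: "gf => gf" is "%x. if x = \<zero>\<^bsub>Gf\<^esub> then \<zero>\<^bsub>Gf\<^esub> else m_inv Gf x" by (auto simp: gf.field_Units)

end

definition divide_gf :: "gf => gf => gf" where "divide_gf x y = x * inverse y"

instance
proof
 interpret gf: Ring.field Gf by (rule Gf(1))
 fix a b c :: gf
 show "a * b * c = a * (b * c)" by transfer (rule gf.m_assoc)
 show "a * b = b * a" by transfer (rule gf.m_comm)
 show "1 * a = a" by transfer (rule gf.l_one)
 show "a + b + c = a + (b + c)" by transfer (rule gf.a_assoc)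
 show "a + b = b + a" by transfer (rule gf.a_comm)
 show "0 + a = a" by transfer (rule gf.l_zero)
 show "- a + a = 0" by transfer (rule gf.l_neg)
 show "a - b = a + - b" by transfer (rule a_minus_def)
 show "(a + b) * c = a * c + b * c" by transfer (rule gf.l_distr)
 show "(0::gf) ~= 1" by transfer (rule gf.zero_not_one)
 show "inverse a * a = 1" if "a ~= 0" using that by transfer (auto simp: gf.field_Units)
 show "inverse (0::gf) = 0" by transfer simp
qed (rule divide_gf_def)

end

text \<open>A violating field would make \<open>Gf\<close> violating, but \<open>Abs_gf\<close>
  identifies \<open>Gf\<close> with the field type \<open>gf\<close>, where
  \<open>rational_places_le\<close> applies.\<close>

theorem rational_places_nat_bound:
 fixes F :: "nat ring"
 assumes "global_function_field K F"
 shows "int (card (function_field.rational_places K F)) <= 1 + int (card K) * (function_field.genus K F + 1)"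
proof (rule ccontr)
 assume "~ ?thesis"
 hence "exceeds_bound Gf" using Gf(2) assms unfolding exceeds_bound_def by blast
 then obtain L where L: "global_function_field L Gf" and n: "~ int (card (function_field.rational_places L Gf)) <= 1 + int (card L) * (function_field.genus L Gf + 1)"
  unfolding exceeds_bound_def by blast
 interpret G: global_function_field L Gf by (rule L)
 interpret tr Gf Abs_gf L
 proof
  fix x y assume xy: "x : carrier Gf" "y : carrier Gf"
  have R: "Rep_gf (Abs_gf x) = x" "Rep_gf (Abs_gf y) = y" using xy Abs_gf_inverse by auto
  show "Abs_gf (x \<otimes>\<^bsub>Gf\<^esub> y) = Abs_gf x * Abs_gf y" using times_gf.rep_eq[of "Abs_gf x" "Abs_gf y"] unfolding R by (metis Rep_gf_inverse)
  show "Abs_gf (x \<oplus>\<^bsub>Gf\<^esub> y) = Abs_gf x + Abs_gf y" using plus_gf.rep_eq[of "Abs_gf x" "Abs_gf y"] unfolding R by (metis Rep_gf_inverse)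
 next
  show "Abs_gf \<one>\<^bsub>Gf\<^esub> = 1" using one_gf.rep_eq by (metis Rep_gf_inverse)
  show "inj_on Abs_gf (carrier Gf)" by (rule inj_onI) (simp add: Abs_gf_inject)
  show "L <= carrier Gf" using subfieldE(3)[OF G.subfield_axioms] .
 qed
 interpret tr_global Gf Abs_gf L
  unfolding tr_global_def tr_global_axioms_def using tr_axioms global_iff L by blast
 show False using rational_places_le(2) n by blast
qed

section \<open>Models on the naturals and the Ihara constant\<close>

text \<open>Countability is what lets \<open>nat_model\<close> renumber the elements of
  \<open>S\<close> by natural numbers.\<close>

lemma countable_function_field:
 assumes F: "ff k S" and fk: "finite k" shows "countable S"
proof -
 interpret ff k S by (rule F)
 obtain x where x: "x : S" "ffin (adj k x) S" using fin by blast
 have p: "countable {p. pk k p}"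
 proof (rule countable_image_inj_on)
  have "coeffs ` {p. pk k p} <= lists k"
  proof
   fix l assume "l : coeffs ` {p. pk k p}"
   then obtain p where "pk k p" "l = coeffs p" by auto
   moreover have "set (coeffs p) <= range (coeff p)" unfolding range_coeff by blast
   ultimately show "l : lists k" using pkD by blast
  qed
  thus "countable (coeffs ` {p. pk k p})" using countable_lists[OF countable_finite[OF fk]] countable_subset by blast
  show "inj_on coeffs {p. pk k p}" by (rule inj_onI) (simp add: coeffs_eq_iff)
 qed
 have "adj k x = (%(p, q). poly p x / poly q x) ` ({p. pk k p} \<times> {p. pk k p})" unfolding adj_def by auto
 hence a: "countable (adj k x)" using p by simp
 have "rd (adj k x) {0} n U ==> countable U" for n U
 proof (induction rule: rdim.induct)
  case (rS n V v)
  have "lext (*) (adj k x) v V = (%(a, u). a * v + u) ` (adj k x \<times> V)" unfolding lext_def by auto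
  thus ?case using a rS.IH by simp
 qed simp
 thus ?thesis using x(2) unfolding ffin_def by blast
qed

lemma nat_model:
 fixes k S :: "'a::field set"
 assumes F: "ff k S" and k: "finite k"
 shows "EX (K :: nat set) (F :: nat ring). global_function_field K F & card K = card k &
  card (function_field.rational_places K F) = card {V : places k S. pdeg k V = 1} & finite {V : places k S. pdeg k V = 1} &
  0 <= function_field.genus K F & (EX A. ff.isdiv k S A & function_field.genus K F = ff.dg k A - ff.ll k S A + 1)"
proof -
 interpret B: ff k S by (rule F)
 let ?R = "ring_of_type_algebra :: 'a ring"
 interpret R: Ring.field ?R by (rule field_from_type_algebra)
 have Rs: "carrier ?R = UNIV" "monoid.mult ?R = (*)" "ring.add ?R = (+)" "\<one>\<^bsub>?R\<^esub> = 1" "\<zero>\<^bsub>?R\<^esub> = 0" unfolding ring_of_type_algebra_def by auto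
 interpret T: tr ?R "%x. x" k by unfold_locales (auto simp: Rs)
 let ?S = "?R\<lparr>carrier := S\<rparr>"
 have "subfield S ?R" using T.subfield_iff[of S] B.S Rs by simp
 then interpret S: Ring.field ?S by (rule R.subfield_iff(2)[of S, rotated])
 define f where "f = to_nat_on S"
 have f: "inj_on f S" unfolding f_def using inj_on_to_nat_on[OF countable_function_field[OF F k]] .
 define g where "g = inv_into S f"
 have g: "x : S ==> g (f x) = x" for x unfolding g_def using inv_into_f_f[OF f] .
 let ?F = "image_ring f ?S"
 have Fs: "carrier ?F = f ` S" "monoid.mult ?F = (%a b. f (g a * g b))" "ring.add ?F = (%a b. f (g a + g b))" "\<one>\<^bsub>?F\<^esub> = f 1"
  unfolding image_ring_def image_group_def monoid.defs g_def by (auto simp: Rs)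
 interpret F: Ring.field ?F by (rule S.inj_imp_image_ring_is_field) (use f in simp)
 interpret tr ?F g "f ` k"
 proof
  fix x y assume "x : carrier ?F" "y : carrier ?F"
  then obtain a b where ab: "a : S" "b : S" "x = f a" "y = f b" unfolding Fs by blast
  show "g (x \<otimes>\<^bsub>?F\<^esub> y) = g x * g y" "g (x \<oplus>\<^bsub>?F\<^esub> y) = g x + g y"
   unfolding Fs ab(3,4) using g ab(1,2) sf_mult[OF B.S ab(1,2)] sf_add[OF B.S ab(1,2)] by simp_all
 next
  show "g \<one>\<^bsub>?F\<^esub> = 1" unfolding Fs using g sf_1[OF B.S] by simp
  show "inj_on g (carrier ?F)" unfolding Fs by (rule inj_onI) (auto simp: g)
  show "f ` k <= carrier ?F" unfolding Fs using B.kS by blast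
 qed
 have "(%x. g (f x)) ` A = (%x. x) ` A" if "A <= S" for A by (rule image_cong) (use that g in auto)
 hence e: "SS = S" "kk = k" unfolding SS_def kk_def Fs using B.kS by (simp_all add: image_image)
 interpret tr_global ?F g "f ` k"
  unfolding tr_global_def tr_global_axioms_def e using tr_axioms F k by simp
 obtain A where A: "B.isdiv A" "G.genus = B.dg A - B.ll A + 1" using genus_bounds(2) unfolding e by blast
 show ?thesis
 proof (intro exI[of _ "f ` k"] exI[of _ ?F] exI[of _ A] conjI A genus_ge_0)
  show "global_function_field (f ` k) ?F" by (rule G.global_function_field_axioms)
  show "card (f ` k) = card k" by (rule card_image[OF inj_on_subset[OF f B.kS]])
  show "card G.rational_places = card {V : B.Pl. pdeg k V = 1}" using card_rational_places unfolding e .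
  show "finite {V : B.Pl. pdeg k V = 1}"
   using finite_imageD[OF rational_places_le(1)[unfolded rational_places_eq] inj_on_subset[OF pl_inj]] unfolding e by blast
 qed
qed

lemma (in conc) many_places:
 assumes l: "l >= 1"
 shows "EX (K :: nat set) (F :: nat ring). global_function_field K F & card K = q ^ (j + 1) &
  real q ^ (j * l) <= real (card (function_field.rational_places K F)) & 0 <= function_field.genus K F &
  ri (function_field.genus K F) <= 6 / (real q - 1) * real (card (function_field.rational_places K F)) + 1"
proof -
 obtain eta where eta: "chn eta l" "ALL i<=l. eta i : I" "ff kk (Lf (eta l))"
  "!!A. ff.isdiv kk (Lf (eta l)) A ==> ri (ff.dg kk A - ff.ll kk (Lf (eta l)) A) <= real (fdeg (adj kk fls_X) (Lf (eta l))) * Cb l"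
  using tower_exists[OF l] by blast
 interpret D: desc q j eta l unfolding desc_def desc_axioms_def using conc_axioms eta(1-3) l by blast
 have n: "real q ^ (j * l) <= real D.nn"
  using tow.n_large[OF towI[OF eta(3,1) l]] tow.n_def[OF towI[OF eta(3,1) l]] unfolding D.nn_def D.K0_def D.Lm_def by simp
 define g where "g = \<lfloor>real D.nn * (6 / (real q - 1))\<rfloor>"
 have "D.L.dg A - D.L.ll A <= g" if A: "D.L.isdiv A" for A
 proof -
  have "ri (D.L.dg A - D.L.ll A) <= real D.nn * Cb l"
   using eta(4) A unfolding D.nn_def D.K0_def D.Lm_def by blast
  also have "... <= real D.nn * (6 / (real q - 1))" using Cb_le by (intro mult_left_mono) simp_all
  finally show ?thesis unfolding g_def by (simp add: le_floor_iff)
 qed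
 hence gE: "D.E.dg A - D.E.ll A <= g" if "D.E.isdiv A" for A using D.genus_EE that by blast
 obtain K :: "nat set" and F :: "nat ring" and A where F: "global_function_field K F" "card K = card KK"
  "card (function_field.rational_places K F) = card {V : places KK D.EE. pdeg KK V = 1}" "finite {V : places KK D.EE. pdeg KK V = 1}"
  "0 <= function_field.genus K F" "D.E.isdiv A" "function_field.genus K F = D.E.dg A - D.E.ll A + 1"
  using nat_model[OF D.ff_EE card_KK(2)] by (elim exE conjE)
 obtain P where "P <= {V : places KK D.EE. pdeg KK V = 1}" "D.nn <= card P" using D.rational_places_EE by blast
 note P = this
 have N: "D.nn <= card (function_field.rational_places K F)" using card_mono[OF F(4) P(1)] P(2) F(3) by simp
 have "ri (function_field.genus K F) <= ri g + 1" using gE[OF F(6)] F(7) by simp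
 also have "... <= real D.nn * (6 / (real q - 1)) + 1" unfolding g_def by simp
 also have "... <= real (card (function_field.rational_places K F)) * (6 / (real q - 1)) + 1"
  using N q4 by (intro add_right_mono mult_right_mono) simp_all
 finally have "ri (function_field.genus K F) <= 6 / (real q - 1) * real (card (function_field.rational_places K F)) + 1" by (simp add: mult.commute)
 moreover have "real q ^ (j * l) <= real (card (function_field.rational_places K F))" using n N by simp
 ultimately show ?thesis using F(1,2,5) card_KK(1) unfolding Q_def by (intro exI[of _ K] exI[of _ F] conjI) simp_all
qed

text \<open>An element lies below the supremum only if the set is bounded above, and boundedness
  comes from \<open>rational_places_nat_bound\<close>.\<close>

lemma le_max_rational_places:
 assumes F: "global_function_field (K :: nat set) (F :: nat ring)" and g: "function_field.genus K F = int g"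
 shows "card (function_field.rational_places K F) <= max_rational_places (card K) g"
 unfolding max_rational_places_def
proof (rule cSup_upper)
 let ?T = "{card (function_field.rational_places L G) | (L :: nat set) (G :: nat ring).
  global_function_field L G & card L = card K & function_field.genus L G = int g}"
 show "card (function_field.rational_places K F) : ?T" using F g by blast
 have "n <= 1 + card K * (g + 1)" if nT: "n : ?T" for n
 proof -
  obtain L :: "nat set" and G :: "nat ring" where L: "global_function_field L G" "card L = card K" "function_field.genus L G = int g"
   "n = card (function_field.rational_places L G)" using nT by blast
  have "int n <= int (1 + card K * (g + 1))"
   using rational_places_nat_bound[OF L(1)] unfolding L(2-4) by (simp only: of_nat_add of_nat_mult of_nat_1)
  thus ?thesis by (simp only: of_nat_le_iff)
 qed
 thus "bdd_above ?T" by (rule bdd_aboveI)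
qed

text \<open>For the limit superior the genera must be unbounded; by
  \<open>rational_places_nat_bound\<close> many rational places force a large genus. The 7 is the 6
  of \<open>Cb_le\<close> plus 1 for the additive constant in the genus bound, absorbed by
  \<open>N >= q - 1\<close>.\<close>

theorem (in conc) ihara_constant_lower: "ereal ((real q - 1) / 7) <= ihara_constant (q ^ (j + 1))"
proof -
 define Qn where "Qn = q ^ (j + 1)"
 have Qn: "Qn > 0" unfolding Qn_def by (rule qn)
 let ?a = "%g. ereal (real (max_rational_places Qn g) / real g)"
 have "EX g>=m. ereal ((real q - 1) / 7) <= ?a g" for m
 proof -
  \<comment> \<open>Since \<open>N >= l\<close>, the first summand forces the genus above
    \<open>m\<close> and the second gives \<open>N >= q - 1\<close>.\<close>
  define l where "l = Qn * (m + 3) + q"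
  have l1: "l >= 1" unfolding l_def using q4 by simp
  obtain K :: "nat set" and F :: "nat ring" where F: "global_function_field K F" "card K = Qn"
   "real q ^ (j * l) <= real (card (function_field.rational_places K F))" "0 <= function_field.genus K F"
   "ri (function_field.genus K F) <= 6 / (real q - 1) * real (card (function_field.rational_places K F)) + 1"
   using many_places[OF l1] unfolding Qn_def by blast
  define N where "N = card (function_field.rational_places K F)"
  define g where "g = nat (function_field.genus K F)"
  have g: "function_field.genus K F = int g" unfolding g_def using F(4) by simp
  have lN: "l <= N"
  proof -
   have "l < 2 ^ l" by (rule less_exp)
   also have "(2::nat) ^ l <= q ^ l" using q4 by (intro power_mono) simp_all
   also have "... <= q ^ (j * l)" using q4 j by (intro power_increasing) simp_all
   finally have "real l <= real q ^ (j * l)" by (metis less_imp_le of_nat_le_iff of_nat_power)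
   thus ?thesis using F(3) unfolding N_def by linarith
  qed
  have "int N <= 1 + int Qn * (int g + 1)" using rational_places_nat_bound[OF F(1)] unfolding F(2) g N_def by simp
  hence "int N <= int (1 + Qn * (g + 1))" by (simp only: of_nat_add of_nat_mult of_nat_1)
  hence "N <= 1 + Qn * (g + 1)" by (simp only: of_nat_le_iff)
  hence "Qn * (m + 3) <= Qn * (g + 1)" using lN q4 unfolding l_def by linarith
  hence "m + 3 <= g + 1" using Qn by (simp only: nat_mult_le_cancel1)
  hence gm: "g >= m + 1" by simp
  have "real g <= 6 / (real q - 1) * real N + 1" using F(5) unfolding g N_def by simp
  also have "... <= 7 / (real q - 1) * real N"
  proof -
   have "real q - 1 <= real N" using lN unfolding l_def by linarith
   hence "1 <= real N / (real q - 1)" using q4 by (simp add: le_divide_eq)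
   moreover have "6 / (real q - 1) * real N = 6 * (real N / (real q - 1))" "7 / (real q - 1) * real N = 7 * (real N / (real q - 1))" by simp_all
   ultimately show ?thesis by linarith
  qed
  finally have "(real q - 1) / 7 * real g <= real N" using q4 by (simp add: field_simps)
  moreover have "N <= max_rational_places Qn g" using le_max_rational_places[OF F(1) g] unfolding F(2) N_def .
  ultimately have "(real q - 1) / 7 * real g <= real (max_rational_places Qn g)" by (meson of_nat_le_iff order_trans)
  hence "(real q - 1) / 7 <= real (max_rational_places Qn g) / real g" using gm by (simp add: le_divide_eq)
  thus ?thesis using gm by (intro exI[of _ g]) simp
 qed
 hence "ereal ((real q - 1) / 7) <= (SUP g\<in>{m..}. ?a g)" for m by (meson SUP_upper2 atLeast_iff)
 thus ?thesis unfolding ihara_constant_def limsup_INF_SUP Qn_def[symmetric] by (intro INF_greatest)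
qed

text \<open>Both right-hand sides at once: \<open>d = 2\<close> and \<open>d = 8\<close> give the
  factors \<open>q - 1\<close> and \<open>q - 4\<close>, and \<open>e\<close> stands for the
  nonnegative rounded terms, which are dropped. From \<open>q >= 1000\<close> on,
  \<open>sqrt (2 * q) >= 40\<close> leaves roughly \<open>q / 20\<close>, below
  \<open>(q - 1) / 7\<close>.\<close>

lemma real_bound:
 fixes q d :: real assumes "q >= 1000" "0 <= d" "d <= 8" "0 <= e"
 shows "(2 * q ^ 2 + d) / (sqrt (2 * q) * (q - d / 2) + e) <= (q - 1) / 7"
proof -
 have s: "40 <= sqrt (2 * q)" using assms(1) by (intro real_le_rsqrt) simp
 have q4: "q - 4 <= q - d / 2" "0 < q - 4" using assms by simp_all
 have "40 * (q - 4) <= sqrt (2 * q) * (q - d / 2)" using s q4 by (intro mult_mono) simp_all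
 hence D: "40 * (q - 4) <= sqrt (2 * q) * (q - d / 2) + e" using assms(4) by simp
 have "(2 * q ^ 2 + d) / (sqrt (2 * q) * (q - d / 2) + e) <= (2 * q ^ 2 + d) / (40 * (q - 4))"
  using D q4(2) assms by (intro divide_left_mono mult_pos_pos) auto
 also have "... <= (q - 1) / 7"
 proof -
  have "1000 * q <= q * q" using assms(1) by (intro mult_right_mono) simp_all
  moreover have "14 * s + 7 * d <= 40 * s - 200 * q + 160" if "1000 * q <= s" for s using that assms by linarith
  moreover have "40 * (q - 4) * (q - 1) = 40 * (q * q) - 200 * q + 160" "7 * (2 * q ^ 2 + d) = 14 * (q * q) + 7 * d"
   by (simp_all add: power2_eq_square algebra_simps)
  ultimately have "7 * (2 * q ^ 2 + d) <= 40 * (q - 4) * (q - 1)" by simp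
  thus ?thesis using q4(2) by (simp add: divide_le_eq le_divide_eq mult_ac)
 qed
 finally show ?thesis .
qed

theorem theorem3p11:
  shows "(\<forall>r::nat. r \<ge> 5 \<and> odd r \<longrightarrow>
      (\<exists>q0::nat. \<forall>q::nat. q \<ge> q0 \<and> (\<exists>k. q = 2 ^ k) \<longrightarrow>
        ihara_constant (q ^ r) \<ge>
          ereal ((2 * (real q)^2 + 2) /
            (sqrt (2 * real q) * (real q - 1)
              + 2 * real_of_int \<lceil>2 * sqrt (2 * (real q)^2 + 2)\<rceil> + 4))))
    \<and> (\<exists>q0::nat. \<forall>q::nat. q \<ge> q0 \<and> (\<exists>k. q = 2 ^ k) \<longrightarrow>
        ihara_constant (q ^ 3) \<ge>
          ereal ((2 * (real q)^2 + 8) /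
            (sqrt (2 * real q) * (real q - 4)
              + 8 * real_of_int \<lceil>sqrt (2 * (real q)^2 + 8)\<rceil> + 16)))"
proof -
  \<comment> \<open>The tower with \<open>j = r - 1\<close> lives over the field with
    \<open>q^r\<close> elements, and \<open>j >= 2\<close> becomes \<open>r >= 3\<close>; the
    threshold 1000 is that of \<open>real_bound\<close>.\<close>
  have key: "ereal x \<le> ihara_constant (q ^ r)" if r: "r \<ge> 3" and q: "q \<ge> 1000" "\<exists>k. q = 2 ^ k" and x: "x \<le> (real q - 1) / 7"
    for r q :: nat and x :: real
  proof -
    obtain h where h: "q = 2 ^ h" using q(2) by blast
    have "h \<ge> 2" using q(1) power_increasing[of h 1 "2::nat"] unfolding h by (cases "h \<ge> 2") auto
    then interpret conc q "r - 1" by unfold_locales (use h r in auto)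
    have "r - 1 + 1 = r" using r by simp
    then have "ereal ((real q - 1) / 7) \<le> ihara_constant (q ^ r)" using ihara_constant_lower by simp
    then show ?thesis using x by (meson ereal_less_eq(3) order_trans)
  qed
  have e: "0 \<le> \<lceil>sqrt x\<rceil>" "0 \<le> \<lceil>2 * sqrt x\<rceil>" if "x \<ge> 0" for x :: real
    using that by (simp_all add: le_ceiling_iff) (meson less_le_trans neg_less_0_iff_less real_sqrt_ge_0_iff zero_less_one mult_nonneg_nonneg zero_le_numeral)+
  show ?thesis
  proof (intro conjI allI impI exI[of _ 1000])
    fix r q :: nat assume r: "r \<ge> 5 \<and> odd r" and q: "q \<ge> 1000 \<and> (\<exists>k. q = 2 ^ k)"
    show "ihara_constant (q ^ r) \<ge> ereal ((2 * (real q)^2 + 2) / (sqrt (2 * real q) * (real q - 1)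
      + 2 * real_of_int \<lceil>2 * sqrt (2 * (real q)^2 + 2)\<rceil> + 4))"
    proof (rule key)
      show "(2 * (real q)^2 + 2) / (sqrt (2 * real q) * (real q - 1) + 2 * real_of_int \<lceil>2 * sqrt (2 * (real q)^2 + 2)\<rceil> + 4) \<le> (real q - 1) / 7"
        using real_bound[of "real q" 2 "2 * real_of_int \<lceil>2 * sqrt (2 * (real q)^2 + 2)\<rceil> + 4"] e(2)[of "2 * (real q)^2 + 2"] q by (simp add: add.assoc)
    qed (use r q in auto)
  next
    fix q :: nat assume q: "q \<ge> 1000 \<and> (\<exists>k. q = 2 ^ k)"
    show "ihara_constant (q ^ 3) \<ge> ereal ((2 * (real q)^2 + 8) / (sqrt (2 * real q) * (real q - 4)
      + 8 * real_of_int \<lceil>sqrt (2 * (real q)^2 + 8)\<rceil> + 16))"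
    proof (rule key)
      show "(2 * (real q)^2 + 8) / (sqrt (2 * real q) * (real q - 4) + 8 * real_of_int \<lceil>sqrt (2 * (real q)^2 + 8)\<rceil> + 16) \<le> (real q - 1) / 7"
        using real_bound[of "real q" 8 "8 * real_of_int \<lceil>sqrt (2 * (real q)^2 + 8)\<rceil> + 16"] e(1)[of "2 * (real q)^2 + 8"] q by (simp add: add.assoc)
    qed (use q in auto)
  qed
qed

end
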